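(* Let $T>0$, let $\Omega\subset\mathbb{R}^d$ ($d=1,2,3$) be a bounded Lipschitz domain, $Q_T:=\Omega\times(0,T)$, let $c\in L^\infty(\Omega)$ with $c(\boldsymbol{x})\ge c_0$ for some constant $c_0>0$, and let $F\in H^1(0,T;L^2(\Omega))$ with $F(\cdot,0)\in L^2(\Omega)$. Then there exists a unique $U\in H^1(0,T;H_0^1(\Omega))\cap H^2_{0,\bullet}(0,T;L^2(\Omega))$ such that $$\mathcal{A}(U,\mathcal{L}_TW)=(F,\partial_t\mathcal{L}_TW)_{L^2(Q_T)}\quad\text{for all }W\in H^1(0,T;H_0^1(\Omega))\cap H^2_{0,\bullet}(0,T;L^2(\Omega)),$$ and it satisfies $$\|U\|_{\mathcal{V}(Q_T)}\le2eT\,\|F\|_{L^2(Q_T)}.$$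
   Context: $H^2_{0,\bullet}(0,T;L^2(\Omega)):=\{U\in H^2(0,T;L^2(\Omega)):U(\cdot,0)=0\}$. The bilinear form is $$\mathcal{A}(U,W):=(\partial_t^2U,\partial_tW)_{L^2(Q_T)}+(\partial_tU(\cdot,0),\partial_tW(\cdot,0))_{L^2(\Omega)}+(c^2\nabla_{\boldsymbol{x}}U,\nabla_{\boldsymbol{x}}\partial_tW)_{L^2(Q_T)},$$ the operator $\mathcal{L}_T$ is $\mathcal{L}_TW(\boldsymbol{x},t):=\int_0^te^{-s/T}\partial_sW(\boldsymbol{x},s)\,\mathrm{d}s$, and $\|U\|_{\mathcal{V}(Q_T)}^2:=\|\partial_tU\|_{L^2(Q_T)}^2+\|c\nabla_{\boldsymbol{x}}U\|_{L^2(Q_T)}^2$. *)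

theory Defs
  imports "HOL-Analysis.Analysis"
begin

section \<open>Bounded Lipschitz domains, test functions\<close>

text \<open>Near every boundary point the domain lies strictly above the graph, in some direction \<open>e\<close>, of
  a Lipschitz function on the hyperplane orthogonal to \<open>e\<close>. (In dimension one the hyperplane is
  \<open>{0}\<close>.)\<close>

definition lipschitz_domain :: "'a::euclidean_space set \<Rightarrow> bool" where
  "lipschitz_domain \<Omega> \<longleftrightarrow> open \<Omega> \<and> connected \<Omega> \<and> \<Omega> \<noteq> {} \<and>
     (\<forall>p\<in>frontier \<Omega>. \<exists>N e (g::'a \<Rightarrow> real) L.
        open N \<and> p \<in> N \<and> norm e = 1 \<and> L-lipschitz_on {z. z \<bullet> e = 0} g \<and>
        \<Omega> \<inter> N = {y \<in> N. g (y - (y \<bullet> e) *\<^sub>R e) < y \<bullet> e})"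

primrec Ck :: "nat \<Rightarrow> ('a::euclidean_space \<Rightarrow> real) \<Rightarrow> bool" where
  "Ck 0 f \<longleftrightarrow> continuous_on UNIV f"
| "Ck (Suc k) f \<longleftrightarrow> (\<forall>x. f differentiable (at x)) \<and>
     (\<forall>b\<in>Basis. Ck k (\<lambda>x. frechet_derivative f (at x) b))"

definition test_functions :: "'a::euclidean_space set \<Rightarrow> ('a \<Rightarrow> real) set" where
  "test_functions \<Omega> = {\<phi>. (\<forall>k. Ck k \<phi>) \<and> compact (closure {x. \<phi> x \<noteq> 0}) \<and> closure {x. \<phi> x \<noteq> 0} \<subseteq> \<Omega>}"


section \<open>Spaces of functions on \<open>\<Omega>\<close>\<close>

text \<open>Elements of Lebesgue and Sobolev spaces are represented by functions; equality in the space
  is equality almost everywhere.\<close>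

definition L2 :: "'a::euclidean_space set \<Rightarrow> ('a \<Rightarrow> 'b::euclidean_space) set" where
  "L2 \<Omega> = {f. f \<in> borel_measurable (lebesgue_on \<Omega>) \<and> integrable (lebesgue_on \<Omega>) (\<lambda>x. (norm (f x))\<^sup>2)}"

definition L2_inner :: "'a::euclidean_space set \<Rightarrow> ('a \<Rightarrow> 'b::euclidean_space) \<Rightarrow> ('a \<Rightarrow> 'b) \<Rightarrow> real" where
  "L2_inner \<Omega> f g = (LINT x|lebesgue_on \<Omega>. f x \<bullet> g x)"

definition L2_norm :: "'a::euclidean_space set \<Rightarrow> ('a \<Rightarrow> 'b::euclidean_space) \<Rightarrow> real" where
  "L2_norm \<Omega> f = sqrt (L2_inner \<Omega> f f)"

definition Linf :: "'a::euclidean_space set \<Rightarrow> ('a \<Rightarrow> real) set" where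
  "Linf \<Omega> = {f. f \<in> borel_measurable (lebesgue_on \<Omega>) \<and> (\<exists>K. AE x in lebesgue_on \<Omega>. \<bar>f x\<bar> \<le> K)}"

definition weak_grad :: "'a::euclidean_space set \<Rightarrow> ('a \<Rightarrow> real) \<Rightarrow> ('a \<Rightarrow> 'a) \<Rightarrow> bool" where
  "weak_grad \<Omega> f g \<longleftrightarrow> (\<forall>\<phi>\<in>test_functions \<Omega>. \<forall>b\<in>Basis.
     (LINT x|lebesgue_on \<Omega>. f x * frechet_derivative \<phi> (at x) b)
       = - (LINT x|lebesgue_on \<Omega>. (g x \<bullet> b) * \<phi> x))"

definition H1 :: "'a::euclidean_space set \<Rightarrow> ('a \<Rightarrow> real) set" where
  "H1 \<Omega> = {f \<in> L2 \<Omega>. \<exists>g\<in>L2 \<Omega>. weak_grad \<Omega> f g}"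

definition grad :: "'a::euclidean_space set \<Rightarrow> ('a \<Rightarrow> real) \<Rightarrow> ('a \<Rightarrow> 'a)" where
  "grad \<Omega> f = (SOME g. g \<in> L2 \<Omega> \<and> weak_grad \<Omega> f g)"

definition H1_norm :: "'a::euclidean_space set \<Rightarrow> ('a \<Rightarrow> real) \<Rightarrow> real" where
  "H1_norm \<Omega> f = sqrt ((L2_norm \<Omega> f)\<^sup>2 + (L2_norm \<Omega> (grad \<Omega> f))\<^sup>2)"

definition H10 :: "'a::euclidean_space set \<Rightarrow> ('a \<Rightarrow> real) set" where
  "H10 \<Omega> = {f \<in> H1 \<Omega>. \<exists>\<phi>. (\<forall>n. \<phi> n \<in> test_functions \<Omega>) \<and>
      (\<lambda>n. H1_norm \<Omega> (\<lambda>x. \<phi> n x - f x)) \<longlonglongrightarrow> 0}"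


section \<open>Bochner--Sobolev spaces on a time interval\<close>

text \<open>The library's Bochner integral needs a Banach space that is a type. Here the value space
  varies with \<open>\<Omega>\<close>, so it is given by a set of functions with a seminorm whose kernel consists of the
  functions vanishing almost everywhere, and the Bochner integral is defined for such spaces as in
  the library.\<close>

record 'a fspace =
  elems :: "('a \<Rightarrow> real) set"
  nrm :: "('a \<Rightarrow> real) \<Rightarrow> real"

definition L2_space :: "'a::euclidean_space set \<Rightarrow> 'a fspace" where
  "L2_space \<Omega> = \<lparr>elems = L2 \<Omega>, nrm = L2_norm \<Omega>\<rparr>"

definition H10_space :: "'a::euclidean_space set \<Rightarrow> 'a fspace" where
  "H10_space \<Omega> = \<lparr>elems = H10 \<Omega>, nrm = H1_norm \<Omega>\<rparr>"

definition simple_into :: "'t measure \<Rightarrow> 'a fspace \<Rightarrow> ('t \<Rightarrow> 'a \<Rightarrow> real) \<Rightarrow> bool" where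
  "simple_into M X s \<longleftrightarrow> simple_function M s \<and> s ` space M \<subseteq> elems X"

definition strongly_measurable :: "'t measure \<Rightarrow> 'a fspace \<Rightarrow> ('t \<Rightarrow> 'a \<Rightarrow> real) \<Rightarrow> bool" where
  "strongly_measurable M X u \<longleftrightarrow> (AE t in M. u t \<in> elems X) \<and>
     (\<exists>s. (\<forall>n. simple_into M X (s n)) \<and>
        (AE t in M. (\<lambda>n. nrm X (\<lambda>x. s n t x - u t x)) \<longlonglongrightarrow> 0))"

text \<open>Only used for finite measures, so that all simple functions are integrable.\<close>

definition simple_integral :: "'t measure \<Rightarrow> ('t \<Rightarrow> 'a \<Rightarrow> real) \<Rightarrow> 'a \<Rightarrow> real" where
  "simple_integral M s x = (\<Sum>v\<in>s ` space M. measure M {t \<in> space M. s t = v} * v x)"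

definition has_bochner :: "'t measure \<Rightarrow> 'a fspace \<Rightarrow> ('t \<Rightarrow> 'a \<Rightarrow> real) \<Rightarrow> ('a \<Rightarrow> real) \<Rightarrow> bool" where
  "has_bochner M X u I \<longleftrightarrow> strongly_measurable M X u \<and> I \<in> elems X \<and>
     (\<exists>s. (\<forall>n. simple_into M X (s n)) \<and>
        (\<lambda>n. \<integral>\<^sup>+ t. ennreal (nrm X (\<lambda>x. s n t x - u t x)) \<partial>M) \<longlonglongrightarrow> 0 \<and>
        (\<lambda>n. nrm X (\<lambda>x. simple_integral M (s n) x - I x)) \<longlonglongrightarrow> 0)"

definition bochner_int :: "'t measure \<Rightarrow> 'a fspace \<Rightarrow> ('t \<Rightarrow> 'a \<Rightarrow> real) \<Rightarrow> 'a \<Rightarrow> real" where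
  "bochner_int M X u = (SOME I. has_bochner M X u I)"

definition bochner_L2 :: "real \<Rightarrow> 'a fspace \<Rightarrow> (real \<Rightarrow> 'a \<Rightarrow> real) set" where
  "bochner_L2 T X = {u. strongly_measurable (lebesgue_on {0<..<T}) X u \<and>
      integrable (lebesgue_on {0<..<T}) (\<lambda>t. (nrm X (u t))\<^sup>2)}"

definition weak_dt :: "real \<Rightarrow> 'a fspace \<Rightarrow> (real \<Rightarrow> 'a \<Rightarrow> real) \<Rightarrow> (real \<Rightarrow> 'a \<Rightarrow> real) \<Rightarrow> bool" where
  "weak_dt T X u v \<longleftrightarrow> (\<forall>\<phi>\<in>test_functions {0<..<T}. \<exists>I.
     has_bochner (lebesgue_on {0<..<T}) X (\<lambda>t x. deriv \<phi> t * u t x) I \<and>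
     has_bochner (lebesgue_on {0<..<T}) X (\<lambda>t x. \<phi> t * v t x) (\<lambda>x. - I x))"

definition bochner_H1 :: "real \<Rightarrow> 'a fspace \<Rightarrow> (real \<Rightarrow> 'a \<Rightarrow> real) set" where
  "bochner_H1 T X = {u \<in> bochner_L2 T X. \<exists>v\<in>bochner_L2 T X. weak_dt T X u v}"

definition bochner_H2 :: "real \<Rightarrow> 'a fspace \<Rightarrow> (real \<Rightarrow> 'a \<Rightarrow> real) set" where
  "bochner_H2 T X = {u \<in> bochner_L2 T X. \<exists>v\<in>bochner_H1 T X. weak_dt T X u v}"

definition dt :: "real \<Rightarrow> 'a fspace \<Rightarrow> (real \<Rightarrow> 'a \<Rightarrow> real) \<Rightarrow> (real \<Rightarrow> 'a \<Rightarrow> real)" where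
  "dt T X u = (SOME v. v \<in> bochner_L2 T X \<and> weak_dt T X u v)"

text \<open>\<open>u(\<cdot>,0)\<close> is the value at 0 of the representative of \<open>u\<close> in \<open>C([0,T];X)\<close>.\<close>

definition has_initial_value :: "real \<Rightarrow> 'a fspace \<Rightarrow> (real \<Rightarrow> 'a \<Rightarrow> real) \<Rightarrow> ('a \<Rightarrow> real) \<Rightarrow> bool" where
  "has_initial_value T X u u0 \<longleftrightarrow> u0 \<in> elems X \<and> (\<exists>w.
     (\<forall>t\<in>{0..T}. w t \<in> elems X) \<and>
     (\<forall>s\<in>{0..T}. ((\<lambda>t. nrm X (\<lambda>x. w t x - w s x)) \<longlongrightarrow> 0) (at s within {0..T})) \<and>
     (AE t in lebesgue_on {0<..<T}. u t \<in> elems X \<and> nrm X (\<lambda>x. w t x - u t x) = 0) \<and>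
     nrm X (\<lambda>x. w 0 x - u0 x) = 0)"

definition initial_value :: "real \<Rightarrow> 'a fspace \<Rightarrow> (real \<Rightarrow> 'a \<Rightarrow> real) \<Rightarrow> 'a \<Rightarrow> real" where
  "initial_value T X u = (SOME u0. has_initial_value T X u u0)"


section \<open>The space-time problem\<close>

text \<open>Functions on \<open>Q\<^sub>T\<close> are curried with time first: \<open>U t x\<close> is \<open>U(x,t)\<close>. Elements of
  \<open>L\<^sup>2(Q\<^sub>T)\<close> are identified with elements of \<open>L\<^sup>2(0,T;L\<^sup>2(\<Omega>))\<close>. A Bochner representative need not
  be jointly measurable, so the integral over \<open>Q\<^sub>T\<close> is written as an iterated one.\<close>

definition Q_inner ::
  "real \<Rightarrow> 'a::euclidean_space set \<Rightarrow> (real \<Rightarrow> 'a \<Rightarrow> 'b::euclidean_space) \<Rightarrow> (real \<Rightarrow> 'a \<Rightarrow> 'b) \<Rightarrow> real" where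
  "Q_inner T \<Omega> f g = (LINT t|lebesgue_on {0<..<T}. L2_inner \<Omega> (f t) (g t))"

definition Q_norm :: "real \<Rightarrow> 'a::euclidean_space set \<Rightarrow> (real \<Rightarrow> 'a \<Rightarrow> 'b::euclidean_space) \<Rightarrow> real" where
  "Q_norm T \<Omega> f = sqrt (Q_inner T \<Omega> f f)"

definition H2_0 :: "real \<Rightarrow> 'a::euclidean_space set \<Rightarrow> (real \<Rightarrow> 'a \<Rightarrow> real) set" where
  "H2_0 T \<Omega> = {U \<in> bochner_H2 T (L2_space \<Omega>). has_initial_value T (L2_space \<Omega>) U (\<lambda>x. 0)}"

text \<open>Time derivatives are taken in \<open>L\<^sup>2(\<Omega>)\<close>. For \<open>U\<close> in \<open>H\<^sup>1(0,T;H\<^sub>0\<^sup>1(\<Omega>))\<close> this agrees almost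
  everywhere with the derivative taken in \<open>H\<^sub>0\<^sup>1(\<Omega>)\<close>, so that \<open>grad\<close> may be applied to it.\<close>

abbreviation ddt :: "real \<Rightarrow> 'a::euclidean_space set \<Rightarrow> (real \<Rightarrow> 'a \<Rightarrow> real) \<Rightarrow> (real \<Rightarrow> 'a \<Rightarrow> real)" where
  "ddt T \<Omega> \<equiv> dt T (L2_space \<Omega>)"

definition wave_form :: "real \<Rightarrow> 'a::euclidean_space set \<Rightarrow> ('a \<Rightarrow> real) \<Rightarrow>
    (real \<Rightarrow> 'a \<Rightarrow> real) \<Rightarrow> (real \<Rightarrow> 'a \<Rightarrow> real) \<Rightarrow> real" where
  "wave_form T \<Omega> c U W =
     Q_inner T \<Omega> (ddt T \<Omega> (ddt T \<Omega> U)) (ddt T \<Omega> W)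
   + L2_inner \<Omega> (initial_value T (L2_space \<Omega>) (ddt T \<Omega> U)) (initial_value T (L2_space \<Omega>) (ddt T \<Omega> W))
   + Q_inner T \<Omega> (\<lambda>t x. (c x)\<^sup>2 *\<^sub>R grad \<Omega> (U t) x) (\<lambda>t. grad \<Omega> (ddt T \<Omega> W t))"

definition LT :: "real \<Rightarrow> 'a::euclidean_space set \<Rightarrow> (real \<Rightarrow> 'a \<Rightarrow> real) \<Rightarrow> (real \<Rightarrow> 'a \<Rightarrow> real)" where
  "LT T \<Omega> W t =
     bochner_int (lebesgue_on {0<..<t}) (L2_space \<Omega>) (\<lambda>s x. exp (- s / T) * ddt T \<Omega> W s x)"

definition V_norm :: "real \<Rightarrow> 'a::euclidean_space set \<Rightarrow> ('a \<Rightarrow> real) \<Rightarrow> (real \<Rightarrow> 'a \<Rightarrow> real) \<Rightarrow> real" where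
  "V_norm T \<Omega> c U =
     sqrt ((Q_norm T \<Omega> (ddt T \<Omega> U))\<^sup>2 + (Q_norm T \<Omega> (\<lambda>t x. c x *\<^sub>R grad \<Omega> (U t) x))\<^sup>2)"

definition trial_space :: "real \<Rightarrow> 'a::euclidean_space set \<Rightarrow> (real \<Rightarrow> 'a \<Rightarrow> real) set" where
  "trial_space T \<Omega> = bochner_H1 T (H10_space \<Omega>) \<inter> H2_0 T \<Omega>"

definition is_solution :: "real \<Rightarrow> 'a::euclidean_space set \<Rightarrow> ('a \<Rightarrow> real) \<Rightarrow>
    (real \<Rightarrow> 'a \<Rightarrow> real) \<Rightarrow> (real \<Rightarrow> 'a \<Rightarrow> real) \<Rightarrow> bool" where
  "is_solution T \<Omega> c F U \<longleftrightarrow> U \<in> trial_space T \<Omega> \<and>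
     (\<forall>W\<in>trial_space T \<Omega>.
        wave_form T \<Omega> c U (LT T \<Omega> W) = Q_inner T \<Omega> F (ddt T \<Omega> (LT T \<Omega> W)))"

end

theory Submission
  imports Defs
begin

text \<open>In terms of \<open>z = weight * ddt W\<close> with \<open>weight t = exp (- t / T)\<close>, testing with \<open>LT W\<close> means testing the
  wave equation \<open>dt (dt U) - div (c\<^sup>2 grad U) = F\<close>, together with \<open>dt U = 0\<close> at time 0, with arbitrary
  \<open>z\<close>. The choice \<open>W = U\<close> and the identity \<open>2 (weight p, v) = exp (- 1) * (norm (v T))\<^sup>2 - (norm (v 0))\<^sup>2 +
  (weight v, v) / T\<close> for \<open>p = dt v\<close> give the estimate, and applied to a difference of two solutions they
  give uniqueness. Existence with the required regularity is the solvability of the equation for the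
  second derivative \<open>p\<close> and for \<open>grad (dt U)\<close>. By the same weighted identity the adjoint of this
  problem satisfies a coercivity estimate, so that the solution is a Riesz representative. Here
  \<open>F \<in> H\<^sup>1\<close> is used to integrate by parts in the right-hand side. All this takes place in
  Hilbert spaces of classes of square-integrable functions, into which the function spaces of the
  statement are embedded isometrically; \<open>H\<^sup>1\<close> in time is described there as constant plus primitive.\<close>

section \<open>Orthogonal projections\<close>

text \<open>The basic estimate controls only \<open>dt U\<close> and \<open>grad U\<close>, whereas
  a trial function must also have \<open>dt (dt U)\<close> and \<open>grad (dt U)\<close> square
  integrable. Coercivity of the form itself would thus not produce a trial function, and the problem
  is shifted by one time derivative: for the velocity the energy norm contains just the missing
  quantities.

  The weight makes the evolution coercive, because \<open>dt weight = - weight / T\<close> creates a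
  volume term that has the right sign. Of the two end terms the one at \<open>T\<close> is harmless.
  The one at time 0 has the wrong sign in the direct problem, which is why the form carries the
  product of the initial velocities; in the adjoint problem the test curve vanishes at
  \<open>T\<close> and the term at time 0 comes out positive.

  The coefficient disappears from the abstract problem by working with the pairs
  \<open>(v, c grad v)\<close>, so that only inner products remain. The compatibility of the two
  components is then a closed linear constraint, and the solution has to be sought within the
  subspace it defines.\<close>

lemma closed_subspace_orthogonal_point:
  fixes U :: "'a::{real_inner,banach} set"
  assumes U: "subspace U" "closed U"
  obtains y where "y \<in> U" "\<And>z. z \<in> U \<Longrightarrow> (x - y) \<bullet> z = 0"
proof -
  define q where "q y = (norm (x - y))\<^sup>2" for y
  define d where "d = Inf (q ` U)"
  have ne: "q ` U \<noteq> {}" using U(1) subspace_0 by auto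
  have bdd: "bdd_below (q ` U)" by (rule bdd_belowI[of _ 0]) (auto simp: q_def)
  have d_le: "d \<le> q y" if "y \<in> U" for y
    unfolding d_def using that bdd by (intro cInf_lower) auto
  have "\<exists>y\<in>U. q y < d + 1 / real (Suc n)" for n
  proof -
    have "d < d + 1 / real (Suc n)" by simp
    then show ?thesis using cInf_lessD[OF ne] unfolding d_def by blast
  qed
  then obtain y where y: "\<And>n. y n \<in> U" "\<And>n. q (y n) < d + 1 / real (Suc n)" by metis
  \<comment> \<open>Parallelogram identity: the midpoint of two near-minimisers lies in
    \<open>U\<close>, so its squared distance is at least \<open>d\<close>; this forces
    near-minimisers together.\<close>
  have par: "(norm (y n - y m))\<^sup>2 \<le> 2 / real (Suc n) + 2 / real (Suc m)" for m n
  proof -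
    have "(1/2) *\<^sub>R (y n + y m) \<in> U" using U(1) y(1) by (simp add: subspace_add subspace_scale)
    then have "4 * d \<le> 4 * q ((1/2) *\<^sub>R (y n + y m))" using d_le by simp
    moreover have "(norm (y n - y m))\<^sup>2 + 4 * q ((1/2) *\<^sub>R (y n + y m)) = 2 * q (y n) + 2 * q (y m)"
      unfolding q_def power2_norm_eq_inner
      by (simp add: inner_diff_left inner_diff_right inner_add_left inner_add_right inner_commute algebra_simps)
    ultimately show ?thesis using y(2)[of n] y(2)[of m] by simp
  qed
  have "Cauchy y"
  proof (rule metric_CauchyI)
    fix e :: real assume e: "0 < e"
    obtain N where N: "4 / e\<^sup>2 < real N" using reals_Archimedean2 by blast
    have "dist (y m) (y n) < e" if "N \<le> m" "N \<le> n" for m n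
    proof -
      have gap: "2 / real (Suc k) < e\<^sup>2 / 2" if "N \<le> k" for k
      proof -
        have "4 / e\<^sup>2 < real (Suc k)" using N that by linarith
        then show ?thesis using e by (simp add: field_simps)
      qed
      have "(norm (y m - y n))\<^sup>2 < e\<^sup>2" using par[of m n] gap[OF that(1)] gap[OF that(2)] by linarith
      then show ?thesis using e by (simp add: dist_norm power_less_imp_less_base)
    qed
    then show "\<exists>M. \<forall>m\<ge>M. \<forall>n\<ge>M. dist (y m) (y n) < e" by blast
  qed
  then obtain l where l: "y \<longlonglongrightarrow> l" using Cauchy_convergent convergent_def by blast
  have lU: "l \<in> U" using U(2) y(1) l closed_sequentially by blast
  have "q l \<le> d"
  proof (rule LIMSEQ_le)
    show "(\<lambda>n. q (y n)) \<longlonglongrightarrow> q l" unfolding q_def by (intro tendsto_intros l)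
    show "(\<lambda>n. d + 1 / real (Suc n)) \<longlonglongrightarrow> d"
      using tendsto_add[OF tendsto_const LIMSEQ_Suc[OF lim_1_over_n]] by simp
  qed (use y(2) less_imp_le in blast)
  have "(x - l) \<bullet> z = 0" if z: "z \<in> U" for z
  proof (cases "z = 0")
    case False
    \<comment> \<open>The minimiser of the quadratic \<open>q (l + t *\<^sub>R z)\<close> in
      \<open>t\<close>; a nonzero product would make this value smaller than
      \<open>q l\<close>.\<close>
    define t where "t = ((x - l) \<bullet> z) / (z \<bullet> z)"
    have zz: "z \<bullet> z > 0" using False by simp
    have "l + t *\<^sub>R z \<in> U" using U(1) lU z by (simp add: subspace_add subspace_scale)
    then have "q l \<le> q (l + t *\<^sub>R z)" using d_le \<open>q l \<le> d\<close> by fastforce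
    moreover have "q (l + t *\<^sub>R z) = q l - 2 * t * ((x - l) \<bullet> z) + t * t * (z \<bullet> z)"
      unfolding q_def power2_norm_eq_inner
      by (simp add: inner_diff_left inner_diff_right inner_add_left inner_add_right inner_commute algebra_simps)
    moreover have "t * t * (z \<bullet> z) = t * ((x - l) \<bullet> z)" unfolding t_def using zz by simp
    ultimately have "t * ((x - l) \<bullet> z) \<le> 0" by simp
    moreover have "t * ((x - l) \<bullet> z) = ((x - l) \<bullet> z)\<^sup>2 / (z \<bullet> z)"
      unfolding t_def by (simp add: power2_eq_square)
    ultimately have "((x - l) \<bullet> z)\<^sup>2 \<le> 0" using zz by (simp add: divide_le_0_iff)
    then show ?thesis by simp
  qed simp
  with lU show ?thesis using that by blast
qed

definition orth_proj :: "'a::real_inner set \<Rightarrow> 'a \<Rightarrow> 'a" where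
  "orth_proj U x = (SOME y. y \<in> U \<and> (\<forall>z\<in>U. (x - y) \<bullet> z = 0))"

locale closed_subspace =
  fixes U :: "'a::{real_inner,banach} set"
  assumes subspace: "subspace U" and closed: "closed U"
begin

lemma orth_proj: "orth_proj U x \<in> U" "z \<in> U \<Longrightarrow> (x - orth_proj U x) \<bullet> z = 0"
proof -
  have "\<exists>y. y \<in> U \<and> (\<forall>z\<in>U. (x - y) \<bullet> z = 0)"
    using closed_subspace_orthogonal_point[OF subspace closed] by metis
  from someI_ex[OF this] show "orth_proj U x \<in> U" "z \<in> U \<Longrightarrow> (x - orth_proj U x) \<bullet> z = 0"
    unfolding orth_proj_def by auto
qed

lemma orth_proj_unique:
  assumes "y \<in> U" "\<And>z. z \<in> U \<Longrightarrow> (x - y) \<bullet> z = 0"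
  shows "orth_proj U x = y"
proof -
  have "orth_proj U x - y \<in> U" using assms(1) orth_proj(1) subspace by (simp add: subspace_diff)
  then have "(x - y) \<bullet> (orth_proj U x - y) - (x - orth_proj U x) \<bullet> (orth_proj U x - y) = 0"
    using assms(2) orth_proj(2) by simp
  then have "(orth_proj U x - y) \<bullet> (orth_proj U x - y) = 0"
    by (simp add: inner_diff_left)
  then show ?thesis by simp
qed

lemma orth_proj_eq [simp]: "x \<in> U \<Longrightarrow> orth_proj U x = x"
  by (rule orth_proj_unique) auto

lemma orth_proj_eq_iff: "orth_proj U x = x \<longleftrightarrow> x \<in> U"
  using orth_proj(1) orth_proj_eq by metis

lemma inner_orth_proj: "z \<in> U \<Longrightarrow> z \<bullet> orth_proj U x = z \<bullet> x"
  using orth_proj(2)[of z x] by (simp add: inner_diff_left inner_diff_right inner_commute)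

lemma norm_orth_proj_le: "norm (orth_proj U x) \<le> norm x"
proof -
  have "(norm (orth_proj U x))\<^sup>2 = orth_proj U x \<bullet> x"
    unfolding power2_norm_eq_inner using inner_orth_proj[OF orth_proj(1)] by simp
  also have "\<dots> \<le> norm (orth_proj U x) * norm x" by (rule norm_cauchy_schwarz)
  finally show ?thesis by (cases "norm (orth_proj U x) = 0") (auto simp: power2_eq_square)
qed

lemma bounded_linear_orth_proj: "bounded_linear (orth_proj U)"
proof (rule bounded_linear_intro[where K=1])
  fix x y :: 'a and r :: real
  show "orth_proj U (x + y) = orth_proj U x + orth_proj U y"
  proof (rule orth_proj_unique)
    show "orth_proj U x + orth_proj U y \<in> U" using orth_proj(1) subspace by (simp add: subspace_add)
    show "(x + y - (orth_proj U x + orth_proj U y)) \<bullet> z = 0" if "z \<in> U" for z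
      using orth_proj(2)[OF that, of x] orth_proj(2)[OF that, of y]
      by (simp add: inner_diff_left inner_add_left)
  qed
  show "orth_proj U (r *\<^sub>R x) = r *\<^sub>R orth_proj U x"
  proof (rule orth_proj_unique)
    show "r *\<^sub>R orth_proj U x \<in> U" using orth_proj(1) subspace by (simp add: subspace_scale)
    show "(r *\<^sub>R x - r *\<^sub>R orth_proj U x) \<bullet> z = 0" if "z \<in> U" for z
      using orth_proj(2)[OF that, of x] by (simp flip: scaleR_diff_right)
  qed
  show "norm (orth_proj U x) \<le> norm x * 1" using norm_orth_proj_le by simp
qed

end

section \<open>Riesz representation\<close>

lemma subspace_closure:
  fixes S :: "'a::real_normed_vector set"
  assumes "subspace S"
  shows "subspace (closure S)"
proof (rule subspaceI)
  show "0 \<in> closure S" using assms subspace_0 closure_subset by blast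
next
  fix x y assume "x \<in> closure S" "y \<in> closure S"
  then obtain f g where "\<And>n::nat. f n \<in> S" "f \<longlonglongrightarrow> x" "\<And>n::nat. g n \<in> S" "g \<longlonglongrightarrow> y"
    unfolding closure_sequential by metis
  then have "(\<lambda>n. f n + g n) \<longlonglongrightarrow> x + y" "\<And>n. f n + g n \<in> S"
    using assms by (auto intro: tendsto_add subspace_add)
  then show "x + y \<in> closure S" unfolding closure_sequential by metis
next
  fix c x assume "x \<in> closure S"
  then obtain f where "\<And>n::nat. f n \<in> S" "f \<longlonglongrightarrow> x" unfolding closure_sequential by metis
  then have "(\<lambda>n. c *\<^sub>R f n) \<longlonglongrightarrow> c *\<^sub>R x" "\<And>n. c *\<^sub>R f n \<in> S"
    using assms by (auto intro: tendsto_intros subspace_scale)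
  then show "c *\<^sub>R x \<in> closure S" unfolding closure_sequential by metis
qed

text \<open>Riesz representation of a functional given by its graph \<open>S\<close>: the representing vector is read
  off the component of \<open>(0,1)\<close> orthogonal to the closure of \<open>S\<close>.\<close>

lemma bounded_graph_representation:
  fixes S :: "('a::{real_inner,banach} \<times> real) set"
  assumes S: "subspace S" and bound: "\<And>x y. (x, y) \<in> S \<Longrightarrow> \<bar>y\<bar> \<le> C * norm x"
    and E: "subspace E" "closed E" "\<And>x y. (x, y) \<in> S \<Longrightarrow> x \<in> E"
  obtains v where "v \<in> E" "\<And>x y. (x, y) \<in> S \<Longrightarrow> v \<bullet> x = y"
proof -
  interpret G: closed_subspace "closure S" using subspace_closure[OF S] by unfold_locales auto
  obtain a b where ab: "orth_proj (closure S) (0, 1) = (a, b)" by fastforce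
  have abS: "(a, b) \<in> closure S" using G.orth_proj(1)[of "(0,1)"] ab by simp
  have cl: "\<bar>snd p\<bar> \<le> C * norm (fst p) \<and> fst p \<in> E" if "p \<in> closure S" for p
  proof -
    have "closed {p :: 'a \<times> real. \<bar>snd p\<bar> \<le> C * norm (fst p)}"
      by (intro closed_Collect_le continuous_intros)
    moreover have "closed {p :: 'a \<times> real. fst p \<in> E}"
      using closed_vimage[OF E(2) continuous_on_fst[OF continuous_on_id]] by (simp add: vimage_def)
    ultimately have "closed ({p. \<bar>snd p\<bar> \<le> C * norm (fst p)} \<inter> {p :: 'a \<times> real. fst p \<in> E})"
      by (rule closed_Int)
    moreover have "S \<subseteq> {p. \<bar>snd p\<bar> \<le> C * norm (fst p)} \<inter> {p :: 'a \<times> real. fst p \<in> E}"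
      using bound E(3) by auto
    ultimately have "closure S \<subseteq> {p. \<bar>snd p\<bar> \<le> C * norm (fst p)} \<inter> {p :: 'a \<times> real. fst p \<in> E}"
      by (rule closure_minimal[rotated])
    then show ?thesis using that by auto
  qed
  have orth: "(1 - b) * y = a \<bullet> x" if "(x, y) \<in> closure S" for x y
    using G.orth_proj(2)[OF that, of "(0,1)"] ab by (simp add: inner_prod_def)
  \<comment> \<open>With \<open>b = 1\<close> the vector \<open>(0, 1)\<close> would be its own
    projection, but the bound, which passes to the closure, excludes vertical directions.\<close>
  have b: "b \<noteq> 1"
  proof
    assume "b = 1"
    then have "a = 0" using orth[OF abS] by simp
    then show False using cl[OF abS] \<open>b = 1\<close> by simp
  qed
  show ?thesis
  proof
    show "(1 / (1 - b)) *\<^sub>R a \<in> E" using cl[OF abS] E(1) by (simp add: subspace_scale)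
    fix x y assume "(x, y) \<in> S"
    then have "(1 - b) * y = a \<bullet> x" using orth closure_subset by blast
    then show "(1 / (1 - b)) *\<^sub>R a \<bullet> x = y" using b by (simp add: field_simps)
  qed
qed

section \<open>Square-integrable functions with values in a Hilbert space\<close>

text \<open>Separability is included because measurability of sums and inner products of Borel
  functions rests on a second-countable target. The class is stable under products and under
  \<open>l2\<close>, so curves whose values are classes of functions in space are covered as
  well.\<close>

class separable_hilbert = real_inner + banach + second_countable_topology

instance euclidean_space \<subseteq> separable_hilbert ..
instance prod :: (separable_hilbert, separable_hilbert) separable_hilbert ..

lemma (in complete_measure) measurable_AE_cong:
  assumes f: "f \<in> measurable M N" and ae: "AE x in M. f x = g x"
    and g: "\<And>x. x \<in> space M \<Longrightarrow> g x \<in> space N"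
  shows "g \<in> measurable M N"
proof (rule measurableI)
  fix A assume A: "A \<in> sets N"
  define Z where "Z = {x \<in> space M. f x \<noteq> g x}"
  have Z: "Z \<in> null_sets M" using ae unfolding AE_iff_null_sets Z_def .
  have "g -` A \<inter> space M \<inter> Z \<in> sets M" by (rule complete[OF _ Z]) auto
  moreover have "f -` A \<inter> space M - Z \<in> sets M" using f A Z by (auto intro: measurable_sets)
  ultimately have "(f -` A \<inter> space M - Z) \<union> (g -` A \<inter> space M \<inter> Z) \<in> sets M" by auto
  moreover have "g -` A \<inter> space M = (f -` A \<inter> space M - Z) \<union> (g -` A \<inter> space M \<inter> Z)"
    by (auto simp: Z_def)
  ultimately show "g -` A \<inter> space M \<in> sets M" by simp
qed (use g in auto)

lemma complete_measure_lebesgue_on: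
  assumes "S \<in> sets lebesgue"
  shows "complete_measure (lebesgue_on S)"
proof
  fix A B assume "B \<subseteq> A" "A \<in> null_sets (lebesgue_on S)"
  then have "A \<in> null_sets lebesgue" "A \<subseteq> S" "B \<subseteq> A" using assms by (auto simp: null_sets_restrict_space)
  then have "B \<in> sets lebesgue" using completion.complete by blast
  with \<open>A \<subseteq> S\<close> \<open>B \<subseteq> A\<close> assms show "B \<in> sets (lebesgue_on S)" by (simp add: sets_restrict_space_iff)
qed

lemma sigma_finite_measure_lebesgue: "sigma_finite_measure (lebesgue :: 'a::euclidean_space measure)"
proof
  show "\<exists>A. countable A \<and> A \<subseteq> sets (lebesgue :: 'a measure) \<and> \<Union> A = space lebesgue \<and> (\<forall>a\<in>A. emeasure lebesgue a \<noteq> \<infinity>)"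
  proof (intro exI conjI)
    show "\<Union> (range (\<lambda>n::nat. cball 0 (real n))) = space (lebesgue :: 'a measure)"
      using real_arch_simple by (auto simp: dist_norm)
    show "\<forall>a\<in>range (\<lambda>n::nat. cball (0::'a) (real n)). emeasure lebesgue a \<noteq> \<infinity>"
      using emeasure_bounded_finite[of "cball (0::'a) _"] by (auto simp: less_top)
  qed auto
qed

text \<open>The Borel sets over which \<open>h\<close> integrates to zero form a Dynkin system, so a
  generating pi-system decides all of them, and a Lebesgue set differs from a Borel set by a null
  set. The total integral is assumed separately: the complement step uses it, and
  \<open>UNIV\<close> need not belong to \<open>G\<close>.\<close>

lemma AE_eq_0_if_integral_generator_eq_0:
  fixes h :: "'a::euclidean_space \<Rightarrow> 'b::{banach,second_countable_topology}"
  assumes h: "integrable lebesgue h"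
    and G: "Int_stable G" "sets borel = sigma_sets UNIV G"
    and zero: "\<And>A. A \<in> G \<Longrightarrow> (LINT x:A|lebesgue. h x) = 0" "(LINT x|lebesgue. h x) = 0"
  shows "AE x in lebesgue. h x = 0"
proof (rule sigma_finite_measure.density_zero[OF sigma_finite_measure_lebesgue h])
  have si: "set_integrable lebesgue A h" if "A \<in> sets lebesgue" for A
    using h that integrable_mult_indicator unfolding set_integrable_def by blast
  have leb: "A \<in> sets lebesgue" if "A \<in> sigma_sets UNIV G" for A using that G(2) by auto
  have borel0: "(LINT x:A|lebesgue. h x) = 0" if "A \<in> sets borel" for A
  proof -
    have "G \<subseteq> Pow UNIV" "A \<in> sigma_sets UNIV G" using that G(2) by auto
    with G(1) show ?thesis
    proof (induct rule: sigma_sets_induct_disjoint)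
      case (basic A) then show ?case using zero(1) by simp
    next
      case empty then show ?case by (simp add: set_lebesgue_integral_def)
    next
      case (compl A)
      have "(LINT x:A \<union> (UNIV - A)|lebesgue. h x) = (LINT x:A|lebesgue. h x) + (LINT x:UNIV - A|lebesgue. h x)"
        using leb[OF compl(1)] by (intro set_integral_Un si) auto
      then show ?case using compl(2) zero(2) by (simp add: set_lebesgue_integral_def)
    next
      case (union A)
      have A: "A i \<in> sets lebesgue" for i using union(2) leb by auto
      have "(LINT x:(\<Union>i. A i)|lebesgue. h x) = (\<Sum>i. (LINT x:A i|lebesgue. h x))"
      proof (rule lebesgue_integral_countable_add)
        show "A i \<inter> A j = {}" if "i \<noteq> j" for i j using union(1) that by (auto simp: disjoint_family_on_def)
        show "set_integrable lebesgue (\<Union> (range A)) h" using A by (intro si) auto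
      qed (use A in auto)
      then show ?case using union(3) by simp
    qed
  qed
  fix A assume "A \<in> sets (lebesgue :: 'a measure)"
  then obtain B N where B: "B \<in> sets borel" "negligible N" "B \<union> N = A" by (rule sets_lebesgue_almost_borel)
  have "(LINT x:A|lebesgue. h x) = (LINT x:B|lebesgue. h x)"
    unfolding set_lebesgue_integral_def
  proof (rule integral_cong_AE)
    show "(\<lambda>x. indicator A x *\<^sub>R h x) \<in> borel_measurable lebesgue"
      using si[OF \<open>A \<in> sets lebesgue\<close>] unfolding set_integrable_def by (rule borel_measurable_integrable)
    show "(\<lambda>x. indicator B x *\<^sub>R h x) \<in> borel_measurable lebesgue"
      using si[of B] B(1) unfolding set_integrable_def by (auto intro: borel_measurable_integrable)
    have "AE x in lebesgue. x \<notin> N" using B(2) by (simp add: negligible_iff_null_sets AE_not_in)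
    then show "AE x in lebesgue. indicator A x *\<^sub>R h x = indicator B x *\<^sub>R h x"
      by eventually_elim (use B(3) in \<open>auto simp: indicator_def\<close>)
  qed
  then show "(LINT x:A|lebesgue. h x) = 0" using borel0[OF B(1)] by simp
qed

section \<open>Square-integrable functions on the whole space\<close>

definition sq_integrable :: "('a::euclidean_space \<Rightarrow> 'b::separable_hilbert) \<Rightarrow> bool" where
  "sq_integrable f \<longleftrightarrow> f \<in> borel_measurable lebesgue \<and> integrable lebesgue (\<lambda>x. (norm (f x))\<^sup>2)"

lemma sq_integrable_measurable [measurable_dest]: "sq_integrable f \<Longrightarrow> f \<in> borel_measurable lebesgue"
  by (simp add: sq_integrable_def)

lemma sq_integrable_norm_sq: "sq_integrable f \<Longrightarrow> integrable lebesgue (\<lambda>x. (norm (f x))\<^sup>2)"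
  by (simp add: sq_integrable_def)

lemma sq_integrable_0 [simp]: "sq_integrable (\<lambda>x. 0)"
  by (simp add: sq_integrable_def)

lemma sq_integrable_bound:
  assumes f: "sq_integrable f" and g: "g \<in> borel_measurable lebesgue"
    and le: "AE x in lebesgue. norm (g x) \<le> C * norm (f x)"
  shows "sq_integrable g"
  unfolding sq_integrable_def
proof (intro conjI g)
  have "integrable lebesgue (\<lambda>x. C\<^sup>2 * (norm (f x))\<^sup>2)" using sq_integrable_norm_sq[OF f] by simp
  then show "integrable lebesgue (\<lambda>x. (norm (g x))\<^sup>2)"
  proof (rule Bochner_Integration.integrable_bound)
    show "AE x in lebesgue. norm ((norm (g x))\<^sup>2) \<le> norm (C\<^sup>2 * (norm (f x))\<^sup>2)"
      using le
    proof eventually_elim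
      case (elim x)
      then have "(norm (g x))\<^sup>2 \<le> (C * norm (f x))\<^sup>2" by (intro power_mono) auto
      then show ?case by (simp add: power_mult_distrib)
    qed
  qed (use g in measurable)
qed

lemma sq_integrable_add:
  assumes f: "sq_integrable f" and g: "sq_integrable g"
  shows "sq_integrable (\<lambda>x. f x + g x)"
  unfolding sq_integrable_def
proof
  show m: "(\<lambda>x. f x + g x) \<in> borel_measurable lebesgue" using f g by measurable
  have "integrable lebesgue (\<lambda>x. 2 * (norm (f x))\<^sup>2 + 2 * (norm (g x))\<^sup>2)"
    using f g by (auto dest!: sq_integrable_norm_sq)
  then show "integrable lebesgue (\<lambda>x. (norm (f x + g x))\<^sup>2)"
  proof (rule Bochner_Integration.integrable_bound)
    have "(norm (f x + g x))\<^sup>2 \<le> 2 * (norm (f x))\<^sup>2 + 2 * (norm (g x))\<^sup>2" for x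
    proof -
      have "(norm (f x + g x))\<^sup>2 \<le> (norm (f x) + norm (g x))\<^sup>2"
        by (intro power_mono norm_triangle_ineq) auto
      also have "\<dots> \<le> 2 * (norm (f x))\<^sup>2 + 2 * (norm (g x))\<^sup>2"
        using sum_squares_bound[of "norm (f x)" "norm (g x)"] by (simp add: power2_sum)
      finally show ?thesis .
    qed
    then show "AE x in lebesgue. norm ((norm (f x + g x))\<^sup>2) \<le> norm (2 * (norm (f x))\<^sup>2 + 2 * (norm (g x))\<^sup>2)"
      by simp
  qed (use m in measurable)
qed

lemma sq_integrable_linear:
  assumes L: "bounded_linear L" and f: "sq_integrable f"
  shows "sq_integrable (\<lambda>x. L (f x))"
proof -
  obtain K where "\<And>x. norm (L x) \<le> norm x * K" using bounded_linear.bounded[OF L] by blast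
  then have "AE x in lebesgue. norm (L (f x)) \<le> K * norm (f x)" by (simp add: mult.commute)
  moreover have "(\<lambda>x. L (f x)) \<in> borel_measurable lebesgue"
    by (rule borel_measurable_continuous_on[OF linear_continuous_on[OF L] sq_integrable_measurable[OF f]])
  ultimately show ?thesis by (rule sq_integrable_bound[OF f, rotated])
qed

lemma sq_integrable_scaleR: "sq_integrable f \<Longrightarrow> sq_integrable (\<lambda>x. c *\<^sub>R f x)"
  by (rule sq_integrable_linear[OF bounded_linear_scaleR_right])

lemma sq_integrable_minus: "sq_integrable f \<Longrightarrow> sq_integrable (\<lambda>x. - f x)"
  by (rule sq_integrable_linear[OF bounded_linear_minus[OF bounded_linear_ident]])

lemma sq_integrable_diff: "sq_integrable f \<Longrightarrow> sq_integrable g \<Longrightarrow> sq_integrable (\<lambda>x. f x - g x)"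
  using sq_integrable_add[of f "\<lambda>x. - g x"] sq_integrable_minus[of g] by simp

lemma integrable_inner_sq_integrable:
  assumes f: "sq_integrable f" and g: "sq_integrable g"
  shows "integrable lebesgue (\<lambda>x. f x \<bullet> g x)"
proof -
  have "integrable lebesgue (\<lambda>x. (norm (f x))\<^sup>2 + (norm (g x))\<^sup>2)"
    using f g by (auto dest!: sq_integrable_norm_sq)
  then show ?thesis
  proof (rule Bochner_Integration.integrable_bound)
    have "\<bar>f x \<bullet> g x\<bar> \<le> (norm (f x))\<^sup>2 + (norm (g x))\<^sup>2" for x
    proof -
      have "\<bar>f x \<bullet> g x\<bar> \<le> norm (f x) * norm (g x)" by (rule Cauchy_Schwarz_ineq2)
      also have "\<dots> \<le> (norm (f x))\<^sup>2 + (norm (g x))\<^sup>2"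
        using sum_squares_bound[of "norm (f x)" "norm (g x)"] by (simp add: mult.assoc) (smt (verit) mult_nonneg_nonneg norm_ge_zero)
      finally show ?thesis .
    qed
    then show "AE x in lebesgue. norm (f x \<bullet> g x) \<le> norm ((norm (f x))\<^sup>2 + (norm (g x))\<^sup>2)" by simp
  qed (use f g in measurable)
qed

section \<open>The quotient modulo null sets as an inner product space\<close>

definition l2_canonical :: "('a::euclidean_space \<Rightarrow> 'b::separable_hilbert) \<Rightarrow> 'a \<Rightarrow> 'b" where
  "l2_canonical f = (SOME g. sq_integrable g \<and> (AE x in lebesgue. g x = f x))"

lemma l2_canonical:
  assumes "sq_integrable f"
  shows "sq_integrable (l2_canonical f)" "AE x in lebesgue. l2_canonical f x = f x"
proof -
  have "sq_integrable f \<and> (AE x in lebesgue. f x = f x)" using assms by simp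
  from someI[where P="\<lambda>g. sq_integrable g \<and> (AE x in lebesgue. g x = f x)", OF this]
  show "sq_integrable (l2_canonical f)" "AE x in lebesgue. l2_canonical f x = f x"
    unfolding l2_canonical_def by auto
qed

text \<open>The predicate from which the representative is chosen is the same for both functions, so
  the choices are identical and not merely equal almost everywhere.\<close>

lemma l2_canonical_cong:
  assumes "AE x in lebesgue. f x = g x"
  shows "l2_canonical f = l2_canonical g"
proof -
  have "(AE x in lebesgue. h x = f x) \<longleftrightarrow> (AE x in lebesgue. h x = g x)" for h
  proof
    assume "AE x in lebesgue. h x = f x" then show "AE x in lebesgue. h x = g x"
      using assms by eventually_elim simp
  next
    assume "AE x in lebesgue. h x = g x" then show "AE x in lebesgue. h x = f x"
      using assms by eventually_elim simp
  qed
  then show ?thesis unfolding l2_canonical_def by simp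
qed

text \<open>The quotient modulo equality almost everywhere is represented by one chosen function from each
  class.\<close>

typedef (overloaded) ('a, 'b) l2 = "{f::'a::euclidean_space \<Rightarrow> 'b::separable_hilbert. sq_integrable f \<and> l2_canonical f = f}"
  morphisms rep_l2 abs_l2
proof
  have "sq_integrable (\<lambda>x::'a. 0::'b)" by simp
  from l2_canonical(1)[OF this] l2_canonical_cong[OF l2_canonical(2)[OF this]]
  show "l2_canonical (\<lambda>x::'a. 0::'b) \<in> {f. sq_integrable f \<and> l2_canonical f = f}" by simp
qed

definition cls :: "('a::euclidean_space \<Rightarrow> 'b::separable_hilbert) \<Rightarrow> ('a, 'b) l2" where
  "cls f = abs_l2 (l2_canonical f)"

lemma sq_integrable_rep_l2 [simp]: "sq_integrable (rep_l2 x)"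
  using rep_l2[of x] by simp

lemma rep_l2_measurable [measurable]: "rep_l2 x \<in> borel_measurable lebesgue"
  by (rule sq_integrable_measurable) simp

lemma rep_cls:
  assumes "sq_integrable f"
  shows "AE x in lebesgue. rep_l2 (cls f) x = f x"
proof -
  have "l2_canonical f \<in> {f. sq_integrable f \<and> l2_canonical f = f}"
    using l2_canonical[OF assms] l2_canonical_cong[OF l2_canonical(2)[OF assms]] by simp
  then have "rep_l2 (cls f) = l2_canonical f" unfolding cls_def by (rule abs_l2_inverse)
  then show ?thesis using l2_canonical(2)[OF assms] by simp
qed

lemma l2_eqI:
  assumes "AE t in lebesgue. rep_l2 x t = rep_l2 y t"
  shows "x = y"
proof -
  have "rep_l2 x = rep_l2 y" using l2_canonical_cong[OF assms] rep_l2[of x] rep_l2[of y] by simp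
  then show ?thesis by (simp add: rep_l2_inject)
qed

lemma cls_cong: "AE x in lebesgue. f x = g x \<Longrightarrow> cls f = cls g"
  unfolding cls_def by (simp add: l2_canonical_cong)

lemma cls_rep [simp]: "cls (rep_l2 x) = x"
  by (rule l2_eqI) (simp add: rep_cls)

lemma rep_cls_ops:
  "AE t in lebesgue. rep_l2 (cls (\<lambda>_. 0)) t = 0"
  "AE t in lebesgue. rep_l2 (cls (\<lambda>t. rep_l2 x t + rep_l2 y t)) t = rep_l2 x t + rep_l2 y t"
  "AE t in lebesgue. rep_l2 (cls (\<lambda>t. - rep_l2 x t)) t = - rep_l2 x t"
  "AE t in lebesgue. rep_l2 (cls (\<lambda>t. rep_l2 x t - rep_l2 y t)) t = rep_l2 x t - rep_l2 y t"
  "AE t in lebesgue. rep_l2 (cls (\<lambda>t. c *\<^sub>R rep_l2 x t)) t = c *\<^sub>R rep_l2 x t"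
  by (intro rep_cls sq_integrable_0 sq_integrable_add sq_integrable_diff sq_integrable_minus
      sq_integrable_scaleR sq_integrable_rep_l2)+

instantiation l2 :: (euclidean_space, separable_hilbert) real_vector
begin

definition zero_l2 :: "('a, 'b) l2" where "zero_l2 = cls (\<lambda>_. 0)"
definition plus_l2 :: "('a, 'b) l2 \<Rightarrow> ('a, 'b) l2 \<Rightarrow> ('a, 'b) l2" where
  "plus_l2 x y = cls (\<lambda>t. rep_l2 x t + rep_l2 y t)"
definition uminus_l2 :: "('a, 'b) l2 \<Rightarrow> ('a, 'b) l2" where
  "uminus_l2 x = cls (\<lambda>t. - rep_l2 x t)"
definition minus_l2 :: "('a, 'b) l2 \<Rightarrow> ('a, 'b) l2 \<Rightarrow> ('a, 'b) l2" where
  "minus_l2 x y = cls (\<lambda>t. rep_l2 x t - rep_l2 y t)"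
definition scaleR_l2 :: "real \<Rightarrow> ('a, 'b) l2 \<Rightarrow> ('a, 'b) l2" where
  "scaleR_l2 c x = cls (\<lambda>t. c *\<^sub>R rep_l2 x t)"

lemmas l2_ops = zero_l2_def plus_l2_def uminus_l2_def minus_l2_def scaleR_l2_def

instance
proof
  fix x y z :: "('a, 'b) l2" and r s :: real
  let ?p = "\<lambda>x y. cls (\<lambda>t. rep_l2 x t + rep_l2 y t)" and ?s = "\<lambda>c x. cls (\<lambda>t. c *\<^sub>R rep_l2 x t)"
    and ?m = "\<lambda>x. cls (\<lambda>t. - rep_l2 x t)" and ?z = "cls (\<lambda>_. 0)"
  show "x + y + z = x + (y + z)" unfolding l2_ops
    by (rule l2_eqI, use rep_cls_ops(2)[of "?p x y" z] rep_cls_ops(2)[of x y]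
        rep_cls_ops(2)[of x "?p y z"] rep_cls_ops(2)[of y z] in eventually_elim) (simp add: add.assoc)
  show "x + y = y + x" unfolding plus_l2_def by (simp add: add.commute)
  show "0 + x = x" unfolding l2_ops
    by (rule l2_eqI, use rep_cls_ops(2)[of ?z x] rep_cls_ops(1) in eventually_elim) simp
  show "- x + x = 0" unfolding l2_ops
    by (rule l2_eqI, use rep_cls_ops(2)[of "?m x" x] rep_cls_ops(3)[of x] rep_cls_ops(1) in eventually_elim) simp
  show "x - y = x + - y" unfolding l2_ops
    by (rule l2_eqI, use rep_cls_ops(4)[of x y] rep_cls_ops(3)[of y] rep_cls_ops(2)[of x "?m y"]
        in eventually_elim) simp
  show "r *\<^sub>R (x + y) = r *\<^sub>R x + r *\<^sub>R y" unfolding l2_ops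
    by (rule l2_eqI, use rep_cls_ops(5)[of r "?p x y"] rep_cls_ops(2)[of x y] rep_cls_ops(2)[of "?s r x" "?s r y"]
        rep_cls_ops(5)[of r x] rep_cls_ops(5)[of r y] in eventually_elim) (simp add: scaleR_add_right)
  show "(r + s) *\<^sub>R x = r *\<^sub>R x + s *\<^sub>R x" unfolding l2_ops
    by (rule l2_eqI, use rep_cls_ops(5)[of "r + s" x] rep_cls_ops(2)[of "?s r x" "?s s x"]
        rep_cls_ops(5)[of r x] rep_cls_ops(5)[of s x] in eventually_elim) (simp add: scaleR_add_left)
  show "r *\<^sub>R s *\<^sub>R x = (r * s) *\<^sub>R x" unfolding l2_ops
    by (rule l2_eqI, use rep_cls_ops(5)[of "r * s" x] rep_cls_ops(5)[of r "?s s x"] rep_cls_ops(5)[of s x]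
        in eventually_elim) simp
  show "1 *\<^sub>R x = x" unfolding l2_ops
    by (rule l2_eqI, use rep_cls_ops(5)[of 1 x] in eventually_elim) simp
qed

end

lemmas rep_l2_AE = rep_cls_ops[folded l2_ops]

instantiation l2 :: (euclidean_space, separable_hilbert) real_inner
begin

definition inner_l2 :: "('a, 'b) l2 \<Rightarrow> ('a, 'b) l2 \<Rightarrow> real" where
  "inner_l2 x y = (LINT t|lebesgue. rep_l2 x t \<bullet> rep_l2 y t)"
definition norm_l2 :: "('a, 'b) l2 \<Rightarrow> real" where "norm_l2 x = sqrt (x \<bullet> x)"
definition sgn_l2 :: "('a, 'b) l2 \<Rightarrow> ('a, 'b) l2" where "sgn_l2 x = scaleR (inverse (norm x)) x"
definition dist_l2 :: "('a, 'b) l2 \<Rightarrow> ('a, 'b) l2 \<Rightarrow> real" where "dist_l2 x y = norm (x - y)"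
definition "uniformity = (INF e\<in>{0 <..}. principal {(x :: ('a, 'b) l2, y). dist x y < e})"
definition "open (U :: ('a, 'b) l2 set) \<longleftrightarrow> (\<forall>x\<in>U. \<forall>\<^sub>F (x', y) in uniformity. x' = x \<longrightarrow> y \<in> U)"

instance
proof
  fix x y z :: "('a, 'b) l2" and r s :: real
  show "dist x y = norm (x - y)" by (simp add: dist_l2_def)
  show "sgn x = x /\<^sub>R norm x" by (simp add: sgn_l2_def)
  show "uniformity = (INF e\<in>{0<..}. principal {(x :: ('a, 'b) l2, y). dist x y < e})"
    by (rule uniformity_l2_def)
  show "open U \<longleftrightarrow> (\<forall>x\<in>U. \<forall>\<^sub>F (x', y) in uniformity. x' = x \<longrightarrow> y \<in> U)" for U :: "('a, 'b) l2 set"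
    by (rule open_l2_def)
  show "x \<bullet> y = y \<bullet> x" unfolding inner_l2_def by (simp add: inner_commute)
  have int: "integrable lebesgue (\<lambda>t. rep_l2 u t \<bullet> rep_l2 v t)" for u v :: "('a, 'b) l2"
    by (intro integrable_inner_sq_integrable) auto
  show "(x + y) \<bullet> z = x \<bullet> z + y \<bullet> z"
  proof -
    have "(x + y) \<bullet> z = (LINT t|lebesgue. rep_l2 x t \<bullet> rep_l2 z t + rep_l2 y t \<bullet> rep_l2 z t)"
      unfolding inner_l2_def
    proof (rule integral_cong_AE)
      show "AE t in lebesgue. rep_l2 (x + y) t \<bullet> rep_l2 z t = rep_l2 x t \<bullet> rep_l2 z t + rep_l2 y t \<bullet> rep_l2 z t"
        using rep_l2_AE(2)[of x y] by eventually_elim (simp add: inner_add_left)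
    qed measurable
    then show ?thesis using int by (simp add: inner_l2_def)
  qed
  show "(r *\<^sub>R x) \<bullet> y = r * (x \<bullet> y)"
  proof -
    have "(r *\<^sub>R x) \<bullet> y = (LINT t|lebesgue. r * (rep_l2 x t \<bullet> rep_l2 y t))"
      unfolding inner_l2_def
    proof (rule integral_cong_AE)
      show "AE t in lebesgue. rep_l2 (r *\<^sub>R x) t \<bullet> rep_l2 y t = r * (rep_l2 x t \<bullet> rep_l2 y t)"
        using rep_l2_AE(5)[of r x] by eventually_elim simp
    qed measurable
    then show ?thesis by (simp add: inner_l2_def)
  qed
  show "0 \<le> x \<bullet> x" unfolding inner_l2_def by (intro integral_nonneg_AE) auto
  show "x \<bullet> x = 0 \<longleftrightarrow> x = 0"
  proof -
    have "x \<bullet> x = 0 \<longleftrightarrow> (AE t in lebesgue. rep_l2 x t \<bullet> rep_l2 x t = 0)"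
      unfolding inner_l2_def by (rule integral_nonneg_eq_0_iff_AE[OF int]) auto
    also have "\<dots> \<longleftrightarrow> x = 0"
    proof
      assume "AE t in lebesgue. rep_l2 x t \<bullet> rep_l2 x t = 0"
      then have ae: "AE t in lebesgue. rep_l2 x t = 0" by simp
      show "x = 0" by (rule l2_eqI, use ae rep_l2_AE(1) in eventually_elim) simp
    next
      assume x: "x = 0"
      show "AE t in lebesgue. rep_l2 x t \<bullet> rep_l2 x t = 0"
        unfolding x using rep_l2_AE(1) by eventually_elim simp
    qed
    finally show ?thesis .
  qed
  show "norm x = sqrt (x \<bullet> x)" by (rule norm_l2_def)
qed

end

lemma inner_cls:
  assumes f: "sq_integrable f" and g: "sq_integrable g"
  shows "cls f \<bullet> cls g = (LINT x|lebesgue. f x \<bullet> g x)"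
  unfolding inner_l2_def
proof (rule integral_cong_AE)
  show "AE x in lebesgue. rep_l2 (cls f) x \<bullet> rep_l2 (cls g) x = f x \<bullet> g x"
    using rep_cls[OF f] rep_cls[OF g] by eventually_elim simp
qed (use f g in measurable)

lemma norm_cls_sq: "sq_integrable f \<Longrightarrow> (norm (cls f))\<^sup>2 = (LINT x|lebesgue. (norm (f x))\<^sup>2)"
  by (simp add: power2_norm_eq_inner inner_cls)

lemma cls_add:
  assumes f: "sq_integrable f" and g: "sq_integrable g"
  shows "cls (\<lambda>x. f x + g x) = cls f + cls g"
  unfolding plus_l2_def
  by (rule cls_cong, use rep_cls[OF f] rep_cls[OF g] in eventually_elim) simp

lemma cls_diff:
  assumes f: "sq_integrable f" and g: "sq_integrable g"
  shows "cls (\<lambda>x. f x - g x) = cls f - cls g"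
  unfolding minus_l2_def
  by (rule cls_cong, use rep_cls[OF f] rep_cls[OF g] in eventually_elim) simp

lemma cls_scaleR:
  assumes f: "sq_integrable f"
  shows "cls (\<lambda>x. c *\<^sub>R f x) = c *\<^sub>R cls f"
  unfolding scaleR_l2_def
  by (rule cls_cong, use rep_cls[OF f] in eventually_elim) simp

lemma cls_0: "cls (\<lambda>x. 0) = 0"
  by (simp add: zero_l2_def)

lemma nn_integral_norm_sq_rep_l2:
  "(\<integral>\<^sup>+ t. ennreal ((norm (rep_l2 x t))\<^sup>2) \<partial>lebesgue) = ennreal ((norm x)\<^sup>2)"
proof -
  have "(norm x)\<^sup>2 = (LINT t|lebesgue. (norm (rep_l2 x t))\<^sup>2)" using norm_cls_sq[of "rep_l2 x"] by simp
  then show ?thesis by (simp add: nn_integral_eq_integral sq_integrable_norm_sq)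
qed

text \<open>Stated with the nonnegative integral, so that a bound coming from Fatou's lemma can be
  used before integrability is known.\<close>

lemma norm_cls_le:
  assumes f: "f \<in> borel_measurable lebesgue" and C: "0 \<le> C"
    and le: "(\<integral>\<^sup>+ x. ennreal ((norm (f x))\<^sup>2) \<partial>lebesgue) \<le> ennreal (C\<^sup>2)"
  shows "sq_integrable f" "norm (cls f) \<le> C"
proof -
  show sq: "sq_integrable f" unfolding sq_integrable_def
  proof (intro conjI f integrableI_bounded)
    show "(\<lambda>x. (norm (f x))\<^sup>2) \<in> borel_measurable lebesgue" using f by measurable
    show "(\<integral>\<^sup>+ x. ennreal (norm ((norm (f x))\<^sup>2)) \<partial>lebesgue) < \<infinity>"
      using le by (simp add: le_less_trans)
  qed
  have "ennreal ((norm (cls f))\<^sup>2) = (\<integral>\<^sup>+ x. ennreal ((norm (f x))\<^sup>2) \<partial>lebesgue)"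
    using norm_cls_sq[OF sq] by (simp add: nn_integral_eq_integral sq_integrable_norm_sq[OF sq])
  then have "ennreal ((norm (cls f))\<^sup>2) \<le> ennreal (C\<^sup>2)" using le by (rule ord_eq_le_trans)
  then have "(norm (cls f))\<^sup>2 \<le> C\<^sup>2" by simp
  then show "norm (cls f) \<le> C" using C by (rule power2_le_imp_le)
qed

text \<open>Riesz--Fischer: a rapidly convergent subsequence converges almost everywhere, since
  \<open>\<Sum> 4 ^ k * (norm (f (k+1) - f k))\<^sup>2\<close> has a finite integral; Fatou's lemma then bounds the distance
  to the limit.\<close>

instance l2 :: (euclidean_space, separable_hilbert) banach
proof
  fix X :: "nat \<Rightarrow> ('a, 'b) l2" assume "Cauchy X"
  then have "\<forall>k. \<exists>N. \<forall>m\<ge>N. \<forall>n\<ge>N. dist (X m) (X n) < (1/4) ^ k"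
    unfolding Cauchy_def by simp
  then obtain N where N: "\<And>k m n. N k \<le> m \<Longrightarrow> N k \<le> n \<Longrightarrow> dist (X m) (X n) < (1/4) ^ k" by metis
  \<comment> \<open>Partial sums instead of \<open>N k\<close> itself: \<open>r m\<close> exceeds
    every \<open>N k\<close> with \<open>k \<le> m\<close>, although \<open>N\<close> need not be
    monotone.\<close>
  define r where "r k = (\<Sum>i\<le>k. N i)" for k
  have rN: "N k \<le> r m" if "k \<le> m" for k m
    unfolding r_def using that by (intro member_le_sum) auto
  define f where "f k = rep_l2 (X (r k))" for k
  have [measurable]: "f k \<in> borel_measurable lebesgue" for k by (simp add: f_def)
  have rep_diff: "(\<integral>\<^sup>+ t. ennreal ((norm (f m t - f k t))\<^sup>2) \<partial>lebesgue) = ennreal ((norm (X (r m) - X (r k)))\<^sup>2)" for m k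
  proof -
    have "(\<integral>\<^sup>+ t. ennreal ((norm (f m t - f k t))\<^sup>2) \<partial>lebesgue)
        = (\<integral>\<^sup>+ t. ennreal ((norm (rep_l2 (X (r m) - X (r k)) t))\<^sup>2) \<partial>lebesgue)"
      by (rule nn_integral_cong_AE, use rep_l2_AE(4)[of "X (r m)" "X (r k)"] in eventually_elim) (simp add: f_def)
    then show ?thesis by (simp add: nn_integral_norm_sq_rep_l2)
  qed
  have small: "(\<integral>\<^sup>+ t. ennreal ((norm (f m t - f k t))\<^sup>2) \<partial>lebesgue) \<le> ennreal (((1/4) ^ k)\<^sup>2)" if "k \<le> m" for m k
    unfolding rep_diff using N[OF rN[OF that] rN[OF order_refl]]
    by (intro ennreal_leI power_mono) (auto simp: dist_norm)
  have "(\<integral>\<^sup>+ t. (\<Sum>k. ennreal (4 ^ k * (norm (f (Suc k) t - f k t))\<^sup>2)) \<partial>lebesgue)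
      = (\<Sum>k. \<integral>\<^sup>+ t. ennreal (4 ^ k * (norm (f (Suc k) t - f k t))\<^sup>2) \<partial>lebesgue)"
    by (rule nn_integral_suminf) measurable
  also have "\<dots> \<le> (\<Sum>k. ennreal ((1/4) ^ k))"
  proof (rule suminf_le)
    fix k
    have "(\<integral>\<^sup>+ t. ennreal (4 ^ k * (norm (f (Suc k) t - f k t))\<^sup>2) \<partial>lebesgue)
        = ennreal (4 ^ k) * (\<integral>\<^sup>+ t. ennreal ((norm (f (Suc k) t - f k t))\<^sup>2) \<partial>lebesgue)"
      by (subst nn_integral_cmult[symmetric]) (auto simp: ennreal_mult')
    \<comment> \<open>The squared distance is at most \<open>(1/4) ^ (2 * k)\<close>, so the factor
      \<open>4 ^ k\<close> still leaves a geometric series.\<close>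
    also have "\<dots> \<le> ennreal (4 ^ k) * ennreal (((1/4) ^ k)\<^sup>2)"
      by (intro mult_left_mono small) auto
    also have "\<dots> = ennreal ((1/4) ^ k)"
      by (simp add: ennreal_mult'[symmetric] power2_eq_square power_mult_distrib[symmetric] field_simps)
    finally show "(\<integral>\<^sup>+ t. ennreal (4 ^ k * (norm (f (Suc k) t - f k t))\<^sup>2) \<partial>lebesgue) \<le> ennreal ((1/4) ^ k)" .
  qed auto
  also have "\<dots> < top"
    unfolding less_top[symmetric] by (intro ennreal_suminf_neq_top summable_geometric) auto
  finally have fin: "AE t in lebesgue. (\<Sum>k. ennreal (4 ^ k * (norm (f (Suc k) t - f k t))\<^sup>2)) \<noteq> \<infinity>"
    by (intro nn_integral_PInf_AE) auto
  define F where "F t = lim (\<lambda>k. f k t)" for t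
  have [measurable]: "F \<in> borel_measurable lebesgue" unfolding F_def by measurable
  have lim: "AE t in lebesgue. (\<lambda>k. f k t) \<longlonglongrightarrow> F t"
    using fin
  proof eventually_elim
    case (elim t)
    define S where "S = (\<Sum>k. ennreal (4 ^ k * (norm (f (Suc k) t - f k t))\<^sup>2))"
    obtain C where C: "S = ennreal C" "0 \<le> C"
      using elim unfolding S_def[symmetric] by (cases S) auto
    \<comment> \<open>A single term is at most the sum \<open>C\<close> of the series; dividing by
      \<open>4 ^ k\<close> and taking roots gives a summable bound for the increments.\<close>
    have "norm (f (Suc k) t - f k t) \<le> sqrt C * (1/2) ^ k" for k
    proof -
      have "sum (\<lambda>k. ennreal (4 ^ k * (norm (f (Suc k) t - f k t))\<^sup>2)) {k}
          \<le> S"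
        unfolding S_def by (rule sum_le_suminf) auto
      then have "4 ^ k * (norm (f (Suc k) t - f k t))\<^sup>2 \<le> C" using C by simp
      moreover have "(2 ^ k)\<^sup>2 = (4::real) ^ k"
        by (simp add: power2_eq_square flip: power_mult_distrib)
      ultimately have "(2 ^ k * norm (f (Suc k) t - f k t))\<^sup>2 \<le> C"
        by (simp add: power_mult_distrib)
      then have "2 ^ k * norm (f (Suc k) t - f k t) \<le> sqrt C" by (rule real_le_rsqrt)
      then show ?thesis by (simp add: field_simps power_divide)
    qed
    moreover have "summable (\<lambda>k. sqrt C * (1/2) ^ k)" by (intro summable_mult summable_geometric) simp
    ultimately have "summable (\<lambda>k. f (Suc k) t - f k t)" by (rule summable_comparison_test'[rotated])
    then have "convergent (\<lambda>m. \<Sum>k<m. f (Suc k) t - f k t)" by (simp add: summable_iff_convergent)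
    then have "convergent (\<lambda>m. (\<Sum>k<m. f (Suc k) t - f k t) + f 0 t)"
      by (intro convergent_add convergent_const)
    then have "convergent (\<lambda>k. f k t)" by (simp only: sum_lessThan_telescope[of "\<lambda>k. f k t"] diff_add_cancel)
    then show ?case unfolding F_def by (simp add: convergent_LIMSEQ_iff)
  qed
  have fatou: "(\<integral>\<^sup>+ t. ennreal ((norm (F t - f k t))\<^sup>2) \<partial>lebesgue) \<le> ennreal (((1/4) ^ k)\<^sup>2)" for k
  proof -
    have "(\<integral>\<^sup>+ t. ennreal ((norm (F t - f k t))\<^sup>2) \<partial>lebesgue)
        = (\<integral>\<^sup>+ t. liminf (\<lambda>m. ennreal ((norm (f m t - f k t))\<^sup>2)) \<partial>lebesgue)"
    proof (rule nn_integral_cong_AE, use lim in eventually_elim)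
      case (elim t)
      then have "(\<lambda>m. ennreal ((norm (f m t - f k t))\<^sup>2)) \<longlonglongrightarrow> ennreal ((norm (F t - f k t))\<^sup>2)"
        by (intro tendsto_intros tendsto_ennrealI)
      then show ?case using lim_imp_Liminf[OF sequentially_bot] by metis
    qed
    also have "\<dots> \<le> liminf (\<lambda>m. \<integral>\<^sup>+ t. ennreal ((norm (f m t - f k t))\<^sup>2) \<partial>lebesgue)"
      by (rule nn_integral_liminf) measurable
    also have "\<dots> \<le> ennreal (((1/4) ^ k)\<^sup>2)"
      by (rule order_trans[OF Liminf_mono Liminf_const[OF sequentially_bot, THEN eq_refl]])
        (use small in \<open>auto simp: eventually_sequentially\<close>)
    finally show ?thesis .
  qed
  have sqd: "sq_integrable (\<lambda>t. F t - f k t)" "norm (cls (\<lambda>t. F t - f k t)) \<le> (1/4) ^ k" for k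
    using norm_cls_le[OF _ _ fatou] by auto
  have sqF: "sq_integrable F"
    using sq_integrable_add[OF sqd(1)[of 0] sq_integrable_rep_l2[of "X (r 0)"]] by (simp add: f_def)
  have near: "norm (X (r k) - cls F) \<le> (1/4) ^ k" for k
    using sqd(2)[of k] cls_diff[OF sqF sq_integrable_rep_l2, of "X (r k)"]
    by (simp add: f_def norm_minus_commute)
  have "X \<longlonglongrightarrow> cls F"
  proof (rule metric_LIMSEQ_I)
    fix e :: real assume "0 < e"
    then obtain k where k: "(1/4::real) ^ k < e / 2" using real_arch_pow_inv[of "e/2" "1/4"] by auto
    have "dist (X n) (cls F) < e" if "N k \<le> n" for n
      using dist_triangle[of "X n" "cls F" "X (r k)"] N[OF that rN[OF order_refl]] near[of k] k
      by (simp add: dist_norm)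
    then show "\<exists>no. \<forall>n\<ge>no. dist (X n) (cls F) < e" by blast
  qed
  then show "convergent X" by (rule convergentI)
qed

section \<open>Separability of the space of classes\<close>

lemma countable_basis_if_countable_dense:
  fixes D :: "'a::metric_space set"
  assumes "countable D" "closure D = UNIV"
  shows "\<exists>B::'a set set. countable B \<and> open = generate_topology B"
proof -
  define B where "B = (\<lambda>(x, n). ball x (1 / real (Suc n))) ` (D \<times> UNIV)"
  have "topological_basis B"
  proof (rule topological_basisI)
    show "open b" if "b \<in> B" for b using that by (auto simp: B_def)
    fix O' and x :: 'a assume "open O'" "x \<in> O'"
    then obtain e where e: "e > 0" "ball x e \<subseteq> O'" by (auto simp: open_contains_ball)
    obtain n where n: "1 / real (Suc n) < e / 2" using nat_approx_posE[of "e/2"] e(1) by auto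
    have "x \<in> closure D" using assms(2) by simp
    then obtain d where d: "d \<in> D" "dist d x < 1 / real (Suc n)"
      unfolding closure_approachable by (metis of_nat_0_less_iff zero_less_Suc zero_less_divide_1_iff)
    have "ball d (1 / real (Suc n)) \<subseteq> ball x e"
    proof
      fix y assume "y \<in> ball d (1 / real (Suc n))"
      then show "y \<in> ball x e" using dist_triangle[of x y d] d(2) n by (simp add: dist_commute)
    qed
    moreover have "x \<in> ball d (1 / real (Suc n))" using d(2) by simp
    moreover have "ball d (1 / real (Suc n)) \<in> B"
      unfolding B_def using d(1) by (intro image_eqI[of _ _ "(d, n)"]) auto
    ultimately show "\<exists>B'\<in>B. x \<in> B' \<and> B' \<subseteq> O'" using e(2) by (meson order_trans)
  qed
  moreover have "countable B" using assms(1) by (simp add: B_def)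
  ultimately show ?thesis using topological_basis_imp_subbasis by blast
qed

text \<open>The finite rational combinations of the \<open>e n\<close> are countable, and their
  closure is a subspace once real scalars have been approximated by rational ones. The difference of
  a vector and its projection to this closure is orthogonal to every \<open>e n\<close>, hence
  zero.\<close>

lemma countable_dense_if_total_sequence:
  fixes e :: "nat \<Rightarrow> 'a::{real_inner,banach}"
  assumes total: "\<And>x. (\<And>n. x \<bullet> e n = 0) \<Longrightarrow> x = 0"
  shows "\<exists>D::'a set. countable D \<and> closure D = UNIV"
proof -
  define comb where "comb l = (\<Sum>(q, i)\<leftarrow>l. of_rat q *\<^sub>R e i)" for l :: "(rat \<times> nat) list"
  define D where "D = range comb"
  have comb_append: "comb (l @ l') = comb l + comb l'" for l l' by (simp add: comb_def)
  have comb_scale: "comb (map (\<lambda>(q, i). (c * q, i)) l) = of_rat c *\<^sub>R comb l" for c l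
    by (induction l) (auto simp: comb_def scaleR_add_right of_rat_mult)
  have seq: "\<exists>f. (\<forall>n. f n \<in> D) \<and> f \<longlonglongrightarrow> x" if "x \<in> closure D" for x
    using that unfolding closure_sequential .
  have lim: "x \<in> closure D" if "f \<longlonglongrightarrow> x" "\<And>n. f n \<in> D" for f :: "nat \<Rightarrow> 'a" and x
    using that(2) closure_subset by (intro closed_sequentially[OF closed_closure _ that(1)]) blast
  have scale: "c *\<^sub>R x \<in> closure D" if x: "x \<in> D" for c x
  proof -
    have "\<exists>q. \<bar>of_rat q - c\<bar> < 1 / real (Suc n)" for n
    proof -
      obtain q :: rat where "c < of_rat q" "of_rat q < c + 1 / real (Suc n)"
        using of_rat_dense[of c "c + 1 / real (Suc n)"] by auto
      then have "\<bar>of_rat q - c\<bar> < 1 / real (Suc n)" by simp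
      then show ?thesis by blast
    qed
    then obtain q where q: "\<And>n. \<bar>of_rat (q n) - c\<bar> < 1 / real (Suc n)" by metis
    have "(\<lambda>n. of_rat (q n) - c) \<longlonglongrightarrow> 0"
      by (rule Lim_null_comparison[OF _ LIMSEQ_Suc[OF lim_1_over_n]])
        (use q less_imp_le in \<open>auto intro!: always_eventually\<close>)
    then have "(\<lambda>n. of_rat (q n)) \<longlonglongrightarrow> c" by (simp add: LIM_zero_iff)
    then have "(\<lambda>n. of_rat (q n) *\<^sub>R x) \<longlonglongrightarrow> c *\<^sub>R x" by (intro tendsto_intros)
    moreover have "of_rat (q n) *\<^sub>R x \<in> D" for n using x comb_scale unfolding D_def by (metis rangeE rangeI)
    ultimately show ?thesis by (rule lim)
  qed
  have "subspace (closure D)"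
  proof (rule subspaceI)
    have "0 \<in> D" unfolding D_def by (rule range_eqI[of _ _ "[]"]) (simp add: comb_def)
    then show "0 \<in> closure D" using closure_subset by blast
  next
    fix x y assume "x \<in> closure D" "y \<in> closure D"
    from seq[OF this(1)] seq[OF this(2)] obtain f g
      where fg: "\<And>n. f n \<in> D" "f \<longlonglongrightarrow> x" "\<And>n. g n \<in> D" "g \<longlonglongrightarrow> y" by auto
    have "f n + g n \<in> D" for n
    proof -
      obtain l l' where "f n = comb l" "g n = comb l'" using fg(1,3)[of n] unfolding D_def by auto
      then have "f n + g n = comb (l @ l')" by (simp add: comb_append)
      then show ?thesis unfolding D_def by simp
    qed
    then show "x + y \<in> closure D" by (rule lim[OF tendsto_add[OF fg(2,4)]])
  next
    fix c x assume "x \<in> closure D"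
    then obtain f where f: "\<And>n. f n \<in> D" "f \<longlonglongrightarrow> x" using seq by metis
    have conv: "(\<lambda>n. c *\<^sub>R f n) \<longlonglongrightarrow> c *\<^sub>R x" by (intro tendsto_intros f)
    have cl: "\<And>n. c *\<^sub>R f n \<in> closure D" using scale f(1) by blast
    show "c *\<^sub>R x \<in> closure D" by (rule closed_sequentially[OF closed_closure cl conv])
  qed
  then interpret closed_subspace "closure D" by unfold_locales auto
  have "x \<in> closure D" for x
  proof -
    have "(x - orth_proj (closure D) x) \<bullet> e n = 0" for n
    proof (rule orth_proj(2))
      have "e n \<in> D" unfolding D_def by (rule range_eqI[of _ _ "[(1, n)]"]) (simp add: comb_def)
      then show "e n \<in> closure D" using closure_subset by blast
    qed
    then have "x - orth_proj (closure D) x = 0" by (rule total)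
    then show ?thesis using orth_proj(1)[of x] by simp
  qed
  then show ?thesis unfolding D_def by (intro exI[of _ "range comb"]) auto
qed

text \<open>The test vectors are \<open>d\<close> times the indicator of a bounded set, with
  \<open>d\<close> from a countable dense set and the sets from a countable pi-system generating the
  Borel sets. For a class orthogonal to all of them, \<open>rep_l2 x t \<bullet> d = 0\<close> holds
  for all these \<open>d\<close> simultaneously off one null set.\<close>

lemma l2_total_sequence:
  "\<exists>e :: nat \<Rightarrow> ('a::euclidean_space, 'b::separable_hilbert) l2. \<forall>x. (\<forall>n. x \<bullet> e n = 0) \<longrightarrow> x = 0"
proof -
  obtain B :: "'a set set" where B: "countable B" "topological_basis B" using ex_countable_basis by blast
  \<comment> \<open>Finite intersections turn the basis into a pi-system and keep it countable; the
    empty intersection contributes \<open>UNIV\<close>.\<close>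
  define G where "G = Inter ` {F. finite F \<and> F \<subseteq> B}"
  have cG: "countable G" unfolding G_def by (intro countable_image countable_Collect_finite_subset B)
  have oG: "open A" if "A \<in> G" for A
    using that topological_basis_open[OF B(2)] by (auto simp: G_def intro!: open_Inter)
  have BG: "B \<subseteq> G"
  proof
    fix b assume "b \<in> B" then show "b \<in> G" unfolding G_def by (intro image_eqI[of _ _ "{b}"]) auto
  qed
  have "topological_basis G" unfolding topological_basis_def
  proof (intro conjI ballI allI impI)
    show "open b" if "b \<in> G" for b using oG that .
    fix x :: "'a set" assume "open x"
    then show "\<exists>B'\<subseteq>G. \<Union>B' = x" using B(2) BG unfolding topological_basis_def by (meson order_trans)
  qed
  then have gen: "sets borel = sigma_sets UNIV G"
    using borel_eq_countable_basis[OF cG] by (metis sets_measure_of subset_Pow_Union top_greatest Pow_UNIV)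
  have Int: "Int_stable G"
  proof (rule Int_stableI)
    fix a b assume "a \<in> G" "b \<in> G"
    then obtain F F' where "a = \<Inter>F" "b = \<Inter>F'" "finite F" "F \<subseteq> B" "finite F'" "F' \<subseteq> B" by (auto simp: G_def)
    then show "a \<inter> b \<in> G" unfolding G_def by (intro image_eqI[of _ _ "F \<union> F'"]) auto
  qed
  obtain D :: "'b set" where D: "countable D" "\<And>X. open X \<Longrightarrow> X \<noteq> {} \<Longrightarrow> \<exists>d\<in>D. d \<in> X"
    using countable_dense_exists by blast
  define E where "E = (\<lambda>(A, n::nat, d). cls (\<lambda>x. indicator (A \<inter> ball 0 (real n)) x *\<^sub>R d)) ` (G \<times> UNIV \<times> D)"
  have ne: "E \<noteq> {}"
  proof -
    have "UNIV \<in> G" unfolding G_def by (intro image_eqI[of _ _ "{}"]) auto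
    moreover have "D \<noteq> {}" using D(2)[of UNIV] by auto
    ultimately show ?thesis unfolding E_def by auto
  qed
  have cE: "countable E" unfolding E_def using cG D(1) by auto
  have sq_ind: "sq_integrable (\<lambda>x. indicator (A \<inter> ball 0 (real n)) x *\<^sub>R d)" if "A \<in> G" for A n and d :: 'b
  proof (rule norm_cls_le(1))
    have [measurable]: "A \<in> sets lebesgue" using oG[OF that] by auto
    show "(\<lambda>x. indicator (A \<inter> ball 0 (real n)) x *\<^sub>R d) \<in> borel_measurable lebesgue"
      by (intro borel_measurable_scaleR borel_measurable_indicator) auto
    have "(\<integral>\<^sup>+ x. ennreal ((norm (indicator (A \<inter> ball 0 (real n)) x *\<^sub>R d))\<^sup>2) \<partial>lebesgue)
       = (\<integral>\<^sup>+ x. ennreal ((norm d)\<^sup>2) * indicator (A \<inter> ball 0 (real n)) x \<partial>lebesgue)"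
      by (intro nn_integral_cong) (auto simp: indicator_def)
    also have "\<dots> = ennreal ((norm d)\<^sup>2) * emeasure lebesgue (A \<inter> ball 0 (real n))"
      by (subst nn_integral_cmult_indicator) auto
    also have "\<dots> < \<infinity>"
    proof -
      have "A \<inter> ball 0 (real n) \<in> lmeasurable"
        by (intro bounded_set_imp_lmeasurable) (auto intro: bounded_subset[OF bounded_ball])
      then show ?thesis by (auto simp: ennreal_mult_less_top fmeasurable_def)
    qed
    \<comment> \<open>The bound is to be given as a square; the root of the integral itself serves,
      as the integral is finite.\<close>
    finally show "(\<integral>\<^sup>+ x. ennreal ((norm (indicator (A \<inter> ball 0 (real n)) x *\<^sub>R d))\<^sup>2) \<partial>lebesgue)
       \<le> ennreal ((sqrt (enn2real (\<integral>\<^sup>+ x. ennreal ((norm (indicator (A \<inter> ball 0 (real n)) x *\<^sub>R d))\<^sup>2) \<partial>lebesgue)))\<^sup>2)"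
      by simp
  qed simp
  have "x = 0" if x: "\<And>n. x \<bullet> from_nat_into E n = 0" for x
  proof -
    have orth: "(LINT t|lebesgue. indicator (A \<inter> ball 0 (real n)) t * (rep_l2 x t \<bullet> d)) = 0"
      if "A \<in> G" "d \<in> D" for A n d
    proof -
      have "cls (\<lambda>x. indicator (A \<inter> ball 0 (real n)) x *\<^sub>R d) \<in> E"
        unfolding E_def using that by (intro image_eqI[of _ _ "(A, n, d)"]) auto
      then have "x \<bullet> cls (\<lambda>x. indicator (A \<inter> ball 0 (real n)) x *\<^sub>R d) = 0"
        using x from_nat_into_surj[OF cE] by metis
      then show ?thesis
        using inner_cls[OF sq_integrable_rep_l2[of x] sq_ind[OF that(1), of n d]] by simp
    qed
    have UG: "UNIV \<in> G" unfolding G_def by (intro image_eqI[of _ _ "{}"]) auto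
    have "AE t in lebesgue. indicator (ball 0 (real n)) t * (rep_l2 x t \<bullet> d) = 0" if d: "d \<in> D" for n d
    proof (rule AE_eq_0_if_integral_generator_eq_0[OF _ Int gen])
      show "integrable lebesgue (\<lambda>t. indicator (ball 0 (real n)) t * (rep_l2 x t \<bullet> d))"
        using integrable_inner_sq_integrable[OF sq_integrable_rep_l2[of x] sq_ind[OF UG, of n d]] by simp
      show "(LINT t|lebesgue. indicator (ball 0 (real n)) t * (rep_l2 x t \<bullet> d)) = 0"
        using orth[OF UG d, of n] by simp
      show "(LINT t:A|lebesgue. indicator (ball 0 (real n)) t * (rep_l2 x t \<bullet> d)) = 0" if "A \<in> G" for A
        using orth[OF that d, of n] unfolding set_lebesgue_integral_def by (simp add: indicator_inter_arith mult.assoc)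
    qed
    then have "AE t in lebesgue. \<forall>d\<in>D. \<forall>n. indicator (ball 0 (real n)) t * (rep_l2 x t \<bullet> d) = 0"
      by (intro AE_ball_countable[OF D(1), THEN iffD2] ballI AE_all_countable[THEN iffD2] allI)
    then have "AE t in lebesgue. rep_l2 x t = 0"
    proof eventually_elim
      case (elim t)
      obtain n where "norm t < real n" using reals_Archimedean2 by blast
      then have zero: "rep_l2 x t \<bullet> d = 0" if "d \<in> D" for d using elim that by (force simp: indicator_def)
      show ?case
      proof (rule ccontr)
        let ?h = "rep_l2 x t"
        assume h: "?h \<noteq> 0"
        \<comment> \<open>A vector that is closer to \<open>?h\<close> than \<open>norm ?h\<close>
          cannot be orthogonal to \<open>?h\<close>.\<close>
        then obtain d where d: "d \<in> D" "d \<in> ball ?h (norm ?h)" using D(2)[of "ball ?h (norm ?h)"] by auto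
        have "norm ?h * norm ?h = ?h \<bullet> (?h - d)" using zero[OF d(1)] by (simp add: inner_diff_right flip: power2_norm_eq_inner power2_eq_square)
        also have "\<dots> \<le> norm ?h * norm (?h - d)" by (rule norm_cauchy_schwarz)
        finally show False using h d(2) by (simp add: dist_norm)
      qed
    qed
    note ae = this
    show "x = 0" by (rule l2_eqI, use ae rep_l2_AE(1) in eventually_elim) simp
  qed
  then show ?thesis by blast
qed

instance l2 :: (euclidean_space, separable_hilbert) separable_hilbert
proof
  obtain e :: "nat \<Rightarrow> ('a, 'b) l2" where "\<And>x. (\<And>n. x \<bullet> e n = 0) \<Longrightarrow> x = 0"
    using l2_total_sequence by blast
  then show "\<exists>B::('a, 'b) l2 set set. countable B \<and> open = generate_topology B"
    using countable_dense_if_total_sequence countable_basis_if_countable_dense by metis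
qed

section \<open>Square-integrable functions on a measurable subset\<close>

definition sq_integrable_on :: "'a::euclidean_space set \<Rightarrow> ('a \<Rightarrow> 'b::separable_hilbert) \<Rightarrow> bool" where
  "sq_integrable_on S f \<longleftrightarrow> f \<in> borel_measurable (lebesgue_on S) \<and> integrable (lebesgue_on S) (\<lambda>x. (norm (f x))\<^sup>2)"

text \<open>Extension by zero lets one type serve all domains: \<open>S\<close> enters as a set and
  not through the type.\<close>

definition cls_on :: "'a::euclidean_space set \<Rightarrow> ('a \<Rightarrow> 'b::separable_hilbert) \<Rightarrow> ('a, 'b) l2" where
  "cls_on S f = cls (\<lambda>x. indicator S x *\<^sub>R f x)"

lemma sq_integrable_on_iff:
  assumes "S \<in> sets lebesgue"
  shows "sq_integrable_on S f \<longleftrightarrow> sq_integrable (\<lambda>x. indicator S x *\<^sub>R f x)"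
proof -
  have "(\<lambda>x. indicator S x *\<^sub>R (norm (f x))\<^sup>2) = (\<lambda>x. (norm (indicator S x *\<^sub>R f x))\<^sup>2)"
    by (auto simp: indicator_def fun_eq_iff)
  then show ?thesis using assms
    by (simp add: sq_integrable_on_def sq_integrable_def borel_measurable_restrict_space_iff integrable_restrict_space)
qed

context
  fixes S :: "'a::euclidean_space set" assumes S: "S \<in> sets lebesgue"
begin

lemma AE_lebesgue_on_iff: "(AE x in lebesgue_on S. P x) \<longleftrightarrow> (AE x in lebesgue. x \<in> S \<longrightarrow> P x)"
  using S by (simp add: AE_restrict_space_iff)

lemma sq_integrable_on_rep_l2: "sq_integrable_on S (rep_l2 x)"
  unfolding sq_integrable_on_iff[OF S]
proof (rule sq_integrable_bound)
  show "sq_integrable (rep_l2 x)" by simp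
  show "(\<lambda>t. indicator S t *\<^sub>R rep_l2 x t) \<in> borel_measurable lebesgue"
    using S by (intro borel_measurable_scaleR borel_measurable_indicator rep_l2_measurable)
  show "AE t in lebesgue. norm (indicator S t *\<^sub>R rep_l2 x t) \<le> 1 * norm (rep_l2 x t)"
    by (simp add: indicator_def)
qed

lemma sq_integrable_on_linear:
  assumes L: "bounded_linear L" and f: "sq_integrable_on S f"
  shows "sq_integrable_on S (\<lambda>x. L (f x))"
  using sq_integrable_linear[OF L] f unfolding sq_integrable_on_iff[OF S]
  by (metis (no_types, lifting) ext L bounded_linear.linear linear_simps(5))

lemma sq_integrable_on_scaleR: "sq_integrable_on S f \<Longrightarrow> sq_integrable_on S (\<lambda>x. c *\<^sub>R f x)"
  by (rule sq_integrable_on_linear[OF bounded_linear_scaleR_right])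

lemma sq_integrable_on_minus: "sq_integrable_on S f \<Longrightarrow> sq_integrable_on S (\<lambda>x. - f x)"
  by (rule sq_integrable_on_linear[OF bounded_linear_minus[OF bounded_linear_ident]])

lemma sq_integrable_on_add:
  "sq_integrable_on S f \<Longrightarrow> sq_integrable_on S g \<Longrightarrow> sq_integrable_on S (\<lambda>x. f x + g x)"
  using sq_integrable_add[of "\<lambda>x. indicator S x *\<^sub>R f x" "\<lambda>x. indicator S x *\<^sub>R g x"]
  by (simp add: sq_integrable_on_iff[OF S] scaleR_add_right)

lemma sq_integrable_on_diff:
  "sq_integrable_on S f \<Longrightarrow> sq_integrable_on S g \<Longrightarrow> sq_integrable_on S (\<lambda>x. f x - g x)"
  using sq_integrable_diff[of "\<lambda>x. indicator S x *\<^sub>R f x" "\<lambda>x. indicator S x *\<^sub>R g x"]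
  by (simp add: sq_integrable_on_iff[OF S] scaleR_diff_right)

lemma sq_integrable_on_Pair:
  assumes f: "sq_integrable_on S f" and g: "sq_integrable_on S g"
  shows "sq_integrable_on S (\<lambda>x. (f x, g x))"
proof -
  have "sq_integrable_on S (\<lambda>x. (f x, 0) + (0, g x))"
    by (intro sq_integrable_on_add sq_integrable_on_linear[OF _ f] sq_integrable_on_linear[OF _ g]
        bounded_linear_Pair bounded_linear_ident bounded_linear_zero)
  then show ?thesis by simp
qed

lemma sq_integrable_on_bound:
  assumes f: "sq_integrable_on S f" and g: "g \<in> borel_measurable (lebesgue_on S)"
    and le: "AE x in lebesgue_on S. norm (g x) \<le> C * norm (f x)"
  shows "sq_integrable_on S g"
  unfolding sq_integrable_on_iff[OF S]
proof (rule sq_integrable_bound)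
  show "sq_integrable (\<lambda>x. indicator S x *\<^sub>R f x)" using f by (simp add: sq_integrable_on_iff[OF S])
  show "(\<lambda>x. indicator S x *\<^sub>R g x) \<in> borel_measurable lebesgue"
    using g S by (simp add: borel_measurable_restrict_space_iff)
  show "AE x in lebesgue. norm (indicator S x *\<^sub>R g x) \<le> C * norm (indicator S x *\<^sub>R f x)"
    using le unfolding AE_lebesgue_on_iff by eventually_elim (simp add: indicator_def)
qed

lemma sq_integrable_on_AE_cong:
  assumes f: "sq_integrable_on S f" and ae: "AE x in lebesgue_on S. f x = g x"
  shows "sq_integrable_on S g"
proof (rule sq_integrable_on_bound[OF f])
  show "g \<in> borel_measurable (lebesgue_on S)"
    using f complete_measure.measurable_AE_cong[OF complete_measure_lebesgue_on[OF S] _ ae]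
    by (simp add: sq_integrable_on_def)
  show "AE x in lebesgue_on S. norm (g x) \<le> 1 * norm (f x)" using ae by eventually_elim simp
qed

lemma rep_cls_on:
  assumes "sq_integrable_on S f"
  shows "AE x in lebesgue_on S. rep_l2 (cls_on S f) x = f x"
  using rep_cls[OF assms[unfolded sq_integrable_on_iff[OF S]]]
  unfolding AE_lebesgue_on_iff cls_on_def by eventually_elim auto

lemma cls_on_cong:
  assumes "AE x in lebesgue_on S. f x = g x"
  shows "cls_on S f = cls_on S g"
  unfolding cls_on_def
  by (rule cls_cong, use assms[unfolded AE_lebesgue_on_iff] in eventually_elim) (auto simp: indicator_def)

lemma cls_on_eq_iff:
  assumes "sq_integrable_on S f" "sq_integrable_on S g"
  shows "cls_on S f = cls_on S g \<longleftrightarrow> (AE x in lebesgue_on S. f x = g x)"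
proof
  assume "cls_on S f = cls_on S g"
  with rep_cls_on[OF assms(2)] have "AE x in lebesgue_on S. rep_l2 (cls_on S f) x = g x" by simp
  with rep_cls_on[OF assms(1)] show "AE x in lebesgue_on S. f x = g x" by eventually_elim simp
qed (rule cls_on_cong)

lemma cls_on_rep_cls_on: "sq_integrable_on S f \<Longrightarrow> cls_on S (rep_l2 (cls_on S f)) = cls_on S f"
  by (rule cls_on_cong[OF rep_cls_on])

lemma cls_on_add:
  "sq_integrable_on S f \<Longrightarrow> sq_integrable_on S g \<Longrightarrow> cls_on S (\<lambda>x. f x + g x) = cls_on S f + cls_on S g"
  using cls_add[of "\<lambda>x. indicator S x *\<^sub>R f x" "\<lambda>x. indicator S x *\<^sub>R g x"]
  by (simp add: sq_integrable_on_iff[OF S] scaleR_add_right cls_on_def)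

lemma cls_on_diff:
  "sq_integrable_on S f \<Longrightarrow> sq_integrable_on S g \<Longrightarrow> cls_on S (\<lambda>x. f x - g x) = cls_on S f - cls_on S g"
  using cls_diff[of "\<lambda>x. indicator S x *\<^sub>R f x" "\<lambda>x. indicator S x *\<^sub>R g x"]
  by (simp add: sq_integrable_on_iff[OF S] scaleR_diff_right cls_on_def)

lemma cls_on_scaleR:
  "sq_integrable_on S f \<Longrightarrow> cls_on S (\<lambda>x. c *\<^sub>R f x) = c *\<^sub>R cls_on S f"
  using cls_scaleR[of "\<lambda>x. indicator S x *\<^sub>R f x" c]
  by (simp add: sq_integrable_on_iff[OF S] cls_on_def mult.commute)

lemma cls_on_0: "cls_on S (\<lambda>x. 0) = 0"
  by (simp add: cls_on_def cls_0)

lemma inner_cls_on: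
  assumes f: "sq_integrable_on S f" and g: "sq_integrable_on S g"
  shows "cls_on S f \<bullet> cls_on S g = (LINT x|lebesgue_on S. f x \<bullet> g x)"
proof -
  have "(\<lambda>x. indicator S x *\<^sub>R (f x \<bullet> g x)) = (\<lambda>x. (indicator S x *\<^sub>R f x) \<bullet> (indicator S x *\<^sub>R g x))"
    by (auto simp: indicator_def)
  then show ?thesis using inner_cls[OF f[unfolded sq_integrable_on_iff[OF S]] g[unfolded sq_integrable_on_iff[OF S]]] S
    by (subst integral_restrict_space) (simp_all add: cls_on_def del: real_scaleR_def inner_scaleR_left inner_scaleR_right)
qed

lemma integrable_inner_on:
  assumes f: "sq_integrable_on S f" and g: "sq_integrable_on S g"
  shows "integrable (lebesgue_on S) (\<lambda>x. f x \<bullet> g x)"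
proof -
  have "(\<lambda>x. indicator S x *\<^sub>R (f x \<bullet> g x)) = (\<lambda>x. (indicator S x *\<^sub>R f x) \<bullet> (indicator S x *\<^sub>R g x))"
    by (auto simp: indicator_def)
  then show ?thesis
    using integrable_inner_sq_integrable[OF f[unfolded sq_integrable_on_iff[OF S]] g[unfolded sq_integrable_on_iff[OF S]]] S
    by (subst integrable_restrict_space) (simp_all del: real_scaleR_def inner_scaleR_left inner_scaleR_right)
qed

lemma norm_cls_on_sq: "sq_integrable_on S f \<Longrightarrow> (norm (cls_on S f))\<^sup>2 = (LINT x|lebesgue_on S. (norm (f x))\<^sup>2)"
  by (simp add: power2_norm_eq_inner inner_cls_on)

end

section \<open>Primitives of Bochner integrable curves\<close>

abbreviation itv :: "real \<Rightarrow> real measure" where "itv T \<equiv> lebesgue_on {0<..<T}"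

definition prim :: "(real \<Rightarrow> 'b::{banach,second_countable_topology}) \<Rightarrow> real \<Rightarrow> 'b" where
  "prim f t = (LINT s|itv t. f s)"

lemma finite_measure_itv: "finite_measure (itv T)"
  by (rule finite_measure_lebesgue_on) simp

lemma sets_itv: "t \<le> T \<Longrightarrow> {0<..<t} \<in> sets (itv T)"
  by (auto simp: sets_restrict_space_iff)

text \<open>Moves the variable end point from the measure into an indicator, so that differences and
  limits of primitives can be taken under one fixed integral.\<close>

lemma prim_eq:
  assumes "t \<le> T"
  shows "prim f t = (LINT s|itv T. indicator {0<..<t} s *\<^sub>R f s)"
proof -
  have "(\<lambda>s. indicator {0<..<T} s *\<^sub>R indicator {0<..<t} s *\<^sub>R f s) = (\<lambda>s. indicator {0<..<t} s *\<^sub>R f s)"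
    using assms by (auto simp: indicator_def)
  then show ?thesis unfolding prim_def by (subst (1 2) integral_restrict_space) (simp_all del: scaleR_scaleR)
qed

lemma prim_0 [simp]: "prim f 0 = 0"
  by (simp add: prim_eq[of 0 0])

lemma integrable_itv_indicator:
  fixes f :: "real \<Rightarrow> 'b::{banach,second_countable_topology}"
  shows "integrable (itv T) f \<Longrightarrow> t \<le> T \<Longrightarrow> integrable (itv T) (\<lambda>s. indicator {0<..<t} s *\<^sub>R f s)"
  by (rule integrable_mult_indicator[OF sets_itv])

lemma AE_itv_neq: "AE s in itv T. s \<noteq> t"
proof -
  have "AE s in lebesgue. s \<notin> {t}" by (rule AE_not_in) (simp add: negligible_iff_null_sets[symmetric])
  then have "AE s in lebesgue. s \<in> {0<..<T} \<longrightarrow> s \<noteq> t" by eventually_elim simp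
  then show ?thesis by (subst AE_lebesgue_on_iff) auto
qed

lemma prim_diff_eq:
  fixes f :: "real \<Rightarrow> 'b::{banach,second_countable_topology}"
  assumes f: "integrable (itv T) f" and "s \<le> T" "t \<le> T"
  shows "prim f t - prim f s = (LINT r|itv T. (indicator {0<..<t} r - indicator {0<..<s} r) *\<^sub>R f r)"
  using assms by (simp add: prim_eq scaleR_diff_left integrable_itv_indicator)

lemma integrable_itv_indicator_diff:
  fixes f :: "real \<Rightarrow> 'b::{banach,second_countable_topology}"
  assumes f: "integrable (itv T) f" and "s \<le> T" "t \<le> T"
  shows "integrable (itv T) (\<lambda>r. (indicator {0<..<t} r - indicator {0<..<s} r) *\<^sub>R f r)"
  using assms by (simp add: scaleR_diff_left integrable_itv_indicator)

lemma norm_prim_diff_le: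
  fixes f :: "real \<Rightarrow> 'b::{banach,second_countable_topology}"
  assumes f: "integrable (itv T) f" and st: "s \<le> t" "t \<le> T"
  shows "norm (prim f t - prim f s) \<le> prim (\<lambda>r. norm (f r)) t - prim (\<lambda>r. norm (f r)) s"
proof -
  have "norm (prim f t - prim f s) \<le> (LINT r|itv T. norm ((indicator {0<..<t} r - indicator {0<..<s} r) *\<^sub>R f r))"
    unfolding prim_diff_eq[OF f order_trans[OF st] st(2)] by (rule integral_norm_bound)
  also have "\<dots> = (LINT r|itv T. (indicator {0<..<t} r - indicator {0<..<s} r) *\<^sub>R norm (f r))"
    using st by (intro Bochner_Integration.integral_cong) (auto simp: indicator_def)
  also have "\<dots> = prim (\<lambda>r. norm (f r)) t - prim (\<lambda>r. norm (f r)) s"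
    using st by (simp add: prim_diff_eq[OF integrable_norm[OF f]])
  finally show ?thesis .
qed

lemma continuous_on_prim:
  fixes f :: "real \<Rightarrow> 'b::{banach,second_countable_topology}"
  assumes f: "integrable (itv T) f"
  shows "continuous_on {0..T} (prim f)"
proof (rule continuous_on_sequentiallyI)
  fix u a assume u: "\<forall>n. u n \<in> {0..T}" "a \<in> {0..T}" "u \<longlonglongrightarrow> a"
  have "(\<lambda>n. LINT s|itv T. indicator {0<..<u n} s *\<^sub>R f s) \<longlonglongrightarrow> (LINT s|itv T. indicator {0<..<a} s *\<^sub>R f s)"
  proof (rule integral_dominated_convergence[where w="\<lambda>s. norm (f s)"])
    \<comment> \<open>At \<open>s = a\<close> the indicators may oscillate, so this one point is
      excluded.\<close>
    show "AE s in itv T. (\<lambda>n. indicator {0<..<u n} s *\<^sub>R f s) \<longlonglongrightarrow> indicator {0<..<a} s *\<^sub>R f s"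
      using AE_itv_neq[of a]
    proof eventually_elim
      case (elim s)
      have "\<forall>\<^sub>F n in sequentially. indicator {0<..<u n} s *\<^sub>R f s = indicator {0<..<a} s *\<^sub>R f s"
      proof (cases "s < a")
        case True
        then have "\<forall>\<^sub>F n in sequentially. s < u n" using u(3) by (simp add: order_tendstoD)
        then show ?thesis by eventually_elim (use True in \<open>simp add: indicator_def\<close>)
      next
        case False
        then have "\<forall>\<^sub>F n in sequentially. u n < s" using u(3) elim by (simp add: order_tendstoD)
        then show ?thesis by eventually_elim (use False in \<open>simp add: indicator_def\<close>)
      qed
      then show ?case by (rule tendsto_eventually)
    qed
    show "(\<lambda>s. indicator {0<..<a} s *\<^sub>R f s) \<in> borel_measurable (itv T)"
      using integrable_itv_indicator[OF f] u(2) by (intro borel_measurable_integrable) auto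
    show "(\<lambda>s. indicator {0<..<u n} s *\<^sub>R f s) \<in> borel_measurable (itv T)" for n
      using integrable_itv_indicator[OF f] u(1) by (intro borel_measurable_integrable) auto
    show "integrable (itv T) (\<lambda>s. norm (f s))" using f by simp
    show "AE s in itv T. norm (indicator {0<..<u n} s *\<^sub>R f s) \<le> norm (f s)" for n
      by (simp add: indicator_def)
  qed
  moreover have "prim f a = (LINT s|itv T. indicator {0<..<a} s *\<^sub>R f s)" using u(2) by (intro prim_eq) auto
  moreover have "prim f (u n) = (LINT s|itv T. indicator {0<..<u n} s *\<^sub>R f s)" for n
    using u(1) by (intro prim_eq) auto
  ultimately show "(\<lambda>n. prim f (u n)) \<longlonglongrightarrow> prim f a" by simp
qed

lemma measurable_itv_continuous:
  assumes "continuous_on {0..T} f"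
  shows "f \<in> borel_measurable (itv T)"
proof -
  have "f \<in> borel_measurable (restrict_space borel {0<..<T})"
    by (rule borel_measurable_continuous_on_restrict) (rule continuous_on_subset[OF assms], auto)
  then show ?thesis
    unfolding measurable_def by (auto simp: sets_restrict_space_iff space_restrict_space)
qed

lemma sq_integrable_on_itv_bounded:
  assumes f: "f \<in> borel_measurable (itv T)" and C: "\<And>t. t \<in> {0<..<T} \<Longrightarrow> norm (f t) \<le> C"
  shows "sq_integrable_on {0<..<T} f"
proof -
  interpret finite_measure "itv T" by (rule finite_measure_itv)
  have const: "sq_integrable_on {0<..<T} (\<lambda>t. C)" unfolding sq_integrable_on_def by simp
  have le: "AE t in itv T. norm (f t) \<le> 1 * norm C"
    by (rule AE_I2) (use C in \<open>force simp: space_restrict_space\<close>)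
  show ?thesis by (rule sq_integrable_on_bound[OF _ const f le]) simp
qed

lemma bounded_continuous_on_itv:
  fixes f :: "real \<Rightarrow> 'b::real_normed_vector"
  assumes "continuous_on {0..T} f"
  obtains C where "\<And>t. t \<in> {0..T} \<Longrightarrow> norm (f t) \<le> C"
proof -
  have "bounded (f ` {0..T})" using compact_imp_bounded[OF compact_continuous_image[OF assms compact_Icc]] .
  then obtain C where "\<forall>x\<in>f ` {0..T}. norm x \<le> C" unfolding bounded_iff ..
  then show ?thesis by (intro that[of C]) auto
qed

lemma sq_integrable_on_itv_continuous:
  fixes f :: "real \<Rightarrow> 'b::separable_hilbert"
  assumes "continuous_on {0..T} f"
  shows "sq_integrable_on {0<..<T} f"
proof -
  obtain C where "\<And>t. t \<in> {0..T} \<Longrightarrow> norm (f t) \<le> C" using bounded_continuous_on_itv[OF assms] by metis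
  then show ?thesis by (intro sq_integrable_on_itv_bounded[where C=C] measurable_itv_continuous[OF assms]) auto
qed

lemma sq_integrable_on_integrable:
  assumes \<Omega>: "\<Omega> \<in> lmeasurable" and f: "sq_integrable_on \<Omega> f"
  shows "integrable (lebesgue_on \<Omega>) f"
proof -
  interpret finite_measure "lebesgue_on \<Omega>" by (rule finite_measure_lebesgue_on[OF \<Omega>])
  have "integrable (lebesgue_on \<Omega>) (\<lambda>t. 1 + (norm (f t))\<^sup>2)" using f by (auto simp: sq_integrable_on_def)
  then show ?thesis
  proof (rule Bochner_Integration.integrable_bound)
    show "f \<in> borel_measurable (lebesgue_on \<Omega>)" using f by (simp add: sq_integrable_on_def)
    have "norm (f t) \<le> 1 + (norm (f t))\<^sup>2" for t
      using sum_squares_bound[of 1 "norm (f t)"] norm_ge_zero[of "f t"] by (simp add: power2_eq_square del: norm_ge_zero)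
    then show "AE t in lebesgue_on \<Omega>. norm (f t) \<le> norm (1 + (norm (f t))\<^sup>2)" by simp
  qed
qed

lemma sq_integrable_on_itv_integrable: "sq_integrable_on {0<..<T} f \<Longrightarrow> integrable (itv T) f"
  by (rule sq_integrable_on_integrable) auto

text \<open>By the intermediate value theorem the interval is cut into \<open>N\<close> pieces on
  each of which \<open>m\<close> grows by \<open>d / N\<close>. The increments of
  \<open>\<Psi>\<close> add up to at most \<open>N * K * (d / N)\<^sup>2\<close>, which tends to
  zero. Equal steps of \<open>m\<close>, rather than of time, are what makes this work without any
  modulus of continuity for \<open>m\<close>.\<close>

lemma constant_if_quadratic_increments:
  fixes \<Psi> :: "real \<Rightarrow> 'b::real_normed_vector" and m :: "real \<Rightarrow> real"
  assumes T: "0 \<le> T" and m: "continuous_on {0..T} m" "m 0 \<le> m T"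
    and inc: "\<And>s t. 0 \<le> s \<Longrightarrow> s \<le> t \<Longrightarrow> t \<le> T \<Longrightarrow> norm (\<Psi> t - \<Psi> s) \<le> K * (m t - m s)\<^sup>2"
  shows "\<Psi> T = \<Psi> 0"
proof -
  define d where "d = m T - m 0"
  have inc': "norm (\<Psi> t - \<Psi> s) \<le> K * (m t - m s)\<^sup>2" if "s \<in> {0..T}" "t \<in> {0..T}" for s t
    using inc[of s t] inc[of t s] that by (cases "s \<le> t") (auto simp: norm_minus_commute power2_commute)
  have "norm (\<Psi> T - \<Psi> 0) \<le> K * d\<^sup>2 / real (Suc n)" for n
  proof -
    define N where "N = real (Suc n)"
    have N: "N > 0" by (simp add: N_def)
    have "\<exists>t\<in>{0..T}. m t = m 0 + (real i / N) * d" if "i \<le> Suc n" for i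
    proof -
      have i: "0 \<le> real i / N" "real i / N \<le> 1" using that N by (simp_all add: N_def)
      have "0 \<le> d" using m(2) by (simp add: d_def)
      then have "0 \<le> (real i / N) * d" "(real i / N) * d \<le> d"
        using i mult_right_mono[of "real i / N" 1 d] mult_nonneg_nonneg[of "real i / N" d] by simp_all
      then have "m 0 \<le> m 0 + (real i / N) * d" "m 0 + (real i / N) * d \<le> m T" by (auto simp: d_def)
      then obtain t where "0 \<le> t" "t \<le> T" "m t = m 0 + (real i / N) * d"
        using IVT'[OF _ _ T m(1)] by blast
      then show ?thesis by (intro bexI[of _ t]) auto
    qed
    then obtain t where t: "\<And>i. i \<le> Suc n \<Longrightarrow> t i \<in> {0..T} \<and> m (t i) = m 0 + (real i / N) * d" by metis
    \<comment> \<open>The chosen point \<open>t 0\<close> need not be 0, but \<open>m\<close> takes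
      the same value there, so \<open>\<Psi>\<close> does as well.\<close>
    have "\<Psi> (t 0) = \<Psi> 0" using inc'[of 0 "t 0"] t[of 0] T by simp
    moreover have "\<Psi> (t (Suc n)) = \<Psi> T"
    proof -
      have "real (Suc n) / N = 1" using N by (simp add: N_def)
      then have "m (t (Suc n)) = m T" using t[of "Suc n"] by (simp only: d_def) simp
      then show ?thesis using inc'[of T "t (Suc n)"] t[of "Suc n"] T by simp
    qed
    ultimately have "norm (\<Psi> T - \<Psi> 0) = norm (\<Sum>i<Suc n. \<Psi> (t (Suc i)) - \<Psi> (t i))"
      by (simp only: sum_lessThan_telescope[of "\<lambda>i. \<Psi> (t i)"])
    also have "\<dots> \<le> (\<Sum>i<Suc n. K * (d / N)\<^sup>2)"
    proof (rule sum_norm_le)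
      fix i assume "i \<in> {..<Suc n}"
      then have "norm (\<Psi> (t (Suc i)) - \<Psi> (t i)) \<le> K * (m (t (Suc i)) - m (t i))\<^sup>2"
        using t[of i] t[of "Suc i"] by (intro inc') auto
      also have "m (t (Suc i)) - m (t i) = d / N"
        using t[of i] t[of "Suc i"] \<open>i \<in> {..<Suc n}\<close> by (simp add: add_divide_distrib distrib_right)
      finally show "norm (\<Psi> (t (Suc i)) - \<Psi> (t i)) \<le> K * (d / N)\<^sup>2" .
    qed
    also have "\<dots> = N * (K * (d / N)\<^sup>2)" by (simp add: N_def)
    also have "\<dots> = K * d\<^sup>2 / N" using N by (simp add: power2_eq_square)
    finally show ?thesis by (simp add: N_def)
  qed
  moreover have "(\<lambda>n. K * d\<^sup>2 / real (Suc n)) \<longlonglongrightarrow> 0"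
    using LIMSEQ_Suc[OF lim_const_over_n[of "K * d\<^sup>2"]] by simp
  ultimately have "norm (\<Psi> T - \<Psi> 0) \<le> 0" by (intro LIMSEQ_le_const) auto
  then show ?thesis by simp
qed

lemma integrable_bilinear_bounded:
  fixes B :: "'a::{banach,second_countable_topology} \<Rightarrow> 'b::{banach,second_countable_topology} \<Rightarrow> 'c::{banach,second_countable_topology}"
  assumes B: "bounded_bilinear B" and f: "integrable (itv T) f"
    and F: "F \<in> borel_measurable (itv T)" "\<And>t. t \<in> {0<..<T} \<Longrightarrow> norm (F t) \<le> C"
  shows "integrable (itv T) (\<lambda>t. B (f t) (F t))"
proof -
  obtain K where K: "0 \<le> K" "\<And>x y. norm (B x y) \<le> norm x * norm y * K"
    using bounded_bilinear.nonneg_bounded[OF B] by blast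
  have "integrable (itv T) (\<lambda>t. norm (f t) * (\<bar>C\<bar> * K))" using f by simp
  then show ?thesis
  proof (rule Bochner_Integration.integrable_bound)
    have "continuous_on UNIV (\<lambda>x. B (fst x) (snd x))"
      by (intro bounded_bilinear.continuous_on[OF B] continuous_on_fst continuous_on_snd continuous_on_id)
    then show "(\<lambda>t. B (f t) (F t)) \<in> borel_measurable (itv T)"
      by (rule borel_measurable_continuous_Pair[OF borel_measurable_integrable[OF f] F(1)])
    have "norm (B (f t) (F t)) \<le> norm (norm (f t) * (\<bar>C\<bar> * K))" if "t \<in> {0<..<T}" for t
    proof -
      have "norm (B (f t) (F t)) \<le> norm (f t) * norm (F t) * K" by (rule K(2))
      also have "\<dots> \<le> norm (f t) * \<bar>C\<bar> * K"
        using F(2)[OF that] K(1) by (intro mult_right_mono mult_left_mono) auto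
      finally show ?thesis using K(1) by (simp add: abs_mult mult.assoc)
    qed
    then show "AE t in itv T. norm (B (f t) (F t)) \<le> norm (norm (f t) * (\<bar>C\<bar> * K))"
      by (intro AE_I2) (simp add: space_restrict_space)
  qed
qed

lemma continuous_on_const_prim:
  fixes f :: "real \<Rightarrow> 'b::{banach,second_countable_topology}"
  shows "integrable (itv T) f \<Longrightarrow> continuous_on {0..T} (\<lambda>t. a + prim f t)"
  by (intro continuous_intros continuous_on_prim)

text \<open>The increments of the difference of both sides are bounded by the square of the increment of a
  continuous function, so the difference is constant.\<close>

lemma prim_product_rule:
  fixes B :: "'a::{banach,second_countable_topology} \<Rightarrow> 'b::{banach,second_countable_topology} \<Rightarrow> 'c::{banach,second_countable_topology}"
  assumes B: "bounded_bilinear B" and f: "integrable (itv T) f" and g: "integrable (itv T) g"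
  shows "integrable (itv T) (\<lambda>r. B (f r) (b + prim g r) + B (a + prim f r) (g r))" (is ?int)
    and "t \<in> {0..T} \<Longrightarrow> B (a + prim f t) (b + prim g t)
      = B a b + prim (\<lambda>r. B (f r) (b + prim g r) + B (a + prim f r) (g r)) t" (is "_ \<Longrightarrow> ?eq")
proof -
  interpret bounded_bilinear B by (rule B)
  define F where "F r = a + prim f r" for r
  define G where "G r = b + prim g r" for r
  define h where "h r = B (f r) (G r) + B (F r) (g r)" for r
  obtain K where K: "0 \<le> K" "\<And>x y. norm (B x y) \<le> norm x * norm y * K"
    using nonneg_bounded by blast
  have cF: "continuous_on {0..T} F" unfolding F_def by (rule continuous_on_const_prim[OF f])
  have cG: "continuous_on {0..T} G" unfolding G_def by (rule continuous_on_const_prim[OF g])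
  obtain CF where CF: "\<And>t. t \<in> {0..T} \<Longrightarrow> norm (F t) \<le> CF" using bounded_continuous_on_itv[OF cF] by metis
  obtain CG where CG: "\<And>t. t \<in> {0..T} \<Longrightarrow> norm (G t) \<le> CG" using bounded_continuous_on_itv[OF cG] by metis
  have int1: "integrable (itv T) (\<lambda>r. B (f r) (G r))"
    by (rule integrable_bilinear_bounded[OF B f measurable_itv_continuous[OF cG], where C=CG]) (use CG in auto)
  have int2: "integrable (itv T) (\<lambda>r. B (F r) (g r))"
    by (rule integrable_bilinear_bounded[OF flip g measurable_itv_continuous[OF cF], where C=CF]) (use CF in auto)
  have int: "integrable (itv T) h" unfolding h_def using int1 int2 by simp
  then show ?int by (simp add: h_def[abs_def] F_def G_def)
  assume t: "t \<in> {0..T}"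
  \<comment> \<open>A common majorant: increments of \<open>m\<close> bound those of both
    \<open>F\<close> and \<open>G\<close>.\<close>
  define m where "m r = prim (\<lambda>r. norm (f r)) r + prim (\<lambda>r. norm (g r)) r" for r
  have m_mono: "m r \<le> m s" if "r \<le> s" "s \<le> T" for r s
    using norm_prim_diff_le[OF f that] norm_prim_diff_le[OF g that] norm_ge_zero unfolding m_def
    by (smt (verit) norm_ge_zero)
  have Fm: "norm (F s - F r) \<le> m s - m r" and Gm: "norm (G s - G r) \<le> m s - m r" if "r \<le> s" "s \<le> T" for r s
    using norm_prim_diff_le[OF f that] norm_prim_diff_le[OF g that]
    unfolding F_def G_def m_def add_diff_cancel_left by (smt (verit) norm_ge_zero)+
  have "B (F t) (G t) - prim h t = B (F 0) (G 0) - prim h 0"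
  proof (rule constant_if_quadratic_increments[where m=m and K=K])
    show "0 \<le> t" using t by simp
    show "continuous_on {0..t} m" unfolding m_def
      by (intro continuous_on_add continuous_on_subset[OF continuous_on_prim]) (use f g t in auto)
    show "m 0 \<le> m t" using m_mono t by simp
    fix s u assume su: "0 \<le> s" "s \<le> u" "u \<le> t"
    then have uT: "s \<le> T" "u \<le> T" using t by auto
    define w where "w r = (indicator {0<..<u} r - indicator {0<..<s} r :: real)" for r
    have iw: "integrable (itv T) (\<lambda>r. w r *\<^sub>R k r)" if "integrable (itv T) k" for k :: "real \<Rightarrow> 'd::{banach,second_countable_topology}"
      unfolding w_def using integrable_itv_indicator_diff[OF that uT] .
    have dw: "prim k u - prim k s = (LINT r|itv T. w r *\<^sub>R k r)" if "integrable (itv T) k"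
      for k :: "real \<Rightarrow> 'd::{banach,second_countable_topology}"
      unfolding w_def using prim_diff_eq[OF that uT] .
    have Bf: "integrable (itv T) (\<lambda>r. B (f r) (G u))" "integrable (itv T) (\<lambda>r. B (F s) (g r))"
      using integrable_bounded_linear[OF bounded_linear_left f] integrable_bounded_linear[OF bounded_linear_right g] .
    have e1: "B (F u - F s) (G u) = (LINT r|itv T. w r *\<^sub>R B (f r) (G u))"
    proof -
      have "F u - F s = (LINT r|itv T. w r *\<^sub>R f r)" using dw[OF f] by (simp add: F_def)
      then show ?thesis using integral_bounded_linear[OF bounded_linear_left iw[OF f], of "G u"]
        by (simp add: scaleR_left)
    qed
    have e2: "B (F s) (G u - G s) = (LINT r|itv T. w r *\<^sub>R B (F s) (g r))"
    proof -
      have "G u - G s = (LINT r|itv T. w r *\<^sub>R g r)" using dw[OF g] by (simp add: G_def)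
      then show ?thesis using integral_bounded_linear[OF bounded_linear_right iw[OF g], of "F s"]
        by (simp add: scaleR_right)
    qed
    have "(B (F u) (G u) - prim h u) - (B (F s) (G s) - prim h s)
      = B (F u - F s) (G u) + B (F s) (G u - G s) - (prim h u - prim h s)"
      by (simp add: diff_left diff_right)
    also have "\<dots> = (LINT r|itv T. w r *\<^sub>R B (f r) (G u) + w r *\<^sub>R B (F s) (g r) - w r *\<^sub>R h r)"
      unfolding e1 e2 dw[OF int] using iw[OF Bf(1)] iw[OF Bf(2)] iw[OF int] by simp
    also have "norm \<dots> \<le> (LINT r|itv T. w r * (norm (f r) + norm (g r)) * (K * (m u - m s)))"
    proof (rule Bochner_Integration.integral_norm_bound_integral)
      show "integrable (itv T) (\<lambda>r. w r *\<^sub>R B (f r) (G u) + w r *\<^sub>R B (F s) (g r) - w r *\<^sub>R h r)"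
        using iw[OF Bf(1)] iw[OF Bf(2)] iw[OF int] by simp
      show "integrable (itv T) (\<lambda>r. w r * (norm (f r) + norm (g r)) * (K * (m u - m s)))"
        using iw[of "\<lambda>r. norm (f r) + norm (g r)"] f g by simp
      fix r assume "r \<in> space (itv T)"
      show "norm (w r *\<^sub>R B (f r) (G u) + w r *\<^sub>R B (F s) (g r) - w r *\<^sub>R h r)
          \<le> w r * (norm (f r) + norm (g r)) * (K * (m u - m s))"
      proof (cases "w r = 0")
        case False
        then have r: "w r = 1" "s \<le> r" "r \<le> u"
          using su \<open>r \<in> space (itv T)\<close>
          by (cases "r < u"; cases "r < s"; simp add: w_def indicator_def space_restrict_space)+
        have "norm (G u - G r) \<le> m u - m s" using Gm[OF r(3) uT(2)] m_mono[OF r(2)] r(3) uT by linarith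
        then have 1: "norm (B (f r) (G u - G r)) \<le> norm (f r) * (m u - m s) * K"
          using K(1) by (intro order_trans[OF K(2)] mult_right_mono mult_left_mono) auto
        have "norm (F r - F s) \<le> m u - m s" using Fm[OF r(2)] m_mono[OF r(3)] r(3) uT by linarith
        then have 2: "norm (B (F s - F r) (g r)) \<le> (m u - m s) * norm (g r) * K"
          using K(1) by (intro order_trans[OF K(2)] mult_right_mono) (auto simp: norm_minus_commute)
        have "w r *\<^sub>R B (f r) (G u) + w r *\<^sub>R B (F s) (g r) - w r *\<^sub>R h r
            = B (f r) (G u - G r) + B (F s - F r) (g r)"
          using r(1) by (simp add: h_def diff_left diff_right)
        also have "norm \<dots> \<le> norm (f r) * (m u - m s) * K + (m u - m s) * norm (g r) * K"
          by (rule order_trans[OF norm_triangle_ineq add_mono[OF 1 2]])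
        finally show ?thesis using r(1) by (simp add: algebra_simps)
      qed simp
    qed
    also have "\<dots> = (LINT r|itv T. w r *\<^sub>R (norm (f r) + norm (g r))) * (K * (m u - m s))" by simp
    also have "(LINT r|itv T. w r *\<^sub>R (norm (f r) + norm (g r))) = m u - m s"
    proof -
      have "(LINT r|itv T. w r *\<^sub>R (norm (f r) + norm (g r)))
        = (LINT r|itv T. w r *\<^sub>R norm (f r)) + (LINT r|itv T. w r *\<^sub>R norm (g r))"
        unfolding scaleR_add_right using iw[OF integrable_norm[OF f]] iw[OF integrable_norm[OF g]]
        by (intro Bochner_Integration.integral_add)
      then show ?thesis using dw[OF integrable_norm[OF f]] dw[OF integrable_norm[OF g]] by (simp add: m_def)
    qed
    finally show "norm ((B (F u) (G u) - prim h u) - (B (F s) (G s) - prim h s)) \<le> K * (m u - m s)\<^sup>2"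
      by (simp add: power2_eq_square mult_ac)
  qed
  then show ?eq unfolding h_def F_def G_def by (simp add: algebra_simps)
qed

lemma integrable_itv_cong_AE:
  fixes f :: "real \<Rightarrow> 'b::{banach,second_countable_topology}"
  assumes f: "integrable (itv T) f" and ae: "AE s in itv T. f s = g s"
  shows "integrable (itv T) g"
proof (rule integrable_cong_AE_imp[OF f _ ae])
  show "g \<in> borel_measurable (itv T)"
    using f ae by (intro complete_measure.measurable_AE_cong[OF complete_measure_lebesgue_on _ ae]) auto
qed

lemma prim_cong_AE:
  fixes f :: "real \<Rightarrow> 'b::{banach,second_countable_topology}"
  assumes f: "integrable (itv T) f" and ae: "AE s in itv T. f s = g s" and t: "t \<le> T"
  shows "prim f t = prim g t"
  unfolding prim_eq[OF t]
proof (rule integral_cong_AE)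
  show "(\<lambda>s. indicator {0<..<t} s *\<^sub>R f s) \<in> borel_measurable (itv T)"
    using integrable_itv_indicator[OF f t] by (rule borel_measurable_integrable)
  show "(\<lambda>s. indicator {0<..<t} s *\<^sub>R g s) \<in> borel_measurable (itv T)"
    using integrable_itv_indicator[OF integrable_itv_cong_AE[OF f ae] t] by (rule borel_measurable_integrable)
  show "AE s in itv T. indicator {0<..<t} s *\<^sub>R f s = indicator {0<..<t} s *\<^sub>R g s"
    using ae by eventually_elim simp
qed

lemma prim_FTC:
  fixes \<phi> \<phi>' :: "real \<Rightarrow> real"
  assumes t: "0 \<le> t" and d: "\<And>s. s \<in> {0..t} \<Longrightarrow> (\<phi> has_real_derivative \<phi>' s) (at s)"
    and c: "continuous_on {0..t} \<phi>'"
  shows "prim \<phi>' t = \<phi> t - \<phi> 0"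
proof -
  have "prim \<phi>' t = (LINT s|lebesgue. indicator {0<..<t} s *\<^sub>R \<phi>' s)"
    unfolding prim_def by (subst integral_restrict_space) auto
  also have "\<dots> = (LINT s|lebesgue. indicator {0..t} s *\<^sub>R \<phi>' s)"
  proof (rule integral_cong_AE)
    have m: "\<phi>' \<in> borel_measurable (lebesgue_on {0..t})"
      by (rule continuous_imp_measurable_on_sets_lebesgue[OF c]) simp
    show "(\<lambda>s. indicator {0..t} s *\<^sub>R \<phi>' s) \<in> borel_measurable lebesgue"
      by (rule borel_measurable_restrict_space_iff[THEN iffD1, OF _ m]) simp
    then have "(\<lambda>s. indicator {0<..<t} s *\<^sub>R indicator {0..t} s *\<^sub>R \<phi>' s) \<in> borel_measurable lebesgue"
      by (rule borel_measurable_scaleR[OF borel_measurable_indicator, rotated]) auto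
    moreover have "(\<lambda>s. indicator {0<..<t} s *\<^sub>R indicator {0..t} s *\<^sub>R \<phi>' s) = (\<lambda>s. indicator {0<..<t} s *\<^sub>R \<phi>' s)"
      by (auto simp: indicator_def)
    ultimately show "(\<lambda>s. indicator {0<..<t} s *\<^sub>R \<phi>' s) \<in> borel_measurable lebesgue" by simp
    have "AE s in lebesgue. s \<notin> {0, t}" by (rule AE_not_in) (simp add: negligible_iff_null_sets[symmetric])
    then show "AE s in lebesgue. indicator {0<..<t} s *\<^sub>R \<phi>' s = indicator {0..t} s *\<^sub>R \<phi>' s"
      by eventually_elim (auto simp: indicator_def)
  qed
  also have "\<dots> = (LINT s|lborel. indicator {0..t} s *\<^sub>R \<phi>' s)"
    by (rule integral_completion) (use borel_measurable_continuous_on_indicator[OF _ c] in auto)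
  also have "\<dots> = \<phi> t - \<phi> 0"
    by (rule integral_FTC_Icc[OF t _ c])
      (use d in \<open>auto simp: has_real_derivative_iff_has_vector_derivative intro: has_vector_derivative_at_within\<close>)
  finally show ?thesis .
qed

section \<open>Weighted energy identities\<close>

definition tail :: "real \<Rightarrow> (real \<Rightarrow> 'b::{banach,second_countable_topology}) \<Rightarrow> real \<Rightarrow> 'b" where
  "tail T f t = prim f T - prim f t"

lemma prim_bounded_linear:
  fixes f :: "real \<Rightarrow> 'b::{banach,second_countable_topology}"
  assumes L: "bounded_linear L" and f: "integrable (itv T) f" and t: "t \<le> T"
  shows "prim (\<lambda>s. L (f s)) t = L (prim f t)"
  using integral_bounded_linear[OF L integrable_itv_indicator[OF f t]]
  by (simp add: prim_eq[OF t] linear_simps(5)[OF L])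

lemma prim_add:
  fixes f :: "real \<Rightarrow> 'b::{banach,second_countable_topology}"
  assumes "integrable (itv T) f" "integrable (itv T) g" "t \<le> T"
  shows "prim (\<lambda>s. f s + g s) t = prim f t + prim g t"
  using assms by (simp add: prim_eq scaleR_add_right integrable_itv_indicator)

lemma prim_diff:
  fixes f :: "real \<Rightarrow> 'b::{banach,second_countable_topology}"
  assumes "integrable (itv T) f" "integrable (itv T) g" "t \<le> T"
  shows "prim (\<lambda>s. f s - g s) t = prim f t - prim g t"
  using assms by (simp add: prim_eq scaleR_diff_right integrable_itv_indicator)

lemma prim_scaleR:
  fixes f :: "real \<Rightarrow> 'b::{banach,second_countable_topology}"
  shows "prim (\<lambda>s. c *\<^sub>R f s) t = c *\<^sub>R prim f t"
  by (simp add: prim_def)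

lemma prim_minus:
  fixes f :: "real \<Rightarrow> 'b::{banach,second_countable_topology}"
  shows "prim (\<lambda>s. - f s) t = - prim f t"
  by (simp add: prim_def)

lemma prim_zero [simp]: "prim (\<lambda>s. 0) t = 0"
  by (simp add: prim_def)

lemma continuous_on_tail:
  fixes f :: "real \<Rightarrow> 'b::{banach,second_countable_topology}"
  shows "integrable (itv T) f \<Longrightarrow> continuous_on {0..T} (tail T f)"
  unfolding tail_def by (intro continuous_intros continuous_on_prim)

text \<open>Integration by parts without end terms: \<open>prim f\<close> vanishes at 0, and the
  additive constant \<open>- prim g T\<close> makes the other factor vanish at
  \<open>T\<close>.\<close>

lemma integral_inner_prim:
  fixes f g :: "real \<Rightarrow> 'h::separable_hilbert"
  assumes T: "0 < T" and f: "sq_integrable_on {0<..<T} f" and g: "sq_integrable_on {0<..<T} g"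
  shows "(LINT t|itv T. prim f t \<bullet> g t) = (LINT t|itv T. f t \<bullet> tail T g t)"
proof -
  note fi = sq_integrable_on_itv_integrable[OF f] and gi = sq_integrable_on_itv_integrable[OF g]
  note P = prim_product_rule[OF bounded_bilinear_inner fi gi, where a=0 and b="- prim g T"]
  have sqp: "sq_integrable_on {0<..<T} (prim f)" "sq_integrable_on {0<..<T} (tail T g)"
    by (intro sq_integrable_on_itv_continuous continuous_on_prim continuous_on_tail fi gi)+
  have i: "integrable (itv T) (\<lambda>t. f t \<bullet> tail T g t)" "integrable (itv T) (\<lambda>t. prim f t \<bullet> g t)"
    by (intro integrable_inner_on f g sqp; simp)+
  have "0 = (LINT t|itv T. f t \<bullet> (- prim g T + prim g t) + prim f t \<bullet> g t)"
    using P(2)[of T] T by (simp add: prim_def)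
  also have "\<dots> = (LINT t|itv T. prim f t \<bullet> g t - f t \<bullet> tail T g t)"
    by (rule arg_cong[where f="integral\<^sup>L (itv T)"]) (auto simp: tail_def inner_diff_right inner_add_right)
  finally show ?thesis using i by simp
qed

definition weight :: "real \<Rightarrow> real \<Rightarrow> real" where "weight T t = exp (- t / T)"

lemma weight_pos [simp]: "0 < weight T t" by (simp add: weight_def)

lemma weight_nonneg [simp]: "0 \<le> weight T t" by (simp add: weight_def)

lemma weight_le_1: "0 < T \<Longrightarrow> 0 \<le> t \<Longrightarrow> weight T t \<le> 1" by (simp add: weight_def)

lemma weight_ge: "0 < T \<Longrightarrow> t \<le> T \<Longrightarrow> exp (-1) \<le> weight T t" by (simp add: weight_def)

lemma continuous_on_weight: "continuous_on A (weight T)"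
  unfolding weight_def[abs_def] by (cases "T = 0") (auto intro!: continuous_intros)

text \<open>Puts the weight into the form constant plus primitive, in which it can enter the product
  rule.\<close>

lemma weight_eq_prim:
  assumes "0 < T" "0 \<le> t"
  shows "weight T t = 1 + prim (\<lambda>s. - weight T s / T) t"
proof -
  have "prim (\<lambda>s. - weight T s / T) t = weight T t - weight T 0"
  proof (rule prim_FTC[OF assms(2)])
    show "(weight T has_real_derivative - weight T s / T) (at s)" for s
      unfolding weight_def[abs_def] using assms(1) by (auto intro!: derivative_eq_intros)
    show "continuous_on {0..t} (\<lambda>s. - weight T s / T)"
      by (intro continuous_intros continuous_on_weight) (use assms in auto)
  qed
  then show ?thesis by (simp add: weight_def)
qed

lemma inverse_weight_eq_prim:
  assumes "0 < T" "0 \<le> t"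
  shows "exp (t / T) = 1 + prim (\<lambda>s. exp (s / T) / T) t"
proof -
  have "prim (\<lambda>s. exp (s / T) / T) t = exp (t / T) - exp (0 / T)"
  proof (rule prim_FTC[OF assms(2)])
    show "((\<lambda>t. exp (t / T)) has_real_derivative exp (s / T) / T) (at s)" for s
      using assms(1) by (auto intro!: derivative_eq_intros)
    show "continuous_on {0..t} (\<lambda>s. exp (s / T) / T)"
      by (intro continuous_intros) (use assms in auto)
  qed
  then show ?thesis by simp
qed

lemma integrable_itv_continuous:
  fixes f :: "real \<Rightarrow> 'b::separable_hilbert"
  shows "continuous_on {0..T} f \<Longrightarrow> integrable (itv T) f"
  by (rule sq_integrable_on_itv_integrable[OF sq_integrable_on_itv_continuous])

lemma sq_integrable_on_scale_continuous:
  fixes f :: "real \<Rightarrow> 'h::separable_hilbert" and a :: "real \<Rightarrow> real"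
  assumes a: "continuous_on {0..T} a" and f: "sq_integrable_on {0<..<T} f"
  shows "sq_integrable_on {0<..<T} (\<lambda>t. a t *\<^sub>R f t)"
proof -
  obtain C where C: "\<And>t. t \<in> {0..T} \<Longrightarrow> norm (a t) \<le> C" using bounded_continuous_on_itv[OF a] by metis
  show ?thesis
  proof (rule sq_integrable_on_bound[OF _ f])
    show "(\<lambda>t. a t *\<^sub>R f t) \<in> borel_measurable (itv T)"
      using f by (intro borel_measurable_scaleR measurable_itv_continuous[OF a]) (simp add: sq_integrable_on_def)
    have "norm (a t *\<^sub>R f t) \<le> C * norm (f t)" if "t \<in> {0<..<T}" for t
      using C[of t] that by (auto intro: mult_right_mono)
    then show "AE t in itv T. norm (a t *\<^sub>R f t) \<le> C * norm (f t)"
      by (intro AE_I2) (simp add: space_restrict_space)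
  qed simp
qed

lemma prim_product_scaleR:
  fixes p :: "real \<Rightarrow> 'b::{banach,second_countable_topology}" and a a' :: "real \<Rightarrow> real"
  assumes a: "\<And>t. t \<in> {0..T} \<Longrightarrow> a t = a0 + prim a' t" "integrable (itv T) a'"
    and p: "integrable (itv T) p" and t: "t \<in> {0..T}"
  shows "a t *\<^sub>R (v0 + prim p t) = a0 *\<^sub>R v0 + prim (\<lambda>s. a' s *\<^sub>R (v0 + prim p s) + a s *\<^sub>R p s) t"
    and "integrable (itv T) (\<lambda>s. a' s *\<^sub>R (v0 + prim p s) + a s *\<^sub>R p s)"
proof -
  note P = prim_product_rule[OF bounded_bilinear_scaleR a(2) p, where a=a0 and b=v0]
  have eq: "AE s in itv T. a' s *\<^sub>R (v0 + prim p s) + (a0 + prim a' s) *\<^sub>R p s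
      = a' s *\<^sub>R (v0 + prim p s) + a s *\<^sub>R p s"
    by (rule AE_I2) (simp add: space_restrict_space a(1))
  show "a t *\<^sub>R (v0 + prim p t) = a0 *\<^sub>R v0 + prim (\<lambda>s. a' s *\<^sub>R (v0 + prim p s) + a s *\<^sub>R p s) t"
    using P(2)[OF t] t a(1)[OF t] prim_cong_AE[OF P(1) eq, of t] by simp
  show "integrable (itv T) (\<lambda>s. a' s *\<^sub>R (v0 + prim p s) + a s *\<^sub>R p s)"
    by (rule integrable_itv_cong_AE[OF P(1) eq])
qed

text \<open>The derivative of \<open>weight T t * (norm (v t))\<^sup>2\<close> is integrated over
  the interval. The end values of the weight are 1 and \<open>exp (-1)\<close>, and its derivative
  \<open>- weight T t / T\<close> yields the last term.\<close>

lemma weighted_energy: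
  fixes p :: "real \<Rightarrow> 'h::separable_hilbert" and v0 :: 'h
  assumes T: "0 < T" and p: "sq_integrable_on {0<..<T} p"
  defines "v t \<equiv> v0 + prim p t"
  shows "2 * (LINT t|itv T. weight T t * (p t \<bullet> v t))
    = exp (-1) * (norm (v T))\<^sup>2 - (norm v0)\<^sup>2 + (LINT t|itv T. weight T t * (norm (v t))\<^sup>2) / T"
proof -
  note pi = sq_integrable_on_itv_integrable[OF p]
  note P = prim_product_rule[OF bounded_bilinear_inner pi pi, where a=v0 and b=v0]
  define n where "n = (\<lambda>t. 2 * (p t \<bullet> v t))"
  have n_eq: "(\<lambda>r. p r \<bullet> (v0 + prim p r) + (v0 + prim p r) \<bullet> p r) = n"
    by (auto simp: n_def v_def inner_commute)
  have n: "integrable (itv T) n" using P(1) unfolding n_eq .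
  have vv: "(norm (v t))\<^sup>2 = (norm v0)\<^sup>2 + prim n t" if "t \<in> {0..T}" for t
    using P(2)[OF that] unfolding n_eq by (simp add: v_def power2_norm_eq_inner)
  have wi: "integrable (itv T) (\<lambda>s. - weight T s / T)"
    by (rule integrable_itv_continuous) (use T in \<open>intro continuous_intros continuous_on_weight; simp\<close>)
  note Q = prim_product_scaleR[OF weight_eq_prim[OF T] wi n, where t=T and ?v0.0="(norm v0)\<^sup>2"]
  have cv: "continuous_on {0..T} v" unfolding v_def by (rule continuous_on_const_prim[OF pi])
  have sqv: "sq_integrable_on {0<..<T} v" by (rule sq_integrable_on_itv_continuous[OF cv])
  have i1: "integrable (itv T) (\<lambda>t. weight T t * (norm (v t))\<^sup>2)"
    by (rule integrable_itv_continuous) (intro continuous_intros continuous_on_weight cv)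
  have i2: "integrable (itv T) (\<lambda>t. weight T t * (p t \<bullet> v t))"
    using integrable_inner_on[OF _ p sq_integrable_on_scale_continuous[OF continuous_on_weight sqv]] by simp
  have "weight T T *\<^sub>R ((norm v0)\<^sup>2 + prim n T)
    = (norm v0)\<^sup>2 + prim (\<lambda>s. (- weight T s / T) *\<^sub>R ((norm v0)\<^sup>2 + prim n s) + weight T s *\<^sub>R n s) T"
    using Q(1) T by simp
  also have "prim (\<lambda>s. (- weight T s / T) *\<^sub>R ((norm v0)\<^sup>2 + prim n s) + weight T s *\<^sub>R n s) T
    = (LINT t|itv T. 2 * (weight T t * (p t \<bullet> v t)) - (weight T t * (norm (v t))\<^sup>2) / T)"
    unfolding prim_def[of _ T]
  proof (rule Bochner_Integration.integral_cong)
    fix t assume "t \<in> space (itv T)"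
    then have "(norm v0)\<^sup>2 + prim n t = (norm (v t))\<^sup>2" using vv by (simp add: space_restrict_space)
    then show "(- weight T t / T) *\<^sub>R ((norm v0)\<^sup>2 + prim n t) + weight T t *\<^sub>R n t
        = 2 * (weight T t * (p t \<bullet> v t)) - (weight T t * (norm (v t))\<^sup>2) / T"
      by (simp add: n_def)
  qed simp
  also have "\<dots> = 2 * (LINT t|itv T. weight T t * (p t \<bullet> v t)) - (LINT t|itv T. weight T t * (norm (v t))\<^sup>2) / T"
    using i1 i2 by simp
  finally show ?thesis using vv[of T] T by (simp add: weight_def)
qed

text \<open>In the doubled equation the weighted identities for \<open>v\<close> and
  \<open>prim r\<close> are inserted. The two copies of \<open>v0 \<bullet> v0\<close> outweigh the
  negative one, and the terms at \<open>T\<close> are nonnegative, so \<open>X / T\<close> is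
  bounded by twice the right-hand side. Since \<open>weight T t \<le> 1\<close>, Cauchy-Schwarz
  bounds the latter by a multiple of \<open>sqrt X\<close>, and one root can be cancelled.\<close>

lemma energy_estimate:
  fixes p f :: "real \<Rightarrow> 'h::separable_hilbert" and r :: "real \<Rightarrow> 'g::separable_hilbert" and v0 :: 'h
  assumes T: "0 < T" and p: "sq_integrable_on {0<..<T} p" and r: "sq_integrable_on {0<..<T} r"
    and f: "sq_integrable_on {0<..<T} f"
  defines "v t \<equiv> v0 + prim p t"
  assumes eq: "(LINT t|itv T. p t \<bullet> (weight T t *\<^sub>R v t)) + v0 \<bullet> v0 + (LINT t|itv T. prim r t \<bullet> (weight T t *\<^sub>R r t))
    = (LINT t|itv T. f t \<bullet> (weight T t *\<^sub>R v t))"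
  shows "(LINT t|itv T. (norm (v t))\<^sup>2) + (LINT t|itv T. (norm (prim r t))\<^sup>2)
    \<le> (2 * exp 1 * T)\<^sup>2 * (LINT t|itv T. (norm (f t))\<^sup>2)"
proof -
  note pi = sq_integrable_on_itv_integrable[OF p] and ri = sq_integrable_on_itv_integrable[OF r]
  define X where "X = (LINT t|itv T. weight T t * (norm (v t))\<^sup>2) + (LINT t|itv T. weight T t * (norm (prim r t))\<^sup>2)"
  have cv: "continuous_on {0..T} v" unfolding v_def by (rule continuous_on_const_prim[OF pi])
  have cr: "continuous_on {0..T} (prim r)" by (rule continuous_on_prim[OF ri])
  have ivw: "integrable (itv T) (\<lambda>t. weight T t * (norm (v t))\<^sup>2)" "integrable (itv T) (\<lambda>t. weight T t * (norm (prim r t))\<^sup>2)"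
    and iv: "integrable (itv T) (\<lambda>t. (norm (v t))\<^sup>2)" "integrable (itv T) (\<lambda>t. (norm (prim r t))\<^sup>2)"
    by (rule integrable_itv_continuous, intro continuous_intros continuous_on_weight cv cr)+
  have sqwv: "sq_integrable_on {0<..<T} (\<lambda>t. weight T t *\<^sub>R v t)"
    by (rule sq_integrable_on_scale_continuous[OF continuous_on_weight sq_integrable_on_itv_continuous[OF cv]])
  have E1: "2 * (LINT t|itv T. p t \<bullet> (weight T t *\<^sub>R v t))
    = exp (-1) * (norm (v T))\<^sup>2 - v0 \<bullet> v0 + (LINT t|itv T. weight T t * (norm (v t))\<^sup>2) / T"
    using weighted_energy[OF T p, of v0] by (simp add: v_def power2_norm_eq_inner[of v0])
  have E2: "2 * (LINT t|itv T. prim r t \<bullet> (weight T t *\<^sub>R r t))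
    = exp (-1) * (norm (prim r T))\<^sup>2 + (LINT t|itv T. weight T t * (norm (prim r t))\<^sup>2) / T"
    using weighted_energy[OF T r, of 0] by (simp add: inner_commute)
  have "X / T \<le> 2 * (LINT t|itv T. f t \<bullet> (weight T t *\<^sub>R v t))"
    using E1 E2 eq unfolding X_def by (simp add: add_divide_distrib)
      (smt (verit) exp_ge_zero inner_ge_zero mult_nonneg_nonneg zero_le_power2)
  then have X1: "X \<le> 2 * T * (LINT t|itv T. f t \<bullet> (weight T t *\<^sub>R v t))"
    using T by (simp add: field_simps)
  define nf where "nf = norm (cls_on {0<..<T} f)"
  have X0: "0 \<le> X" unfolding X_def by (intro add_nonneg_nonneg integral_nonneg_AE) auto
  have "(LINT t|itv T. f t \<bullet> (weight T t *\<^sub>R v t)) = cls_on {0<..<T} f \<bullet> cls_on {0<..<T} (\<lambda>t. weight T t *\<^sub>R v t)"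
    by (rule inner_cls_on[symmetric]) (use f sqwv in auto)
  also have "\<dots> \<le> nf * norm (cls_on {0<..<T} (\<lambda>t. weight T t *\<^sub>R v t))"
    unfolding nf_def by (rule norm_cauchy_schwarz)
  also have "\<dots> \<le> nf * sqrt X"
  proof (rule mult_left_mono)
    have "(norm (cls_on {0<..<T} (\<lambda>t. weight T t *\<^sub>R v t)))\<^sup>2 = (LINT t|itv T. (norm (weight T t *\<^sub>R v t))\<^sup>2)"
      by (rule norm_cls_on_sq) (use sqwv in auto)
    also have "\<dots> \<le> (LINT t|itv T. weight T t * (norm (v t))\<^sup>2)"
    proof (rule integral_mono)
      show "integrable (itv T) (\<lambda>t. (norm (weight T t *\<^sub>R v t))\<^sup>2)" using sqwv by (simp add: sq_integrable_on_def)
      fix t assume "t \<in> space (itv T)"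
      then have "weight T t * weight T t \<le> weight T t * 1"
        using T by (intro mult_left_mono weight_le_1) (auto simp: space_restrict_space)
      then show "(norm (weight T t *\<^sub>R v t))\<^sup>2 \<le> weight T t * (norm (v t))\<^sup>2"
        by (simp add: power_mult_distrib power2_eq_square[of "weight T t"] mult_right_mono)
    qed (rule ivw)
    also have "\<dots> \<le> X" unfolding X_def by (simp add: integral_nonneg_AE)
    finally show "norm (cls_on {0<..<T} (\<lambda>t. weight T t *\<^sub>R v t)) \<le> sqrt X" by (rule real_le_rsqrt)
  qed (simp add: nf_def)
  finally have "X \<le> 2 * T * (nf * sqrt X)" using X1 T by (smt (verit) mult_left_mono)
  then have "sqrt X * sqrt X \<le> (2 * T * nf) * sqrt X" using X0 by simp
  then have "sqrt X \<le> 2 * T * nf"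
    using X0 T mult_right_le_imp_le[of "sqrt X" "sqrt X" "2 * T * nf"] by (cases "X = 0") (auto simp: nf_def)
  then have X2: "X \<le> (2 * T * nf)\<^sup>2" using X0 real_sqrt_le_iff by (simp add: sqrt_le_D)
  have "exp (-1) * ((LINT t|itv T. (norm (v t))\<^sup>2) + (LINT t|itv T. (norm (prim r t))\<^sup>2))
    = (LINT t|itv T. exp (-1) * (norm (v t))\<^sup>2) + (LINT t|itv T. exp (-1) * (norm (prim r t))\<^sup>2)"
    by (simp add: distrib_left)
  also have "\<dots> \<le> X" unfolding X_def
    by (intro add_mono integral_mono ivw integrable_mult_right iv mult_right_mono weight_ge T)
      (auto simp: space_restrict_space)
  also note X2
  finally have "(LINT t|itv T. (norm (v t))\<^sup>2) + (LINT t|itv T. (norm (prim r t))\<^sup>2) \<le> exp 1 * (2 * T * nf)\<^sup>2"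
    by (simp add: exp_minus field_simps)
  \<comment> \<open>Up to here the constant is \<open>2 * T * sqrt (exp 1)\<close>; replacing
    \<open>exp 1\<close> by its square gives the stated one.\<close>
  also have "\<dots> \<le> (exp 1)\<^sup>2 * (2 * T * nf)\<^sup>2"
    by (intro mult_right_mono self_le_power) auto
  also have "\<dots> = (2 * exp 1 * T)\<^sup>2 * nf\<^sup>2" by (simp add: power_mult_distrib)
  also have "nf\<^sup>2 = (LINT t|itv T. (norm (f t))\<^sup>2)"
    unfolding nf_def by (rule norm_cls_on_sq) (use f in auto)
  finally show ?thesis .
qed

section \<open>Solution of the abstract wave equation\<close>

lemma norm_cls_on_le:
  assumes S: "S \<in> sets lebesgue" and f: "sq_integrable_on S f" and g: "sq_integrable_on S g"
    and C: "0 \<le> C" and le: "\<And>x. x \<in> S \<Longrightarrow> norm (g x) \<le> C * norm (f x)"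
  shows "norm (cls_on S g) \<le> C * norm (cls_on S f)"
proof (rule power2_le_imp_le)
  have "(norm (cls_on S g))\<^sup>2 = (LINT x|lebesgue_on S. (norm (g x))\<^sup>2)" by (rule norm_cls_on_sq[OF S g])
  also have "\<dots> \<le> (LINT x|lebesgue_on S. C\<^sup>2 * (norm (f x))\<^sup>2)"
  proof (rule integral_mono)
    show "integrable (lebesgue_on S) (\<lambda>x. (norm (g x))\<^sup>2)" "integrable (lebesgue_on S) (\<lambda>x. C\<^sup>2 * (norm (f x))\<^sup>2)"
      using f g by (simp_all add: sq_integrable_on_def)
    fix x assume "x \<in> space (lebesgue_on S)"
    then have "(norm (g x))\<^sup>2 \<le> (C * norm (f x))\<^sup>2" using le by (intro power_mono) (auto simp: space_restrict_space)
    then show "(norm (g x))\<^sup>2 \<le> C\<^sup>2 * (norm (f x))\<^sup>2" by (simp add: power_mult_distrib)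
  qed
  also have "\<dots> = (C * norm (cls_on S f))\<^sup>2" by (simp add: power_mult_distrib norm_cls_on_sq[OF S f])
  finally show "(norm (cls_on S g))\<^sup>2 \<le> (C * norm (cls_on S f))\<^sup>2" .
qed (use C in simp)

lemma norm_cls_on_rep_l2_le:
  assumes S: "S \<in> sets lebesgue"
  shows "norm (cls_on S (rep_l2 x)) \<le> norm x"
proof -
  have "sq_integrable (\<lambda>t. indicator S t *\<^sub>R rep_l2 x t)"
    using sq_integrable_on_rep_l2[OF S] sq_integrable_on_iff[OF S] by blast
  moreover have "(\<integral>\<^sup>+ t. ennreal ((norm (indicator S t *\<^sub>R rep_l2 x t))\<^sup>2) \<partial>lebesgue) \<le> ennreal ((norm x)\<^sup>2)"
    unfolding nn_integral_norm_sq_rep_l2[symmetric] by (rule nn_integral_mono) (simp add: indicator_def)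
  ultimately show ?thesis unfolding cls_on_def
    by (intro norm_cls_le(2)) (auto simp: sq_integrable_def)
qed

text \<open>Truncation to \<open>S\<close> is part of the operator, so the choice
  \<open>L = (\<lambda>x. x)\<close> gives the projection to the classes carried by
  \<open>S\<close>.\<close>

definition l2_map :: "'a::euclidean_space set \<Rightarrow> ('b::separable_hilbert \<Rightarrow> 'c::separable_hilbert) \<Rightarrow> ('a, 'b) l2 \<Rightarrow> ('a, 'c) l2" where
  "l2_map S L x = cls_on S (\<lambda>t. L (rep_l2 x t))"

lemma bounded_linear_l2_map:
  assumes S: "S \<in> sets lebesgue" and L: "bounded_linear L"
  shows "bounded_linear (l2_map S L)"
proof -
  have sq: "sq_integrable_on S (\<lambda>t. L (rep_l2 x t))" for x
    by (rule sq_integrable_on_linear[OF S L sq_integrable_on_rep_l2[OF S]])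
  obtain K where K: "0 \<le> K" "\<And>x. norm (L x) \<le> norm x * K" using bounded_linear.nonneg_bounded[OF L] by blast
  show ?thesis
  proof (rule bounded_linear_intro[where K=K])
    fix x y :: "('a, 'b) l2" and r :: real
    have "l2_map S L (x + y) = cls_on S (\<lambda>t. L (rep_l2 x t) + L (rep_l2 y t))" unfolding l2_map_def
      by (rule cls_on_cong[OF S], unfold AE_lebesgue_on_iff[OF S], use rep_l2_AE(2)[of x y] in eventually_elim)
        (simp add: linear_simps(1)[OF L])
    then show "l2_map S L (x + y) = l2_map S L x + l2_map S L y"
      unfolding l2_map_def by (simp add: cls_on_add[OF S sq sq])
    have "l2_map S L (r *\<^sub>R x) = cls_on S (\<lambda>t. r *\<^sub>R L (rep_l2 x t))" unfolding l2_map_def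
      by (rule cls_on_cong[OF S], unfold AE_lebesgue_on_iff[OF S], use rep_l2_AE(5)[of r x] in eventually_elim)
        (simp add: linear_simps(5)[OF L])
    then show "l2_map S L (r *\<^sub>R x) = r *\<^sub>R l2_map S L x"
      unfolding l2_map_def by (simp add: cls_on_scaleR[OF S sq])
    have "norm (l2_map S L x) \<le> K * norm (cls_on S (rep_l2 x))" unfolding l2_map_def
      by (rule norm_cls_on_le[OF S sq_integrable_on_rep_l2[OF S] sq K(1)]) (use K(2) in \<open>simp add: mult.commute\<close>)
    also have "\<dots> \<le> K * norm x" by (rule mult_left_mono[OF norm_cls_on_rep_l2_le[OF S] K(1)])
    finally show "norm (l2_map S L x) \<le> norm x * K" by (simp add: mult.commute)
  qed
qed

lemma sets_lebesgue_itv [simp]: "{0<..<T::real} \<in> sets lebesgue" by simp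

lemma norm_prim_le:
  fixes f :: "real \<Rightarrow> 'h::separable_hilbert"
  assumes f: "sq_integrable_on {0<..<T} f" and t: "t \<in> {0..T}"
  shows "norm (prim f t) \<le> sqrt T * norm (cls_on {0<..<T} f)"
proof -
  note fi = sq_integrable_on_itv_integrable[OF f]
  have tT: "t \<le> T" using t by simp
  have sqn: "sq_integrable_on {0<..<T} (\<lambda>t. norm (f t))"
    unfolding sq_integrable_on_def
    using f measurable_compose[OF _ borel_measurable_norm, of f "itv T"] by (simp add: sq_integrable_on_def)
  have sq1: "sq_integrable_on {0<..<T} (\<lambda>t. 1::real)"
    by (rule sq_integrable_on_itv_continuous) (rule continuous_on_const)
  have "norm (prim f t) \<le> (LINT s|itv T. norm (indicator {0<..<t} s *\<^sub>R f s))"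
    unfolding prim_eq[OF tT] by (rule integral_norm_bound)
  also have "\<dots> \<le> (LINT s|itv T. norm (f s))"
    using t by (intro integral_mono integrable_norm integrable_itv_indicator fi) (auto simp: indicator_def)
  also have "\<dots> = cls_on {0<..<T} (\<lambda>t. norm (f t)) \<bullet> cls_on {0<..<T} (\<lambda>t. 1)"
    by (subst inner_cls_on[OF _ sqn sq1]) auto
  also have "\<dots> \<le> norm (cls_on {0<..<T} (\<lambda>t. norm (f t))) * norm (cls_on {0<..<T} (\<lambda>t. 1::real))"
    by (rule norm_cauchy_schwarz)
  also have "norm (cls_on {0<..<T} (\<lambda>t. norm (f t))) = norm (cls_on {0<..<T} f)"
    by (rule power2_eq_imp_eq) (simp_all add: norm_cls_on_sq[OF sets_lebesgue_itv sqn] norm_cls_on_sq[OF sets_lebesgue_itv f])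
  also have "norm (cls_on {0<..<T} (\<lambda>t. 1::real)) = sqrt T"
  proof -
    have "(norm (cls_on {0<..<T} (\<lambda>t. 1::real)))\<^sup>2 = T"
      using norm_cls_on_sq[OF _ sq1] t by (simp add: measure_restrict_space)
    then show ?thesis by (metis abs_of_nonneg norm_ge_zero real_sqrt_abs)
  qed
  finally show ?thesis by (simp add: mult.commute)
qed

definition l2_prim :: "real \<Rightarrow> (real, 'h::separable_hilbert) l2 \<Rightarrow> (real, 'h) l2" where
  "l2_prim T x = cls_on {0<..<T} (prim (rep_l2 x))"

lemma bounded_linear_l2_prim: "bounded_linear (l2_prim T :: (real, 'h::separable_hilbert) l2 \<Rightarrow> _)"
proof -
  have rep: "sq_integrable_on {0<..<T} (rep_l2 x)" for x :: "(real, 'h) l2"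
    by (rule sq_integrable_on_rep_l2) simp
  note repi = sq_integrable_on_itv_integrable[OF rep]
  have cp: "continuous_on {0..T} (prim (rep_l2 x))" for x :: "(real, 'h) l2" by (rule continuous_on_prim[OF repi])
  have sq: "sq_integrable_on {0<..<T} (prim (rep_l2 x))" for x :: "(real, 'h) l2"
    by (rule sq_integrable_on_itv_continuous[OF cp])
  show ?thesis
  proof (rule bounded_linear_intro[where K="\<bar>T\<bar>"])
    fix x y :: "(real, 'h) l2" and r :: real
    have "prim (rep_l2 (x + y)) t = prim (rep_l2 x) t + prim (rep_l2 y) t" if "t \<in> {0<..<T}" for t
    proof -
      have "AE s in itv T. rep_l2 (x + y) s = rep_l2 x s + rep_l2 y s"
        unfolding AE_lebesgue_on_iff[OF sets_lebesgue_itv] using rep_l2_AE(2)[of x y] by eventually_elim simp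
      from prim_cong_AE[OF repi this, of t] show ?thesis using that by (simp add: prim_add[OF repi repi])
    qed
    then have "l2_prim T (x + y) = cls_on {0<..<T} (\<lambda>t. prim (rep_l2 x) t + prim (rep_l2 y) t)"
      unfolding l2_prim_def by (intro cls_on_cong AE_I2) (auto simp: space_restrict_space)
    then show "l2_prim T (x + y) = l2_prim T x + l2_prim T y"
      unfolding l2_prim_def by (simp add: cls_on_add[OF _ sq sq])
    have "prim (rep_l2 (r *\<^sub>R x)) t = r *\<^sub>R prim (rep_l2 x) t" if "t \<in> {0<..<T}" for t
    proof -
      have "AE s in itv T. rep_l2 (r *\<^sub>R x) s = r *\<^sub>R rep_l2 x s"
        unfolding AE_lebesgue_on_iff[OF sets_lebesgue_itv] using rep_l2_AE(5)[of r x] by eventually_elim simp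
      from prim_cong_AE[OF repi this, of t] show ?thesis using that by (simp add: prim_scaleR)
    qed
    then have "l2_prim T (r *\<^sub>R x) = cls_on {0<..<T} (\<lambda>t. r *\<^sub>R prim (rep_l2 x) t)"
      unfolding l2_prim_def by (intro cls_on_cong AE_I2) (auto simp: space_restrict_space)
    then show "l2_prim T (r *\<^sub>R x) = r *\<^sub>R l2_prim T x"
      unfolding l2_prim_def by (simp add: cls_on_scaleR[OF _ sq])
    show "norm (l2_prim T x) \<le> norm x * \<bar>T\<bar>"
    proof (cases "T > 0")
      case True
      define N where "N = norm (cls_on {0<..<T} (rep_l2 x))"
      have sqc: "sq_integrable_on {0<..<T} (\<lambda>t. N)"
        by (rule sq_integrable_on_itv_continuous) (rule continuous_on_const)
      have N: "0 \<le> N" by (simp add: N_def)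
      \<comment> \<open>The pointwise bound contributes one factor \<open>sqrt T\<close>, the norm
        of the constant \<open>N\<close> on the interval another.\<close>
      have "norm (l2_prim T x) \<le> sqrt T * norm (cls_on {0<..<T} (\<lambda>t. N))" unfolding l2_prim_def
        by (rule norm_cls_on_le[OF _ sqc sq]) (use True N norm_prim_le[OF rep[of x]] in \<open>auto simp: N_def\<close>)
      also have "norm (cls_on {0<..<T} (\<lambda>t. N)) = sqrt T * N"
      proof -
        have "(norm (cls_on {0<..<T} (\<lambda>t. N)))\<^sup>2 = T * N\<^sup>2"
          using norm_cls_on_sq[OF _ sqc] True by (simp add: measure_restrict_space)
        also have "\<dots> = (sqrt T * N)\<^sup>2" using True by (simp add: power_mult_distrib)
        finally show ?thesis by (rule power2_eq_imp_eq) (use N True in auto)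
      qed
      also have "sqrt T * (sqrt T * N) \<le> T * norm x"
        using True norm_cls_on_rep_l2_le[of "{0<..<T}" x] by (simp add: N_def mult.assoc[symmetric] mult_left_mono)
      finally show ?thesis using True by (simp add: mult.commute)
    next
      case False
      then have "{0<..<T} = {}" by auto
      then have "l2_prim T x = 0" unfolding l2_prim_def cls_on_def by (simp add: cls_0)
      then show ?thesis by simp
    qed
  qed
qed

lemma l2_map_cls_on:
  assumes S: "S \<in> sets lebesgue" and u: "sq_integrable_on S u"
  shows "l2_map S L (cls_on S u) = cls_on S (\<lambda>t. L (u t))"
  unfolding l2_map_def by (rule cls_on_cong[OF S], use rep_cls_on[OF S u] in eventually_elim) simp

lemma l2_prim_cls_on:
  assumes u: "sq_integrable_on {0<..<T} u"
  shows "l2_prim T (cls_on {0<..<T} u) = cls_on {0<..<T} (prim u)"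
  unfolding l2_prim_def
proof (rule cls_on_cong, simp, rule AE_I2)
  fix t assume t: "t \<in> space (itv T)"
  show "prim (rep_l2 (cls_on {0<..<T} u)) t = prim u t"
    by (rule prim_cong_AE[OF sq_integrable_on_itv_integrable[OF sq_integrable_on_rep_l2] rep_cls_on[OF _ u]])
      (use t in \<open>auto simp: space_restrict_space\<close>)
qed

text \<open>Membership in \<open>V\<close> is the fixed point equation of the orthogonal projection,
  and a bounded linear map commutes with \<open>prim\<close>.\<close>

lemma prim_mem_subspace:
  fixes u :: "real \<Rightarrow> 'h::separable_hilbert"
  assumes V: "closed_subspace V" and u: "integrable (itv T) u" "AE t in itv T. u t \<in> V" and t: "t \<le> T"
  shows "prim u t \<in> V"
proof -
  interpret closed_subspace V by (rule V)
  have "AE s in itv T. u s = orth_proj V (u s)" using u(2) by eventually_elim simp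
  from prim_cong_AE[OF u(1) this t] have "prim u t = prim (\<lambda>s. orth_proj V (u s)) t" .
  also have "\<dots> = orth_proj V (prim u t)" by (rule prim_bounded_linear[OF bounded_linear_orth_proj u(1) t])
  finally have "prim u t = orth_proj V (prim u t)" .
  then show ?thesis using orth_proj_eq_iff by metis
qed

lemma prim_Pair:
  fixes f :: "real \<Rightarrow> 'h::separable_hilbert" and g :: "real \<Rightarrow> 'g::separable_hilbert"
  assumes f: "sq_integrable_on {0<..<T} f" and g: "sq_integrable_on {0<..<T} g" and t: "t \<le> T"
  shows "prim (\<lambda>s. (f s, g s)) t = (prim f t, prim g t)"
proof -
  have i: "integrable (itv T) (\<lambda>s. (f s, g s))"
    by (rule sq_integrable_on_itv_integrable[OF sq_integrable_on_Pair[OF _ f g]]) simp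
  show ?thesis
    using prim_bounded_linear[OF bounded_linear_fst i t] prim_bounded_linear[OF bounded_linear_snd i t]
    by (auto intro: prod_eqI)
qed

text \<open>The equation is solved in the space of pairs \<open>(p, r)\<close>, where \<open>p\<close> is the second time derivative
  and \<open>(prim p, r)\<close> the first one. Testing with \<open>- d/dt (weight * z)\<close>, where \<open>(z, g)\<close> takes values
  in \<open>V\<close> and \<open>z\<close> vanishes at \<open>T\<close>, gives a bilinear form in \<open>(p, r)\<close> and \<open>(z, g)\<close> which is coercive for
  \<open>(p, r) = (z, prim g)\<close>.\<close>

theorem abstract_wave_equation:
  fixes V :: "('h::separable_hilbert \<times> 'g::separable_hilbert) set" and f' :: "real \<Rightarrow> 'h" and f0 :: 'h
  assumes T: "0 < T" and V: "closed_subspace V" and f': "sq_integrable_on {0<..<T} f'"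
  defines "f t \<equiv> f0 + prim f' t"
  obtains p r where "sq_integrable_on {0<..<T} p" "sq_integrable_on {0<..<T} r"
    "AE t in itv T. (prim p t, r t) \<in> V"
    "\<And>z \<zeta>. sq_integrable_on {0<..<T} z \<Longrightarrow> sq_integrable_on {0<..<T} \<zeta> \<Longrightarrow> AE t in itv T. (z t, \<zeta> t) \<in> V \<Longrightarrow>
      (LINT t|itv T. p t \<bullet> z t) + (LINT t|itv T. prim r t \<bullet> \<zeta> t) = (LINT t|itv T. f t \<bullet> z t)"
proof -
  interpret V: closed_subspace V by (rule V)
  let ?S = "{0<..<T}" and ?w = "weight T"
  have S: "?S \<in> sets lebesgue" by simp
  note sq_add = sq_integrable_on_add[OF S] and sq_lin = sq_integrable_on_linear[OF S]
    and sq_scale = sq_integrable_on_scaleR[OF S] and sq_pair = sq_integrable_on_Pair[OF S]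
    and sq_weight = sq_integrable_on_scale_continuous[OF continuous_on_weight]
    and int = sq_integrable_on_itv_integrable
  have sq_prim: "sq_integrable_on ?S (prim q)" if "sq_integrable_on ?S q" for q :: "real \<Rightarrow> 'x::separable_hilbert"
    by (rule sq_integrable_on_itv_continuous[OF continuous_on_prim[OF int[OF that]]])
  have sq_tail: "sq_integrable_on ?S (tail T q)" if "sq_integrable_on ?S q" for q :: "real \<Rightarrow> 'x::separable_hilbert"
    by (rule sq_integrable_on_itv_continuous[OF continuous_on_tail[OF int[OF that]]])
  have cf: "continuous_on {0..T} f" unfolding f_def by (rule continuous_on_const_prim[OF int[OF f']])
  have sqf: "sq_integrable_on ?S f" by (rule sq_integrable_on_itv_continuous[OF cf])

  \<comment> \<open>For \<open>k = (p, r)\<close> this is the part of the curve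
    \<open>(prim p, r)\<close> orthogonal to \<open>V\<close>. Writing it as a composition of
    bounded operators makes its kernel, which is the constraint on the unknown, a closed
    subspace.\<close>
  define N where "N k = l2_map ?S (\<lambda>x. x - orth_proj V x) (l2_map ?S (\<lambda>a. (a, 0)) (l2_prim T (l2_map ?S fst k))
    + l2_map ?S (\<lambda>b. (0, b)) (l2_map ?S snd k))" for k :: "(real, 'h \<times> 'g) l2"
  have QL: "bounded_linear (\<lambda>x. x - orth_proj V x)"
    by (intro bounded_linear_sub bounded_linear_ident V.bounded_linear_orth_proj)
  have P1: "bounded_linear (\<lambda>a::'h. (a, 0::'g))" and P2: "bounded_linear (\<lambda>b::'g. (0::'h, b))"
    by (intro bounded_linear_Pair bounded_linear_ident bounded_linear_zero)+
  have N: "bounded_linear N" unfolding N_def[abs_def]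
    by (intro bounded_linear_compose[OF bounded_linear_l2_map[OF S QL]] bounded_linear_add
        bounded_linear_compose[OF bounded_linear_l2_map[OF S P1]]
        bounded_linear_compose[OF bounded_linear_l2_map[OF S P2]]
        bounded_linear_compose[OF bounded_linear_l2_prim]
        bounded_linear_l2_map S bounded_linear_fst bounded_linear_snd)
  define E where "E = {k. N k = 0}"
  interpret E: closed_subspace E
  proof
    show "subspace E" unfolding E_def by (rule linear_subspace_kernel[OF bounded_linear.linear[OF N]])
    show "closed E" unfolding E_def
      by (intro closed_Collect_eq linear_continuous_on[OF N] continuous_on_const)
  qed
  have sq_fst: "sq_integrable_on ?S (\<lambda>t. fst (rep_l2 k t))" for k :: "(real, 'h \<times> 'g) l2"
    by (rule sq_lin[OF bounded_linear_fst sq_integrable_on_rep_l2[OF S]])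
  have sq_snd: "sq_integrable_on ?S (\<lambda>t. snd (rep_l2 k t))" for k :: "(real, 'h \<times> 'g) l2"
    by (rule sq_lin[OF bounded_linear_snd sq_integrable_on_rep_l2[OF S]])
  have E_iff: "k \<in> E \<longleftrightarrow> (AE t in itv T. (prim (\<lambda>t. fst (rep_l2 k t)) t, snd (rep_l2 k t)) \<in> V)" for k
  proof -
    let ?u = "\<lambda>t. (prim (\<lambda>t. fst (rep_l2 k t)) t, snd (rep_l2 k t))"
    have squ: "sq_integrable_on ?S ?u" by (intro sq_pair sq_prim sq_fst sq_snd)
    have "l2_map ?S (\<lambda>a. (a, 0::'g)) (l2_prim T (l2_map ?S fst k)) + l2_map ?S (\<lambda>b. (0::'h, b)) (l2_map ?S snd k)
      = cls_on ?S (\<lambda>t. (prim (\<lambda>t. fst (rep_l2 k t)) t, 0) + (0, snd (rep_l2 k t)))"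
      unfolding l2_map_def[of _ fst] l2_map_def[of _ snd] l2_prim_cls_on[OF sq_fst]
        l2_map_cls_on[OF S sq_snd] l2_map_cls_on[OF S sq_prim[OF sq_fst]]
      by (rule cls_on_add[symmetric, OF S sq_lin[OF P1 sq_prim[OF sq_fst]] sq_lin[OF P2 sq_snd]])
    then have "N k = cls_on ?S (\<lambda>t. ?u t - orth_proj V (?u t))"
      unfolding N_def by (simp add: l2_map_cls_on[OF S squ])
    then have "k \<in> E \<longleftrightarrow> cls_on ?S (\<lambda>t. ?u t - orth_proj V (?u t)) = cls_on ?S (\<lambda>t. 0)"
      by (simp add: E_def cls_on_0[OF S])
    also have "\<dots> \<longleftrightarrow> (AE t in itv T. ?u t - orth_proj V (?u t) = 0)"
      by (rule cls_on_eq_iff[OF S sq_lin[OF QL squ]]) (simp add: sq_integrable_on_def)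
    also have "\<dots> \<longleftrightarrow> (AE t in itv T. ?u t \<in> V)"
      by (intro AE_cong) (metis V.orth_proj_eq_iff eq_iff_diff_eq_0)
    finally show ?thesis .
  qed

  \<comment> \<open>Here \<open>q\<close> is minus the derivative of the test curve
    \<open>tail T q\<close>, which in this form vanishes at \<open>T\<close> by itself, and
    \<open>g\<close> is its companion in \<open>V\<close>.\<close>
  define adm where "adm q g \<longleftrightarrow> sq_integrable_on ?S q \<and> sq_integrable_on ?S g \<and> (AE t in itv T. (tail T q t, g t) \<in> V)"
    for q :: "real \<Rightarrow> 'h" and g :: "real \<Rightarrow> 'g"
  \<comment> \<open>With \<open>z = tail T q\<close>, this is \<open>- dt (weight * z)\<close>. In
    \<open>K\<close>, the second component \<open>weight * g\<close> plays the role of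
    \<open>tail T \<zeta>\<close> for the actual test pair \<open>(D q, \<zeta>)\<close>: by parts,
    \<open>prim r\<close> against \<open>\<zeta>\<close> is \<open>r\<close> against
    \<open>tail T \<zeta>\<close>.\<close>
  define D where "D q t = ?w t *\<^sub>R ((1 / T) *\<^sub>R tail T q t + q t)" for q :: "real \<Rightarrow> 'h" and t
  define K where "K q g = cls_on ?S (\<lambda>t. (D q t, ?w t *\<^sub>R g t))" for q :: "real \<Rightarrow> 'h" and g :: "real \<Rightarrow> 'g"
  define L where "L q = (LINT t|itv T. f t \<bullet> D q t)" for q
  have sqD: "sq_integrable_on ?S (D q)" if "sq_integrable_on ?S q" for q
    unfolding D_def[abs_def] by (intro sq_weight sq_add sq_scale sq_tail that)
  have sqK: "sq_integrable_on ?S (\<lambda>t. (D q t, ?w t *\<^sub>R g t))" if "adm q g" for q g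
    using that by (intro sq_pair sqD sq_weight) (auto simp: adm_def)
  \<comment> \<open>A solution \<open>k \<in> E\<close> sees only the component of
    \<open>K q g\<close> in \<open>E\<close>, so the functional is a relation on projections. That
    it is single-valued follows from the bound, so no separate argument is required.\<close>
  define G where "G = {(orth_proj E (K q g), L q) | q g. adm q g}"

  have tail_add: "tail T (\<lambda>t. q t + q' t) t = tail T q t + tail T q' t"
    if "sq_integrable_on ?S q" "sq_integrable_on ?S q'" "t \<le> T" for q q' :: "real \<Rightarrow> 'h" and t
    unfolding tail_def using prim_add[OF int[OF that(1)] int[OF that(2)]] that(3) by simp
  have tail_scale: "tail T (\<lambda>t. c *\<^sub>R q t) t = c *\<^sub>R tail T q t" for c t and q :: "real \<Rightarrow> 'h"
    unfolding tail_def prim_scaleR by (simp add: scaleR_diff_right)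
  have "subspace G"
  proof (rule subspaceI)
    have 0: "adm (\<lambda>t. 0) (\<lambda>t. 0)"
      using V.subspace by (simp add: adm_def sq_integrable_on_def tail_def subspace_0 flip: zero_prod_def)
    have "D (\<lambda>t. 0) t = 0" for t by (simp add: D_def tail_def)
    then have "K (\<lambda>t. 0) (\<lambda>t. 0) = 0" "L (\<lambda>t. 0) = 0"
      by (simp_all add: K_def L_def cls_on_0[OF S] flip: zero_prod_def)
    then have "(0, 0) = (orth_proj E (K (\<lambda>t. 0) (\<lambda>t. 0)), L (\<lambda>t. 0))"
      using E.orth_proj_eq[OF subspace_0[OF E.subspace]] by simp
    then show "0 \<in> G" unfolding G_def zero_prod_def using 0 by blast
  next
    fix x y assume "x \<in> G" "y \<in> G"
    then obtain q g q' g' where x: "x = (orth_proj E (K q g), L q)" "adm q g"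
      and y: "y = (orth_proj E (K q' g'), L q')" "adm q' g'" by (auto simp: G_def)
    from x(2) y(2) have sq: "sq_integrable_on ?S q" "sq_integrable_on ?S q'" "sq_integrable_on ?S g" "sq_integrable_on ?S g'"
      by (auto simp: adm_def)
    have adm: "adm (\<lambda>t. q t + q' t) (\<lambda>t. g t + g' t)" unfolding adm_def
    proof (intro conjI sq_add sq)
      have "AE t in itv T. (tail T q t, g t) \<in> V" "AE t in itv T. (tail T q' t, g' t) \<in> V" "AE t in itv T. t \<in> space (itv T)"
        using x(2) y(2) by (auto simp: adm_def)
      then show "AE t in itv T. (tail T (\<lambda>t. q t + q' t) t, g t + g' t) \<in> V"
      proof eventually_elim
        case (elim t)
        then have "t \<le> T" by (simp add: space_restrict_space)
        then show ?case using subspace_add[OF V.subspace elim(1,2)] by (simp add: tail_add[OF sq(1,2)])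
      qed
    qed
    have Dadd: "D (\<lambda>t. q t + q' t) t = D q t + D q' t" if "t \<in> ?S" for t
      using that unfolding D_def by (subst tail_add[OF sq(1,2)]) (auto simp: algebra_simps)
    have "K (\<lambda>t. q t + q' t) (\<lambda>t. g t + g' t) = cls_on ?S (\<lambda>t. (D q t, ?w t *\<^sub>R g t) + (D q' t, ?w t *\<^sub>R g' t))"
      unfolding K_def using Dadd by (intro cls_on_cong[OF S] AE_I2) (auto simp: space_restrict_space scaleR_add_right)
    also have "\<dots> = K q g + K q' g'" unfolding K_def by (rule cls_on_add[OF S sqK[OF x(2)] sqK[OF y(2)]])
    finally have Kadd: "orth_proj E (K (\<lambda>t. q t + q' t) (\<lambda>t. g t + g' t)) = orth_proj E (K q g) + orth_proj E (K q' g')"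
      by (simp add: linear_simps(1)[OF E.bounded_linear_orth_proj])
    have "L (\<lambda>t. q t + q' t) = (LINT t|itv T. f t \<bullet> D q t + f t \<bullet> D q' t)"
      unfolding L_def using Dadd by (intro Bochner_Integration.integral_cong) (auto simp: space_restrict_space inner_add_right)
    also have "\<dots> = L q + L q'" unfolding L_def
      by (intro Bochner_Integration.integral_add integrable_inner_on S sqf sqD sq)
    finally have Ladd: "L (\<lambda>t. q t + q' t) = L q + L q'" .
    have "x + y = (orth_proj E (K (\<lambda>t. q t + q' t) (\<lambda>t. g t + g' t)), L (\<lambda>t. q t + q' t))"
      by (simp add: x(1) y(1) Kadd Ladd)
    then show "x + y \<in> G" unfolding G_def using adm by blast
  next
    fix c x assume "x \<in> G"
    then obtain q g where x: "x = (orth_proj E (K q g), L q)" "adm q g" by (auto simp: G_def)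
    have adm: "adm (\<lambda>t. c *\<^sub>R q t) (\<lambda>t. c *\<^sub>R g t)"
      unfolding adm_def tail_scale
    proof (intro conjI sq_scale)
      show "AE t in itv T. (c *\<^sub>R tail T q t, c *\<^sub>R g t) \<in> V"
        using x(2)[unfolded adm_def, THEN conjunct2, THEN conjunct2]
      proof eventually_elim
        case (elim t)
        from subspace_scale[OF V.subspace this, of c] show ?case by simp
      qed
    qed (use x(2) in \<open>simp_all add: adm_def\<close>)
    have Dsc: "D (\<lambda>t. c *\<^sub>R q t) t = c *\<^sub>R D q t" for t
      unfolding D_def tail_scale by (simp add: scaleR_add_right mult.commute)
    have "K (\<lambda>t. c *\<^sub>R q t) (\<lambda>t. c *\<^sub>R g t) = cls_on ?S (\<lambda>t. c *\<^sub>R (D q t, ?w t *\<^sub>R g t))"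
      unfolding K_def Dsc by (simp add: mult.commute)
    also have "\<dots> = c *\<^sub>R K q g" unfolding K_def by (rule cls_on_scaleR[OF S sqK[OF x(2)]])
    finally have "c *\<^sub>R x = (orth_proj E (K (\<lambda>t. c *\<^sub>R q t) (\<lambda>t. c *\<^sub>R g t)), L (\<lambda>t. c *\<^sub>R q t))"
      by (simp add: x(1) L_def Dsc linear_simps(5)[OF E.bounded_linear_orth_proj])
    then show "c *\<^sub>R x \<in> G" unfolding G_def using adm by blast
  qed

  \<comment> \<open>The coercivity constant: half of the factor \<open>1 / T\<close> in the weighted
    identity survives, and the weight is at least \<open>exp (-1)\<close>.\<close>
  define \<alpha> where "\<alpha> = exp (-1) / (2 * T)"
  have \<alpha>: "0 < \<alpha>" using T by (simp add: \<alpha>_def)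
  \<comment> \<open>One summand for each of the terms that remain after integration by parts:
    \<open>f0\<close> against the initial value \<open>z0\<close>, and \<open>f'\<close> against the
    weighted curve.\<close>
  define C where "C = norm f0 * sqrt (2 / \<alpha>) + norm (cls_on ?S f') / \<alpha>"
  have bound: "\<bar>L q\<bar> \<le> C * norm (orth_proj E (K q g))" if adm: "adm q g" for q g
  proof -
    have q: "sq_integrable_on ?S q" and g: "sq_integrable_on ?S g" and qg: "AE t in itv T. (tail T q t, g t) \<in> V"
      using adm by (auto simp: adm_def)
    let ?z = "tail T q" and ?G = "prim g"
    define z0 where "z0 = prim q T"
    have z_eq: "?z t = z0 + prim (\<lambda>t. - q t) t" for t by (simp add: z0_def tail_def prim_minus)
    have sq_mq: "sq_integrable_on ?S (\<lambda>t. - q t)" by (rule sq_integrable_on_minus[OF S q])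
    \<comment> \<open>The element of the solution space against which \<open>K q g\<close> is
      tested. It satisfies the constraint because integrating \<open>(z, g) \<in> V\<close> over
      time gives \<open>(prim z, prim g) \<in> V\<close>.\<close>
    define \<Phi> where "\<Phi> = cls_on ?S (\<lambda>t. (?z t, ?G t))"
    have sq\<Phi>: "sq_integrable_on ?S (\<lambda>t. (?z t, ?G t))" by (intro sq_pair sq_tail sq_prim q g)
    have "AE t in itv T. t \<in> space (itv T)" by (rule AE_space)
    with rep_cls_on[OF S sq\<Phi>] have ae: "AE t in itv T. (prim (\<lambda>t. fst (rep_l2 \<Phi> t)) t, snd (rep_l2 \<Phi> t)) = (prim ?z t, ?G t)"
    proof eventually_elim
      case (elim t)
      have "AE s in itv T. fst (rep_l2 \<Phi> s) = ?z s"
        unfolding \<Phi>_def using rep_cls_on[OF S sq\<Phi>] by eventually_elim simp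
      from prim_cong_AE[OF int[OF sq_fst] this, of t] elim show ?case
        by (simp add: \<Phi>_def space_restrict_space)
    qed
    have mem: "(prim ?z t, ?G t) \<in> V" if "t \<le> T" for t
      using prim_mem_subspace[OF V int[OF sq_pair[OF sq_tail[OF q] g]] qg that]
      by (simp add: prim_Pair[OF sq_tail[OF q] g that])
    have "\<Phi> \<in> E" unfolding E_iff using ae AE_space[of "itv T"]
      by eventually_elim (simp add: space_restrict_space mem)
    define b where "b = \<Phi> \<bullet> K q g"
    have b1: "b \<le> norm \<Phi> * norm (orth_proj E (K q g))"
      using norm_cauchy_schwarz[of \<Phi> "orth_proj E (K q g)"] by (simp add: b_def E.inner_orth_proj[OF \<open>\<Phi> \<in> E\<close>])
    have cz: "continuous_on {0..T} ?z" and cG: "continuous_on {0..T} ?G"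
      by (intro continuous_on_tail continuous_on_prim int q g)+
    have iz: "integrable (itv T) (\<lambda>t. ?w t * (norm (?z t))\<^sup>2)" "integrable (itv T) (\<lambda>t. ?w t * (norm (?G t))\<^sup>2)"
      "integrable (itv T) (\<lambda>t. (norm (?z t))\<^sup>2)" "integrable (itv T) (\<lambda>t. (norm (?G t))\<^sup>2)"
      by (rule integrable_itv_continuous, intro continuous_intros continuous_on_weight cz cG)+
    have iq: "integrable (itv T) (\<lambda>t. ?w t * (q t \<bullet> ?z t))" "integrable (itv T) (\<lambda>t. ?w t * (g t \<bullet> ?G t))"
      using integrable_inner_on[OF S q sq_weight[OF sq_tail[OF q]]] integrable_inner_on[OF S g sq_weight[OF sq_prim[OF g]]]
      by simp_all
    define X where "X = (LINT t|itv T. ?w t * (norm (?z t))\<^sup>2)"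
    define Y where "Y = (LINT t|itv T. ?w t * (norm (?G t))\<^sup>2)"
    have E1: "2 * (LINT t|itv T. ?w t * (q t \<bullet> ?z t)) = (norm z0)\<^sup>2 - X / T"
    proof -
      have "(LINT t|itv T. ?w t * (- q t \<bullet> ?z t)) = - (LINT t|itv T. ?w t * (q t \<bullet> ?z t))"
        by simp
      moreover have "?z T = 0" by (simp add: tail_def)
      ultimately show ?thesis using weighted_energy[OF T sq_mq, of z0] unfolding z_eq[symmetric] X_def by simp
    qed
    have E2: "2 * (LINT t|itv T. ?w t * (g t \<bullet> ?G t)) = exp (-1) * (norm (?G T))\<^sup>2 + Y / T"
      using weighted_energy[OF T g, of 0] by (simp add: Y_def)
    \<comment> \<open>The derivative of the weight contributes \<open>X / T\<close>, of which the
      term with \<open>q\<close> takes back only half, as \<open>z\<close> vanishes at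
      \<open>T\<close>; it also leaves half of the squared norm of \<open>z0\<close> with positive
      sign.\<close>
    have "b = (LINT t|itv T. (?z t, ?G t) \<bullet> (D q t, ?w t *\<^sub>R g t))"
      unfolding b_def \<Phi>_def K_def by (rule inner_cls_on[OF S sq\<Phi> sqK[OF adm]])
    also have "\<dots> = (LINT t|itv T. (?w t * (norm (?z t))\<^sup>2) / T + ?w t * (q t \<bullet> ?z t) + ?w t * (g t \<bullet> ?G t))"
      by (rule Bochner_Integration.integral_cong)
        (simp_all add: D_def power2_norm_eq_inner inner_add_right inner_commute algebra_simps)
    also have "\<dots> = X / T + (LINT t|itv T. ?w t * (q t \<bullet> ?z t)) + (LINT t|itv T. ?w t * (g t \<bullet> ?G t))"
      using iz iq by (simp add: X_def)
    finally have b2: "2 * b = X / T + (norm z0)\<^sup>2 + exp (-1) * (norm (?G T))\<^sup>2 + Y / T"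
      using E1 E2 by simp
    have "exp (-1) * (norm \<Phi>)\<^sup>2 = (LINT t|itv T. exp (-1) * (norm (?z t))\<^sup>2) + (LINT t|itv T. exp (-1) * (norm (?G t))\<^sup>2)"
      unfolding \<Phi>_def norm_cls_on_sq[OF S sq\<Phi>] norm_Pair using iz by (simp add: distrib_left)
    also have "\<dots> \<le> X + Y" unfolding X_def Y_def
      by (intro add_mono integral_mono iz integrable_mult_right mult_right_mono weight_ge T)
        (auto simp: space_restrict_space)
    finally have "2 * (\<alpha> * (norm \<Phi>)\<^sup>2) \<le> (X + Y) / T" using T by (simp add: \<alpha>_def field_simps)
    then have XY: "2 * (\<alpha> * (norm \<Phi>)\<^sup>2) \<le> X / T + Y / T" by (simp add: add_divide_distrib)
    define x where "x = norm (orth_proj E (K q g))"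
    have x0: "0 \<le> x" by (simp add: x_def)
    have pos: "0 \<le> exp (-1) * (norm (?G T))\<^sup>2" by simp
    have "0 \<le> X / T" "0 \<le> Y / T" unfolding X_def Y_def using T by (auto intro!: divide_nonneg_pos integral_nonneg_AE)
    then have b3: "(norm z0)\<^sup>2 \<le> 2 * b" using b2 pos by linarith
    have b4: "\<alpha> * (norm \<Phi>)\<^sup>2 \<le> b" using XY b2 pos zero_le_power2[of "norm z0"] by linarith
    have \<Phi>x: "norm \<Phi> \<le> x / \<alpha>"
    proof (cases "norm \<Phi> = 0")
      case False
      have "norm \<Phi> * (\<alpha> * norm \<Phi>) \<le> norm \<Phi> * x" using b4 b1 by (simp add: x_def power2_eq_square mult_ac)
      then have "\<alpha> * norm \<Phi> \<le> x" using False by simp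
      then show ?thesis using \<alpha> by (simp add: field_simps)
    qed (use x0 \<alpha> in simp)
    have "(norm z0)\<^sup>2 \<le> 2 * (x / \<alpha> * x)"
      using b3 b1 mult_right_mono[OF \<Phi>x x0] by (simp add: x_def)
    also have "\<dots> = (sqrt (2 / \<alpha>) * x)\<^sup>2" 
      using \<alpha> real_sqrt_pow2[of "2 / \<alpha>"] unfolding power_mult_distrib by (simp add: power2_eq_square[of x])
    finally have z0x: "norm z0 \<le> sqrt (2 / \<alpha>) * x" by (rule power2_le_imp_le) (use x0 \<alpha> in simp)
    have wz: "?w t *\<^sub>R ?z t = z0 + prim (\<lambda>t. - D q t) t" if "t \<in> {0..T}" for t
    proof -
      have wi: "integrable (itv T) (\<lambda>s. - ?w s / T)"
        by (rule integrable_itv_continuous) (use T in \<open>intro continuous_intros continuous_on_weight; simp\<close>)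
      have "(\<lambda>s. (- ?w s / T) *\<^sub>R (z0 + prim (\<lambda>t. - q t) s) + ?w s *\<^sub>R (- q s)) = (\<lambda>s. - D q s)"
        by (auto simp: D_def z_eq scaleR_add_right)
      then show ?thesis
        using prim_product_scaleR(1)[OF weight_eq_prim[OF T] wi int[OF sq_mq] that, of z0] that
        by (simp add: z_eq)
    qed
    have sq_mD: "sq_integrable_on ?S (\<lambda>t. - D q t)" by (rule sq_integrable_on_minus[OF S sqD[OF q]])
    \<comment> \<open>Coercivity controls \<open>z\<close>, but not its derivative, which occurs in
      \<open>D q\<close>. Integration by parts replaces \<open>D q\<close> by
      \<open>weight * z\<close> and produces only the end term at 0.\<close>
    note PR = prim_product_rule[OF bounded_bilinear_inner int[OF f'] int[OF sq_mD], where a=f0 and b=z0]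
    have "0 = f0 \<bullet> z0 + (LINT t|itv T. f' t \<bullet> (z0 + prim (\<lambda>t. - D q t) t) + f t \<bullet> (- D q t))"
      using PR(2)[of T] wz[of T] T by (simp add: f_def prim_def[of _ T] tail_def)
    also have "(LINT t|itv T. f' t \<bullet> (z0 + prim (\<lambda>t. - D q t) t) + f t \<bullet> (- D q t))
      = (LINT t|itv T. f' t \<bullet> (?w t *\<^sub>R ?z t) - f t \<bullet> D q t)"
      by (rule Bochner_Integration.integral_cong) (auto simp: space_restrict_space wz)
    also have "\<dots> = (LINT t|itv T. f' t \<bullet> (?w t *\<^sub>R ?z t)) - L q" unfolding L_def
      by (intro Bochner_Integration.integral_diff integrable_inner_on S f' sqf sqD q sq_weight sq_tail)
    also have "(LINT t|itv T. f' t \<bullet> (?w t *\<^sub>R ?z t)) = cls_on ?S f' \<bullet> cls_on ?S (\<lambda>t. ?w t *\<^sub>R ?z t)"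
      by (rule inner_cls_on[symmetric, OF S f' sq_weight[OF sq_tail[OF q]]])
    finally have "L q = f0 \<bullet> z0 + cls_on ?S f' \<bullet> cls_on ?S (\<lambda>t. ?w t *\<^sub>R ?z t)" by simp
    then have "\<bar>L q\<bar> \<le> norm f0 * norm z0 + norm (cls_on ?S f') * norm (cls_on ?S (\<lambda>t. ?w t *\<^sub>R ?z t))"
      using Cauchy_Schwarz_ineq2[of f0 z0] Cauchy_Schwarz_ineq2[of "cls_on ?S f'" "cls_on ?S (\<lambda>t. ?w t *\<^sub>R ?z t)"]
      by linarith
    also have "norm (cls_on ?S (\<lambda>t. ?w t *\<^sub>R ?z t)) \<le> 1 * norm \<Phi>"
      unfolding \<Phi>_def
    proof (rule norm_cls_on_le[OF S sq\<Phi> sq_weight[OF sq_tail[OF q]]])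
      fix t assume "t \<in> ?S"
      then have "norm (?w t *\<^sub>R ?z t) \<le> 1 * norm (?z t)"
        using mult_right_mono[OF weight_le_1[OF T, of t] norm_ge_zero] by simp
      also have "\<dots> \<le> 1 * norm (?z t, ?G t)" using norm_fst_le[of "?z t" "?G t"] by simp
      finally show "norm (?w t *\<^sub>R ?z t) \<le> 1 * norm (?z t, ?G t)" .
    qed simp
    finally have "\<bar>L q\<bar> \<le> norm f0 * (sqrt (2 / \<alpha>) * x) + norm (cls_on ?S f') * (x / \<alpha>)"
      using z0x \<Phi>x by (smt (verit) mult_left_mono norm_ge_zero)
    also have "\<dots> = C * x" by (simp add: C_def distrib_right)
    finally show ?thesis by (simp add: x_def)
  qed

  obtain k where k: "k \<in> E" "\<And>x y. (x, y) \<in> G \<Longrightarrow> k \<bullet> x = y"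
  proof (rule bounded_graph_representation[OF \<open>subspace G\<close> _ E.subspace E.closed])
    show "\<bar>y\<bar> \<le> C * norm x" if "(x, y) \<in> G" for x y using that bound by (auto simp: G_def)
    show "x \<in> E" if "(x, y) \<in> G" for x y using that E.orth_proj(1) by (auto simp: G_def)
  qed blast
  let ?p = "\<lambda>t. fst (rep_l2 k t)" and ?r = "\<lambda>t. snd (rep_l2 k t)"
  show ?thesis
  proof (rule that[OF sq_fst sq_snd])
    show "AE t in itv T. (prim ?p t, ?r t) \<in> V" using k(1) unfolding E_iff .
    fix z \<zeta> assume z: "sq_integrable_on ?S z" and \<zeta>: "sq_integrable_on ?S \<zeta>" and V\<zeta>: "AE t in itv T. (z t, \<zeta> t) \<in> V"
    define e where "e t = exp (t / T)" for t
    have ce: "continuous_on {0..T} e" unfolding e_def using T by (intro continuous_intros) auto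
    have we: "?w t * e t = 1" for t by (simp add: weight_def e_def exp_minus)
    \<comment> \<open>Solves \<open>D q = z\<close> backwards in time:
      \<open>weight * zz = tail T z\<close> has derivative \<open>- z\<close> and vanishes at
      \<open>T\<close>. The formula for \<open>q\<close> is \<open>- dt zz\<close>, and
      \<open>g\<close> undoes the weight in the second component in the same way.\<close>
    define zz where "zz t = e t *\<^sub>R tail T z t" for t
    define q where "q t = e t *\<^sub>R z t - (1 / T) *\<^sub>R zz t" for t
    define g where "g t = e t *\<^sub>R tail T \<zeta> t" for t
    have sqzz: "sq_integrable_on ?S zz" unfolding zz_def
      by (rule sq_integrable_on_scale_continuous[OF ce sq_tail[OF z]])
    have sqq: "sq_integrable_on ?S q" unfolding q_def
      by (intro sq_integrable_on_diff[OF S] sq_integrable_on_scale_continuous[OF ce z] sq_scale sqzz)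
    have sqg: "sq_integrable_on ?S g" unfolding g_def
      by (rule sq_integrable_on_scale_continuous[OF ce sq_tail[OF \<zeta>]])
    have zz: "zz t = prim z T - prim q t" if "t \<in> {0..T}" for t
    proof -
      have ei: "integrable (itv T) (\<lambda>s. e s / T)"
        by (rule integrable_itv_continuous) (use T in \<open>intro continuous_intros ce; simp\<close>)
      have eq: "(\<lambda>s. (e s / T) *\<^sub>R (prim z T + prim (\<lambda>t. - z t) s) + e s *\<^sub>R (- z s)) = (\<lambda>s. - q s)"
        by (auto simp: q_def zz_def tail_def prim_minus)
      have "e t = 1 + prim (\<lambda>s. e s / T) t" if "t \<in> {0..T}" for t
        unfolding e_def using inverse_weight_eq_prim[OF T] that by simp
      from prim_product_scaleR(1)[OF this ei int[OF sq_integrable_on_minus[OF S z]] that, of "prim z T"]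
      show ?thesis unfolding eq by (simp add: zz_def tail_def prim_minus)
    qed
    have "prim z T = prim q T" using zz[of T] T by (simp add: zz_def tail_def)
    then have tailq: "tail T q t = zz t" if "t \<in> {0..T}" for t using zz[OF that] by (simp add: tail_def)
    have "adm q g" unfolding adm_def
    proof (intro conjI sqq sqg AE_I2)
      fix t assume "t \<in> space (itv T)"
      then have t: "t \<in> {0..T}" by (auto simp: space_restrict_space)
      have "prim (\<lambda>s. (z s, \<zeta> s)) T - prim (\<lambda>s. (z s, \<zeta> s)) t \<in> V"
        by (intro subspace_diff[OF V.subspace] prim_mem_subspace[OF V int[OF sq_pair[OF z \<zeta>]] V\<zeta>]) (use t in auto)
      then have "(tail T z t, tail T \<zeta> t) \<in> V" using t by (simp add: prim_Pair[OF z \<zeta>] tail_def)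
      then have "e t *\<^sub>R (tail T z t, tail T \<zeta> t) \<in> V" by (rule subspace_scale[OF V.subspace])
      then show "(tail T q t, g t) \<in> V" by (simp add: tailq[OF t] zz_def g_def)
    qed
    have Dq: "D q t = z t" if "t \<in> {0..T}" for t
      using we[of t] by (simp add: D_def tailq[OF that] q_def)
    have wg: "?w t *\<^sub>R g t = tail T \<zeta> t" for t using we[of t] by (simp add: g_def)
    have "K q g = cls_on ?S (\<lambda>t. (z t, tail T \<zeta> t))" unfolding K_def
      by (rule cls_on_cong[OF S AE_I2]) (auto simp: space_restrict_space Dq wg)
    moreover have "k \<bullet> K q g = L q"
      using k(2)[of "orth_proj E (K q g)" "L q"] \<open>adm q g\<close> E.inner_orth_proj[OF k(1)] unfolding G_def by auto
    moreover have "k \<bullet> cls_on ?S (\<lambda>t. (z t, tail T \<zeta> t)) = (LINT t|itv T. ?p t \<bullet> z t + ?r t \<bullet> tail T \<zeta> t)"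
    proof -
      let ?Z = "\<lambda>t. (z t, tail T \<zeta> t)"
      have sqZ: "sq_integrable_on ?S ?Z" by (intro sq_pair z sq_tail \<zeta>)
      have "k \<bullet> cls_on ?S ?Z = (LINT t|lebesgue. rep_l2 k t \<bullet> (indicator ?S t *\<^sub>R ?Z t))"
        unfolding cls_on_def
        using inner_cls[OF sq_integrable_rep_l2[of k] sqZ[unfolded sq_integrable_on_iff[OF S]]] by simp
      also have "\<dots> = (LINT t|itv T. rep_l2 k t \<bullet> ?Z t)"
        by (subst integral_restrict_space) (simp_all only: inner_scaleR_right real_scaleR_def
            space_completion space_lborel space_borel Int_UNIV_right sets_lebesgue_itv)
      also have "\<dots> = (LINT t|itv T. ?p t \<bullet> z t + ?r t \<bullet> tail T \<zeta> t)"
        by (simp add: inner_prod_def)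
      finally show ?thesis .
    qed
    moreover have "L q = (LINT t|itv T. f t \<bullet> z t)" unfolding L_def
      by (rule Bochner_Integration.integral_cong) (auto simp: space_restrict_space Dq)
    moreover have "(LINT t|itv T. ?p t \<bullet> z t + ?r t \<bullet> tail T \<zeta> t)
      = (LINT t|itv T. ?p t \<bullet> z t) + (LINT t|itv T. ?r t \<bullet> tail T \<zeta> t)"
      by (intro Bochner_Integration.integral_add integrable_inner_on S sq_fst sq_snd z sq_tail \<zeta>)
    ultimately show "(LINT t|itv T. ?p t \<bullet> z t) + (LINT t|itv T. prim ?r t \<bullet> \<zeta> t) = (LINT t|itv T. f t \<bullet> z t)"
      using integral_inner_prim[OF T sq_snd[of k] \<zeta>] by simp
  qed
qed

section \<open>Test functions\<close>

text \<open>The powers of \<open>1 / x\<close> make the family closed under differentiation up to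
  linear combinations; \<open>n = 0\<close> is the classical flat function.\<close>

definition exp_bump :: "nat \<Rightarrow> real \<Rightarrow> real" where
  "exp_bump n x = (if x > 0 then (1 / x) ^ n * exp (- 1 / x) else 0)"

lemma exp_bump_tendsto_0: "(exp_bump n \<longlongrightarrow> 0) (at_right 0)"
proof -
  have "((\<lambda>y. y ^ n / exp (y::real)) \<longlongrightarrow> 0) at_top" by (rule tendsto_power_div_exp_0)
  then have "((\<lambda>x. (inverse x) ^ n / exp (inverse x)) \<longlongrightarrow> 0) (at_right (0::real))"
    by (rule filterlim_compose[OF _ filterlim_inverse_at_top_right])
  moreover have "\<forall>\<^sub>F x in at_right 0. (inverse x) ^ n / exp (inverse x) = exp_bump n x"
    unfolding eventually_at_right_field
    by (intro exI[of _ 1]) (auto simp: exp_bump_def exp_minus field_simps)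
  ultimately show ?thesis by (rule Lim_transform_eventually)
qed

lemma DERIV_exp_bump:
  "(exp_bump n has_real_derivative exp_bump (n + 2) x - real n * exp_bump (n + 1) x) (at x)"
proof (cases x "0::real" rule: linorder_cases)
  case less
  have "((\<lambda>x. 0) has_real_derivative 0) (at x)" by simp
  moreover have "\<forall>\<^sub>F y in nhds x. 0 = exp_bump n y"
    using eventually_nhds_in_open[of "{..<0}" x] less by (auto elim!: eventually_mono simp: exp_bump_def)
  ultimately have "(exp_bump n has_real_derivative 0) (at x)" using DERIV_cong_ev[of x x] by fastforce
  then show ?thesis using less by (simp add: exp_bump_def)
next
  case greater
  define y where "y = 1 / x"
  have dy: "((\<lambda>x. 1 / x) has_real_derivative - y\<^sup>2) (at x)"
    using greater by (auto intro!: derivative_eq_intros simp: y_def power2_eq_square)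
  have "((\<lambda>x. (1 / x) ^ n * exp (- (1 / x))) has_real_derivative
      real n * (- y\<^sup>2 * y ^ (n - Suc 0)) * exp (- y) + exp (- y) * (- (- y\<^sup>2)) * y ^ n) (at x)"
    unfolding y_def by (rule DERIV_mult[OF DERIV_power[OF dy[unfolded y_def]] DERIV_fun_exp[OF DERIV_minus[OF dy[unfolded y_def]]]])
  moreover have "real n * (- y\<^sup>2 * y ^ (n - Suc 0)) * exp (- y) + exp (- y) * (- (- y\<^sup>2)) * y ^ n
      = y ^ (n + 2) * exp (- y) - real n * (y ^ (n + 1) * exp (- y))"
    by (cases n) (auto simp: power2_eq_square algebra_simps)
  ultimately have "((\<lambda>x. (1 / x) ^ n * exp (- 1 / x)) has_real_derivative
      (1 / x) ^ (n + 2) * exp (- 1 / x) - real n * ((1 / x) ^ (n + 1) * exp (- 1 / x))) (at x)"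
    by (simp add: y_def)
  moreover have "\<forall>\<^sub>F y in nhds x. (1 / y) ^ n * exp (- 1 / y) = exp_bump n y"
    using eventually_nhds_in_open[of "{0<..}" x] greater by (auto elim!: eventually_mono simp: exp_bump_def)
  ultimately have "(exp_bump n has_real_derivative
      (1 / x) ^ (n + 2) * exp (- 1 / x) - real n * ((1 / x) ^ (n + 1) * exp (- 1 / x))) (at x)"
    using DERIV_cong_ev[of x x] by fastforce
  then show ?thesis using greater by (simp add: exp_bump_def)
next
  case equal
  \<comment> \<open>From the right the difference quotient is exactly
    \<open>exp_bump (Suc n)\<close>, from the left it is 0.\<close>
  have "((\<lambda>h. (exp_bump n (0 + h) - exp_bump n 0) / h) \<longlongrightarrow> 0) (at 0)"
  proof (rule filterlim_split_at)
    have "\<forall>\<^sub>F h in at_left 0. 0 = (exp_bump n (0 + h) - exp_bump n 0) / h"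
      unfolding eventually_at_left_field by (intro exI[of _ "-1"]) (auto simp: exp_bump_def)
    then show "((\<lambda>h. (exp_bump n (0 + h) - exp_bump n 0) / h) \<longlongrightarrow> 0) (at_left 0)"
      by (rule Lim_transform_eventually[OF tendsto_const])
    have "\<forall>\<^sub>F h in at_right 0. exp_bump (Suc n) h = (exp_bump n (0 + h) - exp_bump n 0) / h"
      unfolding eventually_at_right_field by (intro exI[of _ 1]) (auto simp: exp_bump_def)
    then show "((\<lambda>h. (exp_bump n (0 + h) - exp_bump n 0) / h) \<longlongrightarrow> 0) (at_right 0)"
      by (rule Lim_transform_eventually[OF exp_bump_tendsto_0])
  qed
  then show ?thesis unfolding equal DERIV_def by (simp add: exp_bump_def)
qed

text \<open>An algebra stable under directional derivatives, so that smoothness of all its members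
  is a single induction and no higher derivative has to be computed.\<close>

inductive_set bump_algebra :: "('a::euclidean_space \<Rightarrow> real) set" where
  const: "(\<lambda>x. c) \<in> bump_algebra"
| add: "f \<in> bump_algebra \<Longrightarrow> g \<in> bump_algebra \<Longrightarrow> (\<lambda>x. f x + g x) \<in> bump_algebra"
| mult: "f \<in> bump_algebra \<Longrightarrow> g \<in> bump_algebra \<Longrightarrow> (\<lambda>x. f x * g x) \<in> bump_algebra"
| bump: "(\<lambda>x. exp_bump n (x \<bullet> v + a)) \<in> bump_algebra"

lemma bump_algebra_derivative:
  "f \<in> bump_algebra \<Longrightarrow> \<exists>D. (\<forall>x. (f has_derivative D x) (at x)) \<and> (\<forall>b. (\<lambda>x. D x b) \<in> bump_algebra)"
proof (induction rule: bump_algebra.induct)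
  case (const c)
  show ?case by (intro exI[of _ "\<lambda>x b. 0"]) (auto intro: bump_algebra.const)
next
  case (add f g)
  then obtain D D' where "\<forall>x. (f has_derivative D x) (at x)" "\<forall>b. (\<lambda>x. D x b) \<in> bump_algebra"
    "\<forall>x. (g has_derivative D' x) (at x)" "\<forall>b. (\<lambda>x. D' x b) \<in> bump_algebra" by blast
  then show ?case
    by (intro exI[of _ "\<lambda>x b. D x b + D' x b"]) (auto intro: bump_algebra.add has_derivative_add)
next
  case (mult f g)
  then obtain D D' where D: "\<forall>x. (f has_derivative D x) (at x)" "\<forall>b. (\<lambda>x. D x b) \<in> bump_algebra"
    "\<forall>x. (g has_derivative D' x) (at x)" "\<forall>b. (\<lambda>x. D' x b) \<in> bump_algebra" by blast
  show ?case
  proof (intro exI[of _ "\<lambda>x b. f x * D' x b + D x b * g x"] conjI allI)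
    show "((\<lambda>x. f x * g x) has_derivative (\<lambda>b. f x * D' x b + D x b * g x)) (at x)" for x
      using D by (intro has_derivative_mult) auto
    show "(\<lambda>x. f x * D' x b + D x b * g x) \<in> bump_algebra" for b
      by (intro bump_algebra.add bump_algebra.mult mult.hyps) (use D in auto)
  qed
next
  case (bump n v a)
  define d where "d x = exp_bump (n + 2) (x \<bullet> v + a) + (- real n) * exp_bump (n + 1) (x \<bullet> v + a)" for x
  show ?case
  proof (intro exI[of _ "\<lambda>x b. d x * (b \<bullet> v)"] conjI allI)
    fix x :: 'a
    have "((\<lambda>x. x \<bullet> v + a) has_derivative (\<lambda>b. b \<bullet> v)) (at x)"
      by (auto intro!: derivative_eq_intros)
    moreover have "(exp_bump n has_derivative (*) (d x)) (at (x \<bullet> v + a))"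
      using DERIV_exp_bump[of n "x \<bullet> v + a"] by (simp add: has_field_derivative_def d_def)
    ultimately show "((\<lambda>x. exp_bump n (x \<bullet> v + a)) has_derivative (\<lambda>b. d x * (b \<bullet> v))) (at x)"
      by (rule has_derivative_compose)
  next
    fix b :: 'a
    show "(\<lambda>x. d x * (b \<bullet> v)) \<in> bump_algebra"
      unfolding d_def by (intro bump_algebra.mult bump_algebra.add bump_algebra.bump bump_algebra.const)
  qed
qed

lemma Ck_bump_algebra: "f \<in> bump_algebra \<Longrightarrow> Ck k f"
proof (induction k arbitrary: f)
  case 0
  then obtain D where "\<And>x. (f has_derivative D x) (at x)" using bump_algebra_derivative by blast
  then have "continuous_on UNIV f" by (metis continuous_at_imp_continuous_on has_derivative_continuous)
  then show ?case by simp
next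
  case (Suc k)
  then obtain D where D: "\<And>x. (f has_derivative D x) (at x)" "\<And>b. (\<lambda>x. D x b) \<in> bump_algebra"
    using bump_algebra_derivative by blast
  have "frechet_derivative f (at x) = D x" for x using frechet_derivative_at[OF D(1)] by simp
  then show ?case using D Suc.IH by (auto simp: differentiable_def)
qed

text \<open>Positive exactly on the open box. The factor \<open>Suc n\<close> steepens the flanks,
  so that these functions converge to the indicator of the box while staying below 1.\<close>

definition box_bump :: "nat \<Rightarrow> 'a::euclidean_space \<Rightarrow> 'a \<Rightarrow> 'a \<Rightarrow> real" where
  "box_bump n a b x = (\<Prod>i\<in>Basis. exp_bump 0 (real (Suc n) * (x \<bullet> i - a \<bullet> i)) * exp_bump 0 (real (Suc n) * (b \<bullet> i - x \<bullet> i)))"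

lemma exp_bump_0: "0 \<le> exp_bump 0 x" "exp_bump 0 x \<le> 1"
  by (auto simp: exp_bump_def)

lemma box_bump_bounds: "0 \<le> box_bump n a b x" "box_bump n a b x \<le> 1"
  unfolding box_bump_def by (auto intro!: prod_nonneg prod_le_1 mult_nonneg_nonneg mult_le_one simp: exp_bump_0)

lemma box_bump_eq_0: "x \<notin> box a b \<Longrightarrow> box_bump n a b x = 0"
proof -
  assume "x \<notin> box a b"
  then obtain i where i: "i \<in> Basis" "x \<bullet> i \<le> a \<bullet> i \<or> b \<bullet> i \<le> x \<bullet> i" by (auto simp: mem_box not_less)
  then have "exp_bump 0 (real (Suc n) * (x \<bullet> i - a \<bullet> i)) * exp_bump 0 (real (Suc n) * (b \<bullet> i - x \<bullet> i)) = 0"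
    by (auto simp: exp_bump_def zero_less_mult_iff)
  then show ?thesis unfolding box_bump_def using i(1) by (intro prod_zero) auto
qed

lemma box_bump_pos: "x \<in> box a b \<Longrightarrow> 0 < box_bump n a b x"
  unfolding box_bump_def mem_box by (auto intro!: prod_pos mult_pos_pos simp: exp_bump_def)

lemma box_bump_tendsto: "(\<lambda>n. box_bump n a b x) \<longlonglongrightarrow> indicator (box a b) x"
proof (cases "x \<in> box a b")
  case True
  have lim: "(\<lambda>n. exp_bump 0 (real (Suc n) * y)) \<longlonglongrightarrow> 1" if "0 < y" for y :: real
  proof -
    have "(\<lambda>n. exp (- (1 / y) / real (Suc n))) \<longlonglongrightarrow> exp 0"
      by (intro tendsto_exp LIMSEQ_Suc lim_const_over_n)
    then show ?thesis using that by (simp add: exp_bump_def mult.commute)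
  qed
  have "(\<lambda>n. box_bump n a b x) \<longlonglongrightarrow> (\<Prod>i\<in>(Basis :: 'a set). 1 * 1)"
    unfolding box_bump_def by (intro tendsto_prod tendsto_mult lim) (use True in \<open>auto simp: mem_box\<close>)
  then show ?thesis using True by simp
qed (simp add: box_bump_eq_0)

lemma box_bump_in_bump_algebra: "box_bump n a b \<in> bump_algebra"
proof -
  have "(\<lambda>x. \<Prod>i\<in>I. exp_bump 0 (real (Suc n) * (x \<bullet> i - a \<bullet> i)) * exp_bump 0 (real (Suc n) * (b \<bullet> i - x \<bullet> i))) \<in> bump_algebra"
    if "finite I" for I
    using that
  proof (induction I)
    case empty
    then show ?case by (simp add: bump_algebra.const)
  next
    case (insert i I)
    have "(\<lambda>x. exp_bump 0 (x \<bullet> (real (Suc n) *\<^sub>R i) + (- real (Suc n) * (a \<bullet> i)))) \<in> bump_algebra"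
      "(\<lambda>x. exp_bump 0 (x \<bullet> (- real (Suc n) *\<^sub>R i) + real (Suc n) * (b \<bullet> i))) \<in> bump_algebra"
      by (rule bump_algebra.bump)+
    then have "(\<lambda>x. exp_bump 0 (real (Suc n) * (x \<bullet> i - a \<bullet> i)) * exp_bump 0 (real (Suc n) * (b \<bullet> i - x \<bullet> i))) \<in> bump_algebra"
      by (intro bump_algebra.mult) (simp_all add: algebra_simps)
    then show ?case unfolding prod.insert[OF insert.hyps] by (rule bump_algebra.mult) (rule insert.IH)
  qed
  then show ?thesis unfolding box_bump_def[abs_def] by simp
qed

lemma test_functionsI:
  assumes "\<And>k. Ck k \<phi>" "\<And>x. x \<notin> cbox a b \<Longrightarrow> \<phi> x = 0" "cbox a b \<subseteq> \<Omega>"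
  shows "\<phi> \<in> test_functions \<Omega>"
proof -
  have "closure {x. \<phi> x \<noteq> 0} \<subseteq> cbox a b"
    by (rule closure_minimal[OF _ closed_cbox]) (use assms(2) in auto)
  moreover from this have "compact (closure {x. \<phi> x \<noteq> 0})"
    using compact_Int_closed[OF compact_cbox closed_closure, of a b "{x. \<phi> x \<noteq> 0}"] by (simp add: inf_absorb2)
  ultimately show ?thesis using assms(1,3) by (auto simp: test_functions_def)
qed

lemma box_bump_test_function: "cbox a b \<subseteq> \<Omega> \<Longrightarrow> box_bump n a b \<in> test_functions \<Omega>"
  by (rule test_functionsI[of _ a b])
    (use box_subset_cbox in \<open>auto intro!: Ck_bump_algebra box_bump_in_bump_algebra box_bump_eq_0\<close>)

section \<open>Fundamental lemma of the calculus of variations and weak time derivatives\<close>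

text \<open>Bumps converge boundedly to indicators of boxes, so \<open>f\<close> has integral zero
  over every box whose closed version lies in \<open>\<Omega>\<close>. Boxes form a pi-system
  generating the Borel sets, which settles each such box, and \<open>\<Omega>\<close> is a countable
  union of closed ones.\<close>

lemma fundamental_lemma:
  fixes f :: "'a::euclidean_space \<Rightarrow> 'b::{banach,second_countable_topology}"
  assumes \<Omega>: "open \<Omega>" and f: "integrable (lebesgue_on \<Omega>) f"
    and zero: "\<And>n a b. cbox a b \<subseteq> \<Omega> \<Longrightarrow> (LINT x|lebesgue_on \<Omega>. box_bump n a b x *\<^sub>R f x) = 0"
  shows "AE x in lebesgue_on \<Omega>. f x = 0"
proof -
  have S: "\<Omega> \<in> sets lebesgue" using \<Omega> by auto
  define g where "g x = indicator \<Omega> x *\<^sub>R f x" for x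
  have g: "integrable lebesgue g" using f S by (simp add: g_def[abs_def] integrable_restrict_space)
  have mb: "box_bump n a b \<in> borel_measurable lebesgue" for n and a b :: 'a
    using Ck_bump_algebra[OF box_bump_in_bump_algebra, of 0 n a b]
    by (intro measurable_completion) (auto intro: borel_measurable_continuous_onI)
  have box0: "(LINT x|lebesgue. indicator (box a b) x *\<^sub>R g x) = 0" if ab: "cbox a b \<subseteq> \<Omega>" for a b
  proof -
    have "(\<lambda>n. LINT x|lebesgue. box_bump n a b x *\<^sub>R g x) \<longlonglongrightarrow> (LINT x|lebesgue. indicator (box a b) x *\<^sub>R g x)"
    proof (rule integral_dominated_convergence[where w="\<lambda>x. norm (g x)"])
      show "(\<lambda>x. indicator (box a b) x *\<^sub>R g x) \<in> borel_measurable lebesgue"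
        using g by (intro borel_measurable_scaleR borel_measurable_indicator) auto
      show "(\<lambda>x. box_bump n a b x *\<^sub>R g x) \<in> borel_measurable lebesgue" for n
        using g by (intro borel_measurable_scaleR mb) auto
      show "integrable lebesgue (\<lambda>x. norm (g x))" using g by simp
      show "AE x in lebesgue. (\<lambda>n. box_bump n a b x *\<^sub>R g x) \<longlonglongrightarrow> indicator (box a b) x *\<^sub>R g x"
        by (intro AE_I2 tendsto_scaleR box_bump_tendsto tendsto_const)
      show "AE x in lebesgue. norm (box_bump n a b x *\<^sub>R g x) \<le> norm (g x)" for n
        by (intro AE_I2) (simp add: box_bump_bounds mult_left_le_one_le)
    qed
    moreover have "(LINT x|lebesgue. box_bump n a b x *\<^sub>R g x) = 0" for n
    proof -
      have "(LINT x|lebesgue_on \<Omega>. box_bump n a b x *\<^sub>R f x) = (LINT x|lebesgue. indicator \<Omega> x *\<^sub>R box_bump n a b x *\<^sub>R f x)"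
        using S by (subst integral_restrict_space) auto
      then show ?thesis using zero[OF ab, of n] by (simp add: g_def mult.commute)
    qed
    ultimately have "(\<lambda>n::nat. 0) \<longlonglongrightarrow> (LINT x|lebesgue. indicator (box a b) x *\<^sub>R g x)" by simp
    then show ?thesis by (simp only: LIMSEQ_const_iff)
  qed
  have cbox0: "AE x in lebesgue. x \<in> cbox c d \<longrightarrow> g x = 0" if cd: "cbox c d \<subseteq> \<Omega>" for c d
  proof -
    have "AE x in lebesgue. indicator (box c d) x *\<^sub>R g x = 0"
    proof (rule AE_eq_0_if_integral_generator_eq_0[where G="range (\<lambda>(a, b). box a b)"])
      show "integrable lebesgue (\<lambda>x. indicator (box c d) x *\<^sub>R g x)"
        by (rule integrable_mult_indicator[OF _ g]) simp
      show "Int_stable (range (\<lambda>(a, b). box a b :: 'a set))" by (auto simp: Int_stable_def box_Int_box)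
      show "sets borel = sigma_sets UNIV (range (\<lambda>(a, b). box a b :: 'a set))"
        unfolding borel_eq_box by (rule sets_measure_of) simp
      show "(LINT x|lebesgue. indicator (box c d) x *\<^sub>R g x) = 0" by (rule box0[OF cd])
      fix A :: "'a set" assume "A \<in> range (\<lambda>(a, b). box a b)"
      then obtain a b where A: "A = box a b" by auto
      \<comment> \<open>The intersection has to be written with corners inside
        \<open>cbox c d\<close>, so that its closed box is again contained in
        \<open>\<Omega>\<close>; explicit maxima and minima ensure this.\<close>
      obtain a' b' where ab': "A \<inter> box c d = box a' b'" "cbox a' b' \<subseteq> cbox c d"
      proof
        show "A \<inter> box c d = box (\<Sum>i\<in>Basis. max (a \<bullet> i) (c \<bullet> i) *\<^sub>R i) (\<Sum>i\<in>Basis. min (b \<bullet> i) (d \<bullet> i) *\<^sub>R i)"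
          unfolding A by (rule box_Int_box)
        show "cbox (\<Sum>i\<in>Basis. max (a \<bullet> i) (c \<bullet> i) *\<^sub>R i) (\<Sum>i\<in>Basis. min (b \<bullet> i) (d \<bullet> i) *\<^sub>R i) \<subseteq> cbox c d"
          by (auto simp: mem_box)
      qed
      have "(LINT x:A|lebesgue. indicator (box c d) x *\<^sub>R g x) = (LINT x|lebesgue. indicator (A \<inter> box c d) x *\<^sub>R g x)"
        unfolding set_lebesgue_integral_def by (simp add: indicator_inter_arith)
      then show "(LINT x:A|lebesgue. indicator (box c d) x *\<^sub>R g x) = 0"
        using box0[of a' b'] ab' cd by auto
    qed
    moreover have "AE x in lebesgue. x \<notin> cbox c d - box c d"
      by (rule AE_not_in) (simp add: negligible_iff_null_sets[symmetric] negligible_frontier_interval)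
    ultimately show ?thesis by eventually_elim (auto simp: indicator_def)
  qed
  obtain \<D> where \<D>: "countable \<D>" "\<D> \<subseteq> Pow \<Omega>" "\<And>X. X \<in> \<D> \<Longrightarrow> \<exists>a b. X = cbox a b" "\<Union>\<D> = \<Omega>"
    using open_countable_Union_open_cbox[OF \<Omega>] by metis
  have "AE x in lebesgue. \<forall>X\<in>\<D>. x \<in> X \<longrightarrow> g x = 0"
    unfolding AE_ball_countable[OF \<D>(1)]
  proof
    fix X assume "X \<in> \<D>"
    then obtain a b where "X = cbox a b" "cbox a b \<subseteq> \<Omega>" using \<D>(2,3) by blast
    then show "AE x in lebesgue. x \<in> X \<longrightarrow> g x = 0" using cbox0 by simp
  qed
  then have "AE x in lebesgue. x \<in> \<Omega> \<longrightarrow> f x = 0"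
    by eventually_elim (use \<D>(4) in \<open>auto simp: g_def indicator_def\<close>)
  then show ?thesis by (simp add: AE_lebesgue_on_iff[OF S])
qed

section \<open>Weak time derivatives as primitives\<close>

lemma test_function_itv:
  assumes "\<phi> \<in> test_functions {0<..<T}"
  shows "(\<phi> has_real_derivative deriv \<phi> t) (at t)" "continuous_on UNIV (deriv \<phi>)"
    "t \<notin> {0<..<T} \<Longrightarrow> \<phi> t = 0"
proof -
  have C: "Ck (Suc 0) \<phi>" using assms by (simp add: test_functions_def)
  have d: "\<phi> differentiable (at t)" for t using C by simp
  then show D: "(\<phi> has_real_derivative deriv \<phi> t) (at t)" for t
    by (simp add: DERIV_deriv_iff_real_differentiable)
  have "frechet_derivative \<phi> (at t) 1 = deriv \<phi> t" for t
    using frechet_derivative_at[OF D[unfolded has_field_derivative_def], of t] by (metis mult.right_neutral)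
  then show "continuous_on UNIV (deriv \<phi>)" using C by simp
  show "t \<notin> {0<..<T} \<Longrightarrow> \<phi> t = 0"
    using assms closure_subset[of "{x. \<phi> x \<noteq> 0}"] by (auto simp: test_functions_def)
qed

lemma integral_test_function_by_parts:
  fixes v :: "real \<Rightarrow> 'b::{banach,second_countable_topology}"
  assumes T: "0 < T" and \<phi>: "\<phi> \<in> test_functions {0<..<T}" and v: "integrable (itv T) v"
  shows "(LINT t|itv T. deriv \<phi> t *\<^sub>R (u0 + prim v t)) = - (LINT t|itv T. \<phi> t *\<^sub>R v t)"
    and "integrable (itv T) (\<lambda>t. deriv \<phi> t *\<^sub>R (u0 + prim v t))"
    and "integrable (itv T) (\<lambda>t. \<phi> t *\<^sub>R v t)"
proof -
  note \<phi>' = test_function_itv[OF \<phi>]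
  have c': "continuous_on A (deriv \<phi>)" for A using \<phi>'(2) continuous_on_subset by blast
  have c: "continuous_on A \<phi>" for A
    using \<phi>'(1) by (intro continuous_at_imp_continuous_on) (auto intro: DERIV_isCont)
  have \<phi>_eq: "\<phi> t = 0 + prim (deriv \<phi>) t" if "t \<in> {0..T}" for t
    using prim_FTC[of t \<phi> "deriv \<phi>"] \<phi>'(1) \<phi>'(3)[of 0] c' that by auto
  have i': "integrable (itv T) (deriv \<phi>)" by (rule integrable_itv_continuous[OF c'])
  note P = prim_product_scaleR[OF \<phi>_eq i' v, of T u0]
  show int1: "integrable (itv T) (\<lambda>t. \<phi> t *\<^sub>R v t)"
  proof -
    obtain C where C: "\<And>t. t \<in> {0..T} \<Longrightarrow> norm (\<phi> t) \<le> C" using bounded_continuous_on_itv[OF c] by metis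
    show ?thesis
      by (rule integrable_bilinear_bounded[OF bounded_bilinear.flip[OF bounded_bilinear_scaleR] v
            measurable_itv_continuous[OF c], where C=C]) (use C in auto)
  qed
  have "integrable (itv T) (\<lambda>t. (deriv \<phi> t *\<^sub>R (u0 + prim v t) + \<phi> t *\<^sub>R v t) - \<phi> t *\<^sub>R v t)"
    using P(2) T int1 by (intro Bochner_Integration.integrable_diff) auto
  then show int2: "integrable (itv T) (\<lambda>t. deriv \<phi> t *\<^sub>R (u0 + prim v t))" by simp
  have "0 = prim (\<lambda>s. deriv \<phi> s *\<^sub>R (u0 + prim v s) + \<phi> s *\<^sub>R v s) T"
    using P(1) \<phi>'(3)[of T] T by simp
  also have "\<dots> = (LINT t|itv T. deriv \<phi> t *\<^sub>R (u0 + prim v t)) + (LINT t|itv T. \<phi> t *\<^sub>R v t)"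
    unfolding prim_def[of _ T] by (rule Bochner_Integration.integral_add[OF int2 int1])
  finally show "(LINT t|itv T. deriv \<phi> t *\<^sub>R (u0 + prim v t)) = - (LINT t|itv T. \<phi> t *\<^sub>R v t)"
    by (simp add: eq_neg_iff_add_eq_0)
qed

text \<open>Lemma of du Bois-Reymond. A function is the derivative of a test function if it is
  smooth, compactly supported and of mean zero. Correcting a bump by a multiple of the fixed bump
  \<open>\<eta>0\<close> achieves mean zero, and the hypothesis then says that \<open>w - c\<close>
  is orthogonal to the bump, with \<open>c\<close> the average of \<open>w\<close> against
  \<open>\<eta>0\<close>.\<close>

lemma constant_if_weak_derivative_0:
  fixes w :: "real \<Rightarrow> 'b::{banach,second_countable_topology}"
  assumes T: "0 < T" and w: "integrable (itv T) w"
    and zero: "\<And>\<phi>. \<phi> \<in> test_functions {0<..<T} \<Longrightarrow> (LINT t|itv T. deriv \<phi> t *\<^sub>R w t) = 0"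
  shows "\<exists>c. AE t in itv T. w t = c"
proof -
  define \<eta>0 where "\<eta>0 = box_bump 0 (T / 3) (2 * T / 3)"
  have cb: "continuous_on A (box_bump n a b)" for A n and a b :: real
    using Ck_bump_algebra[OF box_bump_in_bump_algebra, of 0 n a b] continuous_on_subset by auto
  have ib: "integrable (itv T) (box_bump n a b)" for n a b by (rule integrable_itv_continuous[OF cb])
  have iw: "integrable (itv T) (\<lambda>t. box_bump n a b t *\<^sub>R w t)" for n a b
    by (rule integrable_bilinear_bounded[OF bounded_bilinear.flip[OF bounded_bilinear_scaleR] w
          measurable_itv_continuous[OF cb], where C=1]) (simp add: box_bump_bounds)
  define I0 where "I0 = (LINT t|itv T. \<eta>0 t)"
  have "I0 \<noteq> 0"
  proof
    assume "I0 = 0"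
    then have "AE t in itv T. \<eta>0 t = 0" unfolding I0_def \<eta>0_def
      by (subst (asm) integral_nonneg_eq_0_iff_AE[OF ib]) (auto simp: box_bump_bounds)
    then have "AE t in lebesgue. t \<notin> {T / 3<..<2 * T / 3}"
      unfolding AE_lebesgue_on_iff[OF sets_lebesgue_itv]
    proof eventually_elim
      case (elim t)
      then show ?case using T box_bump_pos[of t "T / 3" "2 * T / 3" 0] by (auto simp: \<eta>0_def)
    qed
    then have "{T / 3<..<2 * T / 3} \<in> null_sets lebesgue" by (subst (asm) AE_iff_null_sets[symmetric]) auto
    then show False using T by (simp add: null_sets_def)
  qed
  define c where "c = (1 / I0) *\<^sub>R (LINT t|itv T. \<eta>0 t *\<^sub>R w t)"
  interpret finite_measure "itv T" by (rule finite_measure_itv)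
  have "AE t in lebesgue_on {0<..<T}. w t - c = 0"
  proof (rule fundamental_lemma)
    show "open {0<..<T}" by simp
    show "integrable (lebesgue_on {0<..<T}) (\<lambda>t. w t - c)" using w by simp
    fix n and a b :: real assume ab: "cbox a b \<subseteq> {0<..<T}"
    define \<eta> where "\<eta> = box_bump n a b"
    define J where "J = (LINT t|itv T. \<eta> t)"
    \<comment> \<open>The multiple of \<open>\<eta>0\<close> is chosen to cancel the integral
      \<open>J\<close>, so that the antiderivative starting from 0 vanishes to the right of the
      supports too.\<close>
    define \<psi> where "\<psi> t = \<eta> t + (- J / I0) * \<eta>0 t" for t
    have \<psi>_alg: "\<psi> \<in> bump_algebra" unfolding \<psi>_def[abs_def] \<eta>_def \<eta>0_def
      by (intro bump_algebra.add bump_algebra.mult bump_algebra.const box_bump_in_bump_algebra)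
    have c\<psi>: "isCont \<psi> t" for t
      using Ck_bump_algebra[OF \<psi>_alg, of 0] by (simp add: continuous_on_eq_continuous_at)
    obtain F where F: "\<And>t. (F has_real_derivative \<psi> t) (at t)"
      using einterval_antiderivative[of "-\<infinity>" "\<infinity>" \<psi>] c\<psi>
      by (auto simp: has_real_derivative_iff_has_vector_derivative)
    define \<Phi> where "\<Phi> t = F t - F 0" for t
    have \<Phi>: "(\<Phi> has_real_derivative \<psi> t) (at t)" for t
      unfolding \<Phi>_def[abs_def] using F by (auto intro!: derivative_eq_intros)
    \<comment> \<open>Together with \<open>b'\<close> an interval that contains both supports. The
      ends of an empty box may lie anywhere and are therefore ignored.\<close>
    define a' where "a' = (if box a b = {} then T / 3 else min a (T / 3))"
    define b' where "b' = (if box a b = {} then 2 * T / 3 else max b (2 * T / 3))"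
    have "0 < a \<and> b < T" if "a < b" using ab[THEN subsetD, of a] ab[THEN subsetD, of b] that by auto
    then have ab': "0 < a'" "b' < T" "a' \<le> b'"
      using T by (auto simp: a'_def b'_def box_eq_empty min_def max_def)
    have \<psi>0: "\<psi> t = 0" if "t \<le> a' \<or> b' \<le> t" for t
    proof -
      have "t \<notin> box a b" "t \<notin> box (T / 3) (2 * T / 3)" using that by (auto simp: a'_def b'_def split: if_splits)
      then show ?thesis by (simp add: \<psi>_def \<eta>_def \<eta>0_def box_bump_eq_0)
    qed
    have const: "\<Phi> t = \<Phi> s" if "s \<le> t" "\<And>r. s \<le> r \<Longrightarrow> r \<le> t \<Longrightarrow> \<psi> r = 0" for s t
    proof (cases "s = t")
      case False
      then show ?thesis
        using DERIV_isconst2[of s t \<Phi> t] that \<Phi> by (metis DERIV_isCont continuous_at_imp_continuous_on less_eq_real_def order_refl)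
    qed simp
    have "prim \<psi> T = \<Phi> T - \<Phi> 0"
      by (rule prim_FTC) (use T \<Phi> c\<psi> in \<open>auto intro: continuous_at_imp_continuous_on\<close>)
    moreover have "prim \<psi> T = J + (- J / I0) * I0"
    proof -
      have "prim \<psi> T = (LINT t|itv T. \<eta> t) + (LINT t|itv T. (- J / I0) * \<eta>0 t)"
        unfolding prim_def \<psi>_def \<eta>_def \<eta>0_def
        by (intro Bochner_Integration.integral_add integrable_mult_right ib)
      then show ?thesis by (simp only: J_def I0_def integral_mult_right_zero)
    qed
    ultimately have \<Phi>T: "\<Phi> T = 0" using \<open>I0 \<noteq> 0\<close> by (simp add: \<Phi>_def)
    have \<Phi>_supp: "\<Phi> t = 0" if "t \<notin> cbox a' b'" for t
    proof (cases "t < a'")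
      case True
      have "\<Phi> a' = \<Phi> 0" using ab' \<psi>0 by (intro const) auto
      moreover have "\<Phi> a' = \<Phi> t" using True \<psi>0 by (intro const) auto
      ultimately show ?thesis by (simp add: \<Phi>_def)
    next
      case False
      then have "b' < t" using that by auto
      then have "\<Phi> t = \<Phi> b'" using \<psi>0 by (intro const) auto
      moreover have "\<Phi> T = \<Phi> b'" using ab' \<psi>0 by (intro const) auto
      ultimately show ?thesis using \<Phi>T by simp
    qed
    have fre: "frechet_derivative \<Phi> (at t) 1 = \<psi> t" for t
      using frechet_derivative_at[OF \<Phi>[unfolded has_field_derivative_def], of t] by (metis mult.right_neutral)
    have diff: "\<Phi> differentiable (at t)" for t
      using \<Phi> by (meson differentiableI has_field_derivative_imp_has_derivative)
    have "Ck k \<Phi>" for k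
    proof (cases k)
      case 0
      then show ?thesis using \<Phi> by (auto intro!: continuous_at_imp_continuous_on DERIV_isCont)
    next
      case (Suc m)
      then show ?thesis using diff fre Ck_bump_algebra[OF \<psi>_alg] by simp
    qed
    then have "\<Phi> \<in> test_functions {0<..<T}"
      by (rule test_functionsI[of _ a' b']) (use \<Phi>_supp ab' in auto)
    moreover have "deriv \<Phi> = \<psi>" using DERIV_imp_deriv[OF \<Phi>] by blast
    ultimately have "(LINT t|itv T. \<psi> t *\<^sub>R w t) = 0" using zero by metis
    moreover have "(LINT t|itv T. \<psi> t *\<^sub>R w t)
      = (LINT t|itv T. \<eta> t *\<^sub>R w t) + (- J / I0) *\<^sub>R (LINT t|itv T. \<eta>0 t *\<^sub>R w t)"
    proof -
      have "(LINT t|itv T. \<psi> t *\<^sub>R w t) = (LINT t|itv T. \<eta> t *\<^sub>R w t + (- J / I0) *\<^sub>R (\<eta>0 t *\<^sub>R w t))"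
        by (simp only: \<psi>_def scaleR_add_left scaleR_scaleR)
      also have "\<dots> = (LINT t|itv T. \<eta> t *\<^sub>R w t) + (LINT t|itv T. (- J / I0) *\<^sub>R (\<eta>0 t *\<^sub>R w t))"
        unfolding \<eta>_def \<eta>0_def by (intro Bochner_Integration.integral_add integrable_scaleR_right iw)
      finally show ?thesis by (simp only: integral_scaleR_right)
    qed
    ultimately have "(LINT t|itv T. \<eta> t *\<^sub>R w t) = J *\<^sub>R c" by (simp add: c_def)
    moreover have "(LINT t|itv T. \<eta> t *\<^sub>R c) = J *\<^sub>R c" unfolding J_def \<eta>_def using ib by simp
    moreover have "integrable (itv T) (\<lambda>t. \<eta> t *\<^sub>R c)" unfolding \<eta>_def using ib by simp
    ultimately show "(LINT t|lebesgue_on {0<..<T}. box_bump n a b t *\<^sub>R (w t - c)) = 0"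
      using iw[of n a b] by (simp add: \<eta>_def scaleR_diff_right)
  qed
  then have "AE t in itv T. w t = c" by simp
  then show ?thesis by blast
qed

text \<open>From left to right, \<open>u - prim v\<close> has weak derivative zero, hence is
  constant; the converse is integration by parts. This turns the definition through test functions
  into a representation with which the product rule can be applied.\<close>

lemma weak_derivative_iff:
  fixes u v :: "real \<Rightarrow> 'b::{banach,second_countable_topology}"
  assumes T: "0 < T" and u: "integrable (itv T) u" and v: "integrable (itv T) v"
  shows "(\<forall>\<phi>\<in>test_functions {0<..<T}. (LINT t|itv T. deriv \<phi> t *\<^sub>R u t) = - (LINT t|itv T. \<phi> t *\<^sub>R v t))
    \<longleftrightarrow> (\<exists>u0. AE t in itv T. u t = u0 + prim v t)" (is "?L \<longleftrightarrow> ?R")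
proof
  assume L: ?L
  have cv: "continuous_on {0..T} (prim v)" by (rule continuous_on_prim[OF v])
  obtain C where C: "\<And>t. t \<in> {0..T} \<Longrightarrow> norm (prim v t) \<le> C" using bounded_continuous_on_itv[OF cv] by metis
  interpret finite_measure "itv T" by (rule finite_measure_itv)
  have pv: "integrable (itv T) (prim v)"
    by (rule integrable_const_bound[where B=C]) (use C measurable_itv_continuous[OF cv] in \<open>auto simp: space_restrict_space\<close>)
  have "\<exists>c. AE t in itv T. u t - prim v t = c"
  proof (rule constant_if_weak_derivative_0[OF T])
    show "integrable (itv T) (\<lambda>t. u t - prim v t)" using u pv by simp
    fix \<phi> assume \<phi>: "\<phi> \<in> test_functions {0<..<T}"
    note bp = integral_test_function_by_parts(1,2)[OF T \<phi> v, of 0]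
    have c': "continuous_on {0..T} (deriv \<phi>)" using test_function_itv(2)[OF \<phi>] continuous_on_subset by blast
    obtain C where C: "\<And>t. t \<in> {0..T} \<Longrightarrow> norm (deriv \<phi> t) \<le> C" using bounded_continuous_on_itv[OF c'] by metis
    have iu: "integrable (itv T) (\<lambda>t. deriv \<phi> t *\<^sub>R u t)"
      by (rule integrable_bilinear_bounded[OF bounded_bilinear.flip[OF bounded_bilinear_scaleR] u
            measurable_itv_continuous[OF c'], where C=C]) (use C in auto)
    have "(LINT t|itv T. deriv \<phi> t *\<^sub>R (u t - prim v t))
      = (LINT t|itv T. deriv \<phi> t *\<^sub>R u t) - (LINT t|itv T. deriv \<phi> t *\<^sub>R prim v t)"
      using iu bp(2) by (simp add: scaleR_diff_right)
    then show "(LINT t|itv T. deriv \<phi> t *\<^sub>R (u t - prim v t)) = 0" using L \<phi> bp(1) by simp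
  qed
  then obtain c where "AE t in itv T. u t - prim v t = c" by blast
  then have "AE t in itv T. u t = c + prim v t" by eventually_elim (simp add: algebra_simps)
  then show ?R by blast
next
  assume ?R
  then obtain u0 where u0: "AE t in itv T. u t = u0 + prim v t" by blast
  show ?L
  proof
    fix \<phi> assume \<phi>: "\<phi> \<in> test_functions {0<..<T}"
    note bp = integral_test_function_by_parts(1,2)[OF T \<phi> v, of u0]
    have "AE t in itv T. deriv \<phi> t *\<^sub>R (u0 + prim v t) = deriv \<phi> t *\<^sub>R u t" using u0 by eventually_elim simp
    from prim_cong_AE[OF bp(2) this order_refl]
    show "(LINT t|itv T. deriv \<phi> t *\<^sub>R u t) = - (LINT t|itv T. \<phi> t *\<^sub>R v t)"
      using bp(1) by (simp add: prim_def)
  qed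
qed

section \<open>Bochner spaces of functions modelled on a Hilbert space\<close>

text \<open>A linear isometry from a seminormed set of functions into a Hilbert space type.
  Closedness of the range lets integrals and limits computed in the type be pulled back to
  functions. The default value 0 keeps \<open>emb (u t)\<close> in the range also at the exceptional
  times at which \<open>u t\<close> is not in the space.\<close>

locale hilbert_model =
  fixes X :: "'a fspace" and emb :: "('a \<Rightarrow> real) \<Rightarrow> 'h::separable_hilbert"
  assumes zero_mem: "(\<lambda>x. 0) \<in> elems X"
    and add_mem: "f \<in> elems X \<Longrightarrow> g \<in> elems X \<Longrightarrow> (\<lambda>x. f x + g x) \<in> elems X"
    and scale_mem: "f \<in> elems X \<Longrightarrow> (\<lambda>x. c * f x) \<in> elems X"
    and emb_add: "f \<in> elems X \<Longrightarrow> g \<in> elems X \<Longrightarrow> emb (\<lambda>x. f x + g x) = emb f + emb g"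
    and emb_scale: "f \<in> elems X \<Longrightarrow> emb (\<lambda>x. c * f x) = c *\<^sub>R emb f"
    and norm_emb: "f \<in> elems X \<Longrightarrow> norm (emb f) = nrm X f"
    and closed_range: "closed (emb ` elems X)"
    and emb_outside: "f \<notin> elems X \<Longrightarrow> emb f = 0"
begin

abbreviation "rng \<equiv> emb ` elems X"

lemma diff_mem: "f \<in> elems X \<Longrightarrow> g \<in> elems X \<Longrightarrow> (\<lambda>x. f x - g x) \<in> elems X"
  using add_mem[of f "\<lambda>x. (-1) * g x"] scale_mem[of g "-1"] by simp

lemma emb_diff: "f \<in> elems X \<Longrightarrow> g \<in> elems X \<Longrightarrow> emb (\<lambda>x. f x - g x) = emb f - emb g"
  using emb_add[of f "\<lambda>x. (-1) * g x"] scale_mem[of g "-1"] emb_scale[of g "-1"] by simp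

lemma nrm_diff: "f \<in> elems X \<Longrightarrow> g \<in> elems X \<Longrightarrow> nrm X (\<lambda>x. f x - g x) = norm (emb f - emb g)"
  by (simp add: norm_emb[OF diff_mem, symmetric] emb_diff)

lemma emb_zero: "emb (\<lambda>x. 0) = 0"
  using emb_scale[OF zero_mem, of 0] by simp

lemma emb_in_rng: "emb f \<in> rng"
proof (cases "f \<in> elems X")
  case False
  then have "emb f = emb (\<lambda>x. 0)" by (simp add: emb_outside emb_zero)
  then show ?thesis using zero_mem by blast
qed simp

sublocale rng: closed_subspace rng
proof
  show "subspace rng"
  proof (rule subspaceI)
    show "0 \<in> rng" using emb_zero emb_in_rng by metis
    fix x y assume "x \<in> rng" "y \<in> rng"
    then obtain f g where "f \<in> elems X" "g \<in> elems X" "x = emb f" "y = emb g" by blast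
    then show "x + y \<in> rng" using emb_in_rng[of "\<lambda>x. f x + g x"] by (simp add: emb_add)
  next
    fix c x assume "x \<in> rng"
    then obtain f where "f \<in> elems X" "x = emb f" by blast
    then show "c *\<^sub>R x \<in> rng" using emb_in_rng[of "\<lambda>x. c * f x"] by (simp add: emb_scale)
  qed
qed (rule closed_range)

text \<open>A right inverse only: \<open>pick (emb f)\<close> is some function with the same image
  as \<open>f\<close>, not \<open>f\<close> itself.\<close>

definition pick :: "'h \<Rightarrow> 'a \<Rightarrow> real" where "pick h = (SOME f. f \<in> elems X \<and> emb f = h)"

lemma pick: "h \<in> rng \<Longrightarrow> pick h \<in> elems X" "h \<in> rng \<Longrightarrow> emb (pick h) = h"
proof -
  assume "h \<in> rng"
  then have "\<exists>f. f \<in> elems X \<and> emb f = h" by blast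
  from someI_ex[OF this] show "pick h \<in> elems X" "emb (pick h) = h" unfolding pick_def by auto
qed

lemma emb_sum:
  "finite A \<Longrightarrow> A \<subseteq> elems X \<Longrightarrow> (\<lambda>x. \<Sum>v\<in>A. c v * v x) \<in> elems X \<and> emb (\<lambda>x. \<Sum>v\<in>A. c v * v x) = (\<Sum>v\<in>A. c v *\<^sub>R emb v)"
proof (induction A rule: finite_induct)
  case empty
  then show ?case by (simp add: zero_mem emb_zero)
next
  case (insert v A)
  then have "v \<in> elems X" and IH: "(\<lambda>x. \<Sum>v\<in>A. c v * v x) \<in> elems X"
    "emb (\<lambda>x. \<Sum>v\<in>A. c v * v x) = (\<Sum>v\<in>A. c v *\<^sub>R emb v)" by auto
  then show ?case
    using add_mem[OF scale_mem[OF \<open>v \<in> elems X\<close>, of "c v"] IH(1)] emb_add[OF scale_mem[OF \<open>v \<in> elems X\<close>, of "c v"] IH(1)]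
    by (simp add: insert.hyps emb_scale)
qed

lemma emb_simple_integral:
  assumes M: "finite_measure M" and s: "simple_into M X s"
  shows "simple_integral M s \<in> elems X"
    and "emb (simple_integral M s) = Bochner_Integration.simple_bochner_integral M (\<lambda>t. emb (s t))"
    and "Bochner_Integration.simple_bochner_integrable M (\<lambda>t. emb (s t))"
proof -
  have sf: "simple_function M s" and sub: "s ` space M \<subseteq> elems X" using s by (auto simp: simple_into_def)
  have fin: "finite (s ` space M)" using sf by (simp add: simple_function_def)
  note S = emb_sum[OF fin sub, of "\<lambda>v. measure M {t \<in> space M. s t = v}"]
  have eq: "simple_integral M s = (\<lambda>x. \<Sum>v\<in>s ` space M. measure M {t \<in> space M. s t = v} * v x)"
    by (simp add: simple_integral_def fun_eq_iff)
  show "simple_integral M s \<in> elems X" unfolding eq using S by (rule conjunct1)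
  interpret finite_measure M by (rule M)
  show si: "Bochner_Integration.simple_bochner_integrable M (\<lambda>t. emb (s t))"
  proof (rule Bochner_Integration.simple_bochner_integrable.intros)
    show "simple_function M (\<lambda>t. emb (s t))" using simple_function_compose1[OF sf] .
  qed simp
  have "Bochner_Integration.simple_bochner_integral M (\<lambda>t. emb (s t)) = (\<Sum>y\<in>s ` space M. measure M {x \<in> space M. s x = y} *\<^sub>R emb y)"
    by (rule simple_bochner_integral_partition[OF si sf]) auto
  then show "emb (simple_integral M s) = Bochner_Integration.simple_bochner_integral M (\<lambda>t. emb (s t))"
    unfolding eq using S by simp
qed

text \<open>The embedded curve is a limit of simple functions merely almost everywhere, which is
  where completeness of the measure enters.\<close>

lemma strongly_measurable_emb:
  assumes M: "complete_measure M" and u: "strongly_measurable M X u"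
  shows "(\<lambda>t. emb (u t)) \<in> borel_measurable M" "AE t in M. u t \<in> elems X"
proof -
  obtain s where s: "\<And>n. simple_into M X (s n)" and lim: "AE t in M. (\<lambda>n. nrm X (\<lambda>x. s n t x - u t x)) \<longlonglongrightarrow> 0"
    and mem: "AE t in M. u t \<in> elems X"
    using u by (auto simp: strongly_measurable_def)
  show "AE t in M. u t \<in> elems X" by (rule mem)
  have m: "(\<lambda>t. emb (s n t)) \<in> borel_measurable M" for n
    using s[of n] by (intro borel_measurable_simple_function simple_function_compose1[where f="s n" and g=emb])
      (simp add: simple_into_def)
  have "AE t in M. lim (\<lambda>n. emb (s n t)) = emb (u t)"
    using lim mem AE_space[of M]
  proof eventually_elim
    case (elim t)
    have "nrm X (\<lambda>x. s n t x - u t x) = norm (emb (s n t) - emb (u t))" for n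
      using s[of n] elim by (intro nrm_diff) (auto simp: simple_into_def)
    then have "(\<lambda>n. norm (emb (s n t) - emb (u t))) \<longlonglongrightarrow> 0" using elim(1) by simp
    then have "(\<lambda>n. emb (s n t)) \<longlonglongrightarrow> emb (u t)" by (simp add: tendsto_norm_zero_iff LIM_zero_iff)
    then show ?case by (rule limI)
  qed
  then show "(\<lambda>t. emb (u t)) \<in> borel_measurable M"
    using complete_measure.measurable_AE_cong[OF M borel_measurable_lim_metric[OF m]] by simp
qed

text \<open>Simple functions approximating the embedded curve may leave the range. Projecting their
  values to it changes neither the limit nor the norm bound, and preimages can then be chosen, one
  for each of the finitely many values.\<close>

lemma simple_approximation:
  assumes m: "(\<lambda>t. emb (u t)) \<in> borel_measurable M"
  obtains s where "\<And>n. simple_into M X (s n)"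
    "\<And>t. t \<in> space M \<Longrightarrow> (\<lambda>n. emb (s n t)) \<longlonglongrightarrow> emb (u t)"
    "\<And>n t. t \<in> space M \<Longrightarrow> norm (emb (s n t)) \<le> 2 * norm (emb (u t))"
proof -
  obtain F where F: "\<And>i. simple_function M (F i)" "\<And>t. t \<in> space M \<Longrightarrow> (\<lambda>i. F i t) \<longlonglongrightarrow> emb (u t)"
    "\<And>i t. t \<in> space M \<Longrightarrow> dist (F i t) 0 \<le> 2 * dist (emb (u t)) 0"
    using borel_measurable_implies_sequence_metric[OF m, of 0] by blast
  define s where "s n t = pick (orth_proj rng (F n t))" for n t
  have emb_s: "emb (s n t) = orth_proj rng (F n t)" for n t
    unfolding s_def by (rule pick(2)[OF rng.orth_proj(1)])
  show ?thesis
  proof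
    show "simple_into M X (s n)" for n
      unfolding simple_into_def
    proof
      show "simple_function M (s n)" unfolding s_def[abs_def] by (rule simple_function_compose1[OF F(1)])
      show "s n ` space M \<subseteq> elems X" unfolding s_def using pick(1)[OF rng.orth_proj(1)] by auto
    qed
    fix t assume t: "t \<in> space M"
    have "(\<lambda>n. orth_proj rng (F n t)) \<longlonglongrightarrow> orth_proj rng (emb (u t))"
      by (rule bounded_linear.tendsto[OF rng.bounded_linear_orth_proj F(2)[OF t]])
    then show "(\<lambda>n. emb (s n t)) \<longlonglongrightarrow> emb (u t)" by (simp add: emb_s emb_in_rng)
    show "norm (emb (s n t)) \<le> 2 * norm (emb (u t))" for n
      using rng.norm_orth_proj_le[of "F n t"] F(3)[OF t, of n] by (simp add: emb_s)
  qed
qed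

lemma strongly_measurableI:
  assumes mem: "AE t in M. u t \<in> elems X" and m: "(\<lambda>t. emb (u t)) \<in> borel_measurable M"
  shows "strongly_measurable M X u"
proof -
  obtain s where s: "\<And>n. simple_into M X (s n)" "\<And>t. t \<in> space M \<Longrightarrow> (\<lambda>n. emb (s n t)) \<longlonglongrightarrow> emb (u t)"
    using simple_approximation[OF m] by metis
  have "AE t in M. (\<lambda>n. nrm X (\<lambda>x. s n t x - u t x)) \<longlonglongrightarrow> 0"
    using mem AE_space[of M]
  proof eventually_elim
    case (elim t)
    have "nrm X (\<lambda>x. s n t x - u t x) = norm (emb (s n t) - emb (u t))" for n
      using s(1)[of n] elim by (intro nrm_diff) (auto simp: simple_into_def)
    then show ?case using s(2)[OF elim(2)] by (simp add: tendsto_norm_zero_iff LIM_zero_iff)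
  qed
  then show ?thesis unfolding strongly_measurable_def using mem s(1) by blast
qed

lemma has_bochner_imp:
  assumes M: "complete_measure M" "finite_measure M" and u: "has_bochner M X u I"
  shows "AE t in M. u t \<in> elems X" "I \<in> elems X" "has_bochner_integral M (\<lambda>t. emb (u t)) (emb I)"
proof -
  obtain s where s: "\<And>n. simple_into M X (s n)"
    "(\<lambda>n. \<integral>\<^sup>+ t. ennreal (nrm X (\<lambda>x. s n t x - u t x)) \<partial>M) \<longlonglongrightarrow> 0"
    "(\<lambda>n. nrm X (\<lambda>x. simple_integral M (s n) x - I x)) \<longlonglongrightarrow> 0"
    and sm: "strongly_measurable M X u" and I: "I \<in> elems X"
    using u by (auto simp: has_bochner_def)
  note mem = strongly_measurable_emb(2)[OF M(1) sm]
  show "AE t in M. u t \<in> elems X" by (rule mem)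
  show "I \<in> elems X" by (rule I)
  show "has_bochner_integral M (\<lambda>t. emb (u t)) (emb I)"
  proof (rule has_bochner_integral.intros[where s="\<lambda>n t. emb (s n t)"])
    show "(\<lambda>t. emb (u t)) \<in> borel_measurable M" by (rule strongly_measurable_emb(1)[OF M(1) sm])
    show "Bochner_Integration.simple_bochner_integrable M (\<lambda>t. emb (s n t))" for n by (rule emb_simple_integral(3)[OF M(2) s(1)])
    have "(\<integral>\<^sup>+ t. norm (emb (u t) - emb (s n t)) \<partial>M) = (\<integral>\<^sup>+ t. ennreal (nrm X (\<lambda>x. s n t x - u t x)) \<partial>M)" for n
    proof (rule nn_integral_cong_AE, use mem AE_space[of M] in eventually_elim)
      case (elim t)
      then show ?case using s(1)[of n] nrm_diff[of "s n t" "u t"] by (auto simp: simple_into_def norm_minus_commute)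
    qed
    then show "(\<lambda>n. \<integral>\<^sup>+ t. norm (emb (u t) - emb (s n t)) \<partial>M) \<longlonglongrightarrow> 0" using s(2) by simp
    have "nrm X (\<lambda>x. simple_integral M (s n) x - I x) = norm (Bochner_Integration.simple_bochner_integral M (\<lambda>t. emb (s n t)) - emb I)" for n
      using nrm_diff[OF emb_simple_integral(1)[OF M(2) s(1)[of n]] I] emb_simple_integral(2)[OF M(2) s(1)] by simp
    then show "(\<lambda>n. Bochner_Integration.simple_bochner_integral M (\<lambda>t. emb (s n t))) \<longlonglongrightarrow> emb I"
      using s(3) by (simp add: tendsto_norm_zero_iff LIM_zero_iff)
  qed
qed

text \<open>The approximating simple functions are dominated by twice the norm of the curve, so they
  converge to it in the mean, and their integrals converge with them.\<close>

lemma has_bochnerI: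
  assumes M: "finite_measure M" and mem: "AE t in M. u t \<in> elems X" and I: "I \<in> elems X"
    and hb: "has_bochner_integral M (\<lambda>t. emb (u t)) (emb I)"
  shows "has_bochner M X u I"
proof -
  have int: "integrable M (\<lambda>t. emb (u t))" and I_eq: "(LINT t|M. emb (u t)) = emb I"
    using hb by (auto simp: integrable.simps has_bochner_integral_integral_eq)
  have m: "(\<lambda>t. emb (u t)) \<in> borel_measurable M" using int by simp
  obtain s where s: "\<And>n. simple_into M X (s n)" "\<And>t. t \<in> space M \<Longrightarrow> (\<lambda>n. emb (s n t)) \<longlonglongrightarrow> emb (u t)"
    "\<And>n t. t \<in> space M \<Longrightarrow> norm (emb (s n t)) \<le> 2 * norm (emb (u t))"
    using simple_approximation[OF m] by metis
  note S = emb_simple_integral[OF M s(1)]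
  have ms: "(\<lambda>t. emb (s n t)) \<in> borel_measurable M" for n
    using S(3)[of n] by (simp add: simple_bochner_integrable.simps borel_measurable_simple_function)
  have conv: "(\<lambda>n. \<integral>\<^sup>+ t. ennreal (norm (emb (u t) - emb (s n t))) \<partial>M) \<longlonglongrightarrow> 0"
  proof (rule nn_integral_dominated_convergence_norm[where w="\<lambda>t. 2 * norm (emb (u t))"])
    have "(\<integral>\<^sup>+ t. ennreal (2 * norm (emb (u t))) \<partial>M) = 2 * (\<integral>\<^sup>+ t. ennreal (norm (emb (u t))) \<partial>M)"
      using m by (subst nn_integral_cmult[symmetric]) (auto simp: ennreal_mult')
    then show "(\<integral>\<^sup>+ t. ennreal (2 * norm (emb (u t))) \<partial>M) < \<infinity>"
      using int by (simp add: integrable_iff_bounded ennreal_mult_less_top)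
  qed (use m ms s(2,3) in \<open>auto intro!: AE_I2 borel_measurable_times measurable_compose[OF _ borel_measurable_norm]\<close>)
  have nrm_eq: "(\<integral>\<^sup>+ t. ennreal (nrm X (\<lambda>x. s n t x - u t x)) \<partial>M) = (\<integral>\<^sup>+ t. norm (emb (u t) - emb (s n t)) \<partial>M)" for n
  proof (rule nn_integral_cong_AE, use mem AE_space[of M] in eventually_elim)
    case (elim t)
    then show ?case using s(1)[of n] nrm_diff[of "s n t" "u t"] by (auto simp: simple_into_def norm_minus_commute)
  qed
  have "(\<lambda>n. ennreal (norm (Bochner_Integration.simple_bochner_integral M (\<lambda>t. emb (s n t)) - emb I))) \<longlonglongrightarrow> 0"
  proof (rule tendsto_sandwich[OF _ _ tendsto_const conv])
    show "\<forall>\<^sub>F n in sequentially. ennreal (norm (Bochner_Integration.simple_bochner_integral M (\<lambda>t. emb (s n t)) - emb I))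
        \<le> (\<integral>\<^sup>+ t. ennreal (norm (emb (u t) - emb (s n t))) \<partial>M)"
    proof (rule always_eventually, rule allI)
      fix n
      have si: "integrable M (\<lambda>t. emb (s n t))"
        using has_bochner_integral_simple_bochner_integrable[OF S(3)] by (rule integrable.intros)
      have "Bochner_Integration.simple_bochner_integral M (\<lambda>t. emb (s n t)) - emb I = - (LINT t|M. emb (u t) - emb (s n t))"
        using int si by (simp add: simple_bochner_integrable_eq_integral[OF S(3)] I_eq)
      then have "norm (Bochner_Integration.simple_bochner_integral M (\<lambda>t. emb (s n t)) - emb I) = norm (LINT t|M. emb (u t) - emb (s n t))"
        by (simp only: norm_minus_cancel)
      then show "ennreal (norm (Bochner_Integration.simple_bochner_integral M (\<lambda>t. emb (s n t)) - emb I))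
          \<le> (\<integral>\<^sup>+ t. ennreal (norm (emb (u t) - emb (s n t))) \<partial>M)"
        using integral_norm_bound_ennreal[OF Bochner_Integration.integrable_diff[OF int si]] by simp
    qed
  qed simp
  then have "(\<lambda>n. norm (Bochner_Integration.simple_bochner_integral M (\<lambda>t. emb (s n t)) - emb I)) \<longlonglongrightarrow> 0"
    by (subst (asm) ennreal_tendsto_0_iff) auto
  moreover have "nrm X (\<lambda>x. simple_integral M (s n) x - I x) = norm (Bochner_Integration.simple_bochner_integral M (\<lambda>t. emb (s n t)) - emb I)" for n
    using nrm_diff[OF S(1)[of n] I] S(2) by simp
  ultimately have "(\<lambda>n. nrm X (\<lambda>x. simple_integral M (s n) x - I x)) \<longlonglongrightarrow> 0" by simp
  then show ?thesis unfolding has_bochner_def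
    using conv by (intro conjI strongly_measurableI[OF mem m] I exI[of _ s] allI s(1)) (simp_all only: nrm_eq)
qed

lemma complete_measure_itv: "complete_measure (itv T)"
  by (rule complete_measure_lebesgue_on) simp

lemma bochner_L2_iff:
  "u \<in> bochner_L2 T X \<longleftrightarrow> (AE t in itv T. u t \<in> elems X) \<and> sq_integrable_on {0<..<T} (\<lambda>t. emb (u t))"
proof -
  have "integrable (itv T) (\<lambda>t. (nrm X (u t))\<^sup>2) \<longleftrightarrow> integrable (itv T) (\<lambda>t. (norm (emb (u t)))\<^sup>2)"
    if mem: "AE t in itv T. u t \<in> elems X" and m: "(\<lambda>t. emb (u t)) \<in> borel_measurable (itv T)"
  proof -
    have ae: "AE t in itv T. (norm (emb (u t)))\<^sup>2 = (nrm X (u t))\<^sup>2" using mem by eventually_elim (simp add: norm_emb)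
    have m1: "(\<lambda>t. (norm (emb (u t)))\<^sup>2) \<in> borel_measurable (itv T)" using m by measurable
    then have "(\<lambda>t. (nrm X (u t))\<^sup>2) \<in> borel_measurable (itv T)"
      using complete_measure.measurable_AE_cong[OF complete_measure_itv m1 ae] by simp
    from integrable_cong_AE[OF m1 this ae] show ?thesis by simp
  qed
  then show ?thesis
    unfolding bochner_L2_def sq_integrable_on_def
    using strongly_measurable_emb[OF complete_measure_itv] strongly_measurableI by blast
qed

lemma integral_mem_rng:
  assumes f: "integrable (itv T) f" "AE t in itv T. f t \<in> rng"
  shows "(LINT t|itv T. f t) \<in> rng"
  using prim_mem_subspace[OF rng.closed_subspace_axioms f order_refl] by (simp add: prim_def)

text \<open>The bridge by which integrals of function-valued curves are replaced by ordinary
  integrals of their embedded curves.\<close>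

lemma has_bochner_itv_iff:
  assumes u: "integrable (itv T) (\<lambda>t. emb (u t))" "AE t in itv T. u t \<in> elems X"
  shows "has_bochner (itv T) X u I \<longleftrightarrow> I \<in> elems X \<and> emb I = (LINT t|itv T. emb (u t))"
proof
  assume "has_bochner (itv T) X u I"
  from has_bochner_imp[OF complete_measure_itv finite_measure_itv this]
  show "I \<in> elems X \<and> emb I = (LINT t|itv T. emb (u t))" using has_bochner_integral_integral_eq by metis
next
  assume "I \<in> elems X \<and> emb I = (LINT t|itv T. emb (u t))"
  then show "has_bochner (itv T) X u I"
    using has_bochner_integral_integrable[OF u(1)] u(2) by (intro has_bochnerI finite_measure_itv) auto
qed

lemma has_bochner_itv_ex:
  assumes u: "integrable (itv T) (\<lambda>t. emb (u t))" "AE t in itv T. u t \<in> elems X"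
  shows "has_bochner (itv T) X u (bochner_int (itv T) X u)"
proof -
  have "(LINT t|itv T. emb (u t)) \<in> rng" using emb_in_rng by (intro integral_mem_rng[OF u(1)]) simp
  then have "has_bochner (itv T) X u (pick (LINT t|itv T. emb (u t)))"
    unfolding has_bochner_itv_iff[OF u] using pick by blast
  then show ?thesis unfolding bochner_int_def by (rule someI[where P="has_bochner (itv T) X u"])
qed

text \<open>Each integral in the definition becomes an integral of embedded curves. The function
  \<open>I\<close> demanded there exists because such integrals stay in the closed range; what is
  left is the vector-valued equivalence of weak derivatives and primitives.\<close>

lemma weak_dt_iff:
  assumes T: "0 < T" and u: "u \<in> bochner_L2 T X" and v: "v \<in> bochner_L2 T X"
  shows "weak_dt T X u v \<longleftrightarrow> (\<exists>u0. AE t in itv T. emb (u t) = u0 + prim (\<lambda>s. emb (v s)) t)"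
proof -
  have um: "AE t in itv T. u t \<in> elems X" and vm: "AE t in itv T. v t \<in> elems X"
    and su: "sq_integrable_on {0<..<T} (\<lambda>t. emb (u t))" and sv: "sq_integrable_on {0<..<T} (\<lambda>t. emb (v t))"
    using u v by (auto simp: bochner_L2_iff)
  note iu = sq_integrable_on_itv_integrable[OF su] and iv = sq_integrable_on_itv_integrable[OF sv]
  have scaled: "AE t in itv T. a t *\<^sub>R emb (u t) = emb (\<lambda>x. a t * u t x)" "AE t in itv T. (\<lambda>x. a t * u t x) \<in> elems X"
    "integrable (itv T) (\<lambda>t. emb (\<lambda>x. a t * u t x))" "(LINT t|itv T. emb (\<lambda>x. a t * u t x)) = (LINT t|itv T. a t *\<^sub>R emb (u t))"
    if um: "AE t in itv T. u t \<in> elems X" and iu: "sq_integrable_on {0<..<T} (\<lambda>t. emb (u t))" and a: "continuous_on {0..T} a"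
    for a :: "real \<Rightarrow> real" and u
  proof -
    show ae: "AE t in itv T. a t *\<^sub>R emb (u t) = emb (\<lambda>x. a t * u t x)" using um by eventually_elim (simp add: emb_scale)
    show "AE t in itv T. (\<lambda>x. a t * u t x) \<in> elems X" using um by eventually_elim (rule scale_mem)
    note int = sq_integrable_on_itv_integrable[OF sq_integrable_on_scale_continuous[OF a iu]]
    show "integrable (itv T) (\<lambda>t. emb (\<lambda>x. a t * u t x))" by (rule integrable_itv_cong_AE[OF int ae])
    show "(LINT t|itv T. emb (\<lambda>x. a t * u t x)) = (LINT t|itv T. a t *\<^sub>R emb (u t))"
      using prim_cong_AE[OF int ae order_refl] by (simp add: prim_def)
  qed
  have "(\<exists>I. has_bochner (itv T) X (\<lambda>t x. deriv \<phi> t * u t x) I \<and> has_bochner (itv T) X (\<lambda>t x. \<phi> t * v t x) (\<lambda>x. - I x))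
    \<longleftrightarrow> (LINT t|itv T. deriv \<phi> t *\<^sub>R emb (u t)) = - (LINT t|itv T. \<phi> t *\<^sub>R emb (v t))"
    if \<phi>: "\<phi> \<in> test_functions {0<..<T}" for \<phi>
  proof -
    have c: "continuous_on {0..T} \<phi>"
      using test_function_itv(1)[OF \<phi>] by (intro continuous_at_imp_continuous_on) (auto intro: DERIV_isCont)
    have c': "continuous_on {0..T} (deriv \<phi>)" using test_function_itv(2)[OF \<phi>] continuous_on_subset by blast
    note U = scaled[OF um su c'] and W = scaled[OF vm sv c]
    have neg: "(\<lambda>x. - I x) \<in> elems X" "emb (\<lambda>x. - I x) = - emb I" if "I \<in> elems X" for I
      using scale_mem[OF that, of "-1"] emb_scale[OF that, of "-1"] by simp_all
    let ?K = "LINT t|itv T. deriv \<phi> t *\<^sub>R emb (u t)" and ?L = "LINT t|itv T. \<phi> t *\<^sub>R emb (v t)"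
    have "(\<exists>I. has_bochner (itv T) X (\<lambda>t x. deriv \<phi> t * u t x) I \<and> has_bochner (itv T) X (\<lambda>t x. \<phi> t * v t x) (\<lambda>x. - I x))
      \<longleftrightarrow> (\<exists>I. I \<in> elems X \<and> emb I = ?K \<and> - emb I = ?L)"
      unfolding has_bochner_itv_iff[OF U(3,2)] has_bochner_itv_iff[OF W(3,2)] U(4) W(4)
      by (rule ex_cong1) (use neg in auto)
    also have "\<dots> \<longleftrightarrow> ?K = - ?L"
    proof
      assume "?K = - ?L"
      moreover have "?K \<in> rng" using integral_mem_rng[OF U(3)] emb_in_rng U(4) by simp
      ultimately show "\<exists>I. I \<in> elems X \<and> emb I = ?K \<and> - emb I = ?L" by (intro exI[of _ "pick ?K"]) (simp add: pick)
    next
      assume "\<exists>I. I \<in> elems X \<and> emb I = ?K \<and> - emb I = ?L"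
      then have "- ?K = ?L" by auto
      then have "- (- ?K) = - ?L" by (simp only:)
      then show "?K = - ?L" by (simp only: minus_minus)
    qed
    finally show ?thesis .
  qed
  then show ?thesis unfolding weak_dt_def weak_derivative_iff[OF T iu iv, symmetric] by simp
qed

lemma dt_H1:
  assumes "u \<in> bochner_H1 T X"
  shows "dt T X u \<in> bochner_L2 T X" "weak_dt T X u (dt T X u)"
proof -
  from assms have "\<exists>v. v \<in> bochner_L2 T X \<and> weak_dt T X u v" by (auto simp: bochner_H1_def)
  from someI_ex[OF this] show "dt T X u \<in> bochner_L2 T X" "weak_dt T X u (dt T X u)" unfolding dt_def by auto
qed

end

text \<open>Both sides have the same integrals against derivatives of test functions, so
  \<open>v\<close> and \<open>v'\<close> have the same integrals against bumps. This is the device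
  that identifies derivatives picked by \<open>SOME\<close> with those known from a
  construction.\<close>

lemma prim_AE_unique:
  fixes v v' :: "real \<Rightarrow> 'b::{banach,second_countable_topology}"
  assumes T: "0 < T" and v: "integrable (itv T) v" "integrable (itv T) v'"
    and eq: "AE t in itv T. u0 + prim v t = u0' + prim v' t"
  shows "AE t in itv T. v t = v' t"
proof -
  have "AE t in itv T. v t - v' t = 0"
  proof (rule fundamental_lemma)
    fix n and a b :: real assume "cbox a b \<subseteq> {0<..<T}"
    then have \<phi>: "box_bump n a b \<in> test_functions {0<..<T}" by (rule box_bump_test_function)
    note bp = integral_test_function_by_parts[OF T \<phi> v(1)] and bp' = integral_test_function_by_parts[OF T \<phi> v(2)]
    have "AE t in itv T. deriv (box_bump n a b) t *\<^sub>R (u0 + prim v t) = deriv (box_bump n a b) t *\<^sub>R (u0' + prim v' t)"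
      using eq by eventually_elim simp
    from prim_cong_AE[OF bp(2)[of u0] this order_refl]
    have "(LINT t|itv T. box_bump n a b t *\<^sub>R v t) = (LINT t|itv T. box_bump n a b t *\<^sub>R v' t)"
      unfolding prim_def using bp(1)[of u0] bp'(1)[of u0'] by (simp add: prim_def)
    then show "(LINT t|itv T. box_bump n a b t *\<^sub>R (v t - v' t)) = 0"
      using bp(3) bp'(3) by (simp add: scaleR_diff_right)
  qed (use v in auto)
  then show ?thesis by simp
qed

lemma continuous_AE_eq_at_0:
  fixes f g :: "real \<Rightarrow> 'b::real_normed_vector"
  assumes T: "0 < T" and f: "continuous_on {0..T} f" and g: "continuous_on {0..T} g"
    and eq: "AE t in itv T. f t = g t"
  shows "f 0 = g 0"
proof (rule ccontr)
  assume neq: "f 0 \<noteq> g 0"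
  define h where "h t = norm (f t - g t)" for t
  have h: "continuous_on {0..T} h" unfolding h_def by (intro continuous_intros f g)
  have "h 0 > 0" using neq by (simp add: h_def)
  then obtain d where d: "d > 0" "\<And>t. t \<in> {0..T} \<Longrightarrow> dist t 0 < d \<Longrightarrow> dist (h t) (h 0) < h 0"
    using h T unfolding continuous_on_iff by (metis atLeastAtMost_iff less_eq_real_def order_refl)
  have "AE t in lebesgue. t \<notin> {0<..<min d T}"
    using eq unfolding AE_lebesgue_on_iff[OF sets_lebesgue_itv]
  proof eventually_elim
    case (elim t)
    show ?case
    proof
      assume t: "t \<in> {0<..<min d T}"
      then have "dist (h t) (h 0) < h 0" by (intro d(2)) auto
      then have "h t > 0" by (simp add: dist_real_def)
      then show False using elim t by (simp add: h_def)
    qed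
  qed
  then have "{0<..<min d T} \<in> null_sets lebesgue" by (subst (asm) AE_iff_null_sets[symmetric]) auto
  then show False using T d(1) by (simp add: null_sets_def)
qed

context hilbert_model begin

text \<open>The continuous representative can only be \<open>u0 + prim v\<close>, since two
  continuous curves that agree almost everywhere agree at 0. Range membership at every time, not
  just almost every time, is required to lift this curve back to functions.\<close>

lemma has_initial_value_iff:
  assumes T: "0 < T" and v: "integrable (itv T) v" and um: "AE t in itv T. u t \<in> elems X"
    and u: "AE t in itv T. emb (u t) = u0 + prim v t" and mem: "\<And>t. t \<in> {0..T} \<Longrightarrow> u0 + prim v t \<in> rng"
  shows "has_initial_value T X u f \<longleftrightarrow> f \<in> elems X \<and> emb f = u0"
proof
  assume "has_initial_value T X u f"
  then obtain w where f: "f \<in> elems X" and w: "\<And>t. t \<in> {0..T} \<Longrightarrow> w t \<in> elems X"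
    "\<And>s. s \<in> {0..T} \<Longrightarrow> ((\<lambda>t. nrm X (\<lambda>x. w t x - w s x)) \<longlongrightarrow> 0) (at s within {0..T})"
    "AE t in itv T. u t \<in> elems X \<and> nrm X (\<lambda>x. w t x - u t x) = 0" "nrm X (\<lambda>x. w 0 x - f x) = 0"
    unfolding has_initial_value_def by blast
  have "continuous_on {0..T} (\<lambda>t. emb (w t))"
    unfolding continuous_on_def
  proof
    fix s assume s: "s \<in> {0..T}"
    have "((\<lambda>t. norm (emb (w t) - emb (w s))) \<longlongrightarrow> 0) (at s within {0..T})"
    proof (rule Lim_transform_eventually[OF w(2)[OF s]])
      show "\<forall>\<^sub>F t in at s within {0..T}. nrm X (\<lambda>x. w t x - w s x) = norm (emb (w t) - emb (w s))"
        unfolding eventually_at_filter using w(1) s by (auto intro!: always_eventually nrm_diff)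
    qed
    then show "((\<lambda>t. emb (w t)) \<longlongrightarrow> emb (w s)) (at s within {0..T})"
      by (simp add: tendsto_norm_zero_iff LIM_zero_iff)
  qed
  moreover have "AE t in itv T. emb (w t) = u0 + prim v t"
    using w(3) u AE_space[of "itv T"]
  proof eventually_elim
    case (elim t)
    then have "w t \<in> elems X" using w(1) by (simp add: space_restrict_space)
    then show ?case using elim nrm_diff[of "w t" "u t"] by simp
  qed
  ultimately have "emb (w 0) = u0 + prim v 0"
    using continuous_AE_eq_at_0[OF T _ continuous_on_const_prim[OF v]] by blast
  moreover have "emb (w 0) = emb f" using w(4) nrm_diff[OF w(1)[of 0] f] T by simp
  ultimately show "f \<in> elems X \<and> emb f = u0" using f by simp
next
  assume f: "f \<in> elems X \<and> emb f = u0"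
  define w where "w t = pick (u0 + prim v t)" for t
  have w: "w t \<in> elems X" "emb (w t) = u0 + prim v t" if "t \<in> {0..T}" for t
    unfolding w_def using pick[OF mem[OF that]] by auto
  show "has_initial_value T X u f" unfolding has_initial_value_def
  proof (intro conjI exI[of _ w] ballI)
    show "f \<in> elems X" using f by simp
    show "w t \<in> elems X" if "t \<in> {0..T}" for t using w(1)[OF that] .
    fix s assume s: "s \<in> {0..T}"
    have "((\<lambda>t. norm ((u0 + prim v t) - (u0 + prim v s))) \<longlongrightarrow> 0) (at s within {0..T})"
      using continuous_on_const_prim[OF v, of u0] s
      unfolding continuous_on_def by (intro tendsto_norm_zero LIM_zero) auto
    then show "((\<lambda>t. nrm X (\<lambda>x. w t x - w s x)) \<longlongrightarrow> 0) (at s within {0..T})"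
    proof (rule Lim_transform_eventually)
      show "\<forall>\<^sub>F t in at s within {0..T}. norm ((u0 + prim v t) - (u0 + prim v s)) = nrm X (\<lambda>x. w t x - w s x)"
        unfolding eventually_at_filter using w s by (auto intro!: always_eventually simp: nrm_diff)
    qed
  next
    show "AE t in itv T. u t \<in> elems X \<and> nrm X (\<lambda>x. w t x - u t x) = 0"
      using um u AE_space[of "itv T"]
      by eventually_elim (use w nrm_diff in \<open>auto simp: space_restrict_space\<close>)
    have "0 \<in> {0..T}" using T by simp
    then show "nrm X (\<lambda>x. w 0 x - f x) = 0" using w[of 0] f nrm_diff[of "w 0" f] by simp
  qed
qed

lemma initial_value_emb:
  assumes T: "0 < T" and v: "integrable (itv T) v" and um: "AE t in itv T. u t \<in> elems X"
    and u: "AE t in itv T. emb (u t) = u0 + prim v t" and mem: "\<And>t. t \<in> {0..T} \<Longrightarrow> u0 + prim v t \<in> rng"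
  shows "initial_value T X u \<in> elems X" "emb (initial_value T X u) = u0"
proof -
  note iff = has_initial_value_iff[OF assms]
  have "u0 \<in> rng" using mem[of 0] T by simp
  then have "has_initial_value T X u (pick u0)" by (intro iff[THEN iffD2] conjI pick)
  then have "has_initial_value T X u (initial_value T X u)"
    unfolding initial_value_def by (rule someI[where P="has_initial_value T X u"])
  then have "initial_value T X u \<in> elems X \<and> emb (initial_value T X u) = u0" by (rule iff[THEN iffD1, rotated])
  then show "initial_value T X u \<in> elems X" "emb (initial_value T X u) = u0" by auto
qed

end

section \<open>The spaces of square-integrable functions and \<open>H10\<close> as Hilbert spaces\<close>

lemma L2_iff: "f \<in> L2 \<Omega> \<longleftrightarrow> sq_integrable_on \<Omega> f"
  by (simp add: L2_def sq_integrable_on_def)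

lemma L2_norm_eq:
  assumes "\<Omega> \<in> sets lebesgue" "f \<in> L2 \<Omega>"
  shows "L2_norm \<Omega> f = norm (cls_on \<Omega> f)"
  using inner_cls_on[of \<Omega> f f] assms by (simp add: L2_norm_def L2_inner_def L2_iff norm_eq_sqrt_inner)

section \<open>Test functions in space and integrals of their derivatives\<close>

lemma Ck_add: "Ck k f \<Longrightarrow> Ck k g \<Longrightarrow> Ck k (\<lambda>x. f x + g x)"
proof (induction k arbitrary: f g)
  case 0
  then show ?case by (simp add: continuous_on_add)
next
  case (Suc k)
  then have d: "f differentiable (at x)" "g differentiable (at x)" for x by auto
  have "frechet_derivative (\<lambda>x. f x + g x) (at x) b = frechet_derivative f (at x) b + frechet_derivative g (at x) b" for x b
    using frechet_derivative_at[OF has_derivative_add[OF d(1)[unfolded frechet_derivative_works] d(2)[unfolded frechet_derivative_works]], symmetric]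
    by simp
  then show ?case using Suc d by (auto intro: differentiable_add)
qed

lemma Ck_scale: "Ck k f \<Longrightarrow> Ck k (\<lambda>x. c * f x)"
proof (induction k arbitrary: f)
  case 0
  then show ?case by (simp add: continuous_on_mult_left)
next
  case (Suc k)
  then have d: "f differentiable (at x)" for x by auto
  have D: "((\<lambda>x. c * f x) has_derivative (\<lambda>b. c * frechet_derivative f (at x) b)) (at x)" for x
    using d[unfolded frechet_derivative_works] by (rule has_derivative_mult_right)
  have "frechet_derivative (\<lambda>x. c * f x) (at x) b = c * frechet_derivative f (at x) b" for x b
    using frechet_derivative_at[OF D, symmetric] by simp
  moreover have "(\<lambda>x. c * f x) differentiable (at x)" for x using D by (rule differentiableI)
  ultimately show ?case using Suc by simp
qed

lemma compact_closure_if_subset: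
  fixes K :: "'a::t2_space set"
  shows "compact K \<Longrightarrow> closure S \<subseteq> K \<Longrightarrow> compact (closure S)"
  using compact_Int_closed[OF _ closed_closure, of K S] by (simp add: Int_absorb1)

lemma test_functions_add:
  assumes "\<phi> \<in> test_functions \<Omega>" "\<psi> \<in> test_functions \<Omega>"
  shows "(\<lambda>x. \<phi> x + \<psi> x) \<in> test_functions \<Omega>"
proof -
  let ?K = "closure {x. \<phi> x \<noteq> 0} \<union> closure {x. \<psi> x \<noteq> 0}"
  have K: "compact ?K" "?K \<subseteq> \<Omega>" using assms by (auto simp: test_functions_def)
  have "closure {x. \<phi> x + \<psi> x \<noteq> 0} \<subseteq> ?K"
  proof (rule closure_minimal)
    show "{x. \<phi> x + \<psi> x \<noteq> 0} \<subseteq> ?K"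
    proof
      fix x assume "x \<in> {x. \<phi> x + \<psi> x \<noteq> 0}"
      then have "x \<in> {x. \<phi> x \<noteq> 0} \<or> x \<in> {x. \<psi> x \<noteq> 0}" by auto
      then show "x \<in> ?K"
      proof
        assume "x \<in> {x. \<phi> x \<noteq> 0}"
        then have "x \<in> closure {x. \<phi> x \<noteq> 0}" by (rule closure_subset[THEN subsetD])
        then show ?thesis by (rule UnI1)
      next
        assume "x \<in> {x. \<psi> x \<noteq> 0}"
        then have "x \<in> closure {x. \<psi> x \<noteq> 0}" by (rule closure_subset[THEN subsetD])
        then show ?thesis by (rule UnI2)
      qed
    qed
  qed (rule compact_imp_closed[OF K(1)])
  moreover from this have "compact (closure {x. \<phi> x + \<psi> x \<noteq> 0})"
    by (rule compact_closure_if_subset[OF K(1)])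
  ultimately show ?thesis using K(2) assms by (auto simp: test_functions_def intro: Ck_add)
qed

lemma test_functions_scale:
  assumes "\<phi> \<in> test_functions \<Omega>"
  shows "(\<lambda>x. c * \<phi> x) \<in> test_functions \<Omega>"
proof -
  let ?K = "closure {x. \<phi> x \<noteq> 0}"
  have K: "compact ?K" "?K \<subseteq> \<Omega>" using assms by (auto simp: test_functions_def)
  have "closure {x. c * \<phi> x \<noteq> 0} \<subseteq> ?K" by (rule closure_mono) auto
  moreover from this have "compact (closure {x. c * \<phi> x \<noteq> 0})"
    by (rule compact_closure_if_subset[OF K(1)])
  ultimately show ?thesis using K(2) assms by (auto simp: test_functions_def intro: Ck_scale)
qed

lemma test_functions_0: "(\<lambda>x. 0) \<in> test_functions \<Omega>"
  by (auto simp: test_functions_def intro: Ck_bump_algebra bump_algebra.const)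

lemma test_functionD:
  assumes "\<phi> \<in> test_functions \<Omega>"
  shows "(\<phi> has_derivative frechet_derivative \<phi> (at x)) (at x)"
    and "continuous_on A \<phi>"
    and "b \<in> Basis \<Longrightarrow> continuous_on A (\<lambda>x. frechet_derivative \<phi> (at x) b)"
    and "x \<notin> \<Omega> \<Longrightarrow> \<phi> x = 0"
    and "x \<notin> \<Omega> \<Longrightarrow> frechet_derivative \<phi> (at x) b = 0"
proof -
  have C: "Ck 0 \<phi>" "Ck (Suc 0) \<phi>" using assms by (auto simp only: test_functions_def mem_Collect_eq)
  show D: "(\<phi> has_derivative frechet_derivative \<phi> (at x)) (at x)" for x
    using C(2) by (simp add: frechet_derivative_works)
  show "continuous_on A \<phi>" using C(1) by (auto intro: continuous_on_subset)
  show "b \<in> Basis \<Longrightarrow> continuous_on A (\<lambda>x. frechet_derivative \<phi> (at x) b)"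
    using C(2) by (auto intro: continuous_on_subset)
  have sub: "closure {x. \<phi> x \<noteq> 0} \<subseteq> \<Omega>" using assms by (simp add: test_functions_def)
  have "{x. \<phi> x \<noteq> 0} \<subseteq> \<Omega>" by (rule order_trans[OF closure_subset sub])
  then show "x \<notin> \<Omega> \<Longrightarrow> \<phi> x = 0" by auto
  assume x: "x \<notin> \<Omega>"
  have "open (- closure {x. \<phi> x \<noteq> 0})" "x \<in> - closure {x. \<phi> x \<noteq> 0}" using x sub by auto
  then have "(\<phi> has_derivative (\<lambda>_. 0)) (at x)"
    by (rule has_derivative_transform_within_open[OF has_derivative_const[of 0]]) (use closure_subset[of "{x. \<phi> x \<noteq> 0}"] in auto)
  from has_derivative_unique[OF D this] show "frechet_derivative \<phi> (at x) b = 0" by simp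
qed

text \<open>By translation invariance every difference quotient in direction \<open>b\<close> has
  integral zero, and dominated convergence passes this on to the derivative.\<close>

lemma integral_derivative_compact_support:
  fixes g :: "'a::euclidean_space \<Rightarrow> real"
  assumes d: "\<And>x. (g has_derivative g' x) (at x)" and c: "continuous_on UNIV (\<lambda>x. g' x b)"
    and supp: "bounded \<Omega>" "\<And>x. x \<notin> \<Omega> \<Longrightarrow> g x = 0" and b: "b \<in> Basis"
  shows "(LINT x|lebesgue. g' x b) = 0" "integrable lebesgue (\<lambda>x. g' x b)"
proof -
  obtain R where R: "\<Omega> \<subseteq> ball 0 R" "0 < R" using supp(1) by (metis bounded_subset_ballD)
  let ?B = "cball (0::'a) (R + 1)"
  have nb: "norm b = 1" using b by simp
  have cg: "continuous_on UNIV g" using d by (metis continuous_at_imp_continuous_on has_derivative_continuous)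
  have line: "((\<lambda>h. g (x + h *\<^sub>R b)) has_real_derivative g' (x + h *\<^sub>R b) b) (at h)" for x h
  proof -
    have "((\<lambda>h. x + h *\<^sub>R b) has_derivative (\<lambda>k. k *\<^sub>R b)) (at h)" by (auto intro!: derivative_eq_intros)
    from has_derivative_compose[OF this d]
    have "((\<lambda>h. g (x + h *\<^sub>R b)) has_derivative (\<lambda>k. g' (x + h *\<^sub>R b) (k *\<^sub>R b))) (at h)" .
    moreover have "(\<lambda>k. g' (x + h *\<^sub>R b) (k *\<^sub>R b)) = (*) (g' (x + h *\<^sub>R b) b)"
      using linear_simps(5)[OF has_derivative_bounded_linear[OF d]] by (simp add: fun_eq_iff)
    ultimately show ?thesis by (simp only: has_field_derivative_def)
  qed
  obtain C where C: "\<And>x. x \<in> cball 0 (R + 2) \<Longrightarrow> norm (g' x b) \<le> C"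
  proof -
    have "compact ((\<lambda>x. g' x b) ` cball 0 (R + 2))"
      by (rule compact_continuous_image[OF continuous_on_subset[OF c] compact_cball]) simp
    then have "bounded ((\<lambda>x. g' x b) ` cball 0 (R + 2))" by (rule compact_imp_bounded)
    then obtain C where C: "\<forall>y\<in>(\<lambda>x. g' x b) ` cball 0 (R + 2). norm y \<le> C" unfolding bounded_iff ..
    show thesis by (rule that[of C]) (rule C[rule_format, OF imageI])
  qed
  define h where "h n = 1 / real (Suc n)" for n
  have h: "0 < h n" "h n \<le> 1" for n by (auto simp: h_def)
  define q where "q n x = (g (x + h n *\<^sub>R b) - g x) / h n" for n x
  \<comment> \<open>Mean value theorem inside the ball. Steps have length at most 1, so for
    \<open>x\<close> outside the ball both points of the quotient miss \<open>\<Omega>\<close>;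
    inside, the intermediate point stays within radius \<open>R + 2\<close>.\<close>
  have q_bound: "norm (q n x) \<le> C * indicator ?B x" for n x
  proof (cases "x \<in> ?B")
    case True
    have "\<exists>z. 0 < z \<and> z < h n \<and> g (x + h n *\<^sub>R b) - g (x + 0 *\<^sub>R b) = (h n - 0) * g' (x + z *\<^sub>R b) b"
      by (rule MVT2[OF h(1)]) (use line in auto)
    then obtain z where z: "0 < z" "z < h n" "g (x + h n *\<^sub>R b) - g x = h n * g' (x + z *\<^sub>R b) b" by auto
    have "norm (x + z *\<^sub>R b) \<le> norm x + z" using norm_triangle_ineq[of x "z *\<^sub>R b"] nb z(1) by simp
    then have "norm (x + z *\<^sub>R b) \<le> R + 2" using True z(2) h(2)[of n] by simp
    then have "norm (g' (x + z *\<^sub>R b) b) \<le> C" by (intro C) simp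
    then show ?thesis using z(3) h(1)[of n] True by (simp add: q_def)
  next
    case False
    then have "R + 1 < norm x" by simp
    moreover have "norm x \<le> norm (x + h n *\<^sub>R b) + h n"
      using norm_triangle_ineq4[of "x + h n *\<^sub>R b" "h n *\<^sub>R b"] nb h(1)[of n] by simp
    ultimately have "x \<notin> \<Omega>" "x + h n *\<^sub>R b \<notin> \<Omega>" using R h(2)[of n] by (auto dest!: subsetD)
    then show ?thesis using supp(2) False by (simp add: q_def)
  qed
  have gint: "integrable lborel g"
  proof -
    have "integrable lborel (\<lambda>x. indicator ?B x *\<^sub>R g x)"
      by (rule borel_integrable_compact[OF compact_cball]) (rule continuous_on_subset[OF cg], simp)
    moreover have "(\<lambda>x. indicator ?B x *\<^sub>R g x) = g"
    proof
      fix x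
      have "x \<in> ?B" if "x \<in> \<Omega>" using subsetD[OF R(1) that] by simp
      then show "indicator ?B x *\<^sub>R g x = g x" using supp(2)[of x] by (cases "x \<in> \<Omega>") auto
    qed
    ultimately show ?thesis by (simp only:)
  qed
  have shift: "integrable lborel (\<lambda>x. g (x + t))" "(LINT x|lborel. g (x + t)) = (LINT x|lborel. g x)" for t
  proof -
    have m: "g \<in> borel_measurable borel" using cg by (rule borel_measurable_continuous_onI)
    have "lborel = distr lborel borel ((+) t)" by (rule lborel_distr_plus[symmetric])
    then have "integrable (distr lborel borel ((+) t)) g" "(LINT x|lborel. g x) = (LINT x|distr lborel borel ((+) t). g x)"
      using gint by simp_all
    then show "integrable lborel (\<lambda>x. g (x + t))" "(LINT x|lborel. g (x + t)) = (LINT x|lborel. g x)"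
      using m by (simp_all add: integrable_distr_eq integral_distr add.commute)
  qed
  have q0: "(LINT x|lborel. q n x) = 0" for n
    unfolding q_def using shift gint by simp
  have lim: "(\<lambda>n. q n x) \<longlonglongrightarrow> g' x b" for x
  proof -
    have "((\<lambda>k. (g (x + (0 + k) *\<^sub>R b) - g (x + 0 *\<^sub>R b)) / k) \<longlongrightarrow> g' (x + 0 *\<^sub>R b) b) (at 0)"
      using line[of x 0] unfolding DERIV_def .
    moreover have "filterlim h (at 0) sequentially"
      unfolding filterlim_at h_def using LIMSEQ_Suc[OF lim_1_over_n] by auto
    ultimately have "((\<lambda>n. (g (x + (0 + h n) *\<^sub>R b) - g (x + 0 *\<^sub>R b)) / h n) \<longlongrightarrow> g' (x + 0 *\<^sub>R b) b) sequentially"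
      by (rule filterlim_compose)
    then show ?thesis by (simp add: q_def)
  qed
  have mq: "q n \<in> borel_measurable lborel" for n
  proof -
    have "continuous_on UNIV (q n)" unfolding q_def[abs_def]
      using h(1)[of n] by (intro continuous_intros continuous_on_compose2[OF cg] cg) auto
    then show ?thesis by (simp add: borel_measurable_continuous_onI)
  qed
  have mg': "(\<lambda>x. g' x b) \<in> borel_measurable lborel" using c by (simp add: borel_measurable_continuous_onI)
  have wint: "integrable lborel (\<lambda>x. C * indicator ?B x)"
    using emeasure_lborel_cball_finite[of "0::'a" "R + 1"] by (simp add: less_top)
  have conv: "(\<lambda>n. LINT x|lborel. q n x) \<longlonglongrightarrow> (LINT x|lborel. g' x b)"
    by (rule integral_dominated_convergence[where w="\<lambda>x. C * indicator ?B x"])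
      (use mg' mq wint lim q_bound in \<open>auto intro!: AE_I2\<close>)
  have int: "integrable lborel (\<lambda>x. g' x b)"
    by (rule integrable_dominated_convergence[where s=q and w="\<lambda>x. C * indicator ?B x"])
      (use mg' mq wint lim q_bound in \<open>auto intro!: AE_I2\<close>)
  have "(LINT x|lborel. g' x b) = 0" using conv by (simp add: q0 LIMSEQ_const_iff)
  then show "(LINT x|lebesgue. g' x b) = 0" using mg' by (simp add: integral_completion)
  show "integrable lebesgue (\<lambda>x. g' x b)" using int mg' by (simp add: integrable_completion)
qed

section \<open>Weak gradients as a closed linear relation\<close>

locale bounded_open =
  fixes \<Omega> :: "'a::euclidean_space set"
  assumes open_domain: "open \<Omega>" and bounded_domain: "bounded \<Omega>"
begin

lemma lmeas: "\<Omega> \<in> lmeasurable"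
  by (rule bounded_set_imp_lmeasurable[OF bounded_domain]) (use open_domain in auto)

lemma meas: "\<Omega> \<in> sets lebesgue"
  using lmeas by auto

lemma sq_integrable_on_continuous:
  fixes f :: "'a \<Rightarrow> 'b::separable_hilbert"
  assumes c: "continuous_on UNIV f"
  shows "sq_integrable_on \<Omega> f"
proof -
  interpret finite_measure "lebesgue_on \<Omega>" by (rule finite_measure_lebesgue_on[OF lmeas])
  have "compact (f ` closure \<Omega>)"
    by (rule compact_continuous_image[OF continuous_on_subset[OF c]]) (use bounded_domain in auto)
  then have "bounded (f ` closure \<Omega>)" by (rule compact_imp_bounded)
  then obtain C where C: "\<forall>x\<in>f ` closure \<Omega>. norm x \<le> C" unfolding bounded_iff ..
  show ?thesis
  proof (rule sq_integrable_on_bound[OF meas, of "\<lambda>x. 1::real" _ C])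
    show "sq_integrable_on \<Omega> (\<lambda>x. 1::real)" unfolding sq_integrable_on_def by simp
    have "f \<in> borel_measurable lebesgue"
      using c by (intro measurable_completion) (simp add: borel_measurable_continuous_onI)
    then show "f \<in> borel_measurable (lebesgue_on \<Omega>)" by (rule measurable_restrict_space1)
    have "norm (f x) \<le> C" if "x \<in> \<Omega>" for x using C closure_subset[THEN subsetD, OF that] by simp
    then show "AE x in lebesgue_on \<Omega>. norm (f x) \<le> C * norm (1::real)"
      by (intro AE_I2) (simp add: space_restrict_space)
  qed
qed

abbreviation cl :: "('a \<Rightarrow> 'b::separable_hilbert) \<Rightarrow> ('a, 'b) l2" where "cl \<equiv> cls_on \<Omega>"

text \<open>The graph of the weak gradient, as a relation between classes. Each condition is the
  vanishing of a continuous linear functional, which makes the relation a closed subspace and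
  independent of representatives.\<close>

definition grad_graph :: "(('a, real) l2 \<times> ('a, 'a) l2) set" where
  "grad_graph = {p. \<forall>\<phi>\<in>test_functions \<Omega>. \<forall>b\<in>Basis.
     fst p \<bullet> cl (\<lambda>x. frechet_derivative \<phi> (at x) b) + snd p \<bullet> cl (\<lambda>x. \<phi> x *\<^sub>R b) = 0}"

lemma subspace_grad_graph: "subspace grad_graph"
  unfolding grad_graph_def
proof (rule subspaceI, goal_cases)
  case (2 x y)
  then show ?case by (simp add: inner_add_left) (smt (verit, ccfv_threshold))
next
  case (3 c x)
  then show ?case by (simp flip: distrib_left)
qed simp

lemma closed_grad_graph: "closed grad_graph"
proof -
  have "grad_graph = (\<Inter>\<phi>\<in>test_functions \<Omega>. \<Inter>b\<in>Basis. {p.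
     fst p \<bullet> cl (\<lambda>x. frechet_derivative \<phi> (at x) b) + snd p \<bullet> cl (\<lambda>x. \<phi> x *\<^sub>R b) = 0})"
    unfolding grad_graph_def by blast
  also have "closed \<dots>" by (intro closed_INT ballI closed_Collect_eq continuous_intros)
  finally show ?thesis .
qed

lemma sq_test_function:
  assumes \<phi>: "\<phi> \<in> test_functions \<Omega>" and b: "b \<in> Basis"
  shows "sq_integrable_on \<Omega> (\<lambda>x. frechet_derivative \<phi> (at x) b)" "sq_integrable_on \<Omega> (\<lambda>x. \<phi> x *\<^sub>R b)"
    "sq_integrable_on \<Omega> \<phi>"
  by (intro sq_integrable_on_continuous continuous_on_scaleR test_functionD[OF \<phi>] b continuous_on_const)+

lemma weak_grad_iff:
  assumes f: "sq_integrable_on \<Omega> f" and g: "sq_integrable_on \<Omega> g"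
  shows "weak_grad \<Omega> f g \<longleftrightarrow> (cl f, cl g) \<in> grad_graph"
proof -
  have "cl f \<bullet> cl (\<lambda>x. frechet_derivative \<phi> (at x) b) = (LINT x|lebesgue_on \<Omega>. f x * frechet_derivative \<phi> (at x) b)"
    "cl g \<bullet> cl (\<lambda>x. \<phi> x *\<^sub>R b) = (LINT x|lebesgue_on \<Omega>. (g x \<bullet> b) * \<phi> x)"
    if "\<phi> \<in> test_functions \<Omega>" "b \<in> Basis" for \<phi> b
    using inner_cls_on[OF meas f sq_test_function(1)[OF that]] inner_cls_on[OF meas g sq_test_function(2)[OF that]]
    by (simp_all add: mult.commute)
  then show ?thesis unfolding weak_grad_def grad_graph_def by (simp add: eq_neg_iff_add_eq_0)
qed

text \<open>Testing with bumps isolates each component of \<open>g\<close>, to which the fundamental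
  lemma applies. This is uniqueness of weak gradients.\<close>

lemma grad_graph_0:
  assumes g: "sq_integrable_on \<Omega> g" and 0: "(0, cl g) \<in> grad_graph"
  shows "cl g = 0"
proof -
  have "AE x in lebesgue_on \<Omega>. g x \<bullet> b = 0" if b: "b \<in> Basis" for b
  proof (rule fundamental_lemma[OF open_domain])
    have "sq_integrable_on \<Omega> (\<lambda>x. g x \<bullet> b)"
      by (rule sq_integrable_on_linear[OF meas bounded_linear_inner_left g])
    then show "integrable (lebesgue_on \<Omega>) (\<lambda>x. g x \<bullet> b)" by (rule sq_integrable_on_integrable[OF lmeas])
    fix n and a c :: 'a assume "cbox a c \<subseteq> \<Omega>"
    then have \<phi>: "box_bump n a c \<in> test_functions \<Omega>" by (rule box_bump_test_function)
    show "(LINT x|lebesgue_on \<Omega>. box_bump n a c x *\<^sub>R (g x \<bullet> b)) = 0"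
      using 0 \<phi> b inner_cls_on[OF meas g sq_test_function(2)[OF \<phi> b]] by (simp add: grad_graph_def)
  qed
  then have "AE x in lebesgue_on \<Omega>. \<forall>b\<in>Basis. g x \<bullet> b = 0" by (intro AE_finite_allI) auto
  then have "AE x in lebesgue_on \<Omega>. g x = 0" by eventually_elim (auto intro: euclidean_eqI)
  then have "cl g = cl (\<lambda>x. 0)" by (rule cls_on_cong[OF meas])
  then show ?thesis by (simp add: cls_on_0[OF meas])
qed

lemma H1_iff: "f \<in> H1 \<Omega> \<longleftrightarrow> sq_integrable_on \<Omega> f \<and> (\<exists>g. sq_integrable_on \<Omega> g \<and> (cl f, cl g) \<in> grad_graph)"
  unfolding H1_def mem_Collect_eq Bex_def L2_iff using weak_grad_iff by blast

lemma grad_H1: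
  assumes "f \<in> H1 \<Omega>"
  shows "sq_integrable_on \<Omega> f" "sq_integrable_on \<Omega> (grad \<Omega> f)" "(cl f, cl (grad \<Omega> f)) \<in> grad_graph"
proof -
  show f: "sq_integrable_on \<Omega> f" using assms by (simp add: H1_iff)
  have "\<exists>g. g \<in> L2 \<Omega> \<and> weak_grad \<Omega> f g" using assms by (auto simp: H1_def)
  from someI_ex[OF this] have g: "sq_integrable_on \<Omega> (grad \<Omega> f)" "weak_grad \<Omega> f (grad \<Omega> f)"
    unfolding grad_def[symmetric] by (auto simp: L2_iff)
  then show "sq_integrable_on \<Omega> (grad \<Omega> f)" "(cl f, cl (grad \<Omega> f)) \<in> grad_graph" using weak_grad_iff[OF f] by auto
qed

text \<open>\<open>grad\<close> is an arbitrary choice; by linearity of the relation and uniqueness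
  its class is nevertheless determined.\<close>

lemma grad_unique:
  assumes f: "sq_integrable_on \<Omega> f" and g: "sq_integrable_on \<Omega> g" and fg: "(cl f, cl g) \<in> grad_graph"
  shows "f \<in> H1 \<Omega>" "cl (grad \<Omega> f) = cl g"
proof -
  show H: "f \<in> H1 \<Omega>" using assms by (auto simp: H1_iff)
  note G = grad_H1[OF H]
  have "(cl f, cl (grad \<Omega> f)) - (cl f, cl g) \<in> grad_graph" by (rule subspace_diff[OF subspace_grad_graph G(3) fg])
  then have "(0, cl (\<lambda>x. grad \<Omega> f x - g x)) \<in> grad_graph" by (simp add: cls_on_diff[OF meas G(2) g])
  from grad_graph_0[OF sq_integrable_on_diff[OF meas G(2) g] this]
  show "cl (grad \<Omega> f) = cl g" by (simp add: cls_on_diff[OF meas G(2) g])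
qed

definition emb_H1 :: "('a \<Rightarrow> real) \<Rightarrow> ('a, real) l2 \<times> ('a, 'a) l2" where
  "emb_H1 f = (cl f, cl (grad \<Omega> f))"

lemma H1_add:
  assumes f: "f \<in> H1 \<Omega>" and g: "g \<in> H1 \<Omega>"
  shows "(\<lambda>x. f x + g x) \<in> H1 \<Omega>" "emb_H1 (\<lambda>x. f x + g x) = emb_H1 f + emb_H1 g"
proof -
  note F = grad_H1[OF f] and G = grad_H1[OF g]
  have "(cl f, cl (grad \<Omega> f)) + (cl g, cl (grad \<Omega> g)) \<in> grad_graph" by (rule subspace_add[OF subspace_grad_graph F(3) G(3)])
  then have "(cl (\<lambda>x. f x + g x), cl (\<lambda>x. grad \<Omega> f x + grad \<Omega> g x)) \<in> grad_graph"
    by (simp add: cls_on_add[OF meas] F G)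
  from grad_unique[OF sq_integrable_on_add[OF meas F(1) G(1)] sq_integrable_on_add[OF meas F(2) G(2)] this]
  show "(\<lambda>x. f x + g x) \<in> H1 \<Omega>" "emb_H1 (\<lambda>x. f x + g x) = emb_H1 f + emb_H1 g"
    by (auto simp: emb_H1_def cls_on_add[OF meas] F G)
qed

lemma H1_scale:
  assumes f: "f \<in> H1 \<Omega>"
  shows "(\<lambda>x. c * f x) \<in> H1 \<Omega>" "emb_H1 (\<lambda>x. c * f x) = c *\<^sub>R emb_H1 f"
proof -
  note F = grad_H1[OF f]
  have cf: "cl (\<lambda>x. c * f x) = c *\<^sub>R cl f" using cls_on_scaleR[OF meas F(1), of c] by simp
  have sf: "sq_integrable_on \<Omega> (\<lambda>x. c * f x)" using sq_integrable_on_scaleR[OF meas F(1), of c] by simp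
  have "c *\<^sub>R (cl f, cl (grad \<Omega> f)) \<in> grad_graph" by (rule subspace_scale[OF subspace_grad_graph F(3)])
  then have "(cl (\<lambda>x. c * f x), cl (\<lambda>x. c *\<^sub>R grad \<Omega> f x)) \<in> grad_graph"
    by (simp add: cf cls_on_scaleR[OF meas F(2)])
  from grad_unique[OF sf sq_integrable_on_scaleR[OF meas F(2)] this]
  show "(\<lambda>x. c * f x) \<in> H1 \<Omega>" "emb_H1 (\<lambda>x. c * f x) = c *\<^sub>R emb_H1 f"
    by (auto simp: emb_H1_def cf cls_on_scaleR[OF meas F(2)])
qed

lemma H1_diff:
  assumes f: "f \<in> H1 \<Omega>" and g: "g \<in> H1 \<Omega>"
  shows "(\<lambda>x. f x - g x) \<in> H1 \<Omega>" "emb_H1 (\<lambda>x. f x - g x) = emb_H1 f - emb_H1 g"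
  using H1_add[OF f H1_scale(1)[OF g, of "-1"]] H1_scale(2)[OF g, of "-1"] by simp_all

lemma H1_norm_eq: "f \<in> H1 \<Omega> \<Longrightarrow> H1_norm \<Omega> f = norm (emb_H1 f)"
  using grad_H1[of f] by (simp add: H1_norm_def emb_H1_def norm_Pair L2_norm_eq[OF meas] L2_iff)

text \<open>The classical gradient is a weak one: the derivative of the product of two test
  functions integrates to zero over the whole space, and outside \<open>\<Omega>\<close> it
  vanishes.\<close>

lemma test_function_H1:
  assumes \<phi>: "\<phi> \<in> test_functions \<Omega>"
  shows "\<phi> \<in> H1 \<Omega>"
proof -
  define g where "g x = (\<Sum>b\<in>Basis. frechet_derivative \<phi> (at x) b *\<^sub>R b)" for x
  have cg: "continuous_on UNIV g" unfolding g_def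
    by (intro continuous_on_sum continuous_on_scaleR continuous_on_const test_functionD(3)[OF \<phi>])
  have gb: "g x \<bullet> b = frechet_derivative \<phi> (at x) b" if "b \<in> Basis" for x b
    using that by (simp add: g_def)
  have sq\<phi>: "sq_integrable_on \<Omega> \<phi>" by (rule sq_integrable_on_continuous[OF test_functionD(2)[OF \<phi>]])
  have sqg: "sq_integrable_on \<Omega> g" by (rule sq_integrable_on_continuous[OF cg])
  have "weak_grad \<Omega> \<phi> g" unfolding weak_grad_def
  proof (intro ballI)
    fix \<psi> and b :: 'a assume \<psi>: "\<psi> \<in> test_functions \<Omega>" and b: "b \<in> Basis"
    let ?d = "\<lambda>x. \<phi> x * frechet_derivative \<psi> (at x) b + frechet_derivative \<phi> (at x) b * \<psi> x"
    have D: "((\<lambda>x. \<phi> x * \<psi> x) has_derivative (\<lambda>b. \<phi> x * frechet_derivative \<psi> (at x) b + frechet_derivative \<phi> (at x) b * \<psi> x)) (at x)" for x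
      by (intro has_derivative_mult test_functionD(1)[OF \<phi>] test_functionD(1)[OF \<psi>])
    have c: "continuous_on UNIV ?d"
      by (intro continuous_intros test_functionD(2,3)[OF \<phi>] test_functionD(2,3)[OF \<psi>] b)
    have "(LINT x|lebesgue. ?d x) = 0"
      by (rule integral_derivative_compact_support(1)[OF D c bounded_domain _ b]) (simp add: test_functionD(4)[OF \<phi>])
    moreover have "(LINT x|lebesgue_on \<Omega>. ?d x) = (LINT x|lebesgue. ?d x)"
    proof -
      have eq: "(\<lambda>x. indicator \<Omega> x *\<^sub>R ?d x) = ?d"
      proof
        fix x show "indicator \<Omega> x *\<^sub>R ?d x = ?d x"
          using test_functionD(4)[OF \<phi>, of x] test_functionD(4)[OF \<psi>, of x] by (cases "x \<in> \<Omega>") auto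
      qed
      have "(LINT x|lebesgue_on \<Omega>. ?d x) = (LINT x|lebesgue. indicator \<Omega> x *\<^sub>R ?d x)"
        by (rule integral_restrict_space) (simp add: meas)
      then show ?thesis by (simp only: eq)
    qed
    moreover have "(LINT x|lebesgue_on \<Omega>. ?d x) = (LINT x|lebesgue_on \<Omega>. \<phi> x * frechet_derivative \<psi> (at x) b)
        + (LINT x|lebesgue_on \<Omega>. frechet_derivative \<phi> (at x) b * \<psi> x)"
      by (intro Bochner_Integration.integral_add sq_integrable_on_integrable[OF lmeas] sq_integrable_on_continuous continuous_intros
          test_functionD(2,3)[OF \<phi>] test_functionD(2,3)[OF \<psi>] b)
    ultimately show "(LINT x|lebesgue_on \<Omega>. \<phi> x * frechet_derivative \<psi> (at x) b) = - (LINT x|lebesgue_on \<Omega>. g x \<bullet> b * \<psi> x)"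
      by (simp add: gb[OF b])
  qed
  then show ?thesis using sq\<phi> sqg by (auto simp: H1_def L2_iff)
qed

text \<open>Since \<open>emb_H1\<close> is linear and isometric, approximation in the
  \<open>H1\<close> norm is convergence of images. The space thus becomes a topological closure and
  is complete by construction.\<close>

lemma H10_iff: "f \<in> H10 \<Omega> \<longleftrightarrow> f \<in> H1 \<Omega> \<and> emb_H1 f \<in> closure (emb_H1 ` test_functions \<Omega>)"
proof -
  have "H1_norm \<Omega> (\<lambda>x. \<phi> n x - f x) = norm (emb_H1 (\<phi> n) - emb_H1 f)"
    if "f \<in> H1 \<Omega>" "\<And>n. \<phi> n \<in> test_functions \<Omega>" for \<phi> :: "nat \<Rightarrow> 'a \<Rightarrow> real" and n
    using H1_diff[OF test_function_H1[OF that(2)] that(1), of n] by (simp add: H1_norm_eq)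
  then have eq: "(\<lambda>n. H1_norm \<Omega> (\<lambda>x. \<phi> n x - f x)) \<longlonglongrightarrow> 0 \<longleftrightarrow> (\<lambda>n. emb_H1 (\<phi> n)) \<longlonglongrightarrow> emb_H1 f"
    if "f \<in> H1 \<Omega>" "\<forall>n. \<phi> n \<in> test_functions \<Omega>" for \<phi> :: "nat \<Rightarrow> 'a \<Rightarrow> real"
    using that by (simp add: tendsto_norm_zero_iff LIM_zero_iff)
  have "emb_H1 f \<in> closure (emb_H1 ` test_functions \<Omega>) \<longleftrightarrow> (\<exists>\<phi>. (\<forall>n. \<phi> n \<in> test_functions \<Omega>) \<and> (\<lambda>n. emb_H1 (\<phi> n)) \<longlonglongrightarrow> emb_H1 f)"
  proof
    assume "emb_H1 f \<in> closure (emb_H1 ` test_functions \<Omega>)"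
    then obtain y where y: "\<And>n. y n \<in> emb_H1 ` test_functions \<Omega>" "y \<longlonglongrightarrow> emb_H1 f" unfolding closure_sequential by metis
    have "\<exists>\<phi>. \<phi> \<in> test_functions \<Omega> \<and> y n = emb_H1 \<phi>" for n using y(1)[of n] by auto
    then obtain \<phi> where \<phi>: "\<And>n. \<phi> n \<in> test_functions \<Omega> \<and> y n = emb_H1 (\<phi> n)" by metis
    then have "y = (\<lambda>n. emb_H1 (\<phi> n))" by auto
    then show "\<exists>\<phi>. (\<forall>n. \<phi> n \<in> test_functions \<Omega>) \<and> (\<lambda>n. emb_H1 (\<phi> n)) \<longlonglongrightarrow> emb_H1 f"
      using y(2) \<phi> by (intro exI[of _ \<phi>]) simp
  next
    assume "\<exists>\<phi>. (\<forall>n. \<phi> n \<in> test_functions \<Omega>) \<and> (\<lambda>n. emb_H1 (\<phi> n)) \<longlonglongrightarrow> emb_H1 f"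
    then obtain \<phi> where \<phi>: "\<And>n. \<phi> n \<in> test_functions \<Omega>" "(\<lambda>n. emb_H1 (\<phi> n)) \<longlonglongrightarrow> emb_H1 f" by blast
    have "emb_H1 (\<phi> n) \<in> closure (emb_H1 ` test_functions \<Omega>)" for n
      by (rule closure_subset[THEN subsetD, OF imageI[OF \<phi>(1)]])
    from closed_sequentially[OF closed_closure this \<phi>(2)] show "emb_H1 f \<in> closure (emb_H1 ` test_functions \<Omega>)" .
  qed
  then show ?thesis unfolding H10_def using eq by auto
qed

lemma subspace_emb_test: "subspace (emb_H1 ` test_functions \<Omega>)"
proof (rule subspaceI)
  have z: "(\<lambda>x. 0) \<in> test_functions \<Omega>"
    by (rule test_functions_0)
  show "0 \<in> emb_H1 ` test_functions \<Omega>"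
    using H1_scale(2)[OF test_function_H1[OF z], of 0] z by (intro image_eqI[OF _ z]) simp
next
  fix x y assume "x \<in> emb_H1 ` test_functions \<Omega>" "y \<in> emb_H1 ` test_functions \<Omega>"
  then obtain \<phi> \<psi> where "\<phi> \<in> test_functions \<Omega>" "\<psi> \<in> test_functions \<Omega>" "x = emb_H1 \<phi>" "y = emb_H1 \<psi>" by blast
  then show "x + y \<in> emb_H1 ` test_functions \<Omega>"
    by (intro image_eqI[of _ _ "\<lambda>x. \<phi> x + \<psi> x"] test_functions_add) (simp_all add: H1_add test_function_H1)
next
  fix c x assume "x \<in> emb_H1 ` test_functions \<Omega>"
  then obtain \<phi> where "\<phi> \<in> test_functions \<Omega>" "x = emb_H1 \<phi>" by blast
  then show "c *\<^sub>R x \<in> emb_H1 ` test_functions \<Omega>"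
    by (intro image_eqI[of _ _ "\<lambda>x. c * \<phi> x"] test_functions_scale) (simp_all add: H1_scale test_function_H1)
qed

definition emb0 :: "('a \<Rightarrow> real) \<Rightarrow> ('a, real) l2" where
  "emb0 f = (if f \<in> L2 \<Omega> then cl f else 0)"

definition emb1 :: "('a \<Rightarrow> real) \<Rightarrow> ('a, real) l2 \<times> ('a, 'a) l2" where
  "emb1 f = (if f \<in> H10 \<Omega> then emb_H1 f else 0)"

text \<open>These are the classes carried by \<open>\<Omega>\<close>, namely the fixed points of
  truncation, which is bounded and linear.\<close>

lemma closed_cls_range: "closed {x :: ('a, 'b::separable_hilbert) l2. cl (rep_l2 x) = x}"
proof -
  have "bounded_linear (l2_map \<Omega> (\<lambda>x::'b. x))" by (rule bounded_linear_l2_map[OF meas bounded_linear_ident])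
  then have "continuous_on UNIV (l2_map \<Omega> (\<lambda>x::'b. x))" by (rule linear_continuous_on)
  then show ?thesis unfolding l2_map_def by (rule closed_Collect_eq[OF _ continuous_on_id])
qed

lemma hilbert_model_L2: "hilbert_model (L2_space \<Omega>) emb0"
proof
  have mem: "f \<in> elems (L2_space \<Omega>) \<longleftrightarrow> sq_integrable_on \<Omega> f" for f by (simp add: L2_space_def L2_iff)
  have emb: "emb0 f = cl f" if "sq_integrable_on \<Omega> f" for f using that by (simp add: emb0_def L2_iff)
  note scale = sq_integrable_on_scaleR[OF meas, of "f :: 'a \<Rightarrow> real" for f, unfolded real_scaleR_def]
  show "(\<lambda>x. 0) \<in> elems (L2_space \<Omega>)" unfolding mem by (simp add: sq_integrable_on_def)
  fix f g :: "'a \<Rightarrow> real" and c :: real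
  show "f \<notin> elems (L2_space \<Omega>) \<Longrightarrow> emb0 f = 0" by (simp add: mem emb0_def L2_iff)
  show "closed (emb0 ` elems (L2_space \<Omega>))"
  proof -
    have "emb0 ` elems (L2_space \<Omega>) = {x. cl (rep_l2 x) = x}"
    proof safe
      fix f assume "f \<in> elems (L2_space \<Omega>)"
      then show "cl (rep_l2 (emb0 f)) = emb0 f" by (simp add: mem emb cls_on_rep_cls_on[OF meas])
    next
      fix x :: "('a, real) l2" assume "cl (rep_l2 x) = x"
      then show "x \<in> emb0 ` elems (L2_space \<Omega>)"
        using sq_integrable_on_rep_l2[OF meas, of x] by (intro image_eqI[of _ _ "rep_l2 x"]) (simp_all add: mem emb)
    qed
    then show ?thesis using closed_cls_range by simp
  qed
  assume f: "f \<in> elems (L2_space \<Omega>)"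
  show "(\<lambda>x. c * f x) \<in> elems (L2_space \<Omega>)" using f scale by (simp add: mem)
  show "emb0 (\<lambda>x. c * f x) = c *\<^sub>R emb0 f"
    using f scale cls_on_scaleR[OF meas, of f c] by (simp add: mem emb)
  show "norm (emb0 f) = nrm (L2_space \<Omega>) f" using f by (simp add: mem emb L2_norm_eq[OF meas] L2_iff L2_space_def)
  assume g: "g \<in> elems (L2_space \<Omega>)"
  show "(\<lambda>x. f x + g x) \<in> elems (L2_space \<Omega>)" using f g sq_integrable_on_add[OF meas] by (simp add: mem)
  show "emb0 (\<lambda>x. f x + g x) = emb0 f + emb0 g"
    using f g by (simp add: mem emb sq_integrable_on_add[OF meas] cls_on_add[OF meas])
qed

lemma hilbert_model_H10: "hilbert_model (H10_space \<Omega>) emb1"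
proof
  let ?C = "closure (emb_H1 ` test_functions \<Omega>)"
  have C: "subspace ?C" by (rule subspace_closure[OF subspace_emb_test])
  have mem: "f \<in> elems (H10_space \<Omega>) \<longleftrightarrow> f \<in> H10 \<Omega>" for f by (simp add: H10_space_def)
  have emb: "emb1 f = emb_H1 f" if "f \<in> H10 \<Omega>" for f using that by (simp add: emb1_def)
  have add: "(\<lambda>x. f x + g x) \<in> H10 \<Omega>" if "f \<in> H10 \<Omega>" "g \<in> H10 \<Omega>" for f g
    using that H1_add subspace_add[OF C] by (simp add: H10_iff)
  have scale: "(\<lambda>x. c * f x) \<in> H10 \<Omega>" if "f \<in> H10 \<Omega>" for c f
    using that H1_scale subspace_scale[OF C] by (simp add: H10_iff)
  show "(\<lambda>x. 0) \<in> elems (H10_space \<Omega>)"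
  proof -
    have z: "(\<lambda>x. 0) \<in> test_functions \<Omega>"
      by (rule test_functions_0)
    show ?thesis unfolding mem H10_iff
      by (intro conjI test_function_H1[OF z] closure_subset[THEN subsetD, OF imageI[OF z]])
  qed
  fix f g :: "'a \<Rightarrow> real" and c :: real
  show "f \<notin> elems (H10_space \<Omega>) \<Longrightarrow> emb1 f = 0" by (simp add: mem emb1_def)
  show "closed (emb1 ` elems (H10_space \<Omega>))"
  proof -
    \<comment> \<open>A closed set containing the embedded test functions and hence their closure.
      Its elements are carried by \<open>\<Omega>\<close> and satisfy the gradient relation, so each
      of them is the image of an actual function.\<close>
    let ?W = "grad_graph \<inter> {p. cl (rep_l2 (fst p)) = fst p} \<inter> {p. cl (rep_l2 (snd p)) = snd p}"
    have "closed ?W"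
      using closed_vimage[OF closed_cls_range continuous_on_fst[OF continuous_on_id]]
        closed_vimage[OF closed_cls_range continuous_on_snd[OF continuous_on_id]]
      by (intro closed_Int closed_grad_graph) (simp_all add: vimage_def)
    moreover have "emb_H1 ` test_functions \<Omega> \<subseteq> ?W"
    proof
      fix p assume "p \<in> emb_H1 ` test_functions \<Omega>"
      then obtain \<phi> where p: "p = emb_H1 \<phi>" "\<phi> \<in> test_functions \<Omega>" by blast
      note G = grad_H1[OF test_function_H1[OF p(2)]]
      show "p \<in> ?W" using G by (simp add: p(1) emb_H1_def cls_on_rep_cls_on[OF meas])
    qed
    ultimately have CW: "?C \<subseteq> ?W" by (rule closure_minimal[rotated])
    have "emb1 ` elems (H10_space \<Omega>) = ?C"
    proof (intro equalityI subsetI)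
      fix p assume "p \<in> emb1 ` elems (H10_space \<Omega>)"
      then obtain f where "f \<in> H10 \<Omega>" "p = emb1 f" by (auto simp: mem)
      then show "p \<in> ?C" by (simp add: emb H10_iff)
    next
      fix p assume "p \<in> ?C"
      then obtain a \<beta> where p: "(a, \<beta>) \<in> ?C" and p_eq: "p = (a, \<beta>)" by (cases p) auto
      then have W: "(a, \<beta>) \<in> grad_graph" "cl (rep_l2 a) = a" "cl (rep_l2 \<beta>) = \<beta>" using CW by auto
      have "rep_l2 a \<in> H1 \<Omega>" "cl (grad \<Omega> (rep_l2 a)) = \<beta>"
        using grad_unique[OF sq_integrable_on_rep_l2[OF meas, of a] sq_integrable_on_rep_l2[OF meas, of \<beta>]] W by auto
      then have "emb_H1 (rep_l2 a) = (a, \<beta>)" "rep_l2 a \<in> H10 \<Omega>" using W p by (auto simp: emb_H1_def H10_iff)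
      then show "p \<in> emb1 ` elems (H10_space \<Omega>)" unfolding p_eq by (intro image_eqI[of _ _ "rep_l2 a"]) (auto simp: mem emb)
    qed
    then show ?thesis by simp
  qed
  assume f: "f \<in> elems (H10_space \<Omega>)"
  show "(\<lambda>x. c * f x) \<in> elems (H10_space \<Omega>)" using f scale by (simp add: mem)
  show "emb1 (\<lambda>x. c * f x) = c *\<^sub>R emb1 f" using f by (simp add: mem emb scale H1_scale H10_iff[of f])
  show "norm (emb1 f) = nrm (H10_space \<Omega>) f" using f by (simp add: mem emb H1_norm_eq H10_iff H10_space_def)
  assume g: "g \<in> elems (H10_space \<Omega>)"
  show "(\<lambda>x. f x + g x) \<in> elems (H10_space \<Omega>)" using f g add by (simp add: mem)
  show "emb1 (\<lambda>x. f x + g x) = emb1 f + emb1 g"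
    using f g by (simp add: mem emb add H1_add H10_iff[of f] H10_iff[of g])
qed

end

section \<open>The space-time problem in the Hilbert space model\<close>

context bounded_open begin

sublocale X0: hilbert_model "L2_space \<Omega>" emb0 by (rule hilbert_model_L2)
sublocale X1: hilbert_model "H10_space \<Omega>" emb1 by (rule hilbert_model_H10)

lemma elems_simps: "f \<in> elems (L2_space \<Omega>) \<longleftrightarrow> sq_integrable_on \<Omega> f" "f \<in> elems (H10_space \<Omega>) \<longleftrightarrow> f \<in> H10 \<Omega>"
  by (simp_all add: L2_space_def H10_space_def L2_iff)

lemma emb0_eq: "sq_integrable_on \<Omega> f \<Longrightarrow> emb0 f = cl f"
  by (simp add: emb0_def L2_iff)

lemma emb1_eq: "f \<in> H10 \<Omega> \<Longrightarrow> emb1 f = (cl f, cl (grad \<Omega> f))"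
  by (simp add: emb1_def emb_H1_def)

lemma H10_sq: "f \<in> H10 \<Omega> \<Longrightarrow> sq_integrable_on \<Omega> f" "f \<in> H10 \<Omega> \<Longrightarrow> sq_integrable_on \<Omega> (grad \<Omega> f)"
  using grad_H1 by (auto simp: H10_iff)

lemma fst_emb1: "f \<in> H10 \<Omega> \<Longrightarrow> fst (emb1 f) = emb0 f"
  by (simp add: emb1_eq emb0_eq H10_sq)

lemma emb1_eq_0:
  assumes "p \<in> X1.rng" "fst p = 0"
  shows "p = 0"
proof -
  obtain f where f: "f \<in> H10 \<Omega>" "p = emb1 f" using assms(1) by (auto simp: elems_simps)
  then have "(cl f, cl (grad \<Omega> f)) \<in> grad_graph" "cl f = 0" using grad_H1(3)[of f] assms(2) by (auto simp: H10_iff emb1_eq)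
  then have "cl (grad \<Omega> f) = 0" using grad_graph_0[OF H10_sq(2)[OF f(1)]] by simp
  then show ?thesis using f \<open>cl f = 0\<close> by (simp add: emb1_eq zero_prod_def)
qed

text \<open>Membership in \<open>H10\<close> depends only on the class. This transfers spatial
  regularity to a time derivative that was formed in \<open>L2\<close>.\<close>

lemma emb1_cong:
  assumes f: "f \<in> H10 \<Omega>" and g: "sq_integrable_on \<Omega> g" and eq: "emb0 g = emb0 f"
  shows "g \<in> H10 \<Omega>" "emb1 g = emb1 f"
proof -
  have c: "cl g = cl f" using eq by (simp add: emb0_eq g H10_sq[OF f])
  have "(cl g, cl (grad \<Omega> f)) \<in> grad_graph" using f grad_H1(3)[of f] by (simp add: c H10_iff)
  from grad_unique[OF g H10_sq(2)[OF f] this] have "g \<in> H1 \<Omega>" "emb_H1 g = emb_H1 f" by (auto simp: emb_H1_def c)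
  then show "g \<in> H10 \<Omega>" using f by (simp add: H10_iff)
  then show "emb1 g = emb1 f" using f \<open>emb_H1 g = emb_H1 f\<close> by (simp add: emb1_def)
qed

section \<open>Multiplication by bounded coefficients\<close>

definition l2_mult :: "('a \<Rightarrow> real) \<Rightarrow> ('a, 'b::separable_hilbert) l2 \<Rightarrow> ('a, 'b) l2" where
  "l2_mult k x = cl (\<lambda>t. k t *\<^sub>R rep_l2 x t)"

lemma sq_integrable_on_mult:
  fixes g :: "'a \<Rightarrow> 'b::separable_hilbert"
  assumes k: "k \<in> borel_measurable (lebesgue_on \<Omega>)" "AE x in lebesgue_on \<Omega>. \<bar>k x\<bar> \<le> K" and g: "sq_integrable_on \<Omega> g"
  shows "sq_integrable_on \<Omega> (\<lambda>x. k x *\<^sub>R g x)"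
proof (rule sq_integrable_on_bound[OF meas g])
  show "(\<lambda>x. k x *\<^sub>R g x) \<in> borel_measurable (lebesgue_on \<Omega>)"
    using k(1) g by (intro borel_measurable_scaleR) (simp_all add: sq_integrable_on_def)
  show "AE x in lebesgue_on \<Omega>. norm (k x *\<^sub>R g x) \<le> K * norm (g x)"
    using k(2) by eventually_elim (simp add: mult_right_mono)
qed

lemma l2_mult_cl:
  fixes g :: "'a \<Rightarrow> 'b::separable_hilbert"
  assumes g: "sq_integrable_on \<Omega> g"
  shows "l2_mult k (cl g) = cl (\<lambda>x. k x *\<^sub>R g x)"
  unfolding l2_mult_def by (rule cls_on_cong[OF meas], use rep_cls_on[OF meas g] in eventually_elim) simp

lemma bounded_linear_l2_mult:
  assumes k: "k \<in> borel_measurable (lebesgue_on \<Omega>)" "AE x in lebesgue_on \<Omega>. \<bar>k x\<bar> \<le> K"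
  shows "bounded_linear (l2_mult k :: ('a, 'b::separable_hilbert) l2 \<Rightarrow> _)"
proof -
  \<comment> \<open>The bound on \<open>k\<close> holds only almost everywhere, while the norm
    comparison asks for it at every point; truncation alters \<open>k\<close> on a null set.\<close>
  define k' where "k' x = max (-\<bar>K\<bar>) (min \<bar>K\<bar> (k x))" for x
  have kk: "AE x in lebesgue_on \<Omega>. k x = k' x" using k(2) by eventually_elim (auto simp: k'_def)
  have k'K: "\<bar>k' x\<bar> \<le> \<bar>K\<bar>" for x by (auto simp: k'_def)
  have sq: "sq_integrable_on \<Omega> (\<lambda>t. k t *\<^sub>R rep_l2 x t)" for x :: "('a, 'b) l2"
    by (rule sq_integrable_on_mult[OF k sq_integrable_on_rep_l2[OF meas]])
  have eq: "AE t in lebesgue_on \<Omega>. k t *\<^sub>R rep_l2 x t = k' t *\<^sub>R rep_l2 x t" for x :: "('a, 'b) l2"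
    using kk by eventually_elim simp
  have sq': "sq_integrable_on \<Omega> (\<lambda>t. k' t *\<^sub>R rep_l2 x t)" for x :: "('a, 'b) l2"
    by (rule sq_integrable_on_AE_cong[OF meas sq eq])
  show ?thesis
  proof (rule bounded_linear_intro[where K="\<bar>K\<bar>"])
    fix x y :: "('a, 'b) l2" and r :: real
    have "l2_mult k (x + y) = cl (\<lambda>t. k t *\<^sub>R rep_l2 x t + k t *\<^sub>R rep_l2 y t)" unfolding l2_mult_def
      by (rule cls_on_cong[OF meas], unfold AE_lebesgue_on_iff[OF meas], use rep_l2_AE(2)[of x y] in eventually_elim)
        (simp add: scaleR_add_right)
    then show "l2_mult k (x + y) = l2_mult k x + l2_mult k y" by (simp add: l2_mult_def cls_on_add[OF meas sq sq])
    have "l2_mult k (r *\<^sub>R x) = cl (\<lambda>t. r *\<^sub>R (k t *\<^sub>R rep_l2 x t))" unfolding l2_mult_def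
      by (rule cls_on_cong[OF meas], unfold AE_lebesgue_on_iff[OF meas], use rep_l2_AE(5)[of r x] in eventually_elim)
        (simp add: mult.commute)
    then show "l2_mult k (r *\<^sub>R x) = r *\<^sub>R l2_mult k x" by (simp only: l2_mult_def cls_on_scaleR[OF meas sq])
    have "norm (l2_mult k x) = norm (cl (\<lambda>t. k' t *\<^sub>R rep_l2 x t))"
      unfolding l2_mult_def by (simp only: cls_on_cong[OF meas eq])
    also have "\<dots> \<le> \<bar>K\<bar> * norm (cl (rep_l2 x))"
      by (rule norm_cls_on_le[OF meas sq_integrable_on_rep_l2[OF meas] sq']) (use k'K in \<open>auto intro: mult_right_mono\<close>)
    also have "\<dots> \<le> \<bar>K\<bar> * norm x" by (rule mult_left_mono[OF norm_cls_on_rep_l2_le[OF meas]]) simp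
    finally show "norm (l2_mult k x) \<le> norm x * \<bar>K\<bar>" by (simp add: mult.commute)
  qed
qed

end

lemma AE_itv_mono: "t \<le> T \<Longrightarrow> AE s in itv T. P s \<Longrightarrow> AE s in itv t. P s"
  unfolding AE_lebesgue_on_iff[OF sets_lebesgue_itv] by (auto elim!: eventually_mono)

lemma integral_itv_cong_AE:
  fixes f :: "real \<Rightarrow> 'b::{banach,second_countable_topology}"
  shows "integrable (itv T) f \<Longrightarrow> AE s in itv T. f s = g s \<Longrightarrow> (LINT t|itv T. f t) = (LINT t|itv T. g t)"
  using prim_cong_AE[of T f g T] by (simp add: prim_def)

lemma AE_itv_ex:
  assumes "0 < T" "AE t in itv T. P t"
  shows "\<exists>t\<in>{0<..<T}. P t"
proof (rule ccontr)
  assume no: "\<not> (\<exists>t\<in>{0<..<T}. P t)"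
  have "AE t in lebesgue. t \<notin> {0<..<T}"
    using assms(2) unfolding AE_lebesgue_on_iff[OF sets_lebesgue_itv] by eventually_elim (use no in auto)
  then have "{0<..<T} \<in> null_sets lebesgue" by (subst (asm) AE_iff_null_sets[symmetric]) auto
  then show False using assms(1) by (simp add: null_sets_def)
qed

section \<open>The coefficient and the energy space\<close>

locale wave_problem = bounded_open \<Omega> for \<Omega> :: "'a::euclidean_space set" +
  fixes T c0 :: real and c :: "'a \<Rightarrow> real"
  assumes T: "0 < T" and c_Linf: "c \<in> Linf \<Omega>" and c0: "0 < c0" and c_ge: "AE x in lebesgue_on \<Omega>. c x \<ge> c0"
begin

lemma bounded_linear_c: "bounded_linear (l2_mult c :: ('a, 'b::separable_hilbert) l2 \<Rightarrow> _)"
  using c_Linf bounded_linear_l2_mult unfolding Linf_def by blast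

lemma inverse_c: "(\<lambda>x. 1 / c x) \<in> borel_measurable (lebesgue_on \<Omega>)" "AE x in lebesgue_on \<Omega>. \<bar>1 / c x\<bar> \<le> 1 / c0"
proof -
  show "(\<lambda>x. 1 / c x) \<in> borel_measurable (lebesgue_on \<Omega>)"
    using c_Linf by (intro borel_measurable_divide) (auto simp: Linf_def)
  show "AE x in lebesgue_on \<Omega>. \<bar>1 / c x\<bar> \<le> 1 / c0"
    using c_ge by eventually_elim (use c0 in \<open>simp add: frac_le\<close>)
qed

lemma sq_c_mult:
  fixes g :: "'a \<Rightarrow> 'b::separable_hilbert"
  shows "sq_integrable_on \<Omega> g \<Longrightarrow> sq_integrable_on \<Omega> (\<lambda>x. c x *\<^sub>R g x)"
  using c_Linf sq_integrable_on_mult unfolding Linf_def by blast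

lemma inverse_c_cancel:
  fixes g :: "'a \<Rightarrow> 'b::separable_hilbert"
  assumes g: "sq_integrable_on \<Omega> g"
  shows "l2_mult (\<lambda>x. 1 / c x) (l2_mult c (cl g)) = cl g"
proof -
  have "l2_mult (\<lambda>x. 1 / c x) (l2_mult c (cl g)) = cl (\<lambda>x. (1 / c x) *\<^sub>R c x *\<^sub>R g x)"
    by (simp only: l2_mult_cl[OF g] l2_mult_cl[OF sq_c_mult[OF g]])
  also have "\<dots> = cl g" by (rule cls_on_cong[OF meas], use c_ge in eventually_elim) (use c0 in auto)
  finally show ?thesis .
qed

text \<open>Attaching \<open>c\<close> to the gradient turns the third term of the form into a plain
  inner product, as the abstract equation requires.\<close>

definition energy_space :: "(('a, real) l2 \<times> ('a, 'a) l2) set" where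
  "energy_space = (\<lambda>p. (fst p, l2_mult c (snd p))) ` X1.rng"

text \<open>The second condition says that \<open>snd p\<close> is carried by
  \<open>\<Omega>\<close>, where alone multiplication by \<open>c\<close> and by
  \<open>1 / c\<close> cancel.\<close>

lemma energy_space_iff:
  "p \<in> energy_space \<longleftrightarrow> (fst p, l2_mult (\<lambda>x. 1 / c x) (snd p)) \<in> X1.rng \<and> l2_mult c (l2_mult (\<lambda>x. 1 / c x) (snd p)) = snd p"
proof
  assume "p \<in> energy_space"
  then obtain f where f: "f \<in> H10 \<Omega>" "p = (fst (emb1 f), l2_mult c (snd (emb1 f)))"
    by (auto simp: energy_space_def elems_simps)
  then have "l2_mult (\<lambda>x. 1 / c x) (snd p) = snd (emb1 f)" by (simp add: emb1_eq inverse_c_cancel H10_sq)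
  then show "(fst p, l2_mult (\<lambda>x. 1 / c x) (snd p)) \<in> X1.rng \<and> l2_mult c (l2_mult (\<lambda>x. 1 / c x) (snd p)) = snd p"
    using f X1.emb_in_rng[of f] by simp
next
  assume "(fst p, l2_mult (\<lambda>x. 1 / c x) (snd p)) \<in> X1.rng \<and> l2_mult c (l2_mult (\<lambda>x. 1 / c x) (snd p)) = snd p"
  then show "p \<in> energy_space" unfolding energy_space_def
    by (intro image_eqI[of _ _ "(fst p, l2_mult (\<lambda>x. 1 / c x) (snd p))"]) auto
qed

text \<open>A bounded image of a closed subspace need not be closed. As \<open>c \<ge> c0\<close>
  makes division by \<open>c\<close> bounded, the space is also a preimage of a closed set under
  bounded maps.\<close>

lemma closed_subspace_energy: "closed_subspace energy_space"
proof
  have lin: "bounded_linear (\<lambda>p :: ('a, real) l2 \<times> ('a, 'a) l2. (fst p, l2_mult c (snd p)))"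
    by (intro bounded_linear_Pair bounded_linear_fst bounded_linear_compose[OF bounded_linear_c] bounded_linear_snd)
  show "subspace energy_space" unfolding energy_space_def
    by (rule linear_subspace_image[OF bounded_linear.linear[OF lin] X1.rng.subspace])
  note ic = bounded_linear_l2_mult[OF inverse_c]
  have lin': "bounded_linear (\<lambda>p :: ('a, real) l2 \<times> ('a, 'a) l2. (fst p, l2_mult (\<lambda>x. 1 / c x) (snd p)))"
    by (intro bounded_linear_Pair bounded_linear_fst bounded_linear_compose[OF ic] bounded_linear_snd)
  have lin'': "bounded_linear (\<lambda>p :: ('a, real) l2 \<times> ('a, 'a) l2. l2_mult c (l2_mult (\<lambda>x. 1 / c x) (snd p)))"
    by (intro bounded_linear_compose[OF bounded_linear_c] bounded_linear_compose[OF ic] bounded_linear_snd)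
  have "energy_space = (\<lambda>p. (fst p, l2_mult (\<lambda>x. 1 / c x) (snd p))) -` X1.rng \<inter> {p. l2_mult c (l2_mult (\<lambda>x. 1 / c x) (snd p)) = snd p}"
    using energy_space_iff by blast
  also have "closed \<dots>"
    by (intro closed_Int closed_vimage[OF X1.closed_range] closed_Collect_eq linear_continuous_on lin' lin'' bounded_linear_snd)
  finally show "closed energy_space" .
qed

text \<open>Coordinates of a trial function: initial velocity \<open>v0\<close>, second time
  derivative \<open>p\<close>, and gradient \<open>w\<close> of the velocity. That \<open>U\<close>
  vanishes at time 0 is expressed by primitives without additive constant.\<close>

definition trial_data ::
  "(real \<Rightarrow> 'a \<Rightarrow> real) \<Rightarrow> ('a, real) l2 \<Rightarrow> (real \<Rightarrow> ('a, real) l2) \<Rightarrow> (real \<Rightarrow> ('a, 'a) l2) \<Rightarrow> bool" where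
  "trial_data U v0 p w \<longleftrightarrow> sq_integrable_on {0<..<T} p \<and> sq_integrable_on {0<..<T} w \<and>
     (AE t in itv T. U t \<in> H10 \<Omega> \<and> emb1 (U t) = (prim (\<lambda>s. v0 + prim p s) t, prim w t)) \<and>
     (AE t in itv T. ddt T \<Omega> U t \<in> H10 \<Omega> \<and> emb1 (ddt T \<Omega> U t) = (v0 + prim p t, w t)) \<and>
     (AE t in itv T. sq_integrable_on \<Omega> (ddt T \<Omega> (ddt T \<Omega> U) t) \<and> emb0 (ddt T \<Omega> (ddt T \<Omega> U) t) = p t) \<and>
     sq_integrable_on \<Omega> (initial_value T (L2_space \<Omega>) (ddt T \<Omega> U)) \<and>
     emb0 (initial_value T (L2_space \<Omega>) (ddt T \<Omega> U)) = v0"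

lemma integrable_const_prim:
  fixes p :: "real \<Rightarrow> 'h::separable_hilbert"
  assumes "sq_integrable_on {0<..<T} p"
  shows "integrable (itv T) (\<lambda>s. v0 + prim p s)" "continuous_on {0..T} (\<lambda>s. v0 + prim p s)"
    "sq_integrable_on {0<..<T} (\<lambda>s. v0 + prim p s)"
proof -
  show c: "continuous_on {0..T} (\<lambda>s. v0 + prim p s)"
    by (rule continuous_on_const_prim[OF sq_integrable_on_itv_integrable[OF assms]])
  show "integrable (itv T) (\<lambda>s. v0 + prim p s)" by (rule integrable_itv_continuous[OF c])
  show "sq_integrable_on {0<..<T} (\<lambda>s. v0 + prim p s)" by (rule sq_integrable_on_itv_continuous[OF c])
qed

lemma L2_curveD:
  assumes "u \<in> bochner_L2 T (L2_space \<Omega>)"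
  shows "AE t in itv T. sq_integrable_on \<Omega> (u t)" "sq_integrable_on {0<..<T} (\<lambda>t. emb0 (u t))"
    "integrable (itv T) (\<lambda>t. emb0 (u t))"
  using assms unfolding X0.bochner_L2_iff elems_simps by (auto intro: sq_integrable_on_itv_integrable)

lemma H10_curveD:
  assumes "u \<in> bochner_L2 T (H10_space \<Omega>)"
  shows "AE t in itv T. u t \<in> H10 \<Omega>" "sq_integrable_on {0<..<T} (\<lambda>t. emb1 (u t))"
    "integrable (itv T) (\<lambda>t. emb1 (u t))"
  using assms unfolding X1.bochner_L2_iff elems_simps by (auto intro: sq_integrable_on_itv_integrable)

text \<open>The two memberships of \<open>U\<close> provide one derivative in \<open>H10\<close> and
  others in \<open>L2\<close>, all of them arbitrary choices. Uniqueness of primitives identifies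
  them almost everywhere, and thereby shows that \<open>grad\<close> may be applied to
  \<open>ddt\<close>.\<close>

lemma trial_data_ex:
  assumes U: "U \<in> trial_space T \<Omega>"
  shows "\<exists>v0 p w. trial_data U v0 p w"
proof -
  let ?D = "ddt T \<Omega> U"
  from U have U1: "U \<in> bochner_H1 T (H10_space \<Omega>)" and U2: "U \<in> bochner_H2 T (L2_space \<Omega>)"
    and U0: "has_initial_value T (L2_space \<Omega>) U (\<lambda>x. 0)" by (auto simp: trial_space_def H2_0_def)
  define V1 where "V1 = dt T (H10_space \<Omega>) U"
  have V1: "V1 \<in> bochner_L2 T (H10_space \<Omega>)" "weak_dt T (H10_space \<Omega>) U V1"
    unfolding V1_def by (rule X1.dt_H1[OF U1])+
  have UL1: "U \<in> bochner_L2 T (H10_space \<Omega>)" using U1 by (simp add: bochner_H1_def)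
  note U1D = H10_curveD[OF UL1] and V1D = H10_curveD[OF V1(1)]
  obtain a where a: "AE t in itv T. emb1 (U t) = a + prim (\<lambda>s. emb1 (V1 s)) t"
    using X1.weak_dt_iff[OF T UL1 V1(1)] V1(2) by blast
  from U2 obtain v where UL0: "U \<in> bochner_L2 T (L2_space \<Omega>)" and v: "v \<in> bochner_H1 T (L2_space \<Omega>)" "weak_dt T (L2_space \<Omega>) U v"
    by (auto simp: bochner_H2_def)
  have vL: "v \<in> bochner_L2 T (L2_space \<Omega>)" using v(1) by (simp add: bochner_H1_def)
  have "U \<in> bochner_H1 T (L2_space \<Omega>)" using UL0 vL v(2) by (auto simp: bochner_H1_def)
  note D = X0.dt_H1[OF this]
  note DD = L2_curveD[OF D(1)]
  obtain a0 where a0: "AE t in itv T. emb0 (U t) = a0 + prim (\<lambda>s. emb0 (?D s)) t"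
    using X0.weak_dt_iff[OF T UL0 D(1)] D(2) by blast
  obtain b0 where b0: "AE t in itv T. emb0 (U t) = b0 + prim (\<lambda>s. emb0 (v s)) t"
    using X0.weak_dt_iff[OF T UL0 vL] v(2) by blast
  \<comment> \<open>\<open>ddt U\<close> need not be the \<open>v\<close> from the definition of
    \<open>bochner_H2\<close>; it inherits a derivative from \<open>v\<close> once both are known to
    agree almost everywhere.\<close>
  have "AE t in itv T. a0 + prim (\<lambda>s. emb0 (?D s)) t = b0 + prim (\<lambda>s. emb0 (v s)) t"
    using a0 b0 by eventually_elim simp
  from prim_AE_unique[OF T DD(3) L2_curveD(3)[OF vL] this] have Dv: "AE t in itv T. emb0 (?D t) = emb0 (v t)" .
  from v(1) obtain v' where v': "v' \<in> bochner_L2 T (L2_space \<Omega>)" "weak_dt T (L2_space \<Omega>) v v'" by (auto simp: bochner_H1_def)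
  obtain c1 where c1: "AE t in itv T. emb0 (v t) = c1 + prim (\<lambda>s. emb0 (v' s)) t"
    using X0.weak_dt_iff[OF T vL v'(1)] v'(2) by blast
  have "AE t in itv T. emb0 (?D t) = c1 + prim (\<lambda>s. emb0 (v' s)) t" using Dv c1 by eventually_elim simp
  then have "weak_dt T (L2_space \<Omega>) ?D v'" using X0.weak_dt_iff[OF T D(1) v'(1)] by blast
  then have "?D \<in> bochner_H1 T (L2_space \<Omega>)" using D(1) v'(1) by (auto simp: bochner_H1_def)
  note P = X0.dt_H1[OF this]
  define p where "p t = emb0 (ddt T \<Omega> ?D t)" for t
  note PD = L2_curveD[OF P(1), folded p_def]
  obtain v0 where v0: "AE t in itv T. emb0 (?D t) = v0 + prim p t"
    using X0.weak_dt_iff[OF T D(1) P(1)] P(2) unfolding p_def by blast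
  have prim_mem: "prim u t \<in> X0.rng" if "integrable (itv T) u" "AE t in itv T. u t \<in> X0.rng" "t \<in> {0..T}" for u t
    using prim_mem_subspace[OF X0.rng.closed_subspace_axioms that(1,2)] that(3) by simp
  have p_rng: "p t \<in> X0.rng" for t unfolding p_def by (rule X0.emb_in_rng)
  \<comment> \<open>Solving the representation for \<open>v0\<close> at one good time shows that
    \<open>v0\<close> lies in the range.\<close>
  obtain t0 where t0: "t0 \<in> {0<..<T}" "emb0 (?D t0) = v0 + prim p t0" using AE_itv_ex[OF T v0] by blast
  have "v0 = emb0 (?D t0) - prim p t0" using t0(2) by simp
  then have v0_rng: "v0 \<in> X0.rng"
    using subspace_diff[OF X0.rng.subspace X0.emb_in_rng prim_mem[OF PD(3)]] p_rng t0(1) by auto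
  have mem_v: "v0 + prim p t \<in> X0.rng" if "t \<in> {0..T}" for t
    using subspace_add[OF X0.rng.subspace v0_rng prim_mem[OF PD(3) _ that]] p_rng by simp
  have Dmem: "AE t in itv T. ?D t \<in> elems (L2_space \<Omega>)" using DD(1) by (simp add: elems_simps)
  note iv = X0.initial_value_emb[OF T PD(3) Dmem v0 mem_v]
  define w where "w t = snd (emb1 (V1 t))" for t
  have sqw: "sq_integrable_on {0<..<T} w" unfolding w_def
    by (rule sq_integrable_on_linear[OF _ bounded_linear_snd V1D(2)]) simp
  note iw = sq_integrable_on_itv_integrable[OF sqw]
  have prim_V1: "prim (\<lambda>s. emb1 (V1 s)) t = (prim (\<lambda>s. fst (emb1 (V1 s))) t, prim w t)" if "t \<le> T" for t
    using prim_bounded_linear[OF bounded_linear_fst V1D(3) that] prim_bounded_linear[OF bounded_linear_snd V1D(3) that]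
    by (simp add: w_def[abs_def] prod_eq_iff)
  have i1: "integrable (itv T) (\<lambda>s. fst (emb1 (V1 s)))" by (rule integrable_bounded_linear[OF bounded_linear_fst V1D(3)])
  have fstU: "AE t in itv T. a0 + prim (\<lambda>s. emb0 (?D s)) t = fst a + prim (\<lambda>s. fst (emb1 (V1 s))) t"
    using a0 a U1D(1) AE_space[of "itv T"]
  proof eventually_elim
    case (elim t)
    then show ?case using fst_emb1[of "U t"] prim_V1[of t] by (simp add: space_restrict_space)
  qed
  from prim_AE_unique[OF T DD(3) i1 this] have DV: "AE t in itv T. emb0 (?D t) = fst (emb1 (V1 t))" .
  have a0_0: "a0 = 0"
  proof -
    have Umem: "AE t in itv T. U t \<in> elems (L2_space \<Omega>)" using L2_curveD(1)[OF UL0] by (simp add: elems_simps)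
    have D_rng: "prim (\<lambda>s. emb0 (?D s)) t \<in> X0.rng" if "t \<in> {0..T}" for t
      using prim_mem[OF DD(3) _ that] X0.emb_in_rng by simp
    obtain t1 where t1: "t1 \<in> {0<..<T}" "emb0 (U t1) = a0 + prim (\<lambda>s. emb0 (?D s)) t1" using AE_itv_ex[OF T a0] by blast
    have "a0 = emb0 (U t1) - prim (\<lambda>s. emb0 (?D s)) t1" using t1(2) by simp
    then have "a0 \<in> X0.rng" using subspace_diff[OF X0.rng.subspace X0.emb_in_rng D_rng] t1(1) by auto
    then have "a0 + prim (\<lambda>s. emb0 (?D s)) t \<in> X0.rng" if "t \<in> {0..T}" for t
      using subspace_add[OF X0.rng.subspace _ D_rng[OF that]] by simp
    from X0.has_initial_value_iff[OF T DD(3) Umem a0 this, of "\<lambda>x. 0"] U0 show ?thesis by (simp add: X0.emb_zero)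
  qed
  \<comment> \<open>The constant in the \<open>H10\<close> representation has function part equal to
    \<open>a0\<close>, by continuity at 0; an element of the range with vanishing function part has
    vanishing gradient part.\<close>
  have "fst a = 0"
  proof -
    have "a0 + prim (\<lambda>s. emb0 (?D s)) 0 = fst a + prim (\<lambda>s. fst (emb1 (V1 s))) 0"
      by (rule continuous_AE_eq_at_0[OF T continuous_on_const_prim[OF DD(3)] continuous_on_const_prim[OF i1] fstU])
    then show ?thesis by (simp add: a0_0)
  qed
  moreover have "a \<in> X1.rng"
  proof -
    obtain t1 where t1: "t1 \<in> {0<..<T}" "emb1 (U t1) = a + prim (\<lambda>s. emb1 (V1 s)) t1" using AE_itv_ex[OF T a] by blast
    have "prim (\<lambda>s. emb1 (V1 s)) t1 \<in> X1.rng"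
      using t1(1) X1.emb_in_rng by (intro prim_mem_subspace[OF X1.rng.closed_subspace_axioms V1D(3)]) auto
    moreover have "a = emb1 (U t1) - prim (\<lambda>s. emb1 (V1 s)) t1" using t1(2) by simp
    ultimately show ?thesis using subspace_diff[OF X1.rng.subspace X1.emb_in_rng] by simp
  qed
  ultimately have a_0: "a = 0" by (rule emb1_eq_0[rotated])
  have ae_v: "AE t in itv T. fst (emb1 (V1 t)) = v0 + prim p t" using DV v0 by eventually_elim simp
  have "AE t in itv T. U t \<in> H10 \<Omega> \<and> emb1 (U t) = (prim (\<lambda>s. v0 + prim p s) t, prim w t)"
    using a U1D(1) AE_space[of "itv T"]
  proof eventually_elim
    case (elim t)
    then have "t \<le> T" by (simp add: space_restrict_space)
    then show ?case using elim prim_V1[of t] prim_cong_AE[OF i1 ae_v, of t] by (simp add: a_0)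
  qed
  moreover have "AE t in itv T. ?D t \<in> H10 \<Omega> \<and> emb1 (?D t) = (v0 + prim p t, w t)"
    using DD(1) V1D(1) DV ae_v
  proof eventually_elim
    case (elim t)
    then have "?D t \<in> H10 \<Omega>" "emb1 (?D t) = emb1 (V1 t)"
      using emb1_cong[of "V1 t" "?D t"] fst_emb1[of "V1 t"] by auto
    then show ?case using elim by (simp add: w_def prod_eq_iff)
  qed
  moreover have "AE t in itv T. sq_integrable_on \<Omega> (ddt T \<Omega> ?D t) \<and> emb0 (ddt T \<Omega> ?D t) = p t"
    using PD(1) by eventually_elim (simp add: p_def)
  ultimately have "trial_data U v0 p w" unfolding trial_data_def
    using PD(2) sqw iv by (auto simp: elems_simps)
  then show ?thesis by blast
qed

lemma trial_data_cong:
  assumes d: "trial_data U v0 p w" and p': "sq_integrable_on {0<..<T} p'" "AE t in itv T. p t = p' t"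
    and w': "sq_integrable_on {0<..<T} w'" "AE t in itv T. w t = w' t"
  shows "trial_data U v0 p' w'"
proof -
  have p: "sq_integrable_on {0<..<T} p" and w: "sq_integrable_on {0<..<T} w" using d by (auto simp: trial_data_def)
  have pp: "prim p t = prim p' t" if "t \<in> space (itv T)" for t
    using prim_cong_AE[OF sq_integrable_on_itv_integrable[OF p] p'(2), of t] that by (simp add: space_restrict_space)
  have ww: "prim w t = prim w' t" if "t \<in> space (itv T)" for t
    using prim_cong_AE[OF sq_integrable_on_itv_integrable[OF w] w'(2), of t] that by (simp add: space_restrict_space)
  have "AE s in itv T. v0 + prim p s = v0 + prim p' s" using pp by (intro AE_I2) simp
  then have vv: "prim (\<lambda>s. v0 + prim p s) t = prim (\<lambda>s. v0 + prim p' s) t" if "t \<in> space (itv T)" for t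
    using prim_cong_AE[OF integrable_const_prim(1)[OF p]] that by (simp add: space_restrict_space)
  have 1: "AE t in itv T. U t \<in> H10 \<Omega> \<and> emb1 (U t) = (prim (\<lambda>s. v0 + prim p' s) t, prim w' t)"
    using d[unfolded trial_data_def, THEN conjunct2, THEN conjunct2, THEN conjunct1] AE_space[of "itv T"]
    by eventually_elim (simp add: vv ww)
  have 2: "AE t in itv T. ddt T \<Omega> U t \<in> H10 \<Omega> \<and> emb1 (ddt T \<Omega> U t) = (v0 + prim p' t, w' t)"
    using d[unfolded trial_data_def, THEN conjunct2, THEN conjunct2, THEN conjunct2, THEN conjunct1] w'(2) AE_space[of "itv T"]
    by eventually_elim (simp add: pp)
  have 3: "AE t in itv T. sq_integrable_on \<Omega> (ddt T \<Omega> (ddt T \<Omega> U) t) \<and> emb0 (ddt T \<Omega> (ddt T \<Omega> U) t) = p' t"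
    using d[unfolded trial_data_def, THEN conjunct2, THEN conjunct2, THEN conjunct2, THEN conjunct2, THEN conjunct1] p'(2)
    by eventually_elim simp
  show ?thesis unfolding trial_data_def using 1 2 3 p' w' d by (simp add: trial_data_def)
qed

text \<open>Converse of \<open>trial_data_ex\<close>. It turns the abstract solution, and likewise
  the difference of two solutions, into a trial function.\<close>

lemma trial_function_ex:
  assumes p: "sq_integrable_on {0<..<T} p" and w: "sq_integrable_on {0<..<T} w"
    and mem: "AE t in itv T. (v0 + prim p t, w t) \<in> X1.rng"
  shows "\<exists>U. U \<in> trial_space T \<Omega> \<and> trial_data U v0 p w"
proof -
  define v where "v t = v0 + prim p t" for t
  note v = integrable_const_prim[OF p, of v0, folded v_def]
  note ip = sq_integrable_on_itv_integrable[OF p] and iw = sq_integrable_on_itv_integrable[OF w]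
  have sqvw: "sq_integrable_on {0<..<T} (\<lambda>t. (v t, w t))" by (rule sq_integrable_on_Pair[OF _ v(3) w]) simp
  note ivw = sq_integrable_on_itv_integrable[OF sqvw]
  have mem': "AE t in itv T. (v t, w t) \<in> X1.rng" using mem by (simp add: v_def)
  have pm: "(prim v t, prim w t) \<in> X1.rng" if "t \<le> T" for t
    using prim_mem_subspace[OF X1.rng.closed_subspace_axioms ivw mem' that] prim_Pair[OF v(3) w that] by simp
  define U where "U t = X1.pick (prim v t, prim w t)" for t
  define V1 where "V1 t = X1.pick (v t, w t)" for t
  have Ut: "U t \<in> H10 \<Omega>" "emb1 (U t) = (prim v t, prim w t)" if "t \<le> T" for t
    unfolding U_def using X1.pick[OF pm[OF that]] by (auto simp: elems_simps)
  have V1t: "AE t in itv T. V1 t \<in> H10 \<Omega> \<and> emb1 (V1 t) = (v t, w t)"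
    using mem' by eventually_elim (use X1.pick in \<open>simp add: V1_def elems_simps\<close>)
  have aeU: "AE t in itv T. U t \<in> H10 \<Omega> \<and> emb1 (U t) = (prim v t, prim w t)"
    by (rule AE_I2) (use Ut in \<open>simp add: space_restrict_space\<close>)
  have sqU: "sq_integrable_on {0<..<T} (\<lambda>t. (prim v t, prim w t))"
    by (intro sq_integrable_on_Pair sq_integrable_on_itv_continuous continuous_on_prim v iw) simp
  have UL1: "U \<in> bochner_L2 T (H10_space \<Omega>)" unfolding X1.bochner_L2_iff elems_simps
    using aeU by (auto intro!: sq_integrable_on_AE_cong[OF _ sqU] elim: eventually_mono)
  have VL1: "V1 \<in> bochner_L2 T (H10_space \<Omega>)" unfolding X1.bochner_L2_iff elems_simps
    using V1t by (auto intro!: sq_integrable_on_AE_cong[OF _ sqvw] elim: eventually_mono)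
  have aeV: "AE t in itv T. (v t, w t) = emb1 (V1 t)" using V1t by eventually_elim simp
  have "AE t in itv T. emb1 (U t) = 0 + prim (\<lambda>s. emb1 (V1 s)) t"
    using aeU AE_space[of "itv T"]
  proof eventually_elim
    case (elim t)
    then have "t \<le> T" by (simp add: space_restrict_space)
    then show ?case using elim prim_cong_AE[OF ivw aeV, of t] prim_Pair[OF v(3) w, of t] by simp
  qed
  then have "weak_dt T (H10_space \<Omega>) U V1" using X1.weak_dt_iff[OF T UL1 VL1] by blast
  then have UH1: "U \<in> bochner_H1 T (H10_space \<Omega>)" using UL1 VL1 by (auto simp: bochner_H1_def)
  have U0: "AE t in itv T. sq_integrable_on \<Omega> (U t) \<and> emb0 (U t) = prim v t"
    using aeU
  proof eventually_elim
    case (elim t)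
    then show ?case using fst_emb1[of "U t"] H10_sq(1)[of "U t"] by simp
  qed
  have V0: "AE t in itv T. sq_integrable_on \<Omega> (V1 t) \<and> emb0 (V1 t) = v t"
    using V1t
  proof eventually_elim
    case (elim t)
    then show ?case using fst_emb1[of "V1 t"] H10_sq(1)[of "V1 t"] by simp
  qed
  have UL0: "U \<in> bochner_L2 T (L2_space \<Omega>)" unfolding X0.bochner_L2_iff elems_simps
    using U0 by (auto intro!: sq_integrable_on_AE_cong[OF _ sq_integrable_on_itv_continuous[OF continuous_on_prim[OF v(1)]]] elim: eventually_mono)
  have VL0: "V1 \<in> bochner_L2 T (L2_space \<Omega>)" unfolding X0.bochner_L2_iff elems_simps
    using V0 by (auto intro!: sq_integrable_on_AE_cong[OF _ v(3)] elim: eventually_mono)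
  have v_rng: "AE t in itv T. v t \<in> X0.rng" using V0
  proof eventually_elim
    case (elim t)
    then show ?case using X0.emb_in_rng[of "V1 t"] by simp
  qed
  \<comment> \<open>The range condition is given for \<open>v0 + prim p\<close>, not for
    \<open>p\<close>. Applying the complementary projection gives a vanishing primitive, whose
    derivative must vanish.\<close>
  have p_rng: "AE t in itv T. p t \<in> X0.rng"
  proof -
    let ?Q = "\<lambda>x. x - orth_proj X0.rng x"
    have Q: "bounded_linear ?Q" by (intro bounded_linear_sub bounded_linear_ident X0.rng.bounded_linear_orth_proj)
    have "AE t in itv T. ?Q v0 + prim (\<lambda>s. ?Q (p s)) t = 0 + prim (\<lambda>s. 0) t"
      using v_rng AE_space[of "itv T"]
    proof eventually_elim
      case (elim t)
      then have "t \<le> T" by (simp add: space_restrict_space)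
      have "?Q v0 + prim (\<lambda>s. ?Q (p s)) t = ?Q (v t)"
        unfolding prim_bounded_linear[OF Q ip \<open>t \<le> T\<close>] v_def by (simp only: linear_simps(1)[OF Q])
      also have "\<dots> = 0" using elim(1) by simp
      finally show ?case by simp
    qed
    from prim_AE_unique[OF T integrable_bounded_linear[OF Q ip] _ this] have "AE t in itv T. ?Q (p t) = 0" by simp
    then show ?thesis
    proof eventually_elim
      case (elim t)
      then have "orth_proj X0.rng (p t) = p t" by simp
      then show ?case by (simp only: X0.rng.orth_proj_eq_iff)
    qed
  qed
  define P where "P t = X0.pick (p t)" for t
  have Pt: "AE t in itv T. sq_integrable_on \<Omega> (P t) \<and> emb0 (P t) = p t"
    using p_rng by eventually_elim (use X0.pick in \<open>simp add: P_def elems_simps\<close>)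
  have PL0: "P \<in> bochner_L2 T (L2_space \<Omega>)" unfolding X0.bochner_L2_iff elems_simps
    using Pt by (auto intro!: sq_integrable_on_AE_cong[OF _ p] elim: eventually_mono)
  have "AE t in itv T. emb0 (V1 t) = v0 + prim (\<lambda>s. emb0 (P s)) t"
    using V0 AE_space[of "itv T"]
  proof eventually_elim
    case (elim t)
    have "AE s in itv T. p s = emb0 (P s)" using Pt by eventually_elim simp
    from prim_cong_AE[OF ip this, of t] elim show ?case by (simp add: v_def space_restrict_space)
  qed
  then have "weak_dt T (L2_space \<Omega>) V1 P" using X0.weak_dt_iff[OF T VL0 PL0] by blast
  then have VH1: "V1 \<in> bochner_H1 T (L2_space \<Omega>)" using VL0 PL0 by (auto simp: bochner_H1_def)
  have aev: "AE s in itv T. v s = emb0 (V1 s)" using V0 by eventually_elim simp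
  have "AE t in itv T. emb0 (U t) = 0 + prim (\<lambda>s. emb0 (V1 s)) t"
    using U0 AE_space[of "itv T"]
  proof eventually_elim
    case (elim t)
    then show ?case using prim_cong_AE[OF v(1) aev, of t] by (simp add: space_restrict_space)
  qed
  then have "weak_dt T (L2_space \<Omega>) U V1" using X0.weak_dt_iff[OF T UL0 VL0] by blast
  then have "U \<in> bochner_H2 T (L2_space \<Omega>)" using UL0 VH1 by (auto simp: bochner_H2_def)
  moreover have "has_initial_value T (L2_space \<Omega>) U (\<lambda>x. 0)"
  proof -
    have 1: "AE t in itv T. U t \<in> elems (L2_space \<Omega>)" using U0 by eventually_elim (simp add: elems_simps)
    have 2: "AE t in itv T. emb0 (U t) = 0 + prim v t" using U0 by eventually_elim simp
    have 3: "0 + prim v t \<in> X0.rng" if "t \<in> {0..T}" for t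
      using prim_mem_subspace[OF X0.rng.closed_subspace_axioms v(1) v_rng] that by simp
    show ?thesis
      by (rule X0.has_initial_value_iff[OF T v(1) 1 2, THEN iffD2]) (use 3 X0.zero_mem X0.emb_zero in auto)
  qed
  ultimately have UT: "U \<in> trial_space T \<Omega>" using UH1 by (simp add: trial_space_def H2_0_def)
  \<comment> \<open>Some data exist because \<open>U\<close> is a trial function; comparing
    primitives shows that they are the prescribed ones.\<close>
  then obtain v0' p' w' where d: "trial_data U v0' p' w'" using trial_data_ex by blast
  then have p': "sq_integrable_on {0<..<T} p'" and w': "sq_integrable_on {0<..<T} w'"
    and aeU': "AE t in itv T. U t \<in> H10 \<Omega> \<and> emb1 (U t) = (prim (\<lambda>s. v0' + prim p' s) t, prim w' t)"
    by (auto simp: trial_data_def)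
  note v' = integrable_const_prim[OF p', of v0']
  have "AE t in itv T. 0 + prim v t = 0 + prim (\<lambda>s. v0' + prim p' s) t" using aeU aeU' by eventually_elim simp
  from prim_AE_unique[OF T v(1) v'(1) this] have vv: "AE t in itv T. v0 + prim p t = v0' + prim p' t" by (simp add: v_def)
  have "AE t in itv T. 0 + prim w t = 0 + prim w' t" using aeU aeU' by eventually_elim simp
  from prim_AE_unique[OF T iw sq_integrable_on_itv_integrable[OF w'] this] have ww: "AE t in itv T. w' t = w t"
    by eventually_elim simp
  from prim_AE_unique[OF T ip sq_integrable_on_itv_integrable[OF p'] vv] have pp: "AE t in itv T. p' t = p t"
    by eventually_elim simp
  have "v0 = v0'"
    using continuous_AE_eq_at_0[OF T v(2)[unfolded v_def] v'(2) vv] by simp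
  then show ?thesis using UT trial_data_cong[OF d p pp w ww] by blast
qed

end

context wave_problem begin

section \<open>The form, the source and the norm in coordinates\<close>

lemma Q_inner_eq:
  fixes f g :: "real \<Rightarrow> 'a \<Rightarrow> 'b::euclidean_space"
  assumes f: "AE t in itv T. sq_integrable_on \<Omega> (f t) \<and> cl (f t) = a t"
    and g: "AE t in itv T. sq_integrable_on \<Omega> (g t) \<and> cl (g t) = b t"
    and a: "sq_integrable_on {0<..<T} a" and b: "sq_integrable_on {0<..<T} b"
  shows "Q_inner T \<Omega> f g = (LINT t|itv T. a t \<bullet> b t)"
proof -
  have "AE t in itv T. a t \<bullet> b t = L2_inner \<Omega> (f t) (g t)"
    using f g
  proof eventually_elim
    case (elim t)
    then show ?case using inner_cls_on[OF meas, of "f t" "g t"] by (simp add: L2_inner_def)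
  qed
  from integral_itv_cong_AE[OF integrable_inner_on[OF _ a b] this] show ?thesis by (simp add: Q_inner_def)
qed

lemma c_in_model:
  assumes "sq_integrable_on {0<..<T} w"
  shows "sq_integrable_on {0<..<T} (\<lambda>t. l2_mult c (w t))"
  by (rule sq_integrable_on_linear[OF _ bounded_linear_c assms]) simp

text \<open>\<open>LT W\<close> is the primitive of \<open>weight * ddt W\<close>, so
  differentiating returns this product, and the gradient is multiplied by the same number. The
  initial velocity is unchanged, because the weight is 1 at time 0.\<close>

lemma LT_trial:
  assumes W: "trial_data W v0 p w" and WT: "W \<in> trial_space T \<Omega>"
  shows "AE t in itv T. ddt T \<Omega> (LT T \<Omega> W) t \<in> H10 \<Omega> \<and>
      emb1 (ddt T \<Omega> (LT T \<Omega> W) t) = weight T t *\<^sub>R (v0 + prim p t, w t)"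
    and "sq_integrable_on \<Omega> (initial_value T (L2_space \<Omega>) (ddt T \<Omega> (LT T \<Omega> W)))"
    and "emb0 (initial_value T (L2_space \<Omega>) (ddt T \<Omega> (LT T \<Omega> W))) = v0"
proof -
  let ?Z = "LT T \<Omega> W"
  define v where "v t = v0 + prim p t" for t
  define z where "z t = weight T t *\<^sub>R v t" for t
  have p: "sq_integrable_on {0<..<T} p" and w: "sq_integrable_on {0<..<T} w" using W by (auto simp: trial_data_def)
  note ip = sq_integrable_on_itv_integrable[OF p]
  note v = integrable_const_prim[OF p, of v0, folded v_def]
  have cz: "continuous_on {0..T} z" unfolding z_def by (intro continuous_intros continuous_on_weight v)
  have iz: "integrable (itv T) z" and sqz: "sq_integrable_on {0<..<T} z"
    by (rule integrable_itv_continuous[OF cz], rule sq_integrable_on_itv_continuous[OF cz])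
  define D where "D t x = exp (- t / T) * ddt T \<Omega> W t x" for t x
  have aeW: "AE t in itv T. ddt T \<Omega> W t \<in> H10 \<Omega> \<and> emb1 (ddt T \<Omega> W t) = (v t, w t)"
    using W by (simp add: trial_data_def v_def)
  have aeD: "AE t in itv T. D t \<in> H10 \<Omega> \<and> emb1 (D t) = weight T t *\<^sub>R (v t, w t)"
    using aeW
  proof eventually_elim
    case (elim t)
    then show ?case using X1.scale_mem[of "ddt T \<Omega> W t" "exp (- t / T)"] X1.emb_scale[of "ddt T \<Omega> W t" "exp (- t / T)"]
      unfolding D_def[abs_def] by (simp add: elems_simps weight_def)
  qed
  have aeD0: "AE t in itv T. sq_integrable_on \<Omega> (D t) \<and> z t = emb0 (D t)"
    using aeD
  proof eventually_elim
    case (elim t)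
    then show ?case using fst_emb1[of "D t"] H10_sq(1)[of "D t"] by (simp add: z_def)
  qed
  have Zt: "?Z t \<in> elems (L2_space \<Omega>) \<and> emb0 (?Z t) = prim z t" if t: "t \<in> {0<..<T}" for t
  proof -
    have tT: "t \<le> T" using t by simp
    have aet: "AE s in itv t. sq_integrable_on \<Omega> (D s) \<and> z s = emb0 (D s)" by (rule AE_itv_mono[OF tT aeD0])
    then have mem: "AE s in itv t. D s \<in> elems (L2_space \<Omega>)" and eq: "AE s in itv t. z s = emb0 (D s)"
      by (auto simp: elems_simps)
    have izt: "integrable (itv t) z"
      by (rule integrable_itv_continuous[OF continuous_on_subset[OF cz]]) (use tT in auto)
    note iD = integrable_itv_cong_AE[OF izt eq]
    have "has_bochner (itv t) (L2_space \<Omega>) D (?Z t)"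
      using X0.has_bochner_itv_ex[OF iD mem] unfolding LT_def D_def[abs_def] .
    then have "?Z t \<in> elems (L2_space \<Omega>) \<and> emb0 (?Z t) = (LINT s|itv t. emb0 (D s))"
      unfolding X0.has_bochner_itv_iff[OF iD mem] .
    then show ?thesis using integral_itv_cong_AE[OF izt eq] by (simp add: prim_def)
  qed
  have Z_ae: "AE t in itv T. ?Z t \<in> elems (L2_space \<Omega>)" "AE t in itv T. prim z t = emb0 (?Z t)"
    using Zt by (auto intro!: AE_I2 simp: space_restrict_space)
  have ZL: "?Z \<in> bochner_L2 T (L2_space \<Omega>)" unfolding X0.bochner_L2_iff
    using Z_ae(1) sq_integrable_on_AE_cong[OF _ sq_integrable_on_itv_continuous[OF continuous_on_prim[OF iz]] Z_ae(2)] by simp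
  have zD: "AE t in itv T. z t = emb0 (D t)" using aeD0 by eventually_elim simp
  have DL: "D \<in> bochner_L2 T (L2_space \<Omega>)" unfolding X0.bochner_L2_iff elems_simps
    using aeD0 sq_integrable_on_AE_cong[OF _ sqz zD] by auto
  have "AE t in itv T. emb0 (?Z t) = 0 + prim (\<lambda>s. emb0 (D s)) t"
    using Z_ae(2) AE_space[of "itv T"]
  proof eventually_elim
    case (elim t)
    then show ?case using prim_cong_AE[OF iz zD, of t] by (simp add: space_restrict_space)
  qed
  then have "weak_dt T (L2_space \<Omega>) ?Z D" using X0.weak_dt_iff[OF T ZL DL] by blast
  then have "?Z \<in> bochner_H1 T (L2_space \<Omega>)" using ZL DL by (auto simp: bochner_H1_def)
  note Z' = X0.dt_H1[OF this]
  obtain a where a: "AE t in itv T. emb0 (?Z t) = a + prim (\<lambda>s. emb0 (ddt T \<Omega> ?Z s)) t"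
    using X0.weak_dt_iff[OF T ZL Z'(1)] Z'(2) by blast
  have "AE t in itv T. 0 + prim z t = a + prim (\<lambda>s. emb0 (ddt T \<Omega> ?Z s)) t"
    using a Z_ae(2) by eventually_elim simp
  from prim_AE_unique[OF T iz L2_curveD(3)[OF Z'(1)] this]
  have zZ: "AE t in itv T. z t = emb0 (ddt T \<Omega> ?Z t)" .
  show "AE t in itv T. ddt T \<Omega> ?Z t \<in> H10 \<Omega> \<and> emb1 (ddt T \<Omega> ?Z t) = weight T t *\<^sub>R (v0 + prim p t, w t)"
    using zZ aeD aeD0 L2_curveD(1)[OF Z'(1)]
  proof eventually_elim
    case (elim t)
    then show ?case using emb1_cong[of "D t" "ddt T \<Omega> ?Z t"] by (simp add: v_def)
  qed
  have wi: "integrable (itv T) (\<lambda>s. - weight T s / T)"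
    by (rule integrable_itv_continuous) (use T in \<open>intro continuous_intros continuous_on_weight; simp\<close>)
  have wt: "weight T t = 1 + prim (\<lambda>s. - weight T s / T) t" if "t \<in> {0..T}" for t
    using weight_eq_prim[OF T] that by simp
  \<comment> \<open>The derivative of \<open>weight * v\<close>: initial values are read off from a
    representation as constant plus primitive.\<close>
  define z' where "z' s = (- weight T s / T) *\<^sub>R (v0 + prim p s) + weight T s *\<^sub>R p s" for s
  have z_prim: "z t = v0 + prim z' t" if "t \<in> {0..T}" for t
    using prim_product_scaleR(1)[OF wt wi ip that, of v0] by (simp add: z_def v_def z'_def[abs_def])
  have iz': "integrable (itv T) z'"
    using prim_product_scaleR(2)[OF wt wi ip, of T v0] T by (simp add: z'_def[abs_def])
  have v0_rng: "v0 \<in> X0.rng" using W X0.emb_in_rng[of "initial_value T (L2_space \<Omega>) (ddt T \<Omega> W)"] by (simp add: trial_data_def)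
  have p_rng: "AE t in itv T. p t \<in> X0.rng"
    using W[unfolded trial_data_def, THEN conjunct2, THEN conjunct2, THEN conjunct2, THEN conjunct2, THEN conjunct1]
  proof eventually_elim
    case (elim t)
    then show ?case using X0.emb_in_rng[of "ddt T \<Omega> (ddt T \<Omega> W) t"] by simp
  qed
  have mem: "v0 + prim z' t \<in> X0.rng" if "t \<in> {0..T}" for t
  proof -
    have "v t \<in> X0.rng" unfolding v_def using that
      by (intro subspace_add[OF X0.rng.subspace v0_rng] prim_mem_subspace[OF X0.rng.closed_subspace_axioms ip p_rng]) simp
    then have "z t \<in> X0.rng" unfolding z_def by (rule subspace_scale[OF X0.rng.subspace])
    then show ?thesis using z_prim[OF that] by simp
  qed
  have "AE t in itv T. emb0 (ddt T \<Omega> ?Z t) = v0 + prim z' t"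
    using zZ AE_space[of "itv T"] by eventually_elim (use z_prim in \<open>auto simp: space_restrict_space\<close>)
  from X0.initial_value_emb[OF T iz' _ this mem] L2_curveD(1)[OF Z'(1)]
  show "sq_integrable_on \<Omega> (initial_value T (L2_space \<Omega>) (ddt T \<Omega> ?Z))"
    "emb0 (initial_value T (L2_space \<Omega>) (ddt T \<Omega> ?Z)) = v0"
    by (auto simp: elems_simps)
qed

lemma wave_form_eq:
  assumes U: "trial_data U u0 q r" and W: "trial_data W v0 p w" and WT: "W \<in> trial_space T \<Omega>"
  defines "z t \<equiv> weight T t *\<^sub>R (v0 + prim p t)"
  shows "wave_form T \<Omega> c U (LT T \<Omega> W)
    = (LINT t|itv T. q t \<bullet> z t) + u0 \<bullet> v0 + (LINT t|itv T. prim (\<lambda>s. l2_mult c (r s)) t \<bullet> (weight T t *\<^sub>R l2_mult c (w t)))"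
proof -
  have q: "sq_integrable_on {0<..<T} q" and r: "sq_integrable_on {0<..<T} r"
    and p: "sq_integrable_on {0<..<T} p" and w: "sq_integrable_on {0<..<T} w"
    using U W by (auto simp: trial_data_def)
  note ir = sq_integrable_on_itv_integrable[OF r]
  note Z = LT_trial[OF W WT]
  have cz: "continuous_on {0..T} z" unfolding z_def by (intro continuous_intros continuous_on_weight integrable_const_prim(2)[OF p])
  have sqz: "sq_integrable_on {0<..<T} z" by (rule sq_integrable_on_itv_continuous[OF cz])
  have Z0: "AE t in itv T. sq_integrable_on \<Omega> (ddt T \<Omega> (LT T \<Omega> W) t) \<and> cl (ddt T \<Omega> (LT T \<Omega> W) t) = z t"
    using Z(1)
  proof eventually_elim
    case (elim t)
    then show ?case using emb1_eq[of "ddt T \<Omega> (LT T \<Omega> W) t"] H10_sq(1)[of "ddt T \<Omega> (LT T \<Omega> W) t"] by (simp add: z_def)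
  qed
  have U2: "AE t in itv T. sq_integrable_on \<Omega> (ddt T \<Omega> (ddt T \<Omega> U) t) \<and> cl (ddt T \<Omega> (ddt T \<Omega> U) t) = q t"
    using U[unfolded trial_data_def, THEN conjunct2, THEN conjunct2, THEN conjunct2, THEN conjunct2, THEN conjunct1]
  proof eventually_elim
    case (elim t)
    then show ?case using emb0_eq[of "ddt T \<Omega> (ddt T \<Omega> U) t"] by simp
  qed
  have "L2_inner \<Omega> (initial_value T (L2_space \<Omega>) (ddt T \<Omega> U)) (initial_value T (L2_space \<Omega>) (ddt T \<Omega> (LT T \<Omega> W))) = u0 \<bullet> v0"
  proof -
    have "sq_integrable_on \<Omega> (initial_value T (L2_space \<Omega>) (ddt T \<Omega> U))"
      "emb0 (initial_value T (L2_space \<Omega>) (ddt T \<Omega> U)) = u0"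
      using U by (simp_all add: trial_data_def)
    with Z(2,3) show ?thesis using inner_cls_on[OF meas, of "initial_value T (L2_space \<Omega>) (ddt T \<Omega> U)"
        "initial_value T (L2_space \<Omega>) (ddt T \<Omega> (LT T \<Omega> W))"] by (simp add: L2_inner_def emb0_eq)
  qed
  moreover have "Q_inner T \<Omega> (\<lambda>t x. (c x)\<^sup>2 *\<^sub>R grad \<Omega> (U t) x) (\<lambda>t. grad \<Omega> (ddt T \<Omega> (LT T \<Omega> W) t))
    = (LINT t|itv T. prim (\<lambda>s. l2_mult c (r s)) t \<bullet> (weight T t *\<^sub>R l2_mult c (w t)))"
    unfolding Q_inner_def
  proof (rule integral_itv_cong_AE[symmetric])
    show "integrable (itv T) (\<lambda>t. prim (\<lambda>s. l2_mult c (r s)) t \<bullet> (weight T t *\<^sub>R l2_mult c (w t)))"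
      by (intro integrable_inner_on sq_integrable_on_itv_continuous continuous_on_prim sq_integrable_on_itv_integrable
          sq_integrable_on_scale_continuous continuous_on_weight c_in_model r w) simp
    show "AE t in itv T. prim (\<lambda>s. l2_mult c (r s)) t \<bullet> (weight T t *\<^sub>R l2_mult c (w t))
        = L2_inner \<Omega> (\<lambda>x. (c x)\<^sup>2 *\<^sub>R grad \<Omega> (U t) x) (grad \<Omega> (ddt T \<Omega> (LT T \<Omega> W) t))"
      using U[unfolded trial_data_def, THEN conjunct2, THEN conjunct2, THEN conjunct1] Z(1) AE_space[of "itv T"]
    proof eventually_elim
      case (elim t)
      then have t: "t \<le> T" by (simp add: space_restrict_space)
      let ?g = "grad \<Omega> (U t)" and ?h = "grad \<Omega> (ddt T \<Omega> (LT T \<Omega> W) t)"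
      have g: "sq_integrable_on \<Omega> ?g" "cl ?g = prim r t" and h: "sq_integrable_on \<Omega> ?h" "cl ?h = weight T t *\<^sub>R w t"
        using elim emb1_eq[of "U t"] H10_sq(2)[of "U t"] emb1_eq[of "ddt T \<Omega> (LT T \<Omega> W) t"] H10_sq(2)[of "ddt T \<Omega> (LT T \<Omega> W) t"]
        by simp_all
      \<comment> \<open>One factor \<open>c\<close> is given to each gradient.\<close>
      have "L2_inner \<Omega> (\<lambda>x. (c x)\<^sup>2 *\<^sub>R ?g x) ?h = (LINT x|lebesgue_on \<Omega>. (c x *\<^sub>R ?g x) \<bullet> (c x *\<^sub>R ?h x))"
        unfolding L2_inner_def by (rule arg_cong[where f="integral\<^sup>L (lebesgue_on \<Omega>)"]) (simp add: power2_eq_square mult.assoc fun_eq_iff)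
      also have "\<dots> = cl (\<lambda>x. c x *\<^sub>R ?g x) \<bullet> cl (\<lambda>x. c x *\<^sub>R ?h x)"
        by (rule inner_cls_on[symmetric, OF meas sq_c_mult[OF g(1)] sq_c_mult[OF h(1)]])
      also have "\<dots> = l2_mult c (prim r t) \<bullet> l2_mult c (weight T t *\<^sub>R w t)"
        by (simp only: l2_mult_cl[OF g(1), symmetric] l2_mult_cl[OF h(1), symmetric] g(2) h(2))
      also have "\<dots> = prim (\<lambda>s. l2_mult c (r s)) t \<bullet> (weight T t *\<^sub>R l2_mult c (w t))"
        by (simp only: prim_bounded_linear[OF bounded_linear_c ir t] linear_simps(5)[OF bounded_linear_c])
      finally show ?case by simp
    qed
  qed
  ultimately show ?thesis unfolding wave_form_def using Q_inner_eq[OF U2 Z0 q sqz] by simp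
qed

lemma source_eq:
  assumes F: "F \<in> bochner_L2 T (L2_space \<Omega>)" and W: "trial_data W v0 p w" and WT: "W \<in> trial_space T \<Omega>"
  shows "Q_inner T \<Omega> F (ddt T \<Omega> (LT T \<Omega> W)) = (LINT t|itv T. emb0 (F t) \<bullet> (weight T t *\<^sub>R (v0 + prim p t)))"
proof (rule Q_inner_eq)
  have p: "sq_integrable_on {0<..<T} p" using W by (auto simp: trial_data_def)
  show "AE t in itv T. sq_integrable_on \<Omega> (F t) \<and> cl (F t) = emb0 (F t)"
    using L2_curveD(1)[OF F] by eventually_elim (simp add: emb0_eq)
  show "AE t in itv T. sq_integrable_on \<Omega> (ddt T \<Omega> (LT T \<Omega> W) t) \<and> cl (ddt T \<Omega> (LT T \<Omega> W) t) = weight T t *\<^sub>R (v0 + prim p t)"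
    using LT_trial(1)[OF W WT]
  proof eventually_elim
    case (elim t)
    then show ?case using emb1_eq[of "ddt T \<Omega> (LT T \<Omega> W) t"] H10_sq(1)[of "ddt T \<Omega> (LT T \<Omega> W) t"] by simp
  qed
  show "sq_integrable_on {0<..<T} (\<lambda>t. emb0 (F t))" by (rule L2_curveD(2)[OF F])
  show "sq_integrable_on {0<..<T} (\<lambda>t. weight T t *\<^sub>R (v0 + prim p t))"
    by (rule sq_integrable_on_scale_continuous[OF continuous_on_weight integrable_const_prim(3)[OF p]])
qed

lemma V_norm_eq:
  assumes U: "trial_data U v0 p w"
  shows "V_norm T \<Omega> c U = sqrt ((LINT t|itv T. (norm (v0 + prim p t))\<^sup>2) + (LINT t|itv T. (norm (prim (\<lambda>s. l2_mult c (w s)) t))\<^sup>2))"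
proof -
  have p: "sq_integrable_on {0<..<T} p" and w: "sq_integrable_on {0<..<T} w" using U by (auto simp: trial_data_def)
  have 1: "AE t in itv T. sq_integrable_on \<Omega> (ddt T \<Omega> U t) \<and> cl (ddt T \<Omega> U t) = v0 + prim p t"
    using U[unfolded trial_data_def, THEN conjunct2, THEN conjunct2, THEN conjunct2, THEN conjunct1]
  proof eventually_elim
    case (elim t)
    then show ?case using emb1_eq[of "ddt T \<Omega> U t"] H10_sq(1)[of "ddt T \<Omega> U t"] by simp
  qed
  have 2: "AE t in itv T. sq_integrable_on \<Omega> (\<lambda>x. c x *\<^sub>R grad \<Omega> (U t) x) \<and>
      cl (\<lambda>x. c x *\<^sub>R grad \<Omega> (U t) x) = prim (\<lambda>s. l2_mult c (w s)) t"
    using U[unfolded trial_data_def, THEN conjunct2, THEN conjunct2, THEN conjunct1] AE_space[of "itv T"]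
  proof eventually_elim
    case (elim t)
    then have "t \<le> T" by (simp add: space_restrict_space)
    note pl = prim_bounded_linear[OF bounded_linear_c sq_integrable_on_itv_integrable[OF w] this]
    have g: "sq_integrable_on \<Omega> (grad \<Omega> (U t))" "cl (grad \<Omega> (U t)) = prim w t"
      using elim emb1_eq[of "U t"] H10_sq(2)[of "U t"] by simp_all
    then show ?case using sq_c_mult[OF g(1)] l2_mult_cl[OF g(1), of c] by (simp add: pl)
  qed
  have sqr: "sq_integrable_on {0<..<T} (prim (\<lambda>s. l2_mult c (w s)))"
    by (rule sq_integrable_on_itv_continuous[OF continuous_on_prim[OF sq_integrable_on_itv_integrable[OF c_in_model[OF w]]]])
  note q1 = Q_inner_eq[OF 1 1 integrable_const_prim(3)[OF p] integrable_const_prim(3)[OF p]]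
  note q2 = Q_inner_eq[OF 2 2 sqr sqr]
  have "0 \<le> Q_inner T \<Omega> (ddt T \<Omega> U) (ddt T \<Omega> U)" "0 \<le> Q_inner T \<Omega> (\<lambda>t x. c x *\<^sub>R grad \<Omega> (U t) x) (\<lambda>t x. c x *\<^sub>R grad \<Omega> (U t) x)"
    unfolding q1 q2 by (auto intro!: integral_nonneg_AE)
  then show ?thesis unfolding V_norm_def Q_norm_def by (simp add: q1 q2 power2_norm_eq_inner)
qed

section \<open>Estimate, uniqueness and existence\<close>

lemma solution_estimate:
  assumes F: "F \<in> bochner_L2 T (L2_space \<Omega>)" and U: "is_solution T \<Omega> c F U"
  shows "V_norm T \<Omega> c U \<le> 2 * exp 1 * T * Q_norm T \<Omega> F"
proof -
  have UT: "U \<in> trial_space T \<Omega>" using U by (simp add: is_solution_def)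
  then obtain v0 p w where d: "trial_data U v0 p w" using trial_data_ex by blast
  then have p: "sq_integrable_on {0<..<T} p" and w: "sq_integrable_on {0<..<T} w" by (auto simp: trial_data_def)
  have "wave_form T \<Omega> c U (LT T \<Omega> U) = Q_inner T \<Omega> F (ddt T \<Omega> (LT T \<Omega> U))" using U UT by (simp add: is_solution_def)
  then have "(LINT t|itv T. (norm (v0 + prim p t))\<^sup>2) + (LINT t|itv T. (norm (prim (\<lambda>s. l2_mult c (w s)) t))\<^sup>2)
    \<le> (2 * exp 1 * T)\<^sup>2 * (LINT t|itv T. (norm (emb0 (F t)))\<^sup>2)"
    unfolding wave_form_eq[OF d d UT] source_eq[OF F d UT]
    by (rule energy_estimate[OF T p c_in_model[OF w] L2_curveD(2)[OF F]])
  then have "V_norm T \<Omega> c U \<le> sqrt ((2 * exp 1 * T)\<^sup>2 * (LINT t|itv T. (norm (emb0 (F t)))\<^sup>2))"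
    unfolding V_norm_eq[OF d] by (rule real_sqrt_le_mono)
  also have "\<dots> = 2 * exp 1 * T * Q_norm T \<Omega> F"
  proof -
    have 1: "AE t in itv T. sq_integrable_on \<Omega> (F t) \<and> cl (F t) = emb0 (F t)"
      using L2_curveD(1)[OF F] by eventually_elim (simp add: emb0_eq)
    show ?thesis using Q_inner_eq[OF 1 1 L2_curveD(2)[OF F] L2_curveD(2)[OF F]] T
      by (simp add: Q_norm_def power2_norm_eq_inner real_sqrt_mult)
  qed
  finally show ?thesis .
qed

text \<open>The differences of the data of two solutions are realised by a trial function
  \<open>W\<close>. Testing both equations with \<open>LT W\<close> and subtracting gives the
  hypothesis of the energy estimate with source zero.\<close>

lemma solution_unique:
  assumes F: "F \<in> bochner_L2 T (L2_space \<Omega>)" and U: "is_solution T \<Omega> c F U" and U': "is_solution T \<Omega> c F U'"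
  shows "AE t in itv T. AE x in lebesgue_on \<Omega>. U' t x = U t x"
proof -
  have UT: "U \<in> trial_space T \<Omega>" "U' \<in> trial_space T \<Omega>" using U U' by (auto simp: is_solution_def)
  obtain v0 p w where d: "trial_data U v0 p w" using trial_data_ex[OF UT(1)] by blast
  obtain v0' p' w' where d': "trial_data U' v0' p' w'" using trial_data_ex[OF UT(2)] by blast
  have p: "sq_integrable_on {0<..<T} p" and w: "sq_integrable_on {0<..<T} w"
    and p': "sq_integrable_on {0<..<T} p'" and w': "sq_integrable_on {0<..<T} w'"
    using d d' by (auto simp: trial_data_def)
  note ip = sq_integrable_on_itv_integrable[OF p] and ip' = sq_integrable_on_itv_integrable[OF p']
  define y0 where "y0 = v0 - v0'"
  define q where "q t = p t - p' t" for t
  define r where "r t = w t - w' t" for t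
  have q: "sq_integrable_on {0<..<T} q" and r: "sq_integrable_on {0<..<T} r"
    unfolding q_def r_def by (intro sq_integrable_on_diff p p' w w'; simp)+
  have primq: "prim q t = prim p t - prim p' t" if "t \<le> T" for t unfolding q_def by (rule prim_diff[OF ip ip' that])
  have mem: "AE t in itv T. (y0 + prim q t, r t) \<in> X1.rng"
    using d[unfolded trial_data_def, THEN conjunct2, THEN conjunct2, THEN conjunct2, THEN conjunct1]
      d'[unfolded trial_data_def, THEN conjunct2, THEN conjunct2, THEN conjunct2, THEN conjunct1] AE_space[of "itv T"]
  proof eventually_elim
    case (elim t)
    then have "emb1 (ddt T \<Omega> U t) - emb1 (ddt T \<Omega> U' t) = (y0 + prim q t, r t)"
      by (simp add: y0_def r_def primq space_restrict_space)
    then show ?case using subspace_diff[OF X1.rng.subspace X1.emb_in_rng[of "ddt T \<Omega> U t"] X1.emb_in_rng[of "ddt T \<Omega> U' t"]] by simp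
  qed
  obtain W where WT: "W \<in> trial_space T \<Omega>" and W: "trial_data W y0 q r" using trial_function_ex[OF q r mem] by blast
  define z where "z t = weight T t *\<^sub>R (y0 + prim q t)" for t
  define \<zeta> where "\<zeta> t = weight T t *\<^sub>R l2_mult c (r t)" for t
  have sqz: "sq_integrable_on {0<..<T} z" unfolding z_def
    by (rule sq_integrable_on_scale_continuous[OF continuous_on_weight integrable_const_prim(3)[OF q]])
  have sq\<zeta>: "sq_integrable_on {0<..<T} \<zeta>" unfolding \<zeta>_def
    by (rule sq_integrable_on_scale_continuous[OF continuous_on_weight c_in_model[OF r]])
  have "wave_form T \<Omega> c U (LT T \<Omega> W) = wave_form T \<Omega> c U' (LT T \<Omega> W)" using U U' WT by (simp add: is_solution_def)
  then have eq: "(LINT t|itv T. p t \<bullet> z t) + v0 \<bullet> y0 + (LINT t|itv T. prim (\<lambda>s. l2_mult c (w s)) t \<bullet> \<zeta> t)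
    = (LINT t|itv T. p' t \<bullet> z t) + v0' \<bullet> y0 + (LINT t|itv T. prim (\<lambda>s. l2_mult c (w' s)) t \<bullet> \<zeta> t)"
    unfolding wave_form_eq[OF d W WT] wave_form_eq[OF d' W WT] z_def \<zeta>_def .
  have S: "{0<..<T} \<in> sets lebesgue" by simp
  have sqpr: "sq_integrable_on {0<..<T} (prim (\<lambda>s. l2_mult c (u s)))" if "sq_integrable_on {0<..<T} u" for u :: "real \<Rightarrow> ('a, 'a) l2"
    by (rule sq_integrable_on_itv_continuous[OF continuous_on_prim[OF sq_integrable_on_itv_integrable[OF c_in_model[OF that]]]])
  have "(LINT t|itv T. q t \<bullet> z t) = (LINT t|itv T. p t \<bullet> z t) - (LINT t|itv T. p' t \<bullet> z t)"
    unfolding q_def inner_diff_left by (intro Bochner_Integration.integral_diff integrable_inner_on[OF S] p p' sqz)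
  moreover have "(LINT t|itv T. prim (\<lambda>s. l2_mult c (r s)) t \<bullet> \<zeta> t)
    = (LINT t|itv T. prim (\<lambda>s. l2_mult c (w s)) t \<bullet> \<zeta> t) - (LINT t|itv T. prim (\<lambda>s. l2_mult c (w' s)) t \<bullet> \<zeta> t)"
  proof -
    have "prim (\<lambda>s. l2_mult c (r s)) t = prim (\<lambda>s. l2_mult c (w s)) t - prim (\<lambda>s. l2_mult c (w' s)) t" if "t \<le> T" for t
      unfolding r_def linear_simps(2)[OF bounded_linear_c]
      by (rule prim_diff[OF _ _ that]) (intro sq_integrable_on_itv_integrable c_in_model w w')+
    then have "(LINT t|itv T. prim (\<lambda>s. l2_mult c (r s)) t \<bullet> \<zeta> t)
      = (LINT t|itv T. prim (\<lambda>s. l2_mult c (w s)) t \<bullet> \<zeta> t - prim (\<lambda>s. l2_mult c (w' s)) t \<bullet> \<zeta> t)"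
      by (intro Bochner_Integration.integral_cong) (auto simp: space_restrict_space inner_diff_left)
    also have "\<dots> = (LINT t|itv T. prim (\<lambda>s. l2_mult c (w s)) t \<bullet> \<zeta> t) - (LINT t|itv T. prim (\<lambda>s. l2_mult c (w' s)) t \<bullet> \<zeta> t)"
      by (intro Bochner_Integration.integral_diff integrable_inner_on[OF S] sqpr w w' sq\<zeta>)
    finally show ?thesis .
  qed
  moreover have "y0 \<bullet> y0 = v0 \<bullet> y0 - v0' \<bullet> y0" by (simp add: y0_def inner_diff_left)
  ultimately have hom: "(LINT t|itv T. q t \<bullet> (weight T t *\<^sub>R (y0 + prim q t))) + y0 \<bullet> y0
    + (LINT t|itv T. prim (\<lambda>s. l2_mult c (r s)) t \<bullet> (weight T t *\<^sub>R l2_mult c (r t)))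
    = (LINT t|itv T. 0 \<bullet> (weight T t *\<^sub>R (y0 + prim q t)))"
    using eq by (simp add: z_def \<zeta>_def)
  have sq0: "sq_integrable_on {0<..<T} (\<lambda>t. 0 :: ('a, real) l2)" by (simp add: sq_integrable_on_def)
  have "0 \<le> (LINT t|itv T. (norm (prim (\<lambda>s. l2_mult c (r s)) t))\<^sup>2)" by (intro integral_nonneg_AE) auto
  moreover have "(LINT t|itv T. (norm (y0 + prim q t))\<^sup>2) + (LINT t|itv T. (norm (prim (\<lambda>s. l2_mult c (r s)) t))\<^sup>2) \<le> 0"
    using energy_estimate[OF T q c_in_model[OF r] sq0 hom] by simp
  ultimately have "(LINT t|itv T. (norm (y0 + prim q t))\<^sup>2) \<le> 0" by linarith
  moreover have "0 \<le> (LINT t|itv T. (norm (y0 + prim q t))\<^sup>2)" by (intro integral_nonneg_AE) auto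
  ultimately have "(LINT t|itv T. (norm (y0 + prim q t))\<^sup>2) = 0" by simp
  then have "AE t in itv T. (norm (y0 + prim q t))\<^sup>2 = 0"
    using integrable_const_prim(3)[OF q, of y0]
    by (subst (asm) integral_nonneg_eq_0_iff_AE) (auto simp: sq_integrable_on_def)
  then have "AE t in itv T. y0 + prim q t = 0" by simp
  with AE_space[of "itv T"] have vv: "AE t in itv T. v0 + prim p t = v0' + prim p' t"
    by eventually_elim (simp add: y0_def primq space_restrict_space algebra_simps)
  \<comment> \<open>Both solutions are primitives of their velocities from value zero, so equality
    of the velocities carries over.\<close>
  show ?thesis
    using d[unfolded trial_data_def, THEN conjunct2, THEN conjunct2, THEN conjunct1]
      d'[unfolded trial_data_def, THEN conjunct2, THEN conjunct2, THEN conjunct1] AE_space[of "itv T"]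
  proof eventually_elim
    case (elim t)
    then have t: "t \<le> T" by (simp add: space_restrict_space)
    have "prim (\<lambda>s. v0 + prim p s) t = prim (\<lambda>s. v0' + prim p' s) t"
      by (rule prim_cong_AE[OF integrable_const_prim(1)[OF p] vv t])
    then have "cl (U' t) = cl (U t)" using elim emb1_eq[of "U t"] emb1_eq[of "U' t"] by simp
    then show ?case using cls_on_eq_iff[OF meas, of "U' t" "U t"] elim H10_sq(1) by simp
  qed
qed

text \<open>In the abstract solution \<open>r\<close> stands for \<open>c grad (dt U)\<close>.
  Conversely, \<open>LT\<close> sends any trial function to a test function whose velocity and
  \<open>c\<close> times whose gradient form a curve in \<open>energy_space\<close>, since scaling
  by the weight preserves a subspace; so all required tests are covered.\<close>

lemma solution_exists:
  assumes F: "F \<in> bochner_H1 T (L2_space \<Omega>)"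
  shows "\<exists>U. is_solution T \<Omega> c F U"
proof -
  have FL: "F \<in> bochner_L2 T (L2_space \<Omega>)" using F by (simp add: bochner_H1_def)
  note dF = X0.dt_H1[OF F]
  define f' where "f' t = emb0 (ddt T \<Omega> F t)" for t
  have f': "sq_integrable_on {0<..<T} f'" unfolding f'_def by (rule L2_curveD(2)[OF dF(1)])
  obtain f0 where f0: "AE t in itv T. emb0 (F t) = f0 + prim f' t"
    using X0.weak_dt_iff[OF T FL dF(1)] dF(2) unfolding f'_def by blast
  obtain p r where p: "sq_integrable_on {0<..<T} p" and r: "sq_integrable_on {0<..<T} r"
    and mem: "AE t in itv T. (prim p t, r t) \<in> energy_space"
    and eq: "\<And>z \<zeta>. sq_integrable_on {0<..<T} z \<Longrightarrow> sq_integrable_on {0<..<T} \<zeta> \<Longrightarrow> AE t in itv T. (z t, \<zeta> t) \<in> energy_space \<Longrightarrow>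
      (LINT t|itv T. p t \<bullet> z t) + (LINT t|itv T. prim r t \<bullet> \<zeta> t) = (LINT t|itv T. (f0 + prim f' t) \<bullet> z t)"
    by (rule abstract_wave_equation[OF T closed_subspace_energy f', of f0]) (rule that, assumption+)
  define w where "w t = l2_mult (\<lambda>x. 1 / c x) (r t)" for t
  have w: "sq_integrable_on {0<..<T} w" unfolding w_def
    by (rule sq_integrable_on_linear[OF _ bounded_linear_l2_mult[OF inverse_c] r]) simp
  have "AE t in itv T. (0 + prim p t, w t) \<in> X1.rng" and rw: "AE t in itv T. r t = l2_mult c (w t)"
    using mem unfolding energy_space_iff w_def by auto
  \<comment> \<open>The initial velocity is taken to be 0, so that \<open>prim p\<close> is the
    velocity and the term of the form at time 0 drops out.\<close>
  then obtain U where UT: "U \<in> trial_space T \<Omega>" and U: "trial_data U 0 p w" using trial_function_ex[OF p w] by blast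
  have "wave_form T \<Omega> c U (LT T \<Omega> W) = Q_inner T \<Omega> F (ddt T \<Omega> (LT T \<Omega> W))" if WT: "W \<in> trial_space T \<Omega>" for W
  proof -
    obtain y0 q s where W: "trial_data W y0 q s" using trial_data_ex[OF WT] by blast
    then have q: "sq_integrable_on {0<..<T} q" and s: "sq_integrable_on {0<..<T} s" by (auto simp: trial_data_def)
    let ?z = "\<lambda>t. weight T t *\<^sub>R (y0 + prim q t)" and ?\<zeta> = "\<lambda>t. weight T t *\<^sub>R l2_mult c (s t)"
    have sqz: "sq_integrable_on {0<..<T} ?z"
      by (rule sq_integrable_on_scale_continuous[OF continuous_on_weight integrable_const_prim(3)[OF q]])
    have sq\<zeta>: "sq_integrable_on {0<..<T} ?\<zeta>"
      by (rule sq_integrable_on_scale_continuous[OF continuous_on_weight c_in_model[OF s]])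
    have "AE t in itv T. (?z t, ?\<zeta> t) \<in> energy_space"
      using W[unfolded trial_data_def, THEN conjunct2, THEN conjunct2, THEN conjunct2, THEN conjunct1]
    proof eventually_elim
      case (elim t)
      then have "(y0 + prim q t, s t) \<in> X1.rng" using X1.emb_in_rng[of "ddt T \<Omega> W t"] by simp
      then have "(y0 + prim q t, l2_mult c (s t)) \<in> energy_space" 
        unfolding energy_space_def by (intro image_eqI[of _ _ "(y0 + prim q t, s t)"]) simp_all
      from subspace_scale[OF closed_subspace.subspace[OF closed_subspace_energy] this, of "weight T t"] show ?case by simp
    qed
    from eq[OF sqz sq\<zeta> this]
    have e: "(LINT t|itv T. p t \<bullet> ?z t) + (LINT t|itv T. prim r t \<bullet> ?\<zeta> t) = (LINT t|itv T. (f0 + prim f' t) \<bullet> ?z t)" .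
    have "(LINT t|itv T. prim r t \<bullet> ?\<zeta> t) = (LINT t|itv T. prim (\<lambda>s. l2_mult c (w s)) t \<bullet> ?\<zeta> t)"
      using prim_cong_AE[OF sq_integrable_on_itv_integrable[OF r] rw]
      by (intro Bochner_Integration.integral_cong) (auto simp: space_restrict_space)
    moreover have "(LINT t|itv T. emb0 (F t) \<bullet> ?z t) = (LINT t|itv T. (f0 + prim f' t) \<bullet> ?z t)"
    proof (rule integral_itv_cong_AE)
      show "integrable (itv T) (\<lambda>t. emb0 (F t) \<bullet> ?z t)" by (rule integrable_inner_on[OF _ L2_curveD(2)[OF FL] sqz]) simp
      show "AE t in itv T. emb0 (F t) \<bullet> ?z t = (f0 + prim f' t) \<bullet> ?z t" using f0 by eventually_elim simp
    qed
    ultimately show ?thesis unfolding wave_form_eq[OF U W WT] source_eq[OF FL W WT] using e by simp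
  qed
  then show ?thesis using UT by (auto simp: is_solution_def)
qed

end

theorem theorem4p3:
  fixes \<Omega> :: "'a::euclidean_space set" and T c0 :: real
    and c :: "'a \<Rightarrow> real" and F :: "real \<Rightarrow> 'a \<Rightarrow> real"
  assumes "T > 0"
    and "DIM('a) \<in> {1, 2, 3}"
    and "bounded \<Omega>" and "lipschitz_domain \<Omega>"
    and "c \<in> Linf \<Omega>"
    and "c0 > 0" and "AE x in lebesgue_on \<Omega>. c x \<ge> c0"
    and "F \<in> bochner_H1 T (L2_space \<Omega>)"
    and "\<exists>F0 \<in> L2 \<Omega>. has_initial_value T (L2_space \<Omega>) F F0"
  shows "\<exists>U. is_solution T \<Omega> c F U \<and>
           (\<forall>U'. is_solution T \<Omega> c F U' \<longrightarrow>
              (AE t in lebesgue_on {0<..<T}. AE x in lebesgue_on \<Omega>. U' t x = U t x)) \<and>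
           V_norm T \<Omega> c U \<le> 2 * exp 1 * T * Q_norm T \<Omega> F"
proof -
  interpret wave_problem \<Omega> T c0 c
    using assms by unfold_locales (auto simp: lipschitz_domain_def)
  have F: "F \<in> bochner_L2 T (L2_space \<Omega>)" using assms(8) by (simp add: bochner_H1_def)
  obtain U where U: "is_solution T \<Omega> c F U" using solution_exists[OF assms(8)] by blast
  show ?thesis
    using U solution_unique[OF F U] solution_estimate[OF F U] by (intro exI[of _ U]) simp
qed

end
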